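(* There is a randomized algorithm running in $\tilde{O}(m^{3/2})$ time that, given a directed graph $G=(V,E)$ with $n$ vertices, $m$ edges and nonnegative integer edge weights, and a set $S\subseteq V$ with $T=V\setminus S$, outputs an estimate $D'$ such that, with high probability, $D_{ST}/2\leq D'\leq D_{ST}$, where $D_{ST}$ is the $ST$-Diameter of $G$. Moreover, if for some $\varepsilon,\delta>0$ there is an $O(m^{2-\varepsilon})$ time $(2-\delta)$-approximation algorithm for this problem (Bichromatic Diameter in directed graphs), then SETH is false.
   Context: For a directed graph $G=(V,E)$, $d(u,v)$ is the length of a shortest directed path from $u$ to $v$. For $S,T\subseteq V$, $D_{ST}=\max_{s\in S}\max_{t\in T}d(s,t)$. An $\alpha$-approximation algorithm outputs $D'$ with $D_{ST}/\alpha\le D'\le D_{ST}$. "With high probability" means with probability at least $1-1/n^c$ for every constant $c$. $\tilde{O}$ hides polylogarithmic factors. SETH: on a word-RAM with $O(\log n)$-bit words there is no constant $\varepsilon>0$ and (possibly randomized) algorithm running in $(2-\varepsilon)^n$ time deciding satisfiability of CNF formulas with $n$ variables and $O(n)$ clauses. *)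

theory Defs
  imports
    "HOL-Probability.Probability_Mass_Function"
    "HOL-Library.Landau_Symbols"
    "Graph_Theory.Shortest_Path"
begin

section \<open>A randomized word RAM\<close>

text \<open>
  Programs are lists of commands over finitely many registers and a word-addressed memory.
  Every command, and every evaluation of a branch or loop condition, costs one time step.
  Compared with a goto machine, structured control flow changes running times by at most a
  constant factor.
\<close>

datatype binop = Add | Sub | Mul | Div | Mod | Less | Eq | And | Or | Xor | Shl | Shr

fun binop_val :: "binop \<Rightarrow> nat \<Rightarrow> nat \<Rightarrow> nat" where
  "binop_val Add a b = a + b"
| "binop_val Sub a b = a - b"
| "binop_val Mul a b = a * b"
| "binop_val Div a b = a div b"
| "binop_val Mod a b = a mod b"
| "binop_val Less a b = of_bool (a < b)"
| "binop_val Eq a b = of_bool (a = b)"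
| "binop_val And a b = Bit_Operations.and a b"
| "binop_val Or a b = Bit_Operations.or a b"
| "binop_val Xor a b = Bit_Operations.xor a b"
| "binop_val Shl a b = push_bit b a"
| "binop_val Shr a b = drop_bit b a"

datatype com =
    Const nat nat             \<comment> \<open>\<open>Const r k\<close>: \<open>r := k\<close>\<close>
  | Op binop nat nat nat      \<comment> \<open>\<open>Op f r a b\<close>: \<open>r := f a b\<close>\<close>
  | Load nat nat              \<comment> \<open>\<open>Load r a\<close>: \<open>r := mem[a]\<close>\<close>
  | Store nat nat             \<comment> \<open>\<open>Store a r\<close>: \<open>mem[a] := r\<close>\<close>
  | Flip nat                  \<comment> \<open>\<open>Flip r\<close>: \<open>r :=\<close> fair random bit\<close>
  | If nat "com list" "com list"
  | While nat "com list"

record state =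
  regs :: "nat \<Rightarrow> nat"
  mem :: "nat \<Rightarrow> nat"

text \<open>The list of commands still to be executed, together with the state; the machine has
  halted when the list is empty.\<close>

type_synonym config = "com list \<times> state"

text \<open>
  A result that does not fit into \<open>w\<close> bits is not written: the machine stays where it is and
  hence never halts. A program thus computes within \<open>w\<close>-bit words only if it never overflows;
  arithmetic modulo \<open>2 ^ w\<close> can be simulated with words longer by a constant factor.
\<close>

definition write_reg :: "nat \<Rightarrow> nat \<Rightarrow> nat \<Rightarrow> com \<Rightarrow> com list \<Rightarrow> state \<Rightarrow> config" where
  "write_reg w r v c cs s =
     (if v < 2 ^ w then (cs, s\<lparr>regs := (regs s)(r := v)\<rparr>) else (c # cs, s))"

fun step :: "nat \<Rightarrow> config \<Rightarrow> config pmf" where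
  "step w ([], s) = return_pmf ([], s)"
| "step w (Const r k # cs, s) = return_pmf (write_reg w r k (Const r k) cs s)"
| "step w (Op f r a b # cs, s) =
     return_pmf (write_reg w r (binop_val f (regs s a) (regs s b)) (Op f r a b) cs s)"
| "step w (Load r a # cs, s) = return_pmf (write_reg w r (mem s (regs s a)) (Load r a) cs s)"
| "step w (Store a r # cs, s) =
     return_pmf (cs, s\<lparr>mem := (mem s)(regs s a := regs s r)\<rparr>)"
| "step w (Flip r # cs, s) =
     map_pmf (\<lambda>x. write_reg w r (of_bool x) (Flip r) cs s) (bernoulli_pmf (1 / 2))"
| "step w (If r p q # cs, s) = return_pmf ((if regs s r \<noteq> 0 then p else q) @ cs, s)"
| "step w (While r p # cs, s) =
     return_pmf (if regs s r \<noteq> 0 then p @ While r p # cs else cs, s)"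

primrec run :: "nat \<Rightarrow> nat \<Rightarrow> config \<Rightarrow> config pmf" where
  "run w 0 c = return_pmf c"
| "run w (Suc t) c = bind_pmf (step w c) (run w t)"

definition init_config :: "com list \<Rightarrow> nat list \<Rightarrow> config" where
  "init_config p xs =
     (p, \<lparr>regs = (\<lambda>_. 0), mem = (\<lambda>i. if i < length xs then xs ! i else 0)\<rparr>)"

text \<open>The time bound holds for all outcomes of the coin flips.\<close>

definition halts_within :: "nat \<Rightarrow> nat \<Rightarrow> com list \<Rightarrow> nat list \<Rightarrow> bool" where
  "halts_within w t p xs \<longleftrightarrow> (\<forall>c \<in> set_pmf (run w t (init_config p xs)). fst c = [])"

definition output_prob ::
  "nat \<Rightarrow> nat \<Rightarrow> com list \<Rightarrow> nat list \<Rightarrow> (state \<Rightarrow> bool) \<Rightarrow> real" where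
  "output_prob w t p xs Q =
     measure_pmf.prob (run w t (init_config p xs)) {c. fst c = [] \<and> Q (snd c)}"

text \<open>Words of \<open>O(log N)\<close> bits, where \<open>b\<close> is the hidden constant.\<close>

definition word_bits :: "nat \<Rightarrow> nat \<Rightarrow> nat" where
  "word_bits b N = b * nat \<lceil>log 2 (real N + 2)\<rceil>"


section \<open>Bichromatic diameter in directed graphs\<close>

text \<open>The vertices are \<open>{..<vertex_count I}\<close>; the edges are listed in arbitrary order.\<close>

record st_instance =
  vertex_count :: nat
  edge_list :: "(nat \<times> nat) list"
  weight :: "nat \<times> nat \<Rightarrow> nat"
  source_set :: "nat set"

definition vertex_set :: "st_instance \<Rightarrow> nat set" where
  "vertex_set I = {..<vertex_count I}"

definition target_set :: "st_instance \<Rightarrow> nat set" where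
  "target_set I = vertex_set I - source_set I"

definition edge_count :: "st_instance \<Rightarrow> nat" where
  "edge_count I = length (edge_list I)"

definition graph_of :: "st_instance \<Rightarrow> (nat, nat \<times> nat) pre_digraph" where
  "graph_of I = \<lparr>verts = vertex_set I, arcs = set (edge_list I), tail = fst, head = snd\<rparr>"

text \<open>Both \<open>S\<close> and \<open>T\<close> have to be nonempty for the maximum defining the \<open>ST\<close>-diameter to
  exist.\<close>

definition valid_instance :: "st_instance \<Rightarrow> bool" where
  "valid_instance I \<longleftrightarrow>
     wf_digraph (graph_of I) \<and> distinct (edge_list I) \<and>
     source_set I \<subseteq> vertex_set I \<and> source_set I \<noteq> {} \<and> target_set I \<noteq> {}"

definition distance :: "st_instance \<Rightarrow> nat \<Rightarrow> nat \<Rightarrow> ereal" where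
  "distance I u v = wf_digraph.\<mu> (graph_of I) (\<lambda>e. real (weight I e)) u v"

text \<open>The value is \<open>\<infinity>\<close> if some vertex of \<open>T\<close> is unreachable from some vertex of \<open>S\<close>.\<close>

definition ST_diameter :: "st_instance \<Rightarrow> ereal" where
  "ST_diameter I = (MAX s\<in>source_set I. MAX t\<in>target_set I. distance I s t)"

definition encode_instance :: "st_instance \<Rightarrow> nat list" where
  "encode_instance I =
     [vertex_count I, edge_count I]
     @ concat (map (\<lambda>e. [fst e, snd e, weight I e]) (edge_list I))
     @ map (\<lambda>v. of_bool (v \<in> source_set I)) [0..<vertex_count I]"

text \<open>Words must be able to hold vertex names and edge weights; for polynomially bounded
  weights these are \<open>O(log n)\<close>-bit words.\<close>

definition instance_magnitude :: "st_instance \<Rightarrow> nat" where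
  "instance_magnitude I =
     vertex_count I + edge_count I + Max (insert 0 (weight I ` set (edge_list I)))"

text \<open>The output is a fraction in registers 0 and 1, where denominator 0 stands for \<open>\<infinity>\<close>.\<close>

definition estimate :: "state \<Rightarrow> ereal" where
  "estimate s = (if regs s 1 = 0 then \<infinity> else ereal (real (regs s 0) / real (regs s 1)))"

text \<open>Approximation factors are at least 1. Without this condition a nonpositive factor would
  make the guarantee trivial.\<close>

definition approximates :: "real \<Rightarrow> ereal \<Rightarrow> ereal \<Rightarrow> bool" where
  "approximates \<alpha> D D' \<longleftrightarrow> 1 \<le> \<alpha> \<and> D / ereal \<alpha> \<le> D' \<and> D' \<le> D"

definition diameter_runs_in_time :: "com list \<Rightarrow> nat \<Rightarrow> (nat \<Rightarrow> nat) \<Rightarrow> bool" where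
  "diameter_runs_in_time p b T \<longleftrightarrow>
     (\<forall>I. valid_instance I \<longrightarrow>
        halts_within (word_bits b (instance_magnitude I)) (T (edge_count I)) p
          (encode_instance I))"

definition diameter_success_prob ::
  "real \<Rightarrow> com list \<Rightarrow> nat \<Rightarrow> (nat \<Rightarrow> nat) \<Rightarrow> st_instance \<Rightarrow> real" where
  "diameter_success_prob \<alpha> p b T I =
     output_prob (word_bits b (instance_magnitude I)) (T (edge_count I)) p (encode_instance I)
       (\<lambda>s. approximates \<alpha> (ST_diameter I) (estimate s))"


section \<open>The Strong Exponential Time Hypothesis\<close>

text \<open>A literal \<open>(i, True)\<close> is the variable \<open>i\<close>, and \<open>(i, False)\<close> is its negation.\<close>

type_synonym literal = "nat \<times> bool"
type_synonym cnf = "literal list list"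

definition is_cnf :: "nat \<Rightarrow> cnf \<Rightarrow> bool" where
  "is_cnf n F \<longleftrightarrow> (\<forall>C \<in> set F. distinct C \<and> (\<forall>l \<in> set C. fst l < n))"

definition satisfiable :: "cnf \<Rightarrow> bool" where
  "satisfiable F \<longleftrightarrow> (\<exists>\<sigma>. \<forall>C \<in> set F. \<exists>l \<in> set C. \<sigma> (fst l) = snd l)"

definition encode_cnf :: "nat \<Rightarrow> cnf \<Rightarrow> nat list" where
  "encode_cnf n F =
     [n, length F]
     @ concat (map (\<lambda>C. length C # map (\<lambda>(i, s). 2 * i + of_bool s) C) F)"

text \<open>
  \<open>p\<close> decides satisfiability of formulas with \<open>n\<close> variables and at most \<open>K * n\<close> clauses, with
  error probability at most 1/3 (nonzero register 0 means satisfiable). An algorithm running in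
  exponential time may use exponentially many cells, so words, which have to hold addresses,
  are logarithmic in \<open>2 ^ n\<close> rather than in \<open>n\<close>. Operations on such words cost at most a
  factor polynomial in \<open>n\<close>, which is immaterial for the hypothesis.
\<close>

definition decides_sat :: "nat \<Rightarrow> com list \<Rightarrow> nat \<Rightarrow> (nat \<Rightarrow> nat) \<Rightarrow> bool" where
  "decides_sat K p b T \<longleftrightarrow>
     (\<forall>n F. is_cnf n F \<and> length F \<le> K * n \<longrightarrow>
        halts_within (word_bits b (2 ^ n)) (T n) p (encode_cnf n F) \<and>
        output_prob (word_bits b (2 ^ n)) (T n) p (encode_cnf n F)
          (\<lambda>s. regs s 0 \<noteq> 0 \<longleftrightarrow> satisfiable F) \<ge> 2 / 3)"

text \<open>The restriction to \<open>\<epsilon> < 1\<close> keeps the base of the time bound above 1; a time bound with a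
  smaller base would be an even stronger algorithm.\<close>

definition SETH :: bool where
  "SETH \<longleftrightarrow>
     (\<forall>\<epsilon>::real. 0 < \<epsilon> \<and> \<epsilon> < 1 \<longrightarrow>
        (\<exists>K. \<not> (\<exists>p b T. (\<lambda>n. real (T n)) \<in> O(\<lambda>n. (2 - \<epsilon>) ^ n) \<and> decides_sat K p b T)))"

end

theory Submission
  imports Defs "HOL-Real_Asymp.Real_Asymp"
begin

text \<open>
  Algorithm. Sample about \<open>sqrt m\<close> (times a polylogarithmic factor) of the edges from \<open>S\<close> to \<open>T\<close>, and let
  \<open>s0\<close> be the source farthest from the tails of the samples. Let \<open>E\<close> be the largest of the following:
  the distances to \<open>T\<close> from the sampled tails and from \<open>s0\<close>, and the distances from \<open>S\<close> to the heads of
  the edges whose tails are closer to \<open>s0\<close> than all sampled tails; with high probability there are at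
  most \<open>sqrt m\<close> of the latter. If \<open>d(s, t) > 2 E\<close>, then \<open>s\<close> is farther than \<open>E\<close> from every sampled tail,
  hence so is \<open>s0\<close>. But \<open>d(s0, t) \<le> E\<close>, so a shortest path from \<open>s0\<close> to \<open>t\<close> crosses from \<open>S\<close> to \<open>T\<close>
  along an edge whose head \<open>b\<close> has been examined, and \<open>d(s, b) + d(b, t) \<le> 2 E\<close>. All distances are
  computed by Dijkstra's algorithm with a segment tree as priority queue.

  Lower bound. The sources and the far targets are the assignments to the two halves of the
  variables, joined by paths through every clause. The path through a clause has length 1 plus the
  number of the two half assignments that satisfy it, so the distance is at least 2 if and only if
  all clauses are satisfied. The instance has \<open>2 ^ (n / 2)\<close> times polynomially many edges.
\<close>

section \<open>A while language and its compilation\<close>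

text \<open>An overflow stops the machine forever, so every intermediate value needs a proof that it
  fits into a word; a structured language with explicit \<open>safe\<close> conditions keeps these
  proofs local. Randomness is confined to one loop: all coin flips are written to memory before the
  main phase, which is then deterministic. Probabilities thus become counts of bit lists, and the
  time bound holds for every outcome. The failure probability has to beat
  \<open>1 / n powr c\<close> for all \<open>c\<close> with a single program; therefore the number
  of samples carries the square of a logarithm, which makes it at most
  \<open>n * exp (- (bitlen m ^ 2 / 2))\<close>. The running time may depend on \<open>m\<close>
  only: if \<open>n > 2 * m\<close>, some vertex is isolated and the answer is infinity without a
  look at the graph. In the lower bound the given diameter program expects words sized for its own
  instance, whereas the deciding program has words sized for \<open>2 ^ n\<close>; a run that surely
  halts never overflows, so longer words do not change it.\<close>

datatype expr =
    Num nat
  | Var nat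
  | Bin binop expr expr
  | Get expr

datatype prog =
    Skip
  | Asg nat expr
  | Put expr expr
  | Seq prog prog (infixr ";;" 60)
  | Cond expr prog prog
  | Loop expr prog

fun ev :: "expr \<Rightarrow> (nat \<Rightarrow> nat) \<Rightarrow> (nat \<Rightarrow> nat) \<Rightarrow> nat" where
  "ev (Num k) R M = k"
| "ev (Var r) R M = R r"
| "ev (Bin f a b) R M = binop_val f (ev a R M) (ev b R M)"
| "ev (Get a) R M = M (ev a R M)"

text \<open>Marked \<open>False\<close> are operations whose result stays below the word bound
  whenever the operands do; for these \<open>safe\<close> asks for no overflow check.\<close>

fun grows :: "binop \<Rightarrow> bool" where
  "grows Sub = False"
| "grows Div = False"
| "grows Mod = False"
| "grows Less = False"
| "grows Eq = False"
| "grows Shr = False"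
| "grows _ = True"

fun safe :: "nat \<Rightarrow> expr \<Rightarrow> (nat \<Rightarrow> nat) \<Rightarrow> (nat \<Rightarrow> nat) \<Rightarrow> bool" where
  "safe L (Num k) R M \<longleftrightarrow> k < L"
| "safe L (Var r) R M \<longleftrightarrow> True"
| "safe L (Bin f a b) R M \<longleftrightarrow>
     safe L a R M \<and> safe L b R M \<and> (grows f \<longrightarrow> binop_val f (ev a R M) (ev b R M) < L)"
| "safe L (Get a) R M \<longleftrightarrow> safe L a R M"

text \<open>Unsafe expressions have no rule, so a derivation certifies the absence of overflow. Time
  counts commands and tests but not the size of expressions; \<open>step_cost\<close> converts it
  into machine steps by a factor depending on the program only.\<close>

inductive big ::
  "nat \<Rightarrow> prog \<Rightarrow> (nat \<Rightarrow> nat) \<Rightarrow> (nat \<Rightarrow> nat) \<Rightarrow> nat \<Rightarrow> (nat \<Rightarrow> nat) \<Rightarrow> (nat \<Rightarrow> nat) \<Rightarrow> bool"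
  for L where
  "big L Skip R M 0 R M"
| "safe L e R M \<Longrightarrow> big L (Asg r e) R M 1 (R(r := ev e R M)) M"
| "safe L a R M \<Longrightarrow> safe L e R M \<Longrightarrow> big L (Put a e) R M 1 R (M(ev a R M := ev e R M))"
| "big L p R M t R1 M1 \<Longrightarrow> big L q R1 M1 t' R2 M2 \<Longrightarrow> big L (p ;; q) R M (t + t') R2 M2"
| "safe L e R M \<Longrightarrow> big L (if ev e R M \<noteq> 0 then p else q) R M t R1 M1 \<Longrightarrow>
     big L (Cond e p q) R M (Suc t) R1 M1"
| "safe L e R M \<Longrightarrow> ev e R M = 0 \<Longrightarrow> big L (Loop e p) R M 1 R M"
| "safe L e R M \<Longrightarrow> ev e R M \<noteq> 0 \<Longrightarrow> big L p R M t R1 M1 \<Longrightarrow> big L (Loop e p) R1 M1 t' R2 M2 \<Longrightarrow>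
     big L (Loop e p) R M (Suc (t + t')) R2 M2"

inductive_cases big_CondE: "big L (Cond e p q) R M t R1 M1"

definition bounded :: "nat \<Rightarrow> (nat \<Rightarrow> nat) \<Rightarrow> (nat \<Rightarrow> nat) \<Rightarrow> bool" where
  "bounded L R M \<longleftrightarrow> (\<forall>x. R x < L) \<and> (\<forall>x. M x < L)"

lemma ev_bounded:
  assumes "bounded L R M" "1 < L" "safe L e R M"
  shows "ev e R M < L"
  using assms(3)
proof (induction e)
  case (Bin f a b)
  then have *: "ev a R M < L" "ev b R M < L" by auto
  show ?case
    using * Bin.prems assms(2)
    by (cases f) (auto simp: of_bool_def drop_bit_eq_div
        intro: le_less_trans[OF div_le_dividend] le_less_trans[OF mod_less_eq_dividend])
qed (use assms in \<open>auto simp: bounded_def\<close>)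

text \<open>Deterministic execution, expressed as equality of the distributions after any number
  \<open>t\<close> of further steps. Such segments can be chained and combined with randomized code
  before or behind them.\<close>

definition steps :: "nat \<Rightarrow> nat \<Rightarrow> config \<Rightarrow> config \<Rightarrow> bool" where
  "steps w k c c' \<longleftrightarrow> (\<forall>t. run w (k + t) c = run w t c')"

lemma steps_refl: "steps w 0 c c"
  by (simp add: steps_def)

lemma steps_eqI: "c = c' \<Longrightarrow> steps w 0 c c'"
  by (simp add: steps_refl)

lemma steps_trans:
  assumes "steps w k c c1" "steps w l c1 c2"
  shows "steps w (k + l) c c2"
  unfolding steps_def
proof
  fix t
  have "run w (k + l + t) c = run w (k + (l + t)) c" by (simp add: add.assoc)
  then show "run w (k + l + t) c = run w t c2" using assms by (simp add: steps_def)
qed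

lemma steps_Suc: "step w c = return_pmf c1 \<Longrightarrow> steps w k c1 c2 \<Longrightarrow> steps w (Suc k) c c2"
  by (simp add: steps_def bind_return_pmf)

lemma steps_Const:
  "v < 2 ^ w \<Longrightarrow> steps w k (cs, s\<lparr>regs := (regs s)(r := v)\<rparr>) c \<Longrightarrow>
    steps w (Suc k) (Const r v # cs, s) c"
  by (rule steps_Suc) (auto simp: write_reg_def)

lemma steps_Op:
  "binop_val f (regs s a) (regs s b) < 2 ^ w \<Longrightarrow>
    steps w k (cs, s\<lparr>regs := (regs s)(r := binop_val f (regs s a) (regs s b))\<rparr>) c \<Longrightarrow>
    steps w (Suc k) (Op f r a b # cs, s) c"
  by (rule steps_Suc) (auto simp: write_reg_def)

lemma steps_Load:
  "mem s (regs s a) < 2 ^ w \<Longrightarrow>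
    steps w k (cs, s\<lparr>regs := (regs s)(r := mem s (regs s a))\<rparr>) c \<Longrightarrow>
    steps w (Suc k) (Load r a # cs, s) c"
  by (rule steps_Suc) (auto simp: write_reg_def)

lemma steps_Store:
  "steps w k (cs, s\<lparr>mem := (mem s)(regs s a := regs s r)\<rparr>) c \<Longrightarrow>
    steps w (Suc k) (Store a r # cs, s) c"
  by (rule steps_Suc) auto

lemma steps_If:
  "steps w k ((if regs s r \<noteq> 0 then p else q) @ cs, s) c \<Longrightarrow>
    steps w (Suc k) (If r p q # cs, s) c"
  by (rule steps_Suc) auto

lemma steps_While:
  "steps w k (if regs s r \<noteq> 0 then p @ While r p # cs else cs, s) c \<Longrightarrow>
    steps w (Suc k) (While r p # cs, s) c"
  by (rule steps_Suc) auto

text \<open>Expressions are evaluated on a stack of registers starting at register \<open>k\<close>.\<close>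

fun cexp :: "expr \<Rightarrow> nat \<Rightarrow> com list" where
  "cexp (Num v) k = [Const k v]"
| "cexp (Var r) k = [Const k 0, Op Add k r k]"
| "cexp (Bin f a b) k = cexp a k @ cexp b (Suc k) @ [Op f k k (Suc k)]"
| "cexp (Get a) k = cexp a k @ [Load k k]"

fun depth :: "expr \<Rightarrow> nat" where
  "depth (Num v) = 1"
| "depth (Var r) = 1"
| "depth (Bin f a b) = max (depth a) (Suc (depth b))"
| "depth (Get a) = depth a"

fun vars_below :: "nat \<Rightarrow> expr \<Rightarrow> bool" where
  "vars_below k (Num v) \<longleftrightarrow> True"
| "vars_below k (Var r) \<longleftrightarrow> r < k"
| "vars_below k (Bin f a b) \<longleftrightarrow> vars_below k a \<and> vars_below k b"
| "vars_below k (Get a) \<longleftrightarrow> vars_below k a"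

lemma depth_pos: "0 < depth e"
  by (induction e) auto

text \<open>\<open>R\<close> is the valuation of the source language and need only agree with the
  machine below \<open>n\<close>. The second operand is evaluated one register higher, so the value
  of the first one in register \<open>k\<close> survives; only registers from \<open>k\<close> to
  \<open>k + depth e - 1\<close> are touched.\<close>

lemma cexp_steps:
  assumes "bounded (2 ^ w) R (mem s)" "1 < (2::nat) ^ w" "safe (2 ^ w) e R (mem s)"
    "vars_below n e" "n \<le> k" "\<forall>r<n. regs s r = R r" "\<forall>r. regs s r < 2 ^ w"
  shows "\<exists>R'. steps w (length (cexp e k)) (cexp e k @ cs, s) (cs, s\<lparr>regs := R'\<rparr>) \<and>
    R' k = ev e R (mem s) \<and> (\<forall>r. r < k \<or> k + depth e \<le> r \<longrightarrow> R' r = regs s r) \<and>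
    (\<forall>r. R' r < 2 ^ w)"
  using assms(1,3-7)
proof (induction e arbitrary: s k cs)
  case (Num v)
  then have "steps w (Suc 0) (cexp (Num v) k @ cs, s) (cs, s\<lparr>regs := (regs s)(k := v)\<rparr>)"
    by (auto intro!: steps_Const steps_eqI)
  then show ?case
    using Num by (intro exI[of _ "(regs s)(k := v)"]) (auto simp: fun_upd_def)
next
  case (Var r)
  have "steps w (Suc (Suc 0)) (cexp (Var r) k @ cs, s) (cs, s\<lparr>regs := (regs s)(k := R r)\<rparr>)"
    using Var assms(2)
    by (simp, intro steps_Const steps_Op) (auto simp: bounded_def intro: steps_refl)
  then show ?case
    using Var
    by (intro exI[of _ "(regs s)(k := R r)"]) (auto simp: bounded_def fun_upd_def)
next
  case (Bin f a b)
  let ?cs1 = "cexp b (Suc k) @ Op f k k (Suc k) # cs"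
  obtain R1 where R1: "steps w (length (cexp a k)) (cexp a k @ ?cs1, s) (?cs1, s\<lparr>regs := R1\<rparr>)"
    "R1 k = ev a R (mem s)" "\<forall>r. r < k \<or> k + depth a \<le> r \<longrightarrow> R1 r = regs s r" "\<forall>r. R1 r < 2 ^ w"
    using Bin.IH(1)[of s k ?cs1] Bin.prems by auto
  let ?cs2 = "Op f k k (Suc k) # cs"
  have "\<exists>R'. steps w (length (cexp b (Suc k))) (cexp b (Suc k) @ ?cs2, s\<lparr>regs := R1\<rparr>)
      (?cs2, (s\<lparr>regs := R1\<rparr>)\<lparr>regs := R'\<rparr>) \<and>
    R' (Suc k) = ev b R (mem (s\<lparr>regs := R1\<rparr>)) \<and>
    (\<forall>r. r < Suc k \<or> Suc k + depth b \<le> r \<longrightarrow> R' r = regs (s\<lparr>regs := R1\<rparr>) r) \<and>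
    (\<forall>r. R' r < 2 ^ w)"
    by (rule Bin.IH(2)) (use Bin.prems R1 in auto)
  then obtain R2 where R2: "steps w (length (cexp b (Suc k))) (cexp b (Suc k) @ ?cs2, s\<lparr>regs := R1\<rparr>)
      (?cs2, s\<lparr>regs := R2\<rparr>)"
    "R2 (Suc k) = ev b R (mem s)" "\<forall>r. r < Suc k \<or> Suc k + depth b \<le> r \<longrightarrow> R2 r = R1 r"
    "\<forall>r. R2 r < 2 ^ w"
    by auto
  let ?v = "ev (Bin f a b) R (mem s)"
  have v: "?v < 2 ^ w"
    by (rule ev_bounded[OF Bin.prems(1) assms(2) Bin.prems(2)])
  have "steps w (Suc 0) (?cs2, s\<lparr>regs := R2\<rparr>) (cs, s\<lparr>regs := R2(k := ?v)\<rparr>)"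
    using v R1(2) R2(2,3) by (intro steps_Op) (auto intro: steps_refl)
  then have "steps w (length (cexp (Bin f a b) k)) (cexp (Bin f a b) k @ cs, s)
      (cs, s\<lparr>regs := R2(k := ?v)\<rparr>)"
    using steps_trans[OF R1(1) steps_trans[OF R2(1), of "Suc 0" "(cs, s\<lparr>regs := R2(k := ?v)\<rparr>)"]]
    by simp
  then show ?case
    using R1 R2 v by (intro exI[of _ "R2(k := ?v)"]) (auto simp: fun_upd_def)
next
  case (Get a)
  let ?cs1 = "Load k k # cs"
  obtain R1 where R1: "steps w (length (cexp a k)) (cexp a k @ ?cs1, s) (?cs1, s\<lparr>regs := R1\<rparr>)"
    "R1 k = ev a R (mem s)" "\<forall>r. r < k \<or> k + depth a \<le> r \<longrightarrow> R1 r = regs s r" "\<forall>r. R1 r < 2 ^ w"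
    using Get.IH[of s k ?cs1] Get.prems by auto
  let ?v = "mem s (ev a R (mem s))"
  have "steps w (Suc 0) (?cs1, s\<lparr>regs := R1\<rparr>) (cs, s\<lparr>regs := R1(k := ?v)\<rparr>)"
    using Get.prems(1) R1(2) by (intro steps_Load) (auto simp: bounded_def intro: steps_refl)
  then have "steps w (length (cexp (Get a) k)) (cexp (Get a) k @ cs, s)
      (cs, s\<lparr>regs := R1(k := ?v)\<rparr>)"
    using steps_trans[OF R1(1), of "Suc 0" "(cs, s\<lparr>regs := R1(k := ?v)\<rparr>)"] by simp
  then show ?case
    using R1 Get.prems(1) depth_pos[of a]
    by (intro exI[of _ "R1(k := ?v)"]) (auto simp: bounded_def fun_upd_def)
qed

text \<open>\<open>While\<close> tests a register, so a loop condition is computed once before the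
  loop and again at the end of each pass. There is no move instruction; values are moved by adding
  0.\<close>

fun compile :: "nat \<Rightarrow> prog \<Rightarrow> com list" where
  "compile T Skip = []"
| "compile T (Asg r e) = cexp e T @ [Const (Suc T) 0, Op Add r T (Suc T)]"
| "compile T (Put a e) = cexp a T @ cexp e (Suc T) @ [Store T (Suc T)]"
| "compile T (p ;; q) = compile T p @ compile T q"
| "compile T (Cond e p q) = cexp e T @ [If T (compile T p) (compile T q)]"
| "compile T (Loop e p) = cexp e T @ [While T (compile T p @ cexp e T)]"

fun prog_depth :: "prog \<Rightarrow> nat" where
  "prog_depth Skip = 0"
| "prog_depth (Asg r e) = max 2 (depth e)"
| "prog_depth (Put a e) = max (depth a) (Suc (depth e))"
| "prog_depth (p ;; q) = max (prog_depth p) (prog_depth q)"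
| "prog_depth (Cond e p q) = max (depth e) (max (prog_depth p) (prog_depth q))"
| "prog_depth (Loop e p) = max (depth e) (prog_depth p)"

fun regs_below :: "nat \<Rightarrow> prog \<Rightarrow> bool" where
  "regs_below T Skip \<longleftrightarrow> True"
| "regs_below T (Asg r e) \<longleftrightarrow> r < T \<and> vars_below T e"
| "regs_below T (Put a e) \<longleftrightarrow> vars_below T a \<and> vars_below T e"
| "regs_below T (p ;; q) \<longleftrightarrow> regs_below T p \<and> regs_below T q"
| "regs_below T (Cond e p q) \<longleftrightarrow> vars_below T e \<and> regs_below T p \<and> regs_below T q"
| "regs_below T (Loop e p) \<longleftrightarrow> vars_below T e \<and> regs_below T p"

fun step_cost :: "prog \<Rightarrow> nat" where
  "step_cost Skip = 0"
| "step_cost (Asg r e) = length (cexp e 0) + 2"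
| "step_cost (Put a e) = length (cexp a 0) + length (cexp e 0) + 1"
| "step_cost (p ;; q) = max (step_cost p) (step_cost q)"
| "step_cost (Cond e p q) = max (length (cexp e 0) + 1) (max (step_cost p) (step_cost q))"
| "step_cost (Loop e p) = max (length (cexp e 0) + 2) (step_cost p)"

lemma length_cexp: "length (cexp e k) = length (cexp e 0)"
proof -
  have "\<forall>k l. length (cexp e k) = length (cexp e l)"
    by (induction e) (auto, metis+)
  then show ?thesis by blast
qed

text \<open>Registers between \<open>T\<close> and \<open>T + D\<close> are scratch space and
  unconstrained. That all later ones are 0 allows a finite number of assignments to restore the
  initial registers when another program is to follow.\<close>

definition implements :: "nat \<Rightarrow> nat \<Rightarrow> nat \<Rightarrow> state \<Rightarrow> (nat \<Rightarrow> nat) \<Rightarrow> (nat \<Rightarrow> nat) \<Rightarrow> bool" where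
  "implements w T D s R M \<longleftrightarrow> mem s = M \<and> (\<forall>r<T. regs s r = R r) \<and>
     (\<forall>r. regs s r < 2 ^ w) \<and> (\<forall>r\<ge>T + D. regs s r = 0) \<and> bounded (2 ^ w) R M"

lemma implements_temp:
  assumes "implements w T D s R M" "\<forall>r. r < T \<or> T + d \<le> r \<longrightarrow> R' r = regs s r"
    "\<forall>r. R' r < 2 ^ w" "d \<le> D"
  shows "implements w T D (s\<lparr>regs := R'\<rparr>) R M"
  using assms by (auto simp: implements_def)

lemma implements_cexp:
  assumes "implements w T D s R M" "1 < (2::nat) ^ w" "safe (2 ^ w) e R M" "vars_below T e"
    "depth e \<le> D"
  shows "\<exists>s'. steps w (length (cexp e 0)) (cexp e T @ cs, s) (cs, s') \<and> implements w T D s' R M \<and>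
    regs s' T = ev e R M"
proof -
  have m: "mem s = M" using assms(1) by (simp add: implements_def)
  obtain R' where R': "steps w (length (cexp e T)) (cexp e T @ cs, s) (cs, s\<lparr>regs := R'\<rparr>)"
    "R' T = ev e R M" "\<forall>r. r < T \<or> T + depth e \<le> r \<longrightarrow> R' r = regs s r" "\<forall>r. R' r < 2 ^ w"
    using cexp_steps[of w R s e T T cs] assms m by (auto simp: implements_def)
  then show ?thesis
    using implements_temp[OF assms(1) R'(3,4) assms(5)] length_cexp[of e T]
    by (intro exI[of _ "s\<lparr>regs := R'\<rparr>"]) auto
qed

text \<open>Each unit of time pays for at most \<open>C\<close> machine steps, namely for the
  evaluation of the expressions of one command or test. The continuation \<open>cs\<close> is
  arbitrary, as induction enters code in the middle of larger code.\<close>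

theorem compile_correct:
  assumes "big (2 ^ w) p R M t R' M'" "implements w T D s R M" "1 < (2::nat) ^ w"
    "regs_below T p" "prog_depth p \<le> D" "step_cost p \<le> C"
  shows "\<exists>k s'. k \<le> C * t \<and> steps w k (compile T p @ cs, s) (cs, s') \<and> implements w T D s' R' M'"
  using assms(1-2,4-6)
proof (induction arbitrary: s cs rule: big.induct)
  case (1 R M)
  then show ?case by (auto intro!: exI[of _ 0] exI[of _ s] steps_refl)
next
  case (2 e R M r)
  let ?cs1 = "Const (Suc T) 0 # Op Add r T (Suc T) # cs"
  obtain s1 where s1: "steps w (length (cexp e 0)) (cexp e T @ ?cs1, s) (?cs1, s1)"
    "implements w T D s1 R M" "regs s1 T = ev e R M"
    using implements_cexp[of w T D s R M e ?cs1] 2 assms(3) by auto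
  have v: "ev e R M < 2 ^ w"
    using ev_bounded[of "2 ^ w" R M e] 2 assms(3) by (auto simp: implements_def)
  let ?s2 = "s1\<lparr>regs := (regs s1)(Suc T := 0, r := ev e R M)\<rparr>"
  have "steps w (Suc (Suc 0)) (?cs1, s1) (cs, ?s2)"
    using s1 v assms(3)
    by (intro steps_Const steps_Op) (auto intro: steps_eqI)
  then have "steps w (length (cexp e 0) + 2) (compile T (Asg r e) @ cs, s) (cs, ?s2)"
    using steps_trans[OF s1(1), of "Suc (Suc 0)" "(cs, ?s2)"] by (simp add: numeral_2_eq_2)
  moreover have "implements w T D ?s2 (R(r := ev e R M)) M"
    using s1 v 2 assms(3) by (auto simp: implements_def bounded_def)
  moreover have "length (cexp e 0) + 2 \<le> C * 1" using 2 by simp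
  ultimately show ?case by blast
next
  case (3 a R M e)
  let ?cs1 = "cexp e (Suc T) @ Store T (Suc T) # cs" let ?cs2 = "Store T (Suc T) # cs"
  obtain s1 where s1: "steps w (length (cexp a 0)) (cexp a T @ ?cs1, s) (?cs1, s1)"
    "implements w T D s1 R M" "regs s1 T = ev a R M"
    using implements_cexp[of w T D s R M a ?cs1] 3 assms(3) by auto
  have m1: "mem s1 = M" using s1(2) by (simp add: implements_def)
  obtain R2 where R2: "steps w (length (cexp e (Suc T))) (?cs1, s1) (?cs2, s1\<lparr>regs := R2\<rparr>)"
    "R2 (Suc T) = ev e R M" "\<forall>r. r < Suc T \<or> Suc T + depth e \<le> r \<longrightarrow> R2 r = regs s1 r"
    "\<forall>r. R2 r < 2 ^ w"
    using cexp_steps[of w R s1 e T "Suc T" ?cs2] 3 assms(3) s1 m1 by (auto simp: implements_def)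
  have v: "ev e R M < 2 ^ w"
    using ev_bounded[of "2 ^ w" R M e] 3 assms(3) by (auto simp: implements_def)
  let ?s3 = "s1\<lparr>regs := R2, mem := M(ev a R M := ev e R M)\<rparr>"
  have "steps w (Suc 0) (?cs2, s1\<lparr>regs := R2\<rparr>) (cs, ?s3)"
    using R2 s1 m1 by (intro steps_Store) (auto intro: steps_refl)
  then have "steps w (length (cexp a 0) + (length (cexp e 0) + 1)) (compile T (Put a e) @ cs, s) (cs, ?s3)"
    using steps_trans[OF s1(1) steps_trans[OF R2(1), of "Suc 0" "(cs, ?s3)"]] length_cexp[of e "Suc T"]
    by simp
  moreover have "implements w T D ?s3 R (M(ev a R M := ev e R M))"
    using s1 v 3 R2 assms(3) by (auto simp: implements_def bounded_def)
  moreover have "length (cexp a 0) + (length (cexp e 0) + 1) \<le> C * 1" using 3 by simp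
  ultimately show ?case by blast
next
  case (4 p R M t R1 M1 q t' R2 M2)
  obtain k1 s1 where 1: "k1 \<le> C * t" "steps w k1 (compile T p @ (compile T q @ cs), s) (compile T q @ cs, s1)"
    "implements w T D s1 R1 M1"
    using 4 by (metis max.bounded_iff prog_depth.simps(4) regs_below.simps(4) step_cost.simps(4))
  obtain k2 s2 where 2: "k2 \<le> C * t'" "steps w k2 (compile T q @ cs, s1) (cs, s2)"
    "implements w T D s2 R2 M2"
    using 4 1(3) by (metis max.bounded_iff prog_depth.simps(4) regs_below.simps(4) step_cost.simps(4))
  show ?case
    using steps_trans[OF 1(2) 2(2)] 1 2 by (intro exI[of _ "k1 + k2"] exI[of _ s2]) (auto simp: algebra_simps)
next
  case (5 e R M p q t R1 M1)
  let ?cs1 = "If T (compile T p) (compile T q) # cs"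
  obtain s1 where s1: "steps w (length (cexp e 0)) (cexp e T @ ?cs1, s) (?cs1, s1)"
    "implements w T D s1 R M" "regs s1 T = ev e R M"
    using implements_cexp[of w T D s R M e ?cs1] 5 assms(3) by auto
  let ?p = "if ev e R M \<noteq> 0 then p else q"
  have "regs_below T ?p" "prog_depth ?p \<le> D" "step_cost ?p \<le> C"
    using 5 by auto
  then obtain k2 s2 where 2: "k2 \<le> C * t" "steps w k2 (compile T ?p @ cs, s1) (cs, s2)"
    "implements w T D s2 R1 M1"
    using 5(3)[of s1 cs] s1 by auto
  have "steps w (Suc k2) (?cs1, s1) (cs, s2)"
    using 2 s1 by (intro steps_If) (auto split: if_splits)
  from steps_trans[OF s1(1) this]
  have "steps w (length (cexp e 0) + Suc k2) (compile T (Cond e p q) @ cs, s) (cs, s2)" by simp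
  moreover have "length (cexp e 0) + Suc k2 \<le> C * Suc t" using 2 5 by simp
  ultimately show ?case using 2 by blast
next
  case (6 e R M p)
  let ?cs1 = "While T (compile T p @ cexp e T) # cs"
  obtain s1 where s1: "steps w (length (cexp e 0)) (cexp e T @ ?cs1, s) (?cs1, s1)"
    "implements w T D s1 R M" "regs s1 T = ev e R M"
    using implements_cexp[of w T D s R M e ?cs1] 6 assms(3) by auto
  have "steps w (Suc 0) (?cs1, s1) (cs, s1)"
    using s1 6 by (intro steps_While) (auto intro: steps_refl)
  from steps_trans[OF s1(1) this]
  have "steps w (length (cexp e 0) + Suc 0) (compile T (Loop e p) @ cs, s) (cs, s1)" by simp
  moreover have "length (cexp e 0) + Suc 0 \<le> C * 1" using 6 by simp
  ultimately show ?case using s1 by blast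
next
  case (7 e R M p t R1 M1 t' R2 M2)
  let ?cs1 = "While T (compile T p @ cexp e T) # cs"
  obtain s1 where s1: "steps w (length (cexp e 0)) (cexp e T @ ?cs1, s) (?cs1, s1)"
    "implements w T D s1 R M" "regs s1 T = ev e R M"
    using implements_cexp[of w T D s R M e ?cs1] 7 assms(3) by auto
  obtain k2 s2 where 2: "k2 \<le> C * t" "steps w k2 (compile T p @ (cexp e T @ ?cs1), s1) (cexp e T @ ?cs1, s2)"
    "implements w T D s2 R1 M1"
    using 7(5)[of s1 "cexp e T @ ?cs1"] s1(2) 7(8-10) by (simp, blast)
  have a: "steps w (Suc k2) (?cs1, s1) (cexp e T @ ?cs1, s2)"
    using 2 s1 7(2) by (intro steps_While) auto
  \<comment> \<open>The code left after the body, \<open>cexp e T @ ?cs1\<close>, is the compiled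
    loop itself; so the induction hypothesis applies and the repeated test is charged to the next
    pass.\<close>
  obtain k3 s3 where 3: "k3 \<le> C * t'" "steps w k3 (compile T (Loop e p) @ cs, s2) (cs, s3)"
    "implements w T D s3 R2 M2"
    using 7(6)[of s2 cs] 2(3) 7(8-10) by (simp, blast)
  have "steps w (length (cexp e 0) + (Suc k2 + k3)) (compile T (Loop e p) @ cs, s) (cs, s3)"
    using steps_trans[OF s1(1) steps_trans[OF a 3(2)[simplified]]] by simp
  moreover have "length (cexp e 0) + (Suc k2 + k3) \<le> C * Suc (t + t')"
    using 2 3 7 by (auto simp: algebra_simps)
  ultimately show ?case using 3 by blast
qed

section \<open>Weakest preconditions for total correctness with running times\<close>

definition wp ::
  "nat \<Rightarrow> prog \<Rightarrow> (nat \<Rightarrow> (nat \<Rightarrow> nat) \<Rightarrow> (nat \<Rightarrow> nat) \<Rightarrow> bool) \<Rightarrow> (nat \<Rightarrow> nat) \<Rightarrow> (nat \<Rightarrow> nat) \<Rightarrow> bool"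
  where "wp L p Q R M \<longleftrightarrow> (\<exists>t R' M'. big L p R M t R' M' \<and> Q t R' M')"

lemma wp_mono: "wp L p Q R M \<Longrightarrow> (\<And>t R' M'. Q t R' M' \<Longrightarrow> Q' t R' M') \<Longrightarrow> wp L p Q' R M"
  unfolding wp_def by blast

lemma wp_Skip: "wp L Skip Q R M \<longleftrightarrow> Q 0 R M"
  by (auto simp: wp_def intro: big.intros elim: big.cases)

lemma wp_Asg: "wp L (Asg r e) Q R M \<longleftrightarrow> safe L e R M \<and> Q 1 (R(r := ev e R M)) M"
  unfolding wp_def
  by (rule iffI, (erule exE conjE)+, erule big.cases) (auto intro!: exI big.intros)

lemma wp_Put:
  "wp L (Put a e) Q R M \<longleftrightarrow>
    safe L a R M \<and> safe L e R M \<and> Q 1 R (M(ev a R M := ev e R M))"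
  unfolding wp_def
  by (rule iffI, (erule exE conjE)+, erule big.cases) (auto intro!: exI big.intros)

lemma wp_Seq:
  "wp L (p ;; q) Q R M \<longleftrightarrow> wp L p (\<lambda>t R M. wp L q (\<lambda>t'. Q (t + t')) R M) R M"
  unfolding wp_def by (rule iffI, (erule exE conjE)+, erule big.cases) (auto intro: big.intros, blast+)

lemma wp_Cond:
  "wp L (Cond e p q) Q R M \<longleftrightarrow>
    safe L e R M \<and>
    (if ev e R M \<noteq> 0 then wp L p (\<lambda>t. Q (Suc t)) R M else wp L q (\<lambda>t. Q (Suc t)) R M)"
  unfolding wp_def
proof
  assume "\<exists>t R' M'. big L (Cond e p q) R M t R' M' \<and> Q t R' M'"
  then show "safe L e R M \<and>
    (if ev e R M \<noteq> 0 then \<exists>t R' M'. big L p R M t R' M' \<and> Q (Suc t) R' M'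
     else \<exists>t R' M'. big L q R M t R' M' \<and> Q (Suc t) R' M')"
    by (elim exE conjE, elim big_CondE) (auto split: if_splits)
next
  assume "safe L e R M \<and>
    (if ev e R M \<noteq> 0 then \<exists>t R' M'. big L p R M t R' M' \<and> Q (Suc t) R' M'
     else \<exists>t R' M'. big L q R M t R' M' \<and> Q (Suc t) R' M')"
  then show "\<exists>t R' M'. big L (Cond e p q) R M t R' M' \<and> Q t R' M'"
    using big.intros(5)[of L e R M p q] by (cases "ev e R M \<noteq> 0") (simp_all, blast+)
qed

lemmas wp_simps = wp_Skip wp_Asg wp_Put wp_Seq wp_Cond

text \<open>The potential \<open>\<phi>\<close> is termination measure and time account in one: each
  pass must lower it by the time of the body plus one for the test. The \<open>Suc\<close> at the
  exit pays for the final failing test.\<close>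

lemma wp_Loop:
  assumes init: "I R M"
    and safe: "\<And>R M. I R M \<Longrightarrow> safe L e R M"
    and body: "\<And>R M. I R M \<Longrightarrow> ev e R M \<noteq> 0 \<Longrightarrow>
      wp L p (\<lambda>t R' M'. I R' M' \<and> Suc t + \<phi> R' M' \<le> \<phi> R M) R M"
    and exit: "\<And>t R' M'. I R' M' \<Longrightarrow> ev e R' M' = 0 \<Longrightarrow> t + \<phi> R' M' \<le> Suc (\<phi> R M) \<Longrightarrow> Q t R' M'"
  shows "wp L (Loop e p) Q R M"
proof -
  have "\<exists>t R' M'. big L (Loop e p) R M t R' M' \<and> I R' M' \<and> ev e R' M' = 0 \<and>
      t + \<phi> R' M' \<le> Suc (\<phi> R M)"
    using init
  proof (induction "\<phi> R M" arbitrary: R M rule: less_induct)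
    case less
    show ?case
    proof (cases "ev e R M = 0")
      case True
      then show ?thesis
        using less.prems safe[of R M] by (rule_tac x = 1 in exI, rule_tac x = R in exI, rule_tac x = M in exI) (auto intro: big.intros(6)[simplified])
    next
      case False
      obtain t R1 M1 where 1: "big L p R M t R1 M1" "I R1 M1" "Suc t + \<phi> R1 M1 \<le> \<phi> R M"
        using body[OF less.prems False] by (auto simp: wp_def)
      obtain t' R2 M2 where 2: "big L (Loop e p) R1 M1 t' R2 M2" "I R2 M2" "ev e R2 M2 = 0"
        "t' + \<phi> R2 M2 \<le> Suc (\<phi> R1 M1)"
        using less.hyps[of R1 M1] 1 by auto
      have "big L (Loop e p) R M (Suc (t + t')) R2 M2"
        using big.intros(7)[OF safe[OF less.prems] False 1(1) 2(1)] .
      then show ?thesis using 1 2 by (intro exI[of _ "Suc (t + t')"] exI[of _ R2] exI[of _ M2]) auto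
    qed
  qed
  then show ?thesis using exit unfolding wp_def by blast
qed

section \<open>Arrays\<close>

abbreviation add_expr (infixl "\<oplus>" 65) where "a \<oplus> b \<equiv> Bin Add a b"
abbreviation sub_expr (infixl "\<ominus>" 65) where "a \<ominus> b \<equiv> Bin Sub a b"
abbreviation mul_expr (infixl "\<otimes>" 70) where "a \<otimes> b \<equiv> Bin Mul a b"
abbreviation less_expr (infix "\<lless>" 60) where "a \<lless> b \<equiv> Bin Less a b"
abbreviation eq_expr (infix "\<doteq>" 60) where "a \<doteq> b \<equiv> Bin Eq a b"

text \<open>Sixteen interleaved arrays, which may grow without overlapping, occupy the memory from
  address \<open>16 * z\<close>, where \<open>z\<close> is kept in register 31.\<close>

definition cell :: "nat \<Rightarrow> nat \<Rightarrow> nat \<Rightarrow> nat" where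
  "cell z c i = 16 * (z + i) + c"

definition addr :: "nat \<Rightarrow> expr \<Rightarrow> expr" where
  "addr c e = Num 16 \<otimes> (Var 31 \<oplus> e) \<oplus> Num c"

abbreviation arr :: "nat \<Rightarrow> expr \<Rightarrow> expr" where
  "arr c e \<equiv> Get (addr c e)"

lemma cell_eq_iff [simp]:
  "c < 16 \<Longrightarrow> d < 16 \<Longrightarrow> cell z c i = cell z d j \<longleftrightarrow> c = d \<and> i = j"
proof
  assume "c < 16" "d < 16" "cell z c i = cell z d j"
  then have "c + 16 * i = d + 16 * j" by (simp add: cell_def)
  then have "(c + 16 * i) mod 16 = (d + 16 * j) mod 16" "c + 16 * i = d + 16 * j" by simp_all
  then show "c = d \<and> i = j"
    unfolding mod_mult_self2 using \<open>c < 16\<close> \<open>d < 16\<close> by simp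
qed auto

lemma cell_neq_low [simp]: "x < z \<Longrightarrow> x \<noteq> cell z c i" "x < z \<Longrightarrow> cell z c i \<noteq> x"
  by (auto simp: cell_def)

lemma ev_addr [simp]: "ev (addr c e) R M = cell (R 31) c (ev e R M)"
  by (simp add: addr_def cell_def)

lemma safe_addr [simp]:
  "c < 16 \<Longrightarrow> 16 * (R 31 + ev e R M) + 16 < L \<Longrightarrow> safe L (addr c e) R M \<longleftrightarrow> safe L e R M"
  by (auto simp: addr_def)

definition keep :: "nat set \<Rightarrow> (nat \<Rightarrow> nat) \<Rightarrow> (nat \<Rightarrow> nat) \<Rightarrow> bool" where
  "keep X f g \<longleftrightarrow> (\<forall>x. x \<notin> X \<longrightarrow> g x = f x)"

lemma keepD: "keep X f g \<Longrightarrow> x \<notin> X \<Longrightarrow> g x = f x"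
  by (simp add: keep_def)

lemma keep_refl [simp]: "keep X f f"
  by (simp add: keep_def)

lemma keep_trans: "keep X f g \<Longrightarrow> keep Y g h \<Longrightarrow> X \<union> Y \<subseteq> Z \<Longrightarrow> keep Z f h"
  unfolding keep_def by (metis UnI1 UnI2 subsetD)

lemma keep_mono: "keep X f g \<Longrightarrow> X \<subseteq> Z \<Longrightarrow> keep Z f g"
  by (auto simp: keep_def)

lemma keep_upd [simp]: "x \<in> X \<Longrightarrow> keep X f (g(x := v)) \<longleftrightarrow> keep X f g"
  by (auto simp: keep_def)

definition cols :: "nat \<Rightarrow> nat set \<Rightarrow> nat set" where
  "cols z C = {cell z c i | c i. c \<in> C}"

lemma cell_in_cols [simp]: "c < 16 \<Longrightarrow> C \<subseteq> {..<16} \<Longrightarrow> cell z c i \<in> cols z C \<longleftrightarrow> c \<in> C"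
proof
  assume "c < 16" "C \<subseteq> {..<16}" "cell z c i \<in> cols z C"
  then obtain d j where "cell z c i = cell z d j" "d \<in> C" "d < 16"
    by (auto simp: cols_def)
  then show "c \<in> C" using \<open>c < 16\<close> by simp
qed (auto simp: cols_def)

lemma low_notin_cols [simp]: "x < z \<Longrightarrow> x \<notin> cols z C"
  by (auto simp: cols_def cell_def)

lemma cols_mono: "C \<subseteq> D \<Longrightarrow> cols z C \<subseteq> cols z D"
  by (auto simp: cols_def)

section \<open>Binary length\<close>

fun bitlen :: "nat \<Rightarrow> nat" where
  "bitlen n = (if n = 0 then 0 else Suc (bitlen (n div 2)))"

declare bitlen.simps [simp del]

lemma bitlen_0 [simp]: "bitlen 0 = 0"
  by (simp add: bitlen.simps)

lemma bitlen_half: "0 < n \<Longrightarrow> bitlen n = Suc (bitlen (n div 2))"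
  by (simp add: bitlen.simps)

lemma bitlen_le_iff: "bitlen n \<le> k \<longleftrightarrow> n < 2 ^ k"
proof (induction n arbitrary: k rule: bitlen.induct)
  case (1 n)
  show ?case
  proof (cases "n = 0")
    case False
    then show ?thesis
      using 1[of "k - 1"] by (cases k) (auto simp: bitlen_half)
  qed simp
qed

lemma bitlen_mono: "m \<le> n \<Longrightarrow> bitlen m \<le> bitlen n"
  using bitlen_le_iff[of m "bitlen n"] bitlen_le_iff[of n "bitlen n"] by simp

section \<open>Walks\<close>

text \<open>Edges are indices below \<open>m\<close>, as in the input; exchanging \<open>a\<close>
  and \<open>b\<close> gives the reversed graph, so one proof of the search serves both
  directions.\<close>

inductive wk ::
  "nat \<Rightarrow> (nat \<Rightarrow> nat) \<Rightarrow> (nat \<Rightarrow> nat) \<Rightarrow> (nat \<Rightarrow> nat) \<Rightarrow> nat \<Rightarrow> nat \<Rightarrow> nat \<Rightarrow> bool"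
  for m a b w where
  wk_refl: "wk m a b w u u 0"
| wk_edge: "wk m a b w u (a e) c \<Longrightarrow> e < m \<Longrightarrow> wk m a b w u (b e) (c + w e)"

lemma wk_trans: "wk m a b w v x d \<Longrightarrow> wk m a b w u v c \<Longrightarrow> wk m a b w u x (c + d)"
  by (induction rule: wk.induct) (auto simp: add.assoc[symmetric] intro: wk_edge)

lemma wk_single: "e < m \<Longrightarrow> wk m a b w (a e) (b e) (w e)"
  using wk_edge[OF wk_refl, of e m a b w] by simp

lemma wk_reverse: "wk m a b w u v c \<Longrightarrow> wk m b a w v u c"
proof (induction rule: wk.induct)
  case (wk_edge u e c)
  have "wk m b a w (b e) (a e) (w e)" using wk_single[of e m b a w] wk_edge by simp
  then show ?case using wk_trans[OF wk_edge.IH, of "b e" "w e"] by (simp add: add.commute)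
qed (rule wk_refl)

section \<open>Linked adjacency lists\<close>

text \<open>The list of the edges leaving \<open>u\<close> is linked downwards: \<open>last_arc a u k\<close> is one more than the
  largest \<open>e < k\<close> with \<open>a e = u\<close>, or 0 if there is none.\<close>

primrec last_arc :: "(nat \<Rightarrow> nat) \<Rightarrow> nat \<Rightarrow> nat \<Rightarrow> nat" where
  "last_arc a u 0 = 0"
| "last_arc a u (Suc k) = (if a k = u then Suc k else last_arc a u k)"

primrec arcs_below :: "(nat \<Rightarrow> nat) \<Rightarrow> nat \<Rightarrow> nat \<Rightarrow> nat" where
  "arcs_below a u 0 = 0"
| "arcs_below a u (Suc k) = arcs_below a u k + (if a k = u then 1 else 0)"

lemma last_arc_le: "last_arc a u k \<le> k"
  by (induction k) auto

lemma last_arc_Suc: "last_arc a u k = Suc e \<Longrightarrow> a e = u \<and> e < k"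
  by (induction k) (auto split: if_splits)

lemma last_arc_gap: "last_arc a u k \<le> e \<Longrightarrow> e < k \<Longrightarrow> a e \<noteq> u"
  by (induction k) (auto split: if_splits simp: less_Suc_eq)

text \<open>Following a link skips only edges that do not leave \<open>u\<close>. Hence
  \<open>arcs_below a u\<close> at the current pointer counts the edges still to be scanned and can
  serve as a time potential.\<close>

lemma arcs_below_last_arc: "arcs_below a u (last_arc a u k) = arcs_below a u k"
  by (induction k) auto

lemma sum_arcs_below:
  assumes "\<And>e. e < m \<Longrightarrow> a e < n"
  shows "(\<Sum>u<n. arcs_below a u m) = m"
  using assms by (induction m) (auto simp: sum.distrib)

section \<open>The segment tree\<close>

text \<open>Column 15 holds a tournament tree for minima with root 1 and leaves \<open>n, \<dots>, 2 * n - 1\<close>; register 30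
  holds \<open>n\<close>. As the machine has no minimum, it is computed as \<open>a - (a - b)\<close>.\<close>

definition pull :: prog where
  "pull = Put (addr 15 (Var 2))
     (arr 15 (Num 2 \<otimes> Var 2) \<ominus> (arr 15 (Num 2 \<otimes> Var 2) \<ominus> arr 15 (Num 2 \<otimes> Var 2 \<oplus> Num 1)))"

definition fixup :: prog where
  "fixup = Asg 2 (Bin Div (Var 2) (Num 2)) ;;
     Loop (Var 2) (pull ;; Asg 2 (Bin Div (Var 2) (Num 2)))"

definition descend :: prog where
  "descend = Asg 2 (Num 1) ;;
     Loop (Var 2 \<lless> Var 30)
       (Asg 2 (Num 2 \<otimes> Var 2 \<oplus> (arr 15 (Var 2) \<lless> arr 15 (Num 2 \<otimes> Var 2))))"

locale arrays =
  fixes L z n m :: nat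
  assumes n_pos: "0 < n"
    and room: "16 * (z + 2 * n + m + 4) + 16 < L"
    and input_below: "4 + 3 * m \<le> z"
begin

definition node_ok :: "(nat \<Rightarrow> nat) \<Rightarrow> nat \<Rightarrow> bool" where
  "node_ok M j \<longleftrightarrow> M (cell z 15 j) = min (M (cell z 15 (2 * j))) (M (cell z 15 (2 * j + 1)))"

definition inner :: "nat set" where
  "inner = {cell z 15 j | j. 0 < j \<and> j < n}"

lemma cell_in_inner [simp]:
  "c < 16 \<Longrightarrow> cell z c i \<in> inner \<longleftrightarrow> c = 15 \<and> 0 < i \<and> i < n"
  unfolding inner_def by auto

lemma inner_subset: "inner \<subseteq> cols z {15}"
  by (auto simp: cols_def inner_def)

lemma min_as_sub: "a - (a - b) = min a (b::nat)"
  by auto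

text \<open>A changed leaf can spoil only its proper ancestors \<open>R 2 div 2 ^ Suc k\<close>.
  Working upwards, the possibly wrong nodes are always the current node and its ancestors, of which
  there are at most \<open>bitlen (2 * n)\<close>.\<close>

lemma wp_fixup:
  assumes R: "R 31 = z" "R 2 < 2 * n"
    and ok: "\<And>j. 0 < j \<Longrightarrow> j < n \<Longrightarrow> (\<And>k. j \<noteq> R 2 div 2 ^ Suc k) \<Longrightarrow> node_ok M j"
    and Q: "\<And>t R' M'. (\<And>j. 0 < j \<Longrightarrow> j < n \<Longrightarrow> node_ok M' j) \<Longrightarrow> t \<le> 2 + 3 * bitlen (2 * n) \<Longrightarrow>
      keep {2} R R' \<Longrightarrow> keep inner M M' \<Longrightarrow> Q t R' M'"
  shows "wp L fixup Q R M"
  unfolding fixup_def wp_Seq wp_Asg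
proof (intro conjI)
  show "safe L (Bin Div (Var 2) (Num 2)) R M" using room by simp
  let ?I = "\<lambda>R' M'. R' 31 = z \<and> R' 2 < n \<and> keep {2} R R' \<and> keep inner M M' \<and>
    (\<forall>j. 0 < j \<longrightarrow> j < n \<longrightarrow> (\<forall>k. j \<noteq> R' 2 div 2 ^ k) \<longrightarrow> node_ok M' j)"
  let ?\<phi> = "\<lambda>R' M'. 3 * bitlen (R' 2)"
  show "wp L (Loop (Var 2) (pull ;; Asg 2 (Bin Div (Var 2) (Num 2)))) (\<lambda>t'. Q (1 + t'))
     (R(2 := ev (Bin Div (Var 2) (Num 2)) R M)) M"
  proof (rule wp_Loop[where I = ?I and \<phi> = ?\<phi>])
    show "?I (R(2 := ev (Bin Div (Var 2) (Num 2)) R M)) M"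
      using R ok by (simp add: div_mult2_eq)
  next
    fix R' M'
    assume I: "?I R' M'" and ne: "ev (Var 2) R' M' \<noteq> 0"
    let ?i = "R' 2" let ?M = "M'(cell z 15 ?i := min (M' (cell z 15 (2 * ?i))) (M' (cell z 15 (2 * ?i + 1))))"
    have i: "0 < ?i" "?i < n" using I ne by auto
    have ok': "node_ok ?M j" if "0 < j" "j < n" "\<forall>k. j \<noteq> ?i div 2 div 2 ^ k" for j
    proof (cases "j = ?i")
      case True
      then show ?thesis using i by (auto simp: node_ok_def)
    next
      case False
      have "j \<noteq> ?i div 2 ^ k" for k
        using False that(3) by (cases k) (auto simp: div_mult2_eq)
      then have "node_ok M' j" using I that by blast
      moreover have "2 * j \<noteq> ?i" "2 * j + 1 \<noteq> ?i"
        using that(3)[rule_format, of 0] by auto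
      ultimately show ?thesis using False by (auto simp: node_ok_def)
    qed
    have b: "bitlen ?i = Suc (bitlen (?i div 2))" using i bitlen_half by simp
    show "wp L (pull ;; Asg 2 (Bin Div (Var 2) (Num 2)))
        (\<lambda>t R'' M''. ?I R'' M'' \<and> Suc t + ?\<phi> R'' M'' \<le> ?\<phi> R' M') R' M'"
      using I i room ok' b by (simp add: pull_def wp_simps min_as_sub)
  next
    fix t R' M'
    assume I: "?I R' M'" and "ev (Var 2) R' M' = 0"
      and t: "t + ?\<phi> R' M' \<le> Suc (?\<phi> (R(2 := ev (Bin Div (Var 2) (Num 2)) R M)) M)"
    have "bitlen (R 2 div 2) \<le> bitlen (2 * n)" using R by (intro bitlen_mono) auto
    then show "Q (1 + t) R' M'"
      using I t \<open>ev (Var 2) R' M' = 0\<close> by (intro Q) auto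
  qed auto
qed

text \<open>Induction from a node to its parent \<open>i div 2\<close>. The indexing works for every
  \<open>n\<close>, not only powers of two; for \<open>n = 1\<close> the root is itself the
  leaf.\<close>

lemma root_le:
  assumes "\<And>j. 0 < j \<Longrightarrow> j < n \<Longrightarrow> node_ok M j" "0 < i" "i < 2 * n"
  shows "M (cell z 15 1) \<le> M (cell z 15 i)"
  using assms(2,3)
proof (induction i rule: less_induct)
  case (less i)
  show ?case
  proof (cases "i = 1")
    case False
    then have j: "0 < i div 2" "i div 2 < i" "i div 2 < n" using less.prems by auto
    have "node_ok M (i div 2)" using assms(1) j by simp
    moreover have "i = 2 * (i div 2) \<or> i = 2 * (i div 2) + 1" by presburger
    ultimately have "M (cell z 15 (i div 2)) \<le> M (cell z 15 i)"
      unfolding node_ok_def by (auto simp: min_def)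
    then show ?thesis using less.IH[of "i div 2"] j less.prems by linarith
  qed simp
qed

text \<open>The truth value of "node is less than left child" is added to the index of the left
  child: the right child is taken exactly when the left one does not attain the minimum.\<close>

lemma wp_descend:
  assumes R: "R 31 = z" "R 30 = n"
    and ok: "\<And>j. 0 < j \<Longrightarrow> j < n \<Longrightarrow> node_ok M j"
    and Q: "\<And>t R'. n \<le> R' 2 \<Longrightarrow> R' 2 < 2 * n \<Longrightarrow> M (cell z 15 (R' 2)) = M (cell z 15 1) \<Longrightarrow>
      t \<le> 2 + 2 * bitlen (2 * n) \<Longrightarrow> keep {2} R R' \<Longrightarrow> Q t R' M"
  shows "wp L descend Q R M"
  unfolding descend_def wp_Seq wp_Asg
proof (intro conjI)
  show "safe L (Num 1) R M" using room by simp
  let ?I = "\<lambda>R' M'. R' 31 = z \<and> R' 30 = n \<and> keep {2} R R' \<and> M' = M \<and> 0 < R' 2 \<and> R' 2 < 2 * n \<and>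
    M (cell z 15 (R' 2)) = M (cell z 15 1)"
  let ?\<phi> = "\<lambda>R' M'. 2 * (bitlen (2 * n) - bitlen (R' 2))"
  let ?e = "Num 2 \<otimes> Var 2 \<oplus> (arr 15 (Var 2) \<lless> arr 15 (Num 2 \<otimes> Var 2))"
  show "wp L (Loop (Var 2 \<lless> Var 30) (Asg 2 ?e)) (\<lambda>t'. Q (1 + t')) (R(2 := ev (Num 1) R M)) M"
  proof (rule wp_Loop[where I = ?I and \<phi> = ?\<phi>])
    show "?I (R(2 := ev (Num 1) R M)) M" using n_pos R by simp
  next
    fix R' M'
    assume I: "?I R' M'" and ne: "ev (Var 2 \<lless> Var 30) R' M' \<noteq> 0"
    let ?i = "R' 2"
    have r: "R' 31 = z" "R' 30 = n" using I by auto
    have i: "0 < ?i" "?i < n" using I ne r by auto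
    let ?j = "2 * ?i + of_bool (M (cell z 15 ?i) < M (cell z 15 (2 * ?i)))"
    have j: "0 < ?j" "?j < 2 * n" "M (cell z 15 ?j) = M (cell z 15 1)"
      using i ok[OF i] I by (auto simp: node_ok_def min_def split: if_splits)
    have "?j div 2 = ?i" by simp
    then have b: "bitlen ?j = Suc (bitlen ?i)" using bitlen_half[OF j(1)] by simp
    have "bitlen ?j \<le> bitlen (2 * n)" using j by (intro bitlen_mono) auto
    then show "wp L (Asg 2 ?e) (\<lambda>t R'' M''. ?I R'' M'' \<and> Suc t + ?\<phi> R'' M'' \<le> ?\<phi> R' M') R' M'"
      using I i room j b by (simp add: wp_simps)
  next
    fix t R' M'
    assume I: "?I R' M'" and "ev (Var 2 \<lless> Var 30) R' M' = 0"
      and t: "t + ?\<phi> R' M' \<le> Suc (?\<phi> (R(2 := ev (Num 1) R M)) M)"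
    then show "Q (1 + t) R' M'"
      using Q[of R' "1 + t"] by auto
  qed auto
qed

end

section \<open>Dijkstra's algorithm\<close>

text \<open>Column 0 holds tentative distances and register 28 a number \<open>BIG\<close> exceeding all finite distances.
  Column \<open>mk\<close> marks the sources; columns \<open>fs\<close> and \<open>nx\<close> hold the first edge of a vertex and the next edge
  in its list; \<open>hc\<close> is the address of the head of edge 0, so that swapping the roles of heads and tails
  yields distances in the reversed graph. A finished vertex has its leaf reset to \<open>BIG\<close>.\<close>

definition dij_init :: "nat \<Rightarrow> prog" where
  "dij_init mk = Asg 3 (Num 0) ;;
     Loop (Var 3 \<lless> Var 30)
       (Asg 4 ((arr mk (Var 3) \<doteq> Num 0) \<otimes> Var 28) ;;
        Put (addr 0 (Var 3)) (Var 4) ;;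
        Put (addr 15 (Var 30 \<oplus> Var 3)) (Var 4) ;;
        Asg 3 (Var 3 \<oplus> Num 1))"

definition dij_build :: prog where
  "dij_build = Asg 2 (Var 30 \<ominus> Num 1) ;; Loop (Var 2) (pull ;; Asg 2 (Var 2 \<ominus> Num 1))"

definition relax :: "nat \<Rightarrow> nat \<Rightarrow> prog" where
  "relax hc nx = Loop (Var 5)
     (Asg 6 (Get (Num hc \<oplus> Num 3 \<otimes> (Var 5 \<ominus> Num 1))) ;;
      Asg 7 (Var 8 \<oplus> Get (Num 4 \<oplus> Num 3 \<otimes> (Var 5 \<ominus> Num 1))) ;;
      Cond (Var 7 \<lless> arr 0 (Var 6))
        (Put (addr 0 (Var 6)) (Var 7) ;;
         Asg 2 (Var 30 \<oplus> Var 6) ;;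
         Put (addr 15 (Var 2)) (Var 7) ;;
         fixup)
        Skip ;;
      Asg 5 (arr nx (Var 5 \<ominus> Num 1)))"

definition dij_main :: "nat \<Rightarrow> nat \<Rightarrow> nat \<Rightarrow> prog" where
  "dij_main hc fs nx = Loop (arr 15 (Num 1) \<lless> Var 28)
     (descend ;;
      Asg 9 (Var 2 \<ominus> Var 30) ;;
      Put (addr 15 (Var 2)) (Var 28) ;;
      fixup ;;
      Asg 8 (arr 0 (Var 9)) ;;
      Asg 5 (arr fs (Var 9)) ;;
      relax hc nx)"

definition dij :: "nat \<Rightarrow> nat \<Rightarrow> nat \<Rightarrow> nat \<Rightarrow> prog" where
  "dij mk hc fs nx = dij_init mk ;; dij_build ;; dij_main hc fs nx"

text \<open>A finite distance uses fewer than \<open>n\<close> edges of weight at most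
  \<open>W\<close>, so \<open>BIG\<close> can stand for infinity; \<open>room_BIG\<close> leaves
  space for adding one weight before a comparison. The columns and \<open>hc\<close> are parameters
  because the search is run on both orientations and with two columns of marks.\<close>

locale dijkstra = arrays L z n m for L z n m +
  fixes a b wt :: "nat \<Rightarrow> nat" and W BIG hc fs nx mk :: nat
  assumes a_less: "e < m \<Longrightarrow> a e < n" and b_less: "e < m \<Longrightarrow> b e < n"
    and wt_le: "e < m \<Longrightarrow> wt e \<le> W"
    and BIG_eq: "BIG = n * W + 1"
    and room_BIG: "BIG + W < L"
    and hc: "hc \<le> 3"
    and columns: "fs < 16" "fs \<noteq> 0" "fs \<noteq> 15" "nx < 16" "nx \<noteq> 0" "nx \<noteq> 15"
      "mk < 16" "mk \<noteq> 0" "mk \<noteq> 15"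
begin

definition graph_in :: "(nat \<Rightarrow> nat) \<Rightarrow> bool" where
  "graph_in M \<longleftrightarrow>
     (\<forall>e<m. M (hc + 3 * e) = b e \<and> M (4 + 3 * e) = wt e \<and>
        M (cell z nx e) = last_arc a (a e) e) \<and>
     (\<forall>u<n. M (cell z fs u) = last_arc a u m)"

definition src_walk :: "nat set \<Rightarrow> nat \<Rightarrow> nat \<Rightarrow> bool" where
  "src_walk S v c \<longleftrightarrow> (\<exists>x\<in>S. wk m a b wt x v c)"

text \<open>No flag is stored: a vertex is finished when its tentative distance is finite although
  its key in the queue has been reset.\<close>

definition finished :: "(nat \<Rightarrow> nat) \<Rightarrow> (nat \<Rightarrow> nat) \<Rightarrow> nat set" where
  "finished D K = {v. v < n \<and> D v < BIG \<and> K v = BIG}"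

text \<open>\<open>d\<close> is the distance extracted last and separates finished from queued
  vertices. \<open>P\<close> tells which edges leaving finished vertices have been relaxed, so that
  the same invariant serves between extractions and during the scan of a list. The bound
  \<open>card (finished D K) * W\<close> keeps finite values below \<open>BIG\<close>: the edges of
  the path found start in distinct finished vertices.\<close>

definition dinv ::
  "nat set \<Rightarrow> nat \<Rightarrow> (nat \<Rightarrow> nat) \<Rightarrow> (nat \<Rightarrow> nat) \<Rightarrow> (nat \<Rightarrow> bool) \<Rightarrow> bool" where
  "dinv S d D K P \<longleftrightarrow>
     (\<forall>v<n. D v \<le> BIG \<and> (K v = D v \<or> K v = BIG)) \<and>
     (\<forall>v\<in>finished D K. D v \<le> d) \<and>
     (\<forall>v<n. K v < BIG \<longrightarrow> d \<le> K v) \<and>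
     (\<forall>v<n. D v < BIG \<longrightarrow> src_walk S v (D v) \<and> D v \<le> card (finished D K) * W) \<and>
     (\<forall>v\<in>S. D v = 0) \<and>
     (\<forall>e<m. a e \<in> finished D K \<longrightarrow> P e \<longrightarrow> D (b e) \<le> D (a e) + wt e)"

lemma finite_finished: "finite (finished D K)" "card (finished D K) \<le> n"
proof -
  have "finished D K \<subseteq> {..<n}" by (auto simp: finished_def)
  then show "finite (finished D K)" "card (finished D K) \<le> n"
    using card_mono[of "{..<n}" "finished D K"] by (auto intro: finite_subset)
qed

lemma dinv_mono: "dinv S d D K P \<Longrightarrow> (\<And>e. e < m \<Longrightarrow> P' e \<Longrightarrow> P e) \<Longrightarrow> dinv S d D K P'"
  by (auto simp: dinv_def)

lemma dinv_extend:
  "dinv S d D K P \<Longrightarrow> D (b e) \<le> D (a e) + wt e \<Longrightarrow> dinv S d D K (\<lambda>e'. P e' \<or> e' = e)"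
  by (auto simp: dinv_def)

lemma dinv_init:
  assumes "S \<subseteq> {..<n}" "\<And>v. v < n \<Longrightarrow> D v = (if v \<in> S then 0 else BIG)" "\<And>v. v < n \<Longrightarrow> K v = D v"
  shows "dinv S 0 D K P"
proof -
  have "finished D K = {}" using assms by (auto simp: finished_def)
  moreover have "src_walk S v 0" if "v \<in> S" for v
    unfolding src_walk_def using that by (intro bexI[of _ v] wk_refl)
  ultimately show ?thesis using assms unfolding dinv_def by (auto split: if_splits)
qed

text \<open>Finished vertices lie at distance at most \<open>d\<close>, and
  \<open>d \<le> K u\<close> as \<open>u\<close> is still queued, so \<open>D u\<close> is a valid
  new threshold. The edges of \<open>u\<close> become unrelaxed edges of a finished vertex, whence
  \<open>a e \<noteq> u\<close>; one more finished vertex pays for one more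
  \<open>W\<close>.\<close>

lemma dinv_extract:
  assumes inv: "dinv S d D K (\<lambda>_. True)" and u: "u < n" "K u < BIG"
    and min: "\<And>v. v < n \<Longrightarrow> K u \<le> K v"
  shows "dinv S (D u) D (K(u := BIG)) (\<lambda>e. a e \<noteq> u)"
    "finished D (K(u := BIG)) = insert u (finished D K)" "u \<notin> finished D K"
    "D u + W \<le> card (finished D (K(u := BIG))) * W" "D u < BIG"
proof -
  have Ku: "K u = D u" using inv u by (auto simp: dinv_def)
  then show *: "finished D (K(u := BIG)) = insert u (finished D K)" "u \<notin> finished D K" "D u < BIG"
    using u by (auto simp: finished_def)
  have c: "card (insert u (finished D K)) = Suc (card (finished D K))"
    using finite_finished * by simp
  then show "D u + W \<le> card (finished D (K(u := BIG))) * W"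
    using inv u Ku * by (auto simp: dinv_def)
  have le: "D v \<le> D u" if "v \<in> finished D K" for v
    using inv u Ku that by (fastforce simp: dinv_def)
  have "D v \<le> card (insert u (finished D K)) * W" if "v < n" "D v < BIG" for v
    using inv that unfolding c by (auto simp: dinv_def intro: trans_le_add2)
  then show "dinv S (D u) D (K(u := BIG)) (\<lambda>e. a e \<noteq> u)"
    using inv le min Ku unfolding dinv_def *(1) by auto
qed

text \<open>An improvement cannot concern a finished vertex, since these have \<open>D\<close> at
  most \<open>D u\<close>. So relaxing never reopens a vertex, and the new value stays below
  \<open>BIG\<close> by the bound in terms of finished vertices.\<close>

lemma dinv_relax:
  assumes inv: "dinv S (D u) D K P" and e: "e < m" "a e = u"
    and u: "u \<in> finished D K" "D u + W \<le> card (finished D K) * W"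
    and x: "D u + wt e < D (b e)"
  defines "D' \<equiv> D(b e := D u + wt e)" and "K' \<equiv> K(b e := D u + wt e)"
  shows "finished D' K' = finished D K" "D' u = D u"
    "dinv S (D u) D' K' (\<lambda>e'. P e' \<or> e' = e)"
proof -
  let ?x = "D u + wt e" let ?v = "b e"
  have v: "?v < n" "wt e \<le> W" using b_less wt_le e by auto
  have "card (finished D K) * W \<le> n * W" using finite_finished(2) by simp
  then have xBIG: "?x < BIG" "?x \<le> card (finished D K) * W" using u v BIG_eq by linarith+
  have nf: "?v \<notin> finished D K"
  proof
    assume "?v \<in> finished D K"
    then have "D ?v \<le> D u" using inv by (auto simp: dinv_def)
    then show False using x by simp
  qed
  show fin: "finished D' K' = finished D K"
  proof (rule set_eqI)
    fix y
    show "y \<in> finished D' K' \<longleftrightarrow> y \<in> finished D K"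
      using nf xBIG by (cases "y = ?v") (auto simp: finished_def D'_def K'_def)
  qed
  show Du: "D' u = D u" using x by (auto simp: D'_def)
  have w: "src_walk S ?v ?x"
  proof -
    have "u < n" "D u < BIG" using u by (auto simp: finished_def)
    then obtain s where "s \<in> S" "wk m a b wt s (a e) (D u)"
      using inv e by (auto simp: dinv_def src_walk_def)
    then have "wk m a b wt s ?v ?x" using wk_edge[of m a b wt s e "D u"] e by simp
    then show ?thesis using \<open>s \<in> S\<close> by (auto simp: src_walk_def)
  qed
  have D'le: "D' y \<le> D y" for y using x by (auto simp: D'_def)
  have D'fin: "D' y = D y" if "y \<in> finished D K" for y using that nf by (auto simp: D'_def)
  show "dinv S (D u) D' K' (\<lambda>e'. P e' \<or> e' = e)"
    unfolding dinv_def fin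
  proof (intro conjI allI impI ballI)
    fix y assume y: "y < n"
    show "D' y \<le> BIG" using inv y D'le[of y] by (auto simp: dinv_def intro: order_trans)
    show "K' y = D' y \<or> K' y = BIG" using inv y by (auto simp: dinv_def D'_def K'_def)
    show "D u \<le> K' y" if "K' y < BIG"
      using inv y that by (auto simp: dinv_def K'_def split: if_splits)
    show "src_walk S y (D' y)" "D' y \<le> card (finished D K) * W" if "D' y < BIG"
      using inv y that w xBIG by (auto simp: dinv_def D'_def split: if_splits)
  next
    fix y assume "y \<in> finished D K"
    then show "D' y \<le> D u" using inv D'fin by (auto simp: dinv_def)
  next
    fix y assume "y \<in> S"
    then show "D' y = 0" using inv D'le[of y] by (auto simp: dinv_def)
  next
    fix e' assume e': "e' < m" "a e' \<in> finished D K" "P e' \<or> e' = e"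
    show "D' (b e') \<le> D' (a e') + wt e'"
    proof (cases "e' = e")
      case True
      then show ?thesis using Du e by (auto simp: D'_def)
    next
      case False
      then have "D (b e') \<le> D (a e') + wt e'" using inv e' by (auto simp: dinv_def)
      then show ?thesis using D'le[of "b e'"] D'fin[OF e'(2)] by simp
    qed
  qed
qed

text \<open>With an empty queue every reached vertex is finished, hence all its edges are relaxed,
  and induction along a walk bounds \<open>D\<close> by the cost of the walk.\<close>

lemma dinv_final:
  assumes inv: "dinv S d D K (\<lambda>_. True)" and K: "\<And>v. v < n \<Longrightarrow> BIG \<le> K v" and S: "S \<subseteq> {..<n}"
  shows "v < n \<Longrightarrow> D v \<le> BIG" "v < n \<Longrightarrow> D v < BIG \<Longrightarrow> src_walk S v (D v)"
    "src_walk S v c \<Longrightarrow> D v \<le> c \<and> D v < BIG"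
proof -
  show "v < n \<Longrightarrow> D v \<le> BIG" "v < n \<Longrightarrow> D v < BIG \<Longrightarrow> src_walk S v (D v)"
    using inv by (auto simp: dinv_def)
  have fin: "y \<in> finished D K" if "y < n" "D y < BIG" for y
    using inv K[of y] that by (force simp: dinv_def finished_def)
  have bound: "card (finished D K) * W < BIG"
    using finite_finished(2)[of D K] BIG_eq by (simp add: less_Suc_eq_le)
  have "v < n \<and> D v \<le> c \<and> D v < BIG" if "wk m a b wt x v c" "x \<in> S" for x
    using that
  proof (induction rule: wk.induct)
    case (wk_refl x)
    have "D x = 0" using inv wk_refl by (auto simp: dinv_def)
    then show ?case using wk_refl S BIG_eq by auto
  next
    case (wk_edge x e c)
    then have "a e \<in> finished D K" using fin by auto
    then have le: "D (b e) \<le> D (a e) + wt e" "D (a e) < BIG" using inv wk_edge by (auto simp: dinv_def finished_def)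
    have D: "D (a e) \<le> card (finished D K) * W" using inv wk_edge by (auto simp: dinv_def)
    have be: "b e < n" using b_less wk_edge by simp
    \<comment> \<open>Otherwise \<open>b e\<close> is unfinished, at most \<open>n - 1\<close>
      vertices are finished, and \<open>D (a e) + wt e\<close> is at most \<open>n * W\<close>, so
      the relaxed edge \<open>e\<close> would have given \<open>b e\<close> a finite value.\<close>
    have "D (b e) < BIG"
    proof (rule ccontr)
      assume "\<not> D (b e) < BIG"
      then have nb: "b e \<notin> finished D K" by (auto simp: finished_def)
      then have "card (finished D K) < n"
        using psubset_card_mono[of "{..<n}" "finished D K"] be by (auto simp: finished_def)
      then have "Suc (card (finished D K)) * W \<le> n * W" by (intro mult_right_mono) auto
      then have "D (a e) + wt e < BIG" using D wt_le[of e] wk_edge BIG_eq by simp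
      then show False using le \<open>\<not> D (b e) < BIG\<close> by simp
    qed
    then show ?case using le wk_edge be by auto
  qed
  then show "src_walk S v c \<Longrightarrow> D v \<le> c \<and> D v < BIG" by (auto simp: src_walk_def)
qed

section \<open>Dijkstra's algorithm on the memory of the machine\<close>

definition dcol :: "(nat \<Rightarrow> nat) \<Rightarrow> nat \<Rightarrow> nat" where
  "dcol M v = M (cell z 0 v)"

definition kcol :: "(nat \<Rightarrow> nat) \<Rightarrow> nat \<Rightarrow> nat" where
  "kcol M v = M (cell z 15 (n + v))"

lemma col_upd [simp]:
  "dcol (M(cell z 0 v := x)) = (dcol M)(v := x)"
  "dcol (M(cell z 15 i := x)) = dcol M"
  "kcol (M(cell z 0 i := x)) = kcol M"
  "kcol (M(cell z 15 (n + v) := x)) = (kcol M)(v := x)"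
  by (auto simp: dcol_def kcol_def)

lemma col_keep_inner:
  assumes "keep inner M M'"
  shows "dcol M' = dcol M" "kcol M' = kcol M"
  using assms by (auto simp: dcol_def kcol_def keep_def fun_eq_iff)

lemma graph_in_upd [simp]:
  "graph_in (M(cell z 15 i := x)) = graph_in M"
  using input_below hc columns by (auto simp: graph_in_def)

lemma graph_in_keep:
  assumes "keep (cols z {0, 15}) M M'"
  shows "graph_in M' = graph_in M"
proof -
  have "M' (hc + 3 * e) = M (hc + 3 * e) \<and> M' (4 + 3 * e) = M (4 + 3 * e)" if "e < m" for e
    using assms that input_below hc by (auto simp: keep_def)
  moreover have "M' (cell z nx e) = M (cell z nx e)" "M' (cell z fs e) = M (cell z fs e)" for e
    using assms columns by (auto simp: keep_def)
  ultimately show ?thesis by (simp add: graph_in_def)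
qed

lemma node_ok_upd:
  "node_ok (M(cell z 0 i := x)) j = node_ok M j"
  "j < n \<Longrightarrow> (\<And>k. j \<noteq> (n + v) div 2 ^ Suc k) \<Longrightarrow> node_ok (M(cell z 15 (n + v) := x)) j = node_ok M j"
proof -
  assume j: "j < n" "\<And>k. j \<noteq> (n + v) div 2 ^ Suc k"
  have "2 * j \<noteq> n + v" "2 * j + 1 \<noteq> n + v" using j(2)[of 0] by auto
  then show "node_ok (M(cell z 15 (n + v) := x)) j = node_ok M j"
    using j by (auto simp: node_ok_def)
qed (simp add: node_ok_def)

definition tree_ok :: "(nat \<Rightarrow> nat) \<Rightarrow> bool" where
  "tree_ok M \<longleftrightarrow> (\<forall>j. 0 < j \<longrightarrow> j < n \<longrightarrow> node_ok M j)"

abbreviation arc_time :: nat where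
  "arc_time \<equiv> 10 + 3 * bitlen (2 * n)"

text \<open>Because lists are linked downwards, a value \<open>k\<close> of register 5 says that
  precisely the edges leaving \<open>u\<close> with index at least \<open>k\<close> have been
  relaxed; register 5 holds an index plus one, and 0 ends the list. Time is charged to the edges of
  \<open>u\<close> not yet passed.\<close>

lemma wp_relax:
  assumes u: "u < n"
    and R: "R 31 = z" "R 30 = n" "R 5 = last_arc a u m" "R 8 = dcol M u"
    and M: "graph_in M" "tree_ok M"
    and inv: "dinv S (dcol M u) (dcol M) (kcol M) (\<lambda>e. a e \<noteq> u)"
    and fin: "u \<in> finished (dcol M) (kcol M)"
      "dcol M u + W \<le> card (finished (dcol M) (kcol M)) * W"
    and Q: "\<And>t R' M'. keep {2, 5, 6, 7} R R' \<Longrightarrow> keep (cols z {0, 15}) M M' \<Longrightarrow> tree_ok M' \<Longrightarrow>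
      finished (dcol M') (kcol M') = finished (dcol M) (kcol M) \<Longrightarrow>
      dinv S (dcol M u) (dcol M') (kcol M') (\<lambda>_. True) \<Longrightarrow>
      t \<le> 1 + arc_time * arcs_below a u m \<Longrightarrow> Q t R' M'"
  shows "wp L (relax hc nx) Q R M"
proof -
  let ?I = "\<lambda>R' M'. R' 31 = z \<and> R' 30 = n \<and> R' 8 = dcol M u \<and> dcol M' u = dcol M u \<and>
    keep {2, 5, 6, 7} R R' \<and> keep (cols z {0, 15}) M M' \<and> graph_in M' \<and> tree_ok M' \<and>
    finished (dcol M') (kcol M') = finished (dcol M) (kcol M) \<and>
    dinv S (dcol M u) (dcol M') (kcol M') (\<lambda>e. a e \<noteq> u \<or> R' 5 \<le> e) \<and>
    R' 5 \<le> m \<and> (0 < R' 5 \<longrightarrow> a (R' 5 - 1) = u)"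
  let ?\<phi> = "\<lambda>R' M'. arc_time * arcs_below a u (R' 5)"
  show ?thesis
    unfolding relax_def
  proof (rule wp_Loop[where I = ?I and \<phi> = ?\<phi>])
    have "R 5 \<le> m" "0 < R 5 \<longrightarrow> a (R 5 - 1) = u"
      using last_arc_le[of a u m] last_arc_Suc[of a u m "R 5 - 1"] R(3) by auto
    moreover have "dinv S (dcol M u) (dcol M) (kcol M) (\<lambda>e. a e \<noteq> u \<or> R 5 \<le> e)"
      by (rule dinv_mono[OF inv]) (use last_arc_gap[of a u m] R(3) in auto)
    ultimately show "?I R M" using R M by simp
  next
    fix R' M'
    assume I: "?I R' M'" and ne: "ev (Var 5) R' M' \<noteq> 0"
    define e where "e = R' 5 - 1"
    have e: "R' 5 = Suc e" "e < m" "a e = u" using I ne by (auto simp: e_def)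
    let ?v = "b e" let ?x = "dcol M u + wt e"
    have v: "?v < n" "wt e \<le> W" using e b_less wt_le by auto
    have "dcol M u < BIG" using fin by (auto simp: finished_def)
    then have xL: "?x < L" using v room_BIG by simp
    have g: "M' (hc + 3 * e) = ?v" "M' (4 + 3 * e) = wt e" "M' (cell z nx e) = last_arc a u e"
      using I e by (auto simp: graph_in_def)
    have D: "M' (cell z 0 ?v) = dcol M' ?v" by (simp add: dcol_def)
    have eL: "3 * e < L" "hc + 3 * e < L" "4 + 3 * e < L"
      using room input_below hc e by auto
    have la: "last_arc a u e \<le> m" "0 < last_arc a u e \<longrightarrow> a (last_arc a u e - 1) = u"
      using last_arc_le[of a u e] last_arc_Suc[of a u e "last_arc a u e - 1"] e by auto
    have time: "arcs_below a u (Suc e) = Suc (arcs_below a u (last_arc a u e))"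
      using e by (simp add: arcs_below_last_arc)
    \<comment> \<open>No edge between \<open>last_arc a u e\<close> and \<open>e\<close> leaves
      \<open>u\<close>, so moving the pointer down claims nothing new except the edge
      \<open>e\<close> just treated.\<close>
    have P: "a e' \<noteq> u \<or> Suc e \<le> e' \<or> e' = e" if "a e' \<noteq> u \<or> last_arc a u e \<le> e'" for e'
      using that last_arc_gap[of a u e e'] by (cases "e' < e") auto
    have skip: "dinv S (dcol M u) (dcol M') (kcol M') (\<lambda>e'. a e' \<noteq> u \<or> last_arc a u e \<le> e')"
      if x: "\<not> ?x < dcol M' ?v"
    proof -
      have "dinv S (dcol M u) (dcol M') (kcol M') (\<lambda>e'. a e' \<noteq> u \<or> Suc e \<le> e')"
        using I e by simp
      moreover have "dcol M' (b e) \<le> dcol M' (a e) + wt e" using x I e by simp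
      ultimately have "dinv S (dcol M u) (dcol M') (kcol M') (\<lambda>e'. (a e' \<noteq> u \<or> Suc e \<le> e') \<or> e' = e)"
        by (rule dinv_extend)
      then show ?thesis by (rule dinv_mono) (use P in blast)
    qed
    let ?M = "M'(cell z 0 ?v := ?x, cell z 15 (n + ?v) := ?x)"
    let ?body = "Asg 6 (Get (Num hc \<oplus> Num 3 \<otimes> (Var 5 \<ominus> Num 1))) ;;
      Asg 7 (Var 8 \<oplus> Get (Num 4 \<oplus> Num 3 \<otimes> (Var 5 \<ominus> Num 1))) ;;
      Cond (Var 7 \<lless> arr 0 (Var 6))
        (Put (addr 0 (Var 6)) (Var 7) ;; Asg 2 (Var 30 \<oplus> Var 6) ;;
         Put (addr 15 (Var 2)) (Var 7) ;; fixup) Skip ;;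
      Asg 5 (arr nx (Var 5 \<ominus> Num 1))"
    have inner': "keep (cols z {0, 15}) M M''" if "keep inner ?M M''" for M''
    proof -
      have "keep (cols z {0, 15}) M ?M" using I by simp
      then show ?thesis
        by (rule keep_trans[OF _ that]) (use inner_subset cols_mono[of "{15}" "{0,15}" z] in auto)
    qed
    have fx: "wp L fixup Q' R'' ?M"
      if x: "?x < dcol M' ?v" and R'': "R'' 31 = z" "R'' 2 = n + ?v"
        and Q': "\<And>t R3 M''. keep {2} R'' R3 \<Longrightarrow> keep (cols z {0, 15}) M M'' \<Longrightarrow> graph_in M'' \<Longrightarrow> tree_ok M'' \<Longrightarrow>
          dcol M'' u = dcol M u \<Longrightarrow> finished (dcol M'') (kcol M'') = finished (dcol M) (kcol M) \<Longrightarrow>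
          dinv S (dcol M u) (dcol M'') (kcol M'') (\<lambda>e'. a e' \<noteq> u \<or> last_arc a u e \<le> e') \<Longrightarrow>
          M'' (cell z nx e) = last_arc a u e \<Longrightarrow>
          t \<le> 2 + 3 * bitlen (2 * n) \<Longrightarrow> Q' t R3 M''" for Q' R''
    proof (rule wp_fixup)
      show "R'' 31 = z" "R'' 2 < 2 * n" using R'' v by auto
      show "node_ok ?M j" if "0 < j" "j < n" "\<And>k. j \<noteq> R'' 2 div 2 ^ Suc k" for j
        using that I R'' node_ok_upd(2)[of j "b e" "M'(cell z 0 ?v := ?x)" ?x]
        by (simp add: node_ok_upd(1) tree_ok_def)
    next
      fix t R3 M'' assume ok: "\<And>j. 0 < j \<Longrightarrow> j < n \<Longrightarrow> node_ok M'' j"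
        "t \<le> 2 + 3 * bitlen (2 * n)" "keep {2} R'' R3" "keep inner ?M M''"
      have c: "dcol M'' = (dcol M')(?v := ?x)" "kcol M'' = (kcol M')(?v := ?x)"
        using col_keep_inner[OF ok(4)] by simp_all
      have x': "dcol M' u + wt e < dcol M' (b e)" using x I by simp
      have inv': "dinv S (dcol M' u) (dcol M') (kcol M') (\<lambda>e'. a e' \<noteq> u \<or> Suc e \<le> e')" using I e by simp
      have fin': "u \<in> finished (dcol M') (kcol M')" 
        "dcol M' u + W \<le> card (finished (dcol M') (kcol M')) * W" using fin I by simp_all
      note r = dinv_relax[OF inv' e(2,3) fin' x']
      have Du: "dcol M' u = dcol M u" using I by simp
      have k: "keep (cols z {0, 15}) M M''" using inner'[OF ok(4)] .
      have gi: "graph_in M''" using graph_in_keep[OF k] M by simp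
      show "Q' t R3 M''"
      proof (rule Q')
        show "dinv S (dcol M u) (dcol M'') (kcol M'') (\<lambda>e'. a e' \<noteq> u \<or> last_arc a u e \<le> e')"
          using dinv_mono[OF r(3), of "\<lambda>e'. a e' \<noteq> u \<or> last_arc a u e \<le> e'"] P
          unfolding c Du by blast
        show "M'' (cell z nx e) = last_arc a u e" using gi e by (auto simp: graph_in_def)
      qed (use ok k gi r I c Du in \<open>auto simp: tree_ok_def\<close>)
    qed
    show "wp L ?body (\<lambda>t R'' M''. ?I R'' M'' \<and> Suc t + ?\<phi> R'' M'' \<le> ?\<phi> R' M') R' M'"
    proof (cases "?x < dcol M' ?v")
      case True
      have R6: "R' 31 = z" "R' 30 = n" "R' 8 = dcol M u" using I by auto
      show ?thesis
        using room input_below v(1) xL columns eL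
        apply (simp add: wp_simps e g D True R6)
        apply (rule fx[OF True])
          apply (simp_all add: R6)[2]
        subgoal premises prems for t R3 M''
        proof -
          have k: "keep {2} (R'(6 := b e, 7 := dcol M u + wt e, 2 := n + b e)) R3"
            using prems by simp
          have "keep {2, 5, 6, 7} R R3"
            by (rule keep_trans[OF _ k, of "{2, 5, 6, 7}"]) (use I in simp_all)
          moreover have "R3 31 = z" "R3 30 = n" "R3 8 = dcol M u" "R3 5 = Suc e"
            using R6 e keepD[OF k] by simp_all
          ultimately show ?thesis using prems la time e room columns n_pos by simp
        qed
        done
    next
      case False
      show ?thesis
        using I e g D False room input_below hc v xL columns n_pos la time skip
        by (simp add: wp_simps)
    qed
  next
    fix t R' M'
    assume I: "?I R' M'" and z: "ev (Var 5) R' M' = 0" and t: "t + ?\<phi> R' M' \<le> Suc (?\<phi> R M)"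
    show "Q t R' M'"
      by (rule Q) (use I z t R in \<open>auto simp: arcs_below_last_arc\<close>)
  qed simp
qed

end

section \<open>Amortized running time of the search\<close>

context dijkstra
begin

abbreviation vertex_time :: nat where
  "vertex_time \<equiv> 12 + 6 * bitlen (2 * n)"

text \<open>Cost of the remaining work: every vertex not yet finished pays once for its extraction
  and once for each edge leaving it.\<close>

definition pot :: "nat set \<Rightarrow> nat" where
  "pot F = (\<Sum>v\<in>{..<n} - F. vertex_time + arc_time * arcs_below a v m)"

lemma pot_insert:
  assumes "u < n" "u \<notin> F"
  shows "pot F = pot (insert u F) + (vertex_time + arc_time * arcs_below a u m)"
proof -
  have "{..<n} - insert u F = {..<n} - F - {u}" by auto
  then show ?thesis
    using sum.remove[of "{..<n} - F" u "\<lambda>v. vertex_time + arc_time * arcs_below a v m"] assms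
    unfolding pot_def by (simp add: add.commute)
qed

lemma pot_le: "pot F \<le> n * vertex_time + arc_time * m"
proof -
  have "pot F \<le> (\<Sum>v<n. vertex_time + arc_time * arcs_below a v m)"
    unfolding pot_def by (rule sum_mono2) auto
  also have "\<dots> = n * vertex_time + arc_time * m"
    using sum_arcs_below[of m a n] a_less by (simp add: sum.distrib sum_distrib_left[symmetric])
  finally show ?thesis .
qed

text \<open>One pass of the main loop. The root is below \<open>BIG\<close>, so the leaf found
  belongs to an unfinished vertex; the finished set grows by exactly this vertex, and its share of
  \<open>pot\<close> covers the two repairs of the tree, the descent and the scan of its
  edges.\<close>

lemma wp_extract:
  assumes R: "R 31 = z" "R 30 = n" "R 28 = BIG"
    and M: "graph_in M" "tree_ok M"
    and inv: "dinv S d (dcol M) (kcol M) (\<lambda>_. True)"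
    and root: "M (cell z 15 1) < BIG"
    and Q: "\<And>t R' M' d'. keep {2, 5, 6, 7, 8, 9} R R' \<Longrightarrow> keep (cols z {0, 15}) M M' \<Longrightarrow> tree_ok M' \<Longrightarrow>
      dinv S d' (dcol M') (kcol M') (\<lambda>_. True) \<Longrightarrow>
      Suc t + pot (finished (dcol M') (kcol M')) \<le> pot (finished (dcol M) (kcol M)) \<Longrightarrow> Q t R' M'"
  shows "wp L (descend ;; Asg 9 (Var 2 \<ominus> Var 30) ;; Put (addr 15 (Var 2)) (Var 28) ;; fixup ;;
      Asg 8 (arr 0 (Var 9)) ;; Asg 5 (arr fs (Var 9)) ;; relax hc nx) Q R M"
  unfolding wp_Seq[of L descend]
proof (rule wp_descend)
  show "R 31 = z" "R 30 = n" by fact+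
  show "node_ok M j" if "0 < j" "j < n" for j using M that by (simp add: tree_ok_def)
next
  fix t R1
  assume R1: "n \<le> R1 2" "R1 2 < 2 * n" "M (cell z 15 (R1 2)) = M (cell z 15 1)"
    and t: "t \<le> 2 + 2 * bitlen (2 * n)" and keep1: "keep {2} R R1"
  define u where "u = R1 2 - n"
  have u: "u < n" "R1 2 = n + u" using R1 by (auto simp: u_def)
  have R1': "R1 31 = z" "R1 30 = n" "R1 28 = BIG" using keepD[OF keep1] R by simp_all
  have Ku: "kcol M u < BIG" "\<And>v. v < n \<Longrightarrow> kcol M u \<le> kcol M v"
    using root R1(3) u root_le[of M] M(2) by (auto simp: kcol_def tree_ok_def)
  note ex = dinv_extract[OF inv u(1) Ku]
  let ?M = "M(cell z 15 (n + u) := BIG)"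
  let ?R = "R1(9 := u)"
  have "wp L (fixup ;; Asg 8 (arr 0 (Var 9)) ;; Asg 5 (arr fs (Var 9)) ;; relax hc nx)
    (\<lambda>t'. Q (t + (1 + (1 + t')))) ?R ?M"
    unfolding wp_Seq[of L fixup]
  proof (rule wp_fixup)
    show "?R 31 = z" "?R 2 < 2 * n" using R1' u by auto
    show "node_ok ?M j" if "0 < j" "j < n" "\<And>k. j \<noteq> ?R 2 div 2 ^ Suc k" for j
      using that M node_ok_upd(2)[of j u M BIG] u by (simp add: tree_ok_def)
  next
    fix t1 R2 M2
    assume ok: "\<And>j. 0 < j \<Longrightarrow> j < n \<Longrightarrow> node_ok M2 j" and t1: "t1 \<le> 2 + 3 * bitlen (2 * n)"
      and keep2: "keep {2} ?R R2" and keepM: "keep inner ?M M2"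
    have c: "dcol M2 = dcol M" "kcol M2 = (kcol M)(u := BIG)"
      using col_keep_inner[OF keepM] by simp_all
    have R2: "R2 31 = z" "R2 30 = n" "R2 28 = BIG" "R2 9 = u"
      using keepD[OF keep2] R1' by simp_all
    have k2: "keep (cols z {0, 15}) M M2"
      by (rule keep_trans[OF _ keepM, of "cols z {0, 15}"])
        (use inner_subset cols_mono[of "{15}" "{0, 15}" z] in auto)
    have g2: "graph_in M2" using graph_in_keep[OF k2] M by simp
    have fs: "M2 (cell z fs u) = last_arc a u m" using g2 u by (simp add: graph_in_def)
    have d: "M2 (cell z 0 u) = dcol M2 u" by (simp add: dcol_def)
    have keepR: "keep {2, 5, 6, 7, 8, 9} R R2"
      by (rule keep_trans[OF _ keep2, of "{2, 9}"]) (use keep_mono[OF keep1, of "{2, 9}"] in auto)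
    let ?R3 = "R2(8 := dcol M2 u, 5 := last_arc a u m)"
    have "wp L (relax hc nx) (\<lambda>t2. Q (t + (1 + (1 + (t1 + (1 + (1 + t2))))))) ?R3 M2"
    proof (rule wp_relax)
      show "u < n" by fact
      show "?R3 31 = z" "?R3 30 = n" "?R3 5 = last_arc a u m" "?R3 8 = dcol M2 u"
        using R2 by simp_all
      show "graph_in M2" "tree_ok M2" using g2 ok by (auto simp: tree_ok_def)
      show "dinv S (dcol M2 u) (dcol M2) (kcol M2) (\<lambda>e. a e \<noteq> u)"
        "u \<in> finished (dcol M2) (kcol M2)"
        "dcol M2 u + W \<le> card (finished (dcol M2) (kcol M2)) * W"
        using ex unfolding c by auto
    next
      fix t2 R' M'
      assume r: "keep {2, 5, 6, 7} ?R3 R'" "keep (cols z {0, 15}) M2 M'" "tree_ok M'"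
        "finished (dcol M') (kcol M') = finished (dcol M2) (kcol M2)"
        "dinv S (dcol M2 u) (dcol M') (kcol M') (\<lambda>_. True)" "t2 \<le> 1 + arc_time * arcs_below a u m"
      have "keep {2, 5, 6, 7, 8, 9} R R'"
        by (rule keep_trans[OF _ r(1), of "{2, 5, 6, 7, 8, 9}"]) (use keepR in auto)
      moreover have "keep (cols z {0, 15}) M M'"
        by (rule keep_trans[OF k2 r(2)]) auto
      moreover have "pot (finished (dcol M) (kcol M)) = pot (finished (dcol M') (kcol M')) +
          (vertex_time + arc_time * arcs_below a u m)"
        using pot_insert[OF u(1) ex(3)] ex(2) r(4) unfolding c by simp
      ultimately show "Q (t + (1 + (1 + (t1 + (1 + (1 + t2)))))) R' M'"
        using r t t1 by (intro Q) auto
    qed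
    then show "wp L (Asg 8 (arr 0 (Var 9)) ;; Asg 5 (arr fs (Var 9)) ;; relax hc nx)
        (\<lambda>t'. Q (t + (1 + (1 + (t1 + t'))))) R2 M2"
      using R2 room u columns fs d by (simp add: wp_simps)
  qed
  then show "wp L (Asg 9 (Var 2 \<ominus> Var 30) ;; Put (addr 15 (Var 2)) (Var 28) ;; fixup ;;
      Asg 8 (arr 0 (Var 9)) ;; Asg 5 (arr fs (Var 9)) ;; relax hc nx) (\<lambda>t'. Q (t + t')) R1 M"
    unfolding wp_Seq[of L "Asg 9 _"] wp_Seq[of L "Put _ _"] wp_Asg wp_Put
    using R1' room u by simp
qed

lemma wp_dij_main:
  assumes R: "R 31 = z" "R 30 = n" "R 28 = BIG"
    and M: "graph_in M" "tree_ok M"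
    and inv: "dinv S 0 (dcol M) (kcol M) (\<lambda>_. True)"
    and Q: "\<And>t R' M' d. keep {2, 5, 6, 7, 8, 9} R R' \<Longrightarrow> keep (cols z {0, 15}) M M' \<Longrightarrow>
      dinv S d (dcol M') (kcol M') (\<lambda>_. True) \<Longrightarrow> (\<And>v. v < n \<Longrightarrow> BIG \<le> kcol M' v) \<Longrightarrow>
      t \<le> 1 + n * vertex_time + arc_time * m \<Longrightarrow> Q t R' M'"
  shows "wp L (dij_main hc fs nx) Q R M"
  unfolding dij_main_def
proof (rule wp_Loop[where I = "\<lambda>R' M'. keep {2, 5, 6, 7, 8, 9} R R' \<and> keep (cols z {0, 15}) M M' \<and>
      tree_ok M' \<and> (\<exists>d. dinv S d (dcol M') (kcol M') (\<lambda>_. True))"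
      and \<phi> = "\<lambda>R' M'. pot (finished (dcol M') (kcol M'))"])
  show "keep {2, 5, 6, 7, 8, 9} R R \<and> keep (cols z {0, 15}) M M \<and>
      tree_ok M \<and> (\<exists>d. dinv S d (dcol M) (kcol M) (\<lambda>_. True))"
    using M inv by auto
next
  fix R' M'
  assume I: "keep {2, 5, 6, 7, 8, 9} R R' \<and> keep (cols z {0, 15}) M M' \<and>
      tree_ok M' \<and> (\<exists>d. dinv S d (dcol M') (kcol M') (\<lambda>_. True))"
  then have R': "R' 31 = z" "R' 28 = BIG" "R' 30 = n" using R by (auto simp: keep_def)
  show "safe L (arr 15 (Num 1) \<lless> Var 28) R' M'" using R' room n_pos by simp
  assume ne: "ev (arr 15 (Num 1) \<lless> Var 28) R' M' \<noteq> 0"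
  obtain d where d: "dinv S d (dcol M') (kcol M') (\<lambda>_. True)" using I by blast
  have k: "keep {2, 5, 6, 7, 8, 9} R R'" "keep (cols z {0, 15}) M M'" using I by auto
  show "wp L (descend ;; Asg 9 (Var 2 \<ominus> Var 30) ;; Put (addr 15 (Var 2)) (Var 28) ;; fixup ;;
      Asg 8 (arr 0 (Var 9)) ;; Asg 5 (arr fs (Var 9)) ;; relax hc nx)
      (\<lambda>t R'' M''. (keep {2, 5, 6, 7, 8, 9} R R'' \<and> keep (cols z {0, 15}) M M'' \<and>
      tree_ok M'' \<and> (\<exists>d. dinv S d (dcol M'') (kcol M'') (\<lambda>_. True))) \<and>
      Suc t + pot (finished (dcol M'') (kcol M'')) \<le> pot (finished (dcol M') (kcol M'))) R' M'"
  proof (rule wp_extract[OF R'(1,3,2) _ _ d])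
    show "graph_in M'" using graph_in_keep[OF k(2)] M by simp
    show "tree_ok M'" using I by blast
    show "M' (cell z 15 1) < BIG" using ne R' by (simp split: if_splits)
  next
    fix t R'' M'' d'
    assume a: "keep {2, 5, 6, 7, 8, 9} R' R''" "keep (cols z {0, 15}) M' M''" "tree_ok M''"
      "dinv S d' (dcol M'') (kcol M'') (\<lambda>_. True)"
      "Suc t + pot (finished (dcol M'') (kcol M'')) \<le> pot (finished (dcol M') (kcol M'))"
    have "keep {2, 5, 6, 7, 8, 9} R R''" "keep (cols z {0, 15}) M M''"
      using keep_trans[OF k(1) a(1)] keep_trans[OF k(2) a(2)] by auto
    then show "(keep {2, 5, 6, 7, 8, 9} R R'' \<and> keep (cols z {0, 15}) M M'' \<and>
      tree_ok M'' \<and> (\<exists>d. dinv S d (dcol M'') (kcol M'') (\<lambda>_. True))) \<and>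
      Suc t + pot (finished (dcol M'') (kcol M'')) \<le> pot (finished (dcol M') (kcol M'))"
      using a by blast
  qed
next
  fix t R' M'
  assume I: "keep {2, 5, 6, 7, 8, 9} R R' \<and> keep (cols z {0, 15}) M M' \<and>
      tree_ok M' \<and> (\<exists>d. dinv S d (dcol M') (kcol M') (\<lambda>_. True))"
    and e: "ev (arr 15 (Num 1) \<lless> Var 28) R' M' = 0"
    and t: "t + pot (finished (dcol M') (kcol M')) \<le> Suc (pot (finished (dcol M) (kcol M)))"
  have R': "R' 31 = z" "R' 28 = BIG" using I R by (auto simp: keep_def)
  have root: "BIG \<le> M' (cell z 15 1)" using e R' by (simp split: if_splits)
  obtain d where d: "dinv S d (dcol M') (kcol M') (\<lambda>_. True)" using I by blast
  have "BIG \<le> kcol M' v" if "v < n" for v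
    using root_le[of M' "n + v"] I that root n_pos by (simp add: tree_ok_def kcol_def)
  then show "Q t R' M'"
    using I t pot_le[of "finished (dcol M) (kcol M)"] by (intro Q[OF _ _ d]) auto
qed

lemma wp_dij_init:
  assumes R: "R 31 = z" "R 30 = n" "R 28 = BIG"
    and Q: "\<And>t R' M'. keep {3, 4} R R' \<Longrightarrow> keep (cols z {0, 15}) M M' \<Longrightarrow>
      (\<And>v. v < n \<Longrightarrow> dcol M' v = (if M (cell z mk v) = 0 then BIG else 0)) \<Longrightarrow>
      (\<And>v. v < n \<Longrightarrow> kcol M' v = dcol M' v) \<Longrightarrow> t \<le> 2 + 5 * n \<Longrightarrow> Q t R' M'"
  shows "wp L (dij_init mk) Q R M"
  unfolding dij_init_def wp_Seq[of L "Asg 3 (Num 0)"] wp_Asg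
proof (intro conjI)
  show "safe L (Num 0) R M" using room by simp
  let ?I = "\<lambda>R' M'. R' 31 = z \<and> R' 30 = n \<and> R' 28 = BIG \<and> R' 3 \<le> n \<and>
    keep {3, 4} R R' \<and> keep (cols z {0, 15}) M M' \<and> (\<forall>v. M' (cell z mk v) = M (cell z mk v)) \<and>
    (\<forall>v<R' 3. dcol M' v = (if M (cell z mk v) = 0 then BIG else 0) \<and> kcol M' v = dcol M' v)"
  show "wp L (Loop (Var 3 \<lless> Var 30)
       (Asg 4 ((arr mk (Var 3) \<doteq> Num 0) \<otimes> Var 28) ;;
        Put (addr 0 (Var 3)) (Var 4) ;;
        Put (addr 15 (Var 30 \<oplus> Var 3)) (Var 4) ;;
        Asg 3 (Var 3 \<oplus> Num 1))) (\<lambda>t. Q (1 + t)) (R(3 := ev (Num 0) R M)) M"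
  proof (rule wp_Loop[where I = ?I and \<phi> = "\<lambda>R' M'. 5 * (n - R' 3)"])
    show "?I (R(3 := ev (Num 0) R M)) M" using R by simp
  next
    fix R' M'
    assume I: "?I R' M'" and ne: "ev (Var 3 \<lless> Var 30) R' M' \<noteq> 0"
    then have i: "R' 3 < n" by (auto split: if_splits)
    have t: "5 * (n - R' 3) = 5 + 5 * (n - Suc (R' 3))" using i by auto
    have x: "of_bool P * BIG = (if P then BIG else 0)" for P by simp
    show "wp L (Asg 4 ((arr mk (Var 3) \<doteq> Num 0) \<otimes> Var 28) ;;
        Put (addr 0 (Var 3)) (Var 4) ;;
        Put (addr 15 (Var 30 \<oplus> Var 3)) (Var 4) ;;
        Asg 3 (Var 3 \<oplus> Num 1))
      (\<lambda>t R'' M''. ?I R'' M'' \<and> Suc t + 5 * (n - R'' 3) \<le> 5 * (n - R' 3)) R' M'"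
      using I i room room_BIG columns unfolding t
      by (simp add: wp_simps x less_Suc_eq)
  next
    fix t R' M'
    assume I: "?I R' M'" and e: "ev (Var 3 \<lless> Var 30) R' M' = 0"
      and t: "t + 5 * (n - R' 3) \<le> Suc (5 * (n - (R(3 := ev (Num 0) R M)) 3))"
    then have "R' 3 = n" by (auto split: if_splits)
    then show "Q (1 + t) R' M'" using I t by (intro Q) auto
  qed simp
qed

lemma wp_dij_build:
  assumes R: "R 31 = z" "R 30 = n"
    and Q: "\<And>t R' M'. keep {2} R R' \<Longrightarrow> keep inner M M' \<Longrightarrow> tree_ok M' \<Longrightarrow>
      t \<le> 2 + 3 * n \<Longrightarrow> Q t R' M'"
  shows "wp L dij_build Q R M"
  unfolding dij_build_def wp_Seq[of L "Asg 2 (Var 30 \<ominus> Num 1)"] wp_Asg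
proof (intro conjI)
  show "safe L (Var 30 \<ominus> Num 1) R M" using room by simp
  let ?I = "\<lambda>R' M'. R' 31 = z \<and> R' 2 < n \<and> keep {2} R R' \<and> keep inner M M' \<and>
    (\<forall>j. R' 2 < j \<longrightarrow> j < n \<longrightarrow> node_ok M' j)"
  show "wp L (Loop (Var 2) (pull ;; Asg 2 (Var 2 \<ominus> Num 1))) (\<lambda>t. Q (1 + t))
      (R(2 := ev (Var 30 \<ominus> Num 1) R M)) M"
  proof (rule wp_Loop[where I = ?I and \<phi> = "\<lambda>R' M'. 3 * R' 2"])
    show "?I (R(2 := ev (Var 30 \<ominus> Num 1) R M)) M" using R n_pos by auto
  next
    fix R' M'
    assume I: "?I R' M'" and ne: "ev (Var 2) R' M' \<noteq> 0"
    let ?i = "R' 2" let ?M = "M'(cell z 15 ?i := min (M' (cell z 15 (2 * ?i))) (M' (cell z 15 (2 * ?i + 1))))"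
    have i: "0 < ?i" "?i < n" using I ne by auto
    have "node_ok ?M j" if "?i - 1 < j" "j < n" for j
    proof (cases "j = ?i")
      case True
      then show ?thesis using i by (auto simp: node_ok_def)
    next
      case False
      then have "?i < j" using that by simp
      then show ?thesis using I that by (auto simp: node_ok_def)
    qed
    then show "wp L (pull ;; Asg 2 (Var 2 \<ominus> Num 1))
      (\<lambda>t R'' M''. ?I R'' M'' \<and> Suc t + 3 * R'' 2 \<le> 3 * R' 2) R' M'"
      using I i room by (auto simp: pull_def wp_simps min_as_sub)
  next
    fix t R' M'
    assume I: "?I R' M'" and e: "ev (Var 2) R' M' = 0"
      and t: "t + 3 * R' 2 \<le> Suc (3 * (R(2 := ev (Var 30 \<ominus> Num 1) R M)) 2)"
    then show "Q (1 + t) R' M'" using R by (intro Q) (auto simp: tree_ok_def)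
  qed simp
qed

text \<open>The distance from the set \<open>S\<close>, described by attainment and minimality, with
  \<open>BIG\<close> for unreachable vertices.\<close>

definition is_dist :: "nat set \<Rightarrow> (nat \<Rightarrow> nat) \<Rightarrow> bool" where
  "is_dist S D \<longleftrightarrow> (\<forall>v<n. D v \<le> BIG \<and> (D v < BIG \<longrightarrow> src_walk S v (D v))) \<and>
     (\<forall>v c. src_walk S v c \<longrightarrow> D v \<le> c \<and> D v < BIG)"

abbreviation dij_time :: nat where
  "dij_time \<equiv> 5 + 8 * n + n * vertex_time + arc_time * m"

lemma wp_dij:
  assumes R: "R 31 = z" "R 30 = n" "R 28 = BIG" and M: "graph_in M"
    and Q: "\<And>t R' M'. keep {2..9} R R' \<Longrightarrow> keep (cols z {0, 15}) M M' \<Longrightarrow>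
      is_dist {v. v < n \<and> M (cell z mk v) \<noteq> 0} (dcol M') \<Longrightarrow> t \<le> dij_time \<Longrightarrow> Q t R' M'"
  shows "wp L (dij mk hc fs nx) Q R M"
  unfolding dij_def wp_Seq[of L "dij_init mk"]
proof (rule wp_dij_init[OF R])
  let ?S = "{v. v < n \<and> M (cell z mk v) \<noteq> 0}"
  fix t1 R1 M1
  assume 1: "keep {3, 4} R R1" "keep (cols z {0, 15}) M M1"
    "\<And>v. v < n \<Longrightarrow> dcol M1 v = (if M (cell z mk v) = 0 then BIG else 0)"
    "\<And>v. v < n \<Longrightarrow> kcol M1 v = dcol M1 v" "t1 \<le> 2 + 5 * n"
  have R1: "R1 31 = z" "R1 30 = n" "R1 28 = BIG" using keepD[OF 1(1)] R by simp_all
  show "wp L (dij_build ;; dij_main hc fs nx) (\<lambda>t'. Q (t1 + t')) R1 M1"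
    unfolding wp_Seq
  proof (rule wp_dij_build[OF R1(1,2)])
    fix t2 R2 M2
    assume 2: "keep {2} R1 R2" "keep inner M1 M2" "tree_ok M2" "t2 \<le> 2 + 3 * n"
    have R2: "R2 31 = z" "R2 30 = n" "R2 28 = BIG" using keepD[OF 2(1)] R1 by simp_all
    have k2: "keep (cols z {0, 15}) M M2"
      by (rule keep_trans[OF 1(2) 2(2)]) (use inner_subset cols_mono[of "{15}" "{0, 15}" z] in auto)
    show "wp L (dij_main hc fs nx) (\<lambda>t'. Q (t1 + (t2 + t'))) R2 M2"
    proof (rule wp_dij_main[OF R2])
      show "graph_in M2" using graph_in_keep[OF k2] M by simp
      show "tree_ok M2" by fact
      show "dinv ?S 0 (dcol M2) (kcol M2) (\<lambda>_. True)"
        by (rule dinv_init) (use 1 col_keep_inner[OF 2(2)] in auto)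
    next
      fix t3 R' M' d
      assume 3: "keep {2, 5, 6, 7, 8, 9} R2 R'" "keep (cols z {0, 15}) M2 M'"
        "dinv ?S d (dcol M') (kcol M') (\<lambda>_. True)" "\<And>v. v < n \<Longrightarrow> BIG \<le> kcol M' v"
        "t3 \<le> 1 + n * vertex_time + arc_time * m"
      note f = dinv_final[OF 3(3,4)]
      show "Q (t1 + (t2 + t3)) R' M'"
      proof (rule Q)
        show "keep {2..9} R R'"
          by (rule keep_trans[OF 1(1) keep_trans[OF 2(1) 3(1) order_refl]]) auto
        show "keep (cols z {0, 15}) M M'"
          by (rule keep_trans[OF k2 3(2)]) auto
        show "is_dist ?S (dcol M')"
          unfolding is_dist_def using f by auto
        show "t1 + (t2 + t3) \<le> dij_time" using 1 2 3 by simp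
      qed
    qed
  qed
qed

end

section \<open>Eccentricities\<close>

text \<open>Register 27 accumulates the maximum of the distances from register 10 to the vertices on one side,
  again via truncated subtraction.\<close>

definition clear_marks :: "nat \<Rightarrow> prog" where
  "clear_marks mk = Asg 3 (Num 0) ;;
     Loop (Var 3 \<lless> Var 30) (Put (addr mk (Var 3)) (Var 3 \<doteq> Var 10) ;; Asg 3 (Var 3 \<oplus> Num 1))"

definition side_of :: "expr \<Rightarrow> expr" where
  "side_of e = Get (Num 2 \<oplus> Num 3 \<otimes> Var 29 \<oplus> e)"

definition scan :: "nat \<Rightarrow> prog" where
  "scan flag = Asg 3 (Num 0) ;;
     Loop (Var 3 \<lless> Var 30)
       (Asg 4 ((side_of (Var 3) \<doteq> Num flag) \<otimes> arr 0 (Var 3)) ;;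
        Asg 27 (Var 27 \<oplus> (Var 4 \<ominus> Var 27)) ;;
        Asg 3 (Var 3 \<oplus> Num 1))"

definition ecc :: "nat \<Rightarrow> nat \<Rightarrow> nat \<Rightarrow> nat \<Rightarrow> nat \<Rightarrow> prog" where
  "ecc flag mk hc fs nx = clear_marks mk ;; dij mk hc fs nx ;; scan flag"

context dijkstra
begin

lemma graph_in_upd_mark [simp]:
  assumes "mk \<noteq> fs" "mk \<noteq> nx"
  shows "graph_in (M(cell z mk i := x)) = graph_in M"
proof -
  have low: "hc + 3 * e < z" "4 + 3 * e < z" if "e < m" for e
    using input_below hc that by auto
  have "(M(cell z mk i := x)) (hc + 3 * e) = M (hc + 3 * e) \<and>
      (M(cell z mk i := x)) (4 + 3 * e) = M (4 + 3 * e)" if "e < m" for e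
    using low[OF that] by simp
  moreover have "(M(cell z mk i := x)) (cell z nx e) = M (cell z nx e)"
    "(M(cell z mk i := x)) (cell z fs e) = M (cell z fs e)" for e
    using columns assms by auto
  ultimately show ?thesis unfolding graph_in_def by simp
qed

lemma wp_clear_marks:
  assumes R: "R 31 = z" "R 30 = n" "R 10 = x" and M: "graph_in M" and mk: "mk \<noteq> fs" "mk \<noteq> nx"
    and Q: "\<And>t R' M'. keep {3} R R' \<Longrightarrow> keep (cols z {mk}) M M' \<Longrightarrow> graph_in M' \<Longrightarrow>
      (\<And>v. v < n \<Longrightarrow> M' (cell z mk v) = of_bool (v = x)) \<Longrightarrow> t \<le> 2 + 3 * n \<Longrightarrow> Q t R' M'"
  shows "wp L (clear_marks mk) Q R M"
  unfolding clear_marks_def wp_Seq[of L "Asg 3 (Num 0)"] wp_Asg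
proof (intro conjI)
  show "safe L (Num 0) R M" using room by simp
  let ?I = "\<lambda>R' M'. R' 31 = z \<and> R' 30 = n \<and> R' 10 = x \<and> R' 3 \<le> n \<and>
    keep {3} R R' \<and> keep (cols z {mk}) M M' \<and> graph_in M' \<and>
    (\<forall>v<R' 3. M' (cell z mk v) = of_bool (v = x))"
  show "wp L (Loop (Var 3 \<lless> Var 30) (Put (addr mk (Var 3)) (Var 3 \<doteq> Var 10) ;; Asg 3 (Var 3 \<oplus> Num 1)))
      (\<lambda>t. Q (1 + t)) (R(3 := ev (Num 0) R M)) M"
  proof (rule wp_Loop[where I = ?I and \<phi> = "\<lambda>R' M'. 3 * (n - R' 3)"])
    show "?I (R(3 := ev (Num 0) R M)) M" using R M by simp
  next
    fix R' M'
    assume I: "?I R' M'" and ne: "ev (Var 3 \<lless> Var 30) R' M' \<noteq> 0"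
    then have i: "R' 3 < n" by (auto split: if_splits)
    have t: "3 * (n - R' 3) = 3 + 3 * (n - Suc (R' 3))" using i by auto
    show "wp L (Put (addr mk (Var 3)) (Var 3 \<doteq> Var 10) ;; Asg 3 (Var 3 \<oplus> Num 1))
      (\<lambda>t R'' M''. ?I R'' M'' \<and> Suc t + 3 * (n - R'' 3) \<le> 3 * (n - R' 3)) R' M'"
      using I i room columns mk unfolding t by (simp add: wp_simps less_Suc_eq)
  next
    fix t R' M'
    assume I: "?I R' M'" and e: "ev (Var 3 \<lless> Var 30) R' M' = 0"
      and t: "t + 3 * (n - R' 3) \<le> Suc (3 * (n - (R(3 := ev (Num 0) R M)) 3))"
    then have "R' 3 = n" by (auto split: if_splits)
    then show "Q (1 + t) R' M'" using I t by (intro Q) auto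
  qed simp
qed

lemma max_as_add: "x + (y - x) = max x (y::nat)"
  by auto

text \<open>Vertices on the other side contribute 0 to the maximum. Unreachable ones contribute
  \<open>BIG\<close>, so an accumulated value of \<open>BIG\<close> stands for an infinite
  eccentricity.\<close>

lemma wp_scan:
  assumes R: "R 31 = z" "R 30 = n" "R 29 = m" "R 27 \<le> BIG" and z: "2 + 3 * m + n \<le> z"
    and side: "\<And>v. v < n \<Longrightarrow> M (2 + 3 * m + v) = of_bool (sd v)"
    and D: "\<And>v. v < n \<Longrightarrow> dcol M v \<le> BIG"
    and Q: "\<And>t R'. keep {3, 4, 27} R R' \<Longrightarrow> R 27 \<le> R' 27 \<Longrightarrow> R' 27 \<le> BIG \<Longrightarrow>
      (\<And>v. v < n \<Longrightarrow> sd v = fl \<Longrightarrow> dcol M v \<le> R' 27) \<Longrightarrow>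
      R' 27 = R 27 \<or> (\<exists>v<n. sd v = fl \<and> R' 27 = dcol M v) \<Longrightarrow> t \<le> 2 + 4 * n \<Longrightarrow> Q t R' M"
  shows "wp L (scan (of_bool fl)) Q R M"
  unfolding scan_def wp_Seq[of L "Asg 3 (Num 0)"] wp_Asg
proof (intro conjI)
  show "safe L (Num 0) R M" using room by simp
  let ?I = "\<lambda>R' M'. M' = M \<and> R' 31 = z \<and> R' 30 = n \<and> R' 29 = m \<and> R' 3 \<le> n \<and> R' 27 \<le> BIG \<and>
    R 27 \<le> R' 27 \<and> keep {3, 4, 27} R R' \<and> (\<forall>v<R' 3. sd v = fl \<longrightarrow> dcol M v \<le> R' 27) \<and>
    (R' 27 = R 27 \<or> (\<exists>v<n. sd v = fl \<and> R' 27 = dcol M v))"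
  let ?body = "Asg 4 ((side_of (Var 3) \<doteq> Num (of_bool fl)) \<otimes> arr 0 (Var 3)) ;;
        Asg 27 (Var 27 \<oplus> (Var 4 \<ominus> Var 27)) ;; Asg 3 (Var 3 \<oplus> Num 1)"
  show "wp L (Loop (Var 3 \<lless> Var 30) ?body) (\<lambda>t. Q (1 + t)) (R(3 := ev (Num 0) R M)) M"
  proof (rule wp_Loop[where I = ?I and \<phi> = "\<lambda>R' M'. 4 * (n - R' 3)"])
    show "?I (R(3 := ev (Num 0) R M)) M" using R by simp
  next
    fix R' M'
    assume I: "?I R' M'" and ne: "ev (Var 3 \<lless> Var 30) R' M' \<noteq> 0"
    then have i: "R' 3 < n" by (auto split: if_splits)
    let ?v = "R' 3" let ?y = "max (R' 27) (of_bool (sd ?v = fl) * dcol M ?v)"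
    have t: "4 * (n - R' 3) = 4 + 4 * (n - Suc (R' 3))" using i by auto
    have s: "M (2 + 3 * m + ?v) = of_bool (sd ?v)" using side i by simp
    have d: "M (cell z 0 ?v) = dcol M ?v" by (simp add: dcol_def)
    have eq: "(of_bool (sd ?v) = (of_bool fl :: nat)) = (sd ?v = fl)" by auto
    have L: "3 * m < L" "2 + 3 * m < L" "2 + 3 * m + ?v < L" using i z room by auto
    have dl: "dcol M ?v \<le> BIG" using D i by simp
    have y: "?y \<le> BIG" "?y < L" "R 27 \<le> ?y" "?y = R' 27 \<or> ?y = dcol M ?v \<and> sd ?v = fl"
      "\<And>v. v < Suc ?v \<Longrightarrow> sd v = fl \<Longrightarrow> dcol M v \<le> ?y"
      using I dl room_BIG by (auto simp: max_def less_Suc_eq)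
    have y': "?y = R 27 \<or> (\<exists>v<n. sd v = fl \<and> ?y = dcol M v)" using y(4) I i by metis
    have b: "of_bool (sd ?v = fl) * dcol M ?v < L" using dl room_BIG by auto
    have "wp L ?body (\<lambda>t R'' M''. M'' = M \<and> R'' = R'(4 := of_bool (sd ?v = fl) * dcol M ?v, 27 := ?y, 3 := Suc ?v) \<and> t = 3)
        R' M'"
      using I i room s d L b y(2) by (simp add: wp_simps side_of_def max_as_add eq)
    then show "wp L ?body (\<lambda>t R'' M''. ?I R'' M'' \<and> Suc t + 4 * (n - R'' 3) \<le> 4 * (n - R' 3)) R' M'"
    proof (rule wp_mono)
      fix t :: nat and R'' M''
      assume 1: "M'' = M \<and> R'' = R'(4 := of_bool (sd ?v = fl) * dcol M ?v, 27 := ?y, 3 := Suc ?v) \<and> t = 3"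
      have k: "keep {3, 4, 27} R R''" using 1 I by simp
      show "?I R'' M'' \<and> Suc t + 4 * (n - R'' 3) \<le> 4 * (n - R' 3)"
        using 1 I y(1,3,5) y' i t k by simp
    qed
  next
    fix t R' M'
    assume I: "?I R' M'" and e: "ev (Var 3 \<lless> Var 30) R' M' = 0"
      and t: "t + 4 * (n - R' 3) \<le> Suc (4 * (n - (R(3 := ev (Num 0) R M)) 3))"
    then have "R' 3 = n" by (auto split: if_splits)
    then have "Q (1 + t) R' M" using I t by (intro Q) auto
    then show "Q (1 + t) R' M'" using I by simp
  qed simp
qed

abbreviation ecc_time :: nat where
  "ecc_time \<equiv> dij_time + 7 * n + 4"

lemma wp_ecc:
  assumes R: "R 31 = z" "R 30 = n" "R 29 = m" "R 28 = BIG" "R 27 \<le> BIG" "R 10 = x" "x < n"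
    and z: "2 + 3 * m + n \<le> z" and M: "graph_in M" and mk: "mk \<noteq> fs" "mk \<noteq> nx"
    and side: "\<And>v. v < n \<Longrightarrow> M (2 + 3 * m + v) = of_bool (sd v)"
    and Q: "\<And>t R' M'. keep ({2..9} \<union> {27}) R R' \<Longrightarrow> keep (cols z {0, mk, 15}) M M' \<Longrightarrow>
      is_dist {x} (dcol M') \<Longrightarrow> R 27 \<le> R' 27 \<Longrightarrow> R' 27 \<le> BIG \<Longrightarrow>
      (\<And>v. v < n \<Longrightarrow> sd v = fl \<Longrightarrow> dcol M' v \<le> R' 27) \<Longrightarrow>
      R' 27 = R 27 \<or> (\<exists>v<n. sd v = fl \<and> R' 27 = dcol M' v) \<Longrightarrow> t \<le> ecc_time \<Longrightarrow> Q t R' M'"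
  shows "wp L (ecc (of_bool fl) mk hc fs nx) Q R M"
  unfolding ecc_def wp_Seq[of L "clear_marks mk"]
proof (rule wp_clear_marks[OF R(1,2,6) M mk])
  fix t1 R1 M1
  assume 1: "keep {3} R R1" "keep (cols z {mk}) M M1" "graph_in M1"
    "\<And>v. v < n \<Longrightarrow> M1 (cell z mk v) = of_bool (v = x)" "t1 \<le> 2 + 3 * n"
  have R1: "R1 31 = z" "R1 30 = n" "R1 28 = BIG" "R1 29 = m" "R1 27 = R 27"
    using keepD[OF 1(1)] R by simp_all
  have S: "{v. v < n \<and> M1 (cell z mk v) \<noteq> 0} = {x}" using 1(4) R(7) by (auto split: if_splits)
  show "wp L (dij mk hc fs nx ;; scan (of_bool fl)) (\<lambda>t'. Q (t1 + t')) R1 M1"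
    unfolding wp_Seq
  proof (rule wp_dij[OF R1(1-3) 1(3)], unfold S)
    fix t2 R2 M2
    assume 2: "keep {2..9} R1 R2" "keep (cols z {0, 15}) M1 M2" "is_dist {x} (dcol M2)" "t2 \<le> dij_time"
    have R2: "R2 31 = z" "R2 30 = n" "R2 29 = m" "R2 27 = R 27"
      using keepD[OF 2(1)] R1 by simp_all
    have kM: "keep (cols z {0, mk, 15}) M M2"
      by (rule keep_trans[OF 1(2) 2(2)]) (use cols_mono[of "{mk}" "{0, mk, 15}" z] cols_mono[of "{0, 15}" "{0, mk, 15}" z] in auto)
    have side2: "M2 (2 + 3 * m + v) = of_bool (sd v)" if "v < n" for v
      using keepD[OF kM, of "2 + 3 * m + v"] side that z by simp
    have D2: "dcol M2 v \<le> BIG" if "v < n" for v using 2(3) that by (auto simp: is_dist_def)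
    have le: "R2 27 \<le> BIG" using R2 R by simp
    show "wp L (scan (of_bool fl)) (\<lambda>t'. Q (t1 + (t2 + t'))) R2 M2"
    proof (rule wp_scan[where sd = sd, OF R2(1-3) le z side2 D2])
      fix t3 R'
      assume 3: "keep {3, 4, 27} R2 R'" "R2 27 \<le> R' 27" "R' 27 \<le> BIG"
        "\<And>v. v < n \<Longrightarrow> sd v = fl \<Longrightarrow> dcol M2 v \<le> R' 27"
        "R' 27 = R2 27 \<or> (\<exists>v<n. sd v = fl \<and> R' 27 = dcol M2 v)" "t3 \<le> 2 + 4 * n"
      have "keep ({2..9} \<union> {27}) R R'"
        by (rule keep_trans[OF 1(1) keep_trans[OF 2(1) 3(1) order_refl]]) auto
      then show "Q (t1 + (t2 + t3)) R' M2"
        using 3 1 2 kM R2 by (intro Q) auto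
    qed
  qed
qed

lemma is_distD:
  assumes "is_dist S D" "v < n"
  shows "D v < BIG \<Longrightarrow> src_walk S v (D v)" "src_walk S v c \<Longrightarrow> D v \<le> c \<and> D v < BIG" "D v \<le> BIG"
  using assms by (auto simp: is_dist_def)

end

section \<open>The approximation algorithm\<close>

text \<open>\<open>X\<close> bounds the length of those columns that are indexed by samples,
  candidates or coin flips instead of vertices and edges.\<close>

locale bichrom = arrays L z n m for L z n m +
  fixes tl hd wt :: "nat \<Rightarrow> nat" and sd :: "nat \<Rightarrow> bool" and W BIG X :: nat
  assumes tl_less: "e < m \<Longrightarrow> tl e < n" and hd_less: "e < m \<Longrightarrow> hd e < n"
    and wt_le': "e < m \<Longrightarrow> wt e \<le> W"
    and BIG_eq': "BIG = n * W + 1"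
    and room_BIG': "BIG + W < L"
    and z_eq: "z = 2 + 3 * m + n"
    and room_X: "16 * (z + X) + 16 < L"

text \<open>The reversed graph finds its heads at the addresses of the tails (2 instead of 3) and
  has its own lists in columns 6 and 7. The third instance differs from the second only in the
  marks: column 3 holds the sampled tails, column 2 is overwritten for every single-source
  search.\<close>

sublocale bichrom \<subseteq> fwd: dijkstra L z n m tl hd wt W BIG 3 4 5 2
  by unfold_locales (use tl_less hd_less wt_le' BIG_eq' room_BIG' in auto)

sublocale bichrom \<subseteq> bwd: dijkstra L z n m hd tl wt W BIG 2 6 7 2
  by unfold_locales (use tl_less hd_less wt_le' BIG_eq' room_BIG' in auto)

sublocale bichrom \<subseteq> bwm: dijkstra L z n m hd tl wt W BIG 2 6 7 3
  by unfold_locales (use tl_less hd_less wt_le' BIG_eq' room_BIG' in auto)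

context bichrom
begin

abbreviation gwk :: "nat \<Rightarrow> nat \<Rightarrow> nat \<Rightarrow> bool" where
  "gwk \<equiv> wk m tl hd wt"

lemma gwk_reverse: "wk m hd tl wt u v c \<longleftrightarrow> gwk v u c"
  using wk_reverse[of m hd tl wt u v c] wk_reverse[of m tl hd wt v u c] by blast

definition gd :: "nat \<Rightarrow> nat \<Rightarrow> nat" where
  "gd u v = (if \<exists>c. gwk u v c then LEAST c. gwk u v c else BIG)"

lemma gd_le: "gwk u v c \<Longrightarrow> gd u v \<le> c"
  by (auto simp: gd_def intro: Least_le)

lemma gd_eqI:
  assumes "D < BIG \<Longrightarrow> gwk u v D" "\<And>c. gwk u v c \<Longrightarrow> D \<le> c \<and> D < BIG" "D \<le> BIG"
  shows "D = gd u v"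
proof (cases "\<exists>c. gwk u v c")
  case True
  then have "(LEAST c. gwk u v c) = D" using assms by (intro Least_equality) blast+
  then show ?thesis using True by (simp add: gd_def)
next
  case False
  then show ?thesis using assms by (auto simp: gd_def le_less)
qed

lemma is_dist_gd:
  assumes "fwd.is_dist {x} D" "v < n"
  shows "D v = gd x v"
  using fwd.is_distD[OF assms] by (intro gd_eqI) (auto simp: fwd.src_walk_def)

lemma crossing_arc:
  assumes "gwk s t c" "sd s" "\<not> sd t"
  obtains e c1 c2 where "e < m" "sd (tl e)" "\<not> sd (hd e)" "gwk s (tl e) c1" "gwk (hd e) t c2"
    "c1 + wt e + c2 = c"
proof -
  have "\<exists>e c1 c2. e < m \<and> sd (tl e) \<and> \<not> sd (hd e) \<and> gwk s (tl e) c1 \<and> gwk (hd e) t c2 \<and>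
      c1 + wt e + c2 = c"
    using assms
  proof (induction rule: wk.induct)
    case (wk_edge s f c)
    show ?case
    proof (cases "sd (tl f)")
      case True
      then show ?thesis
        using wk_edge wk_refl[of m tl hd wt "hd f"] by (intro exI[of _ f] exI[of _ c] exI[of _ 0]) simp
    next
      case False
      then obtain e c1 c2 where e: "e < m" "sd (tl e)" "\<not> sd (hd e)" "gwk s (tl e) c1"
        "gwk (hd e) (tl f) c2" "c1 + wt e + c2 = c"
        using wk_edge by blast
      then have "gwk (hd e) (hd f) (c2 + wt f)"
        using wk.wk_edge[of m tl hd wt "hd e" f c2] wk_edge by simp
      then show ?thesis
        using e by (intro exI[of _ e] exI[of _ c1] exI[of _ "c2 + wt f"]) simp
    qed
  qed simp
  then show ?thesis using that by blast
qed

text \<open>The edges from \<open>S\<close> to \<open>T\<close>. Samples and candidates are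
  positions in this list.\<close>

definition es :: "nat list" where
  "es = filter (\<lambda>e. sd (tl e) \<and> \<not> sd (hd e)) [0..<m]"

lemma es_nth: "k < length es \<Longrightarrow> es ! k < m \<and> sd (tl (es ! k)) \<and> \<not> sd (hd (es ! k))"
  using nth_mem[of k es] by (auto simp: es_def)

lemma es_complete: "e < m \<Longrightarrow> sd (tl e) \<Longrightarrow> \<not> sd (hd e) \<Longrightarrow> \<exists>k<length es. es ! k = e"
proof -
  assume "e < m" "sd (tl e)" "\<not> sd (hd e)"
  then have "e \<in> set es" by (auto simp: es_def)
  then show ?thesis by (auto simp: in_set_conv_nth)
qed

lemma length_es: "length es \<le> m"
  using length_filter_le[of "\<lambda>e. sd (tl e) \<and> \<not> sd (hd e)" "[0..<m]"] by (simp add: es_def)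

text \<open>Nothing is claimed for \<open>y \<ge> BIG\<close>, where the estimate is infinite and
  only has to be justified from below.\<close>

definition reach_out :: "nat \<Rightarrow> nat \<Rightarrow> bool" where
  "reach_out y x \<longleftrightarrow> (y < BIG \<longrightarrow> (\<forall>t<n. \<not> sd t \<longrightarrow> (\<exists>c\<le>y. gwk x t c)))"

definition reach_in :: "nat \<Rightarrow> nat \<Rightarrow> bool" where
  "reach_in y x \<longleftrightarrow> (y < BIG \<longrightarrow> (\<forall>s<n. sd s \<longrightarrow> (\<exists>c\<le>y. gwk s x c)))"

text \<open>A certificate that \<open>y\<close> does not exceed the diameter. The value
  \<open>BIG\<close> is only allowed for a pair without any walk, which makes an infinite output
  correct.\<close>

definition attained :: "nat \<Rightarrow> bool" where
  "attained y \<longleftrightarrow> y = 0 \<or>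
     (\<exists>s t. s < n \<and> t < n \<and> sd s \<and> \<not> sd t \<and> (\<forall>c. gwk s t c \<longrightarrow> y \<le> c \<and> y < BIG))"

lemma reach_mono:
  "y \<le> y' \<Longrightarrow> reach_out y x \<Longrightarrow> reach_out y' x"
  "y \<le> y' \<Longrightarrow> reach_in y x \<Longrightarrow> reach_in y' x"
  unfolding reach_out_def reach_in_def by (meson le_trans le_less_trans)+

text \<open>The heart of the approximation guarantee: the source farthest from the samples reaches the
  target of a bad pair along an arc whose head has been examined.\<close>

lemma two_approximation:
  assumes y: "y < BIG"
    and samples: "\<And>x. x \<in> A \<Longrightarrow> reach_out y x"
    and D: "\<And>v x. v < n \<Longrightarrow> x \<in> A \<Longrightarrow> D v \<le> gd v x"
      "\<And>v. v < n \<Longrightarrow> D v < BIG \<Longrightarrow> \<exists>x\<in>A. gwk v x (D v)"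
    and far: "s0 < n" "sd s0" "\<And>v. v < n \<Longrightarrow> sd v \<Longrightarrow> D v \<le> D s0" "reach_out y s0"
    and cands: "\<And>k. k < length es \<Longrightarrow> gd s0 (tl (es ! k)) < D s0 \<Longrightarrow> reach_in y (hd (es ! k))"
    and st: "s < n" "sd s" "t < n" "\<not> sd t"
  shows "\<exists>c\<le>2 * y. gwk s t c"
proof (rule ccontr)
  assume no: "\<not> (\<exists>c\<le>2 * y. gwk s t c)"
  have "y < D s"
  proof (rule ccontr)
    assume "\<not> y < D s"
    then have "D s < BIG" "D s \<le> y" using y by auto
    then obtain x where x: "x \<in> A" "gwk s x (D s)" using D(2) st by blast
    then obtain c where "c \<le> y" "gwk x t c"
      using samples[OF x(1)] y st by (auto simp: reach_out_def)
    then show False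
      using no wk_trans[OF _ x(2), of t c] \<open>D s \<le> y\<close> by (metis add_mono mult_2)
  qed
  then have far_y: "y < D s0" using far(3) st by fastforce
  obtain c where c: "c \<le> y" "gwk s0 t c" using far(4) y st by (auto simp: reach_out_def)
  obtain e c1 c2 where e: "e < m" "sd (tl e)" "\<not> sd (hd e)" "gwk s0 (tl e) c1" "gwk (hd e) t c2"
    "c1 + wt e + c2 = c"
    using crossing_arc[OF c(2) far(2) st(4)] .
  obtain k where k: "k < length es" "es ! k = e" using es_complete e by blast
  \<comment> \<open>The part of the path before the crossing edge costs at most
    \<open>c \<le> y\<close>, which is less than \<open>D s0\<close>; so the edge is nearer to
    \<open>s0\<close> than all samples.\<close>
  have "gd s0 (tl e) < D s0" using gd_le[OF e(4)] e(6) c(1) far_y by simp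
  then have "reach_in y (hd e)" using cands k by blast
  then obtain d where d: "d \<le> y" "gwk s (hd e) d" using y st by (auto simp: reach_in_def)
  show False
    using no wk_trans[OF e(5) d(2)] d e(6) c(1) by (metis add_leD2 add_mono le_trans mult_2)
qed

text \<open>The part of the memory that the main phase only reads: the input, the adjacency lists of
  both orientations and, in column 8, the list \<open>es\<close>.\<close>

definition inp :: "(nat \<Rightarrow> nat) \<Rightarrow> bool" where
  "inp M \<longleftrightarrow> (\<forall>v<n. M (2 + 3 * m + v) = of_bool (sd v)) \<and>
     (\<forall>e<m. M (2 + 3 * e) = tl e \<and> M (3 + 3 * e) = hd e) \<and>
     fwd.graph_in M \<and> bwd.graph_in M \<and> (\<forall>k<length es. M (cell z 8 k) = es ! k)"

abbreviation work_cols :: "nat set" where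
  "work_cols \<equiv> {0, 2, 3, 9, 11, 15}"

lemma inp_keep:
  assumes "keep (cols z work_cols) M M'" "inp M"
  shows "inp M'"
proof -
  have low: "M' x = M x" if "x < z" for x using keepD[OF assms(1)] that by simp
  have c: "M' (cell z c i) = M (cell z c i)" if "c \<in> {4, 5, 6, 7, 8}" for c i
    using keepD[OF assms(1)] that by auto
  have "M' (2 + 3 * m + v) = M (2 + 3 * m + v)" if "v < n" for v
    using low z_eq that by simp
  moreover have "M' (2 + 3 * e) = M (2 + 3 * e)" "M' (3 + 3 * e) = M (3 + 3 * e)"
    "M' (4 + 3 * e) = M (4 + 3 * e)" if "e < m" for e
    using low z_eq that by simp_all
  ultimately show ?thesis
    using assms(2) c unfolding inp_def fwd.graph_in_def bwd.graph_in_def by simp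
qed

text \<open>Register contents throughout the main phase: number \<open>q\<close> of edges near \<open>s0\<close> to be examined, number
  \<open>r\<close> of samples, bits \<open>l\<close> per sample.\<close>

definition base :: "nat \<Rightarrow> nat \<Rightarrow> nat \<Rightarrow> (nat \<Rightarrow> nat) \<Rightarrow> bool" where
  "base q r l R \<longleftrightarrow> R 31 = z \<and> R 30 = n \<and> R 29 = m \<and> R 28 = BIG \<and> R 25 = q \<and> R 23 = r \<and>
     R 22 = length es \<and> R 21 = l"

abbreviation work_regs :: "nat set" where
  "work_regs \<equiv> {2..16} \<union> {27}"

lemma base_keep: "keep work_regs R R' \<Longrightarrow> base q r l R \<Longrightarrow> base q r l R'"
  by (simp add: base_def keep_def)

abbreviation ecc_time :: nat where
  "ecc_time \<equiv> fwd.ecc_time"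

text \<open>The distances from \<open>x\<close> are left behind in column 0; after the call for
  \<open>s0\<close> they are what candidate edges are selected by.\<close>

lemma wp_ecc_out:
  assumes R: "base q r l R" "R 27 \<le> BIG" "R 10 = x" "x < n" "sd x" and M: "inp M"
    and Q: "\<And>t R' M'. keep ({2..9} \<union> {27}) R R' \<Longrightarrow> keep (cols z {0, 2, 15}) M M' \<Longrightarrow>
      (\<And>v. v < n \<Longrightarrow> M' (cell z 0 v) = gd x v) \<Longrightarrow> R 27 \<le> R' 27 \<Longrightarrow> R' 27 \<le> BIG \<Longrightarrow>
      reach_out (R' 27) x \<Longrightarrow> (attained (R 27) \<Longrightarrow> attained (R' 27)) \<Longrightarrow> t \<le> ecc_time \<Longrightarrow> Q t R' M'"
  shows "wp L (ecc 0 2 3 4 5) Q R M"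
proof -
  have "wp L (ecc (of_bool False) 2 3 4 5) Q R M"
  proof (rule fwd.wp_ecc[where sd = sd and fl = False])
    show "R 31 = z" "R 30 = n" "R 29 = m" "R 28 = BIG" "R 27 \<le> BIG" "R 10 = x" "x < n"
      using R by (auto simp: base_def)
    show "2 + 3 * m + n \<le> z" using z_eq by simp
    show "fwd.graph_in M" "\<And>v. v < n \<Longrightarrow> M (2 + 3 * m + v) = of_bool (sd v)"
      using M by (auto simp: inp_def)
  next
    fix t R' M'
    assume 1: "keep ({2..9} \<union> {27}) R R'" "keep (cols z {0, 2, 15}) M M'"
      "fwd.is_dist {x} (fwd.dcol M')" "R 27 \<le> R' 27" "R' 27 \<le> BIG"
      "\<And>v. v < n \<Longrightarrow> sd v = False \<Longrightarrow> fwd.dcol M' v \<le> R' 27"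
      "R' 27 = R 27 \<or> (\<exists>v<n. sd v = False \<and> R' 27 = fwd.dcol M' v)" "t \<le> ecc_time"
    note d = fwd.is_distD[OF 1(3)]
    have "\<exists>c\<le>R' 27. gwk x t c" if "R' 27 < BIG" "t < n" "\<not> sd t" for t
      using 1(6)[of t] d(1)[of t] that by (auto simp: fwd.src_walk_def)
    then have "reach_out (R' 27) x" by (auto simp: reach_out_def)
    moreover have "attained (R' 27)" if "attained (R 27)"
      using 1(7)
    proof
      assume "\<exists>v<n. sd v = False \<and> R' 27 = fwd.dcol M' v"
      then obtain v where v: "v < n" "\<not> sd v" "R' 27 = fwd.dcol M' v" by auto
      then have "\<forall>c. gwk x v c \<longrightarrow> R' 27 \<le> c \<and> R' 27 < BIG"
        using d(2)[OF v(1)] by (auto simp: fwd.src_walk_def)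
      then show ?thesis unfolding attained_def using R v by blast
    qed (use that in simp)
    moreover have "M' (cell z 0 v) = gd x v" if "v < n" for v
      using is_dist_gd[OF 1(3) that] by (simp add: fwd.dcol_def)
    ultimately show "Q t R' M'" using 1 by (intro Q) auto
  qed auto
  then show ?thesis by simp
qed

lemma wp_ecc_in:
  assumes R: "base q r l R" "R 27 \<le> BIG" "R 10 = x" "x < n" "\<not> sd x" and M: "inp M"
    and Q: "\<And>t R' M'. keep ({2..9} \<union> {27}) R R' \<Longrightarrow> keep (cols z {0, 2, 15}) M M' \<Longrightarrow>
      R 27 \<le> R' 27 \<Longrightarrow> R' 27 \<le> BIG \<Longrightarrow>
      reach_in (R' 27) x \<Longrightarrow> (attained (R 27) \<Longrightarrow> attained (R' 27)) \<Longrightarrow> t \<le> ecc_time \<Longrightarrow> Q t R' M'"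
  shows "wp L (ecc 1 2 2 6 7) Q R M"
proof -
  have "wp L (ecc (of_bool True) 2 2 6 7) Q R M"
  proof (rule bwd.wp_ecc[where sd = sd and fl = True])
    show "R 31 = z" "R 30 = n" "R 29 = m" "R 28 = BIG" "R 27 \<le> BIG" "R 10 = x" "x < n"
      using R by (auto simp: base_def)
    show "2 + 3 * m + n \<le> z" using z_eq by simp
    show "bwd.graph_in M" "\<And>v. v < n \<Longrightarrow> M (2 + 3 * m + v) = of_bool (sd v)"
      using M by (auto simp: inp_def)
  next
    fix t R' M'
    assume 1: "keep ({2..9} \<union> {27}) R R'" "keep (cols z {0, 2, 15}) M M'"
      "bwd.is_dist {x} (bwd.dcol M')" "R 27 \<le> R' 27" "R' 27 \<le> BIG"
      "\<And>v. v < n \<Longrightarrow> sd v = True \<Longrightarrow> bwd.dcol M' v \<le> R' 27"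
      "R' 27 = R 27 \<or> (\<exists>v<n. sd v = True \<and> R' 27 = bwd.dcol M' v)" "t \<le> ecc_time"
    note d = bwd.is_distD[OF 1(3)]
    have "\<exists>c\<le>R' 27. gwk s x c" if "R' 27 < BIG" "s < n" "sd s" for s
      using 1(6)[of s] d(1)[of s] that by (auto simp: bwd.src_walk_def gwk_reverse)
    then have "reach_in (R' 27) x" by (auto simp: reach_in_def)
    moreover have "attained (R' 27)" if "attained (R 27)"
      using 1(7)
    proof
      assume "\<exists>v<n. sd v = True \<and> R' 27 = bwd.dcol M' v"
      then obtain v where v: "v < n" "sd v" "R' 27 = bwd.dcol M' v" by auto
      then have "\<forall>c. gwk v x c \<longrightarrow> R' 27 \<le> c \<and> R' 27 < BIG"
        using d(2)[OF v(1)] by (auto simp: bwd.src_walk_def gwk_reverse)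
      then show ?thesis unfolding attained_def using R v by blast
    qed (use that in simp)
    ultimately show "Q t R' M'" using 1 by (intro Q) auto
  qed auto
  then show ?thesis by simp
qed

end

definition sample_eccs :: prog where
  "sample_eccs = Asg 11 (Num 0) ;;
     Loop (Var 11 \<lless> Var 23)
       (Asg 10 (Get (Num 2 \<oplus> Num 3 \<otimes> arr 11 (Var 11))) ;; ecc 0 2 3 4 5 ;;
        Asg 11 (Var 11 \<oplus> Num 1))"

definition cand_eccs :: prog where
  "cand_eccs = Asg 11 (Num 0) ;;
     Loop (Var 11 \<lless> Var 15)
       (Asg 10 (arr 9 (Var 11)) ;; ecc 1 2 2 6 7 ;; Asg 11 (Var 11 \<oplus> Num 1))"

text \<open>One search in the reversed graph from all sampled tails together gives every vertex its
  distance to the nearest sample. Updating on ties as well guarantees that register 13 receives a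
  source even if all these distances are 0.\<close>

definition farthest :: prog where
  "farthest = dij 3 2 6 7 ;; Asg 12 (Num 0) ;; Asg 13 (Num 0) ;; Asg 3 (Num 0) ;;
     Loop (Var 3 \<lless> Var 30)
       (Cond (side_of (Var 3))
         (Cond (arr 0 (Var 3) \<lless> Var 12) Skip (Asg 12 (arr 0 (Var 3)) ;; Asg 13 (Var 3)))
         Skip ;;
        Asg 3 (Var 3 \<oplus> Num 1))"

text \<open>At most \<open>q\<close> candidates, the content of register 25, are kept even if there
  are more. Thus the time bound holds for every outcome of the coin flips, and an unlucky sample can
  only harm the quality of the estimate.\<close>

definition select :: prog where
  "select = Asg 14 (Num 0) ;; Asg 15 (Num 0) ;;
     Loop (Var 14 \<lless> Var 22)
       (Asg 16 (arr 8 (Var 14)) ;;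
        Cond ((arr 0 (Get (Num 2 \<oplus> Num 3 \<otimes> Var 16)) \<lless> Var 12) \<otimes> (Var 15 \<lless> Var 25))
          (Put (addr 9 (Var 15)) (Get (Num 3 \<oplus> Num 3 \<otimes> Var 16)) ;; Asg 15 (Var 15 \<oplus> Num 1))
          Skip ;;
        Asg 14 (Var 14 \<oplus> Num 1))"

context bichrom
begin

lemma small_L: "3 * m + n + 5 < L" "X + z < L" "e < m \<Longrightarrow> 3 * e + 2 < L"
  using room z_eq room_X by auto

lemma wp_sample_eccs:
  assumes R: "base q r l R" "R 27 \<le> BIG" and r: "r \<le> X" and M: "inp M"
    and al: "\<And>i. i < r \<Longrightarrow> M (cell z 11 i) = al i" "\<And>i. i < r \<Longrightarrow> al i < m \<and> sd (tl (al i))"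
    and Q: "\<And>t R' M'. keep work_regs R R' \<Longrightarrow> keep (cols z {0, 2, 15}) M M' \<Longrightarrow>
      R' 27 \<le> BIG \<Longrightarrow> (\<And>i. i < r \<Longrightarrow> reach_out (R' 27) (tl (al i))) \<Longrightarrow>
      (attained (R 27) \<Longrightarrow> attained (R' 27)) \<Longrightarrow> t \<le> 2 + (ecc_time + 3) * r \<Longrightarrow> Q t R' M'"
  shows "wp L sample_eccs Q R M"
  unfolding sample_eccs_def wp_Seq[of L "Asg 11 (Num 0)"] wp_Asg
proof (intro conjI)
  show "safe L (Num 0) R M" using room by simp
  let ?I = "\<lambda>R' M'. base q r l R' \<and> keep work_regs R R' \<and> keep (cols z {0, 2, 15}) M M' \<and> R' 11 \<le> r \<and>
    R' 27 \<le> BIG \<and> (attained (R 27) \<longrightarrow> attained (R' 27)) \<and>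
    (\<forall>i<R' 11. reach_out (R' 27) (tl (al i)))"
  let ?body = "Asg 10 (Get (Num 2 \<oplus> Num 3 \<otimes> arr 11 (Var 11))) ;; ecc 0 2 3 4 5 ;;
        Asg 11 (Var 11 \<oplus> Num 1)"
  let ?\<phi> = "\<lambda>R' (M' :: nat \<Rightarrow> nat). (ecc_time + 3) * (r - R' 11)"
  show "wp L (Loop (Var 11 \<lless> Var 23) ?body) (\<lambda>t. Q (1 + t)) (R(11 := ev (Num 0) R M)) M"
  proof (rule wp_Loop[where I = ?I and \<phi> = ?\<phi>])
    show "?I (R(11 := ev (Num 0) R M)) M" using R by (simp add: base_def)
  next
    fix R' M'
    assume I: "?I R' M'" and ne: "ev (Var 11 \<lless> Var 23) R' M' \<noteq> 0"
    let ?i = "R' 11" let ?x = "tl (al ?i)"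
    have i: "?i < r" using I ne by (auto simp: base_def split: if_splits)
    have k: "keep (cols z work_cols) M M'" using I keep_mono cols_mono[of "{0, 2, 15}" work_cols z] by blast
    have inp': "inp M'" using inp_keep[OF k M] .
    have a: "al ?i < m" "sd ?x" "?x < n" using al i tl_less by auto
    have "M' (cell z 11 ?i) = al ?i" using keepD[of "cols z {0, 2, 15}" M M'] I al i by auto
    then have g: "M' (cell z 11 ?i) = al ?i" "M' (2 + 3 * al ?i) = ?x" using inp' a by (auto simp: inp_def)
    have z': "R' 31 = z" using I by (simp add: base_def)
    have t: "(ecc_time + 3) * (r - ?i) = (ecc_time + 3) + (ecc_time + 3) * (r - Suc ?i)"
      using i by (metis Suc_diff_Suc mult_Suc_right)
    have "wp L (ecc 0 2 3 4 5) (\<lambda>t. wp L (Asg 11 (Var 11 \<oplus> Num 1))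
        (\<lambda>t' R'' M''. ?I R'' M'' \<and> Suc (1 + (t + t')) + ?\<phi> R'' M'' \<le> ?\<phi> R' M')) (R'(10 := ?x)) M'"
    proof (rule wp_ecc_out)
      show "base q r l (R'(10 := ?x))" "(R'(10 := ?x)) 27 \<le> BIG" "(R'(10 := ?x)) 10 = ?x"
        using I by (auto simp: base_def)
      show "?x < n" "sd ?x" "inp M'" by fact+
    next
      fix t R1 M1
      assume 1: "keep ({2..9} \<union> {27}) (R'(10 := ?x)) R1" "keep (cols z {0, 2, 15}) M' M1"
        "(R'(10 := ?x)) 27 \<le> R1 27" "R1 27 \<le> BIG" "reach_out (R1 27) ?x"
        "attained ((R'(10 := ?x)) 27) \<Longrightarrow> attained (R1 27)" "t \<le> ecc_time"
      have k1: "keep work_regs R R1"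
        by (rule keep_trans[OF _ 1(1), of work_regs]) (use I in auto)
      have b1: "base q r l R1" using base_keep[OF k1] R by simp
      have R11: "R1 11 = ?i" using keepD[OF 1(1)] by simp
      have kM: "keep (cols z {0, 2, 15}) M M1" using keep_trans[of _ M M', OF _ 1(2)] I by blast
      have "reach_out (R1 27) (tl (al j))" if "j < Suc ?i" for j
        using that I 1(3,5) reach_mono(1)[of "R' 27" "R1 27"] by (auto simp: less_Suc_eq)
      moreover have "R1 11 + 1 < L" using R11 i r small_L(2) by simp
      ultimately show "wp L (Asg 11 (Var 11 \<oplus> Num 1))
        (\<lambda>t' R'' M''. ?I R'' M'' \<and> Suc (1 + (t + t')) + ?\<phi> R'' M'' \<le> ?\<phi> R' M') R1 M1"
        using k1 kM b1 R11 1 I i room t by (simp add: wp_Asg base_def)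
    qed
    then show "wp L ?body (\<lambda>t R'' M''. ?I R'' M'' \<and> Suc t + ?\<phi> R'' M'' \<le> ?\<phi> R' M') R' M'"
      unfolding wp_Seq wp_Asg[of L 10]
      using g z' i r room_X small_L a by simp
  next
    fix t R' M'
    assume I: "?I R' M'" and e: "ev (Var 11 \<lless> Var 23) R' M' = 0"
      and t: "t + ?\<phi> R' M' \<le> Suc (?\<phi> (R(11 := ev (Num 0) R M)) M)"
    then have "R' 11 = r" by (auto simp: base_def split: if_splits)
    then show "Q (1 + t) R' M'" using I t by (intro Q) auto
  qed simp
qed

lemma wp_cand_eccs:
  assumes R: "base q r l R" "R 27 \<le> BIG" and r: "R 15 = c" "c \<le> X" and M: "inp M"
    and al: "\<And>i. i < c \<Longrightarrow> M (cell z 9 i) = bl i" "\<And>i. i < c \<Longrightarrow> bl i < n \<and> \<not> sd (bl i)"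
    and Q: "\<And>t R' M'. keep work_regs R R' \<Longrightarrow> keep (cols z {0, 2, 15}) M M' \<Longrightarrow>
      R 27 \<le> R' 27 \<Longrightarrow> R' 27 \<le> BIG \<Longrightarrow> (\<And>i. i < c \<Longrightarrow> reach_in (R' 27) (bl i)) \<Longrightarrow>
      (attained (R 27) \<Longrightarrow> attained (R' 27)) \<Longrightarrow> t \<le> 2 + (ecc_time + 3) * c \<Longrightarrow> Q t R' M'"
  shows "wp L cand_eccs Q R M"
  unfolding cand_eccs_def wp_Seq[of L "Asg 11 (Num 0)"] wp_Asg
proof (intro conjI)
  show "safe L (Num 0) R M" using room by simp
  let ?I = "\<lambda>R' M'. base q r l R' \<and> R' 15 = c \<and> keep work_regs R R' \<and> keep (cols z {0, 2, 15}) M M' \<and>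
    R' 11 \<le> c \<and> R 27 \<le> R' 27 \<and> R' 27 \<le> BIG \<and> (attained (R 27) \<longrightarrow> attained (R' 27)) \<and>
    (\<forall>i<R' 11. reach_in (R' 27) (bl i))"
  let ?body = "Asg 10 (arr 9 (Var 11)) ;; ecc 1 2 2 6 7 ;; Asg 11 (Var 11 \<oplus> Num 1)"
  let ?\<phi> = "\<lambda>R' (M' :: nat \<Rightarrow> nat). (ecc_time + 3) * (c - R' 11)"
  show "wp L (Loop (Var 11 \<lless> Var 15) ?body) (\<lambda>t. Q (1 + t)) (R(11 := ev (Num 0) R M)) M"
  proof (rule wp_Loop[where I = ?I and \<phi> = ?\<phi>])
    show "?I (R(11 := ev (Num 0) R M)) M" using R r by (simp add: base_def)
  next
    fix R' M'
    assume I: "?I R' M'" and ne: "ev (Var 11 \<lless> Var 15) R' M' \<noteq> 0"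
    let ?i = "R' 11" let ?x = "bl ?i"
    have i: "?i < c" using I ne by (auto split: if_splits)
    have k: "keep (cols z work_cols) M M'" using I keep_mono cols_mono[of "{0, 2, 15}" work_cols z] by blast
    have inp': "inp M'" using inp_keep[OF k M] .
    have a: "\<not> sd ?x" "?x < n" using al i by auto
    have g: "M' (cell z 9 ?i) = bl ?i" using keepD[of "cols z {0, 2, 15}" M M'] I al i by auto
    have z': "R' 31 = z" using I by (simp add: base_def)
    have t: "(ecc_time + 3) * (c - ?i) = (ecc_time + 3) + (ecc_time + 3) * (c - Suc ?i)"
      using i by (metis Suc_diff_Suc mult_Suc_right)
    have "wp L (ecc 1 2 2 6 7) (\<lambda>t. wp L (Asg 11 (Var 11 \<oplus> Num 1))
        (\<lambda>t' R'' M''. ?I R'' M'' \<and> Suc (1 + (t + t')) + ?\<phi> R'' M'' \<le> ?\<phi> R' M')) (R'(10 := ?x)) M'"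
    proof (rule wp_ecc_in)
      show "base q r l (R'(10 := ?x))" "(R'(10 := ?x)) 27 \<le> BIG" "(R'(10 := ?x)) 10 = ?x"
        using I by (auto simp: base_def)
      show "?x < n" "\<not> sd ?x" "inp M'" by fact+
    next
      fix t R1 M1
      assume 1: "keep ({2..9} \<union> {27}) (R'(10 := ?x)) R1" "keep (cols z {0, 2, 15}) M' M1"
        "(R'(10 := ?x)) 27 \<le> R1 27" "R1 27 \<le> BIG" "reach_in (R1 27) ?x"
        "attained ((R'(10 := ?x)) 27) \<Longrightarrow> attained (R1 27)" "t \<le> ecc_time"
      have k1: "keep work_regs R R1"
        by (rule keep_trans[OF _ 1(1), of work_regs]) (use I in auto)
      have b1: "base q r l R1" using base_keep[OF k1] R by simp
      have R11: "R1 11 = ?i" "R1 15 = c" using keepD[OF 1(1)] I by simp_all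
      have kM: "keep (cols z {0, 2, 15}) M M1" using keep_trans[of _ M M', OF _ 1(2)] I by blast
      have "reach_in (R1 27) (bl j)" if "j < Suc ?i" for j
        using that I 1(3,5) reach_mono(2)[of "R' 27" "R1 27"] by (auto simp: less_Suc_eq)
      moreover have "R1 11 + 1 < L" using R11 i r small_L(2) by simp
      ultimately show "wp L (Asg 11 (Var 11 \<oplus> Num 1))
        (\<lambda>t' R'' M''. ?I R'' M'' \<and> Suc (1 + (t + t')) + ?\<phi> R'' M'' \<le> ?\<phi> R' M') R1 M1"
        using k1 kM b1 R11 1 I i room t by (simp add: wp_Asg base_def)
    qed
    then show "wp L ?body (\<lambda>t R'' M''. ?I R'' M'' \<and> Suc t + ?\<phi> R'' M'' \<le> ?\<phi> R' M') R' M'"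
      unfolding wp_Seq wp_Asg[of L 10]
      using g z' i r room_X small_L a by simp
  next
    fix t R' M'
    assume I: "?I R' M'" and e: "ev (Var 11 \<lless> Var 15) R' M' = 0"
      and t: "t + ?\<phi> R' M' \<le> Suc (?\<phi> (R(11 := ev (Num 0) R M)) M)"
    then have "R' 11 = c" by (auto split: if_splits)
    then show "Q (1 + t) R' M'" using I t by (intro Q) auto
  qed simp
qed

end

text \<open>Column 10 contains the coin flips, \<open>l\<close> consecutive ones for each sample.\<close>

primrec bitsval :: "(nat \<Rightarrow> nat) \<Rightarrow> nat \<Rightarrow> nat \<Rightarrow> nat" where
  "bitsval f p 0 = 0"
| "bitsval f p (Suc j) = 2 * bitsval f p j + f (p + j)"

lemma bitsval_less: "(\<And>i. i < j \<Longrightarrow> f (p + i) \<le> 1) \<Longrightarrow> bitsval f p j < 2 ^ j"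
proof (induction j)
  case (Suc j)
  then have "bitsval f p j < 2 ^ j" "f (p + j) \<le> 1" by auto
  then show ?case by simp
qed simp

definition draw_bits :: prog where
  "draw_bits = Loop (Var 14 \<lless> Var 21)
     (Asg 13 (Num 2 \<otimes> Var 13 \<oplus> arr 10 (Var 12)) ;;
      Asg 12 (Var 12 \<oplus> Num 1) ;; Asg 14 (Var 14 \<oplus> Num 1))"

definition draw_samples :: prog where
  "draw_samples = Asg 11 (Num 0) ;; Asg 12 (Num 0) ;;
     Loop (Var 11 \<lless> Var 23)
       (Asg 13 (Num 0) ;; Asg 14 (Num 0) ;; draw_bits ;;
        Asg 15 (arr 8 (Bin Mod (Var 13) (Var 22))) ;;
        Put (addr 11 (Var 11)) (Var 15) ;;
        Put (addr 3 (Get (Num 2 \<oplus> Num 3 \<otimes> Var 15))) (Num 1) ;;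
        Asg 11 (Var 11 \<oplus> Num 1))"

definition main_body :: prog where
  "main_body = draw_samples ;; sample_eccs ;; farthest ;; Asg 10 (Var 13) ;; ecc 0 2 3 4 5 ;;
     select ;; cand_eccs ;; Asg 0 (Var 27) ;; Asg 1 (Var 27 \<lless> Var 28)"

context bichrom
begin

lemma wp_draw_bits:
  assumes R: "R 31 = z" "R 21 = l" "R 12 = p" "R 13 = 0" "R 14 = 0"
    and f: "\<And>i. i < l \<Longrightarrow> M (cell z 10 (p + i)) \<le> 1" and pX: "p + l \<le> X" and l: "2 ^ l < L"
    and Q: "\<And>t R'. keep {12, 13, 14} R R' \<Longrightarrow> R' 12 = p + l \<Longrightarrow>
      R' 13 = bitsval (\<lambda>i. M (cell z 10 i)) p l \<Longrightarrow> t \<le> 1 + 4 * l \<Longrightarrow> Q t R' M"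
  shows "wp L draw_bits Q R M"
  unfolding draw_bits_def
proof (rule wp_Loop[where I = "\<lambda>R' M'. M' = M \<and> R' 31 = z \<and> R' 21 = l \<and> R' 14 \<le> l \<and>
      R' 12 = p + R' 14 \<and> R' 13 = bitsval (\<lambda>i. M (cell z 10 i)) p (R' 14) \<and> keep {12, 13, 14} R R'"
      and \<phi> = "\<lambda>R' M'. 4 * (l - R' 14)"])
  show "M = M \<and> R 31 = z \<and> R 21 = l \<and> R 14 \<le> l \<and>
      R 12 = p + R 14 \<and> R 13 = bitsval (\<lambda>i. M (cell z 10 i)) p (R 14) \<and> keep {12, 13, 14} R R"
    using R by simp
next
  fix R' M'
  assume I: "M' = M \<and> R' 31 = z \<and> R' 21 = l \<and> R' 14 \<le> l \<and>
      R' 12 = p + R' 14 \<and> R' 13 = bitsval (\<lambda>i. M (cell z 10 i)) p (R' 14) \<and> keep {12, 13, 14} R R'"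
    and ne: "ev (Var 14 \<lless> Var 21) R' M' \<noteq> 0"
  let ?f = "\<lambda>i. M (cell z 10 i)"
  have i: "R' 14 < l" using ne I by (auto split: if_splits)
  have "bitsval ?f p (Suc (R' 14)) < 2 ^ Suc (R' 14)" by (rule bitsval_less) (use f i in auto)
  also have "\<dots> \<le> 2 ^ l" using i by (intro power_increasing) auto
  finally have v: "2 * bitsval ?f p (R' 14) + ?f (p + R' 14) < L" using l by simp
  have t: "4 * (l - R' 14) = 4 + 4 * (l - Suc (R' 14))" using i by auto
  have x: "2 * bitsval ?f p (R' 14) < L" using v by simp
  show "wp L (Asg 13 (Num 2 \<otimes> Var 13 \<oplus> arr 10 (Var 12)) ;;
      Asg 12 (Var 12 \<oplus> Num 1) ;; Asg 14 (Var 14 \<oplus> Num 1))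
     (\<lambda>t R'' M''. (M'' = M \<and> R'' 31 = z \<and> R'' 21 = l \<and> R'' 14 \<le> l \<and>
      R'' 12 = p + R'' 14 \<and> R'' 13 = bitsval ?f p (R'' 14) \<and> keep {12, 13, 14} R R'') \<and>
      Suc t + 4 * (l - R'' 14) \<le> 4 * (l - R' 14)) R' M'"
    using I i room_X small_L(2) v x pX unfolding t by (simp add: wp_simps)
next
  fix t R' M'
  assume I: "M' = M \<and> R' 31 = z \<and> R' 21 = l \<and> R' 14 \<le> l \<and>
      R' 12 = p + R' 14 \<and> R' 13 = bitsval (\<lambda>i. M (cell z 10 i)) p (R' 14) \<and> keep {12, 13, 14} R R'"
    and e: "ev (Var 14 \<lless> Var 21) R' M' = 0" and t: "t + 4 * (l - R' 14) \<le> Suc (4 * (l - R 14))"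
  then have "R' 14 = l" by (auto split: if_splits)
  then have "Q t R' M" using I t R by (intro Q) auto
  then show "Q t R' M'" using I by simp
qed simp

text \<open>An \<open>l\<close>-bit number reduced modulo the length of the list is not uniform.
  Once \<open>2 ^ l\<close> is at least this length, however, every position has at least half its
  uniform probability, which costs no more than a factor 2 in an exponent.\<close>

definition sample_at :: "(nat \<Rightarrow> nat) \<Rightarrow> nat \<Rightarrow> nat \<Rightarrow> nat" where
  "sample_at f l i = es ! (bitsval f (i * l) l mod length es)"

lemma wp_draw_samples:
  assumes R: "base q r l R" and es: "es \<noteq> []" and M: "inp M"
    and f: "\<And>i. i < r * l \<Longrightarrow> M (cell z 10 i) \<le> 1" and X: "r * l \<le> X" "r \<le> X" and l: "2 ^ l < L"
    and clear: "\<And>v. v < n \<Longrightarrow> M (cell z 3 v) = 0"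
    and Q: "\<And>t R' M'. keep work_regs R R' \<Longrightarrow> R' 27 = R 27 \<Longrightarrow> keep (cols z {3, 11}) M M' \<Longrightarrow>
      (\<And>i. i < r \<Longrightarrow> M' (cell z 11 i) = sample_at (\<lambda>i. M (cell z 10 i)) l i) \<Longrightarrow>
      {v. v < n \<and> M' (cell z 3 v) \<noteq> 0} = (\<lambda>i. tl (sample_at (\<lambda>i. M (cell z 10 i)) l i)) ` {..<r} \<Longrightarrow>
      t \<le> 3 + (4 * l + 8) * r \<Longrightarrow> Q t R' M'"
  shows "wp L draw_samples Q R M"
  unfolding draw_samples_def wp_Seq[of L "Asg 11 (Num 0)"] wp_Seq[of L "Asg 12 (Num 0)"] wp_Asg
proof (intro conjI)
  show "safe L (Num 0) R M" "safe L (Num 0) (R(11 := ev (Num 0) R M)) M" using room by auto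
  let ?f = "\<lambda>i. M (cell z 10 i)"
  let ?al = "sample_at ?f l"
  have al: "?al i < m" "tl (?al i) < n" for i
  proof -
    have "bitsval ?f (i * l) l mod length es < length es" using es by simp
    then show "?al i < m" unfolding sample_at_def using es_nth by blast
    then show "tl (?al i) < n" by (rule tl_less)
  qed
  let ?I = "\<lambda>R' M'. base q r l R' \<and> keep work_regs R R' \<and> R' 27 = R 27 \<and> keep (cols z {3, 11}) M M' \<and>
    R' 11 \<le> r \<and> R' 12 = R' 11 * l \<and>
    (\<forall>i<R' 11. M' (cell z 11 i) = ?al i) \<and>
    {v. v < n \<and> M' (cell z 3 v) \<noteq> 0} = (\<lambda>i. tl (?al i)) ` {..<R' 11}"
  let ?body = "Asg 13 (Num 0) ;; Asg 14 (Num 0) ;; draw_bits ;;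
        Asg 15 (arr 8 (Bin Mod (Var 13) (Var 22))) ;;
        Put (addr 11 (Var 11)) (Var 15) ;;
        Put (addr 3 (Get (Num 2 \<oplus> Num 3 \<otimes> Var 15))) (Num 1) ;;
        Asg 11 (Var 11 \<oplus> Num 1)"
  let ?\<phi> = "\<lambda>R' (M' :: nat \<Rightarrow> nat). (4 * l + 8) * (r - R' 11)"
  show "wp L (Loop (Var 11 \<lless> Var 23) ?body) (\<lambda>t. Q (1 + (1 + t)))
      (R(11 := ev (Num 0) R M, 12 := ev (Num 0) (R(11 := ev (Num 0) R M)) M)) M"
  proof (rule wp_Loop[where I = ?I and \<phi> = ?\<phi>])
    show "?I (R(11 := ev (Num 0) R M, 12 := ev (Num 0) (R(11 := ev (Num 0) R M)) M)) M"
      using R clear by (auto simp: base_def)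
  next
    fix R' M'
    assume I: "?I R' M'" and ne: "ev (Var 11 \<lless> Var 23) R' M' \<noteq> 0"
    let ?i = "R' 11"
    have i: "?i < r" using I ne by (auto simp: base_def split: if_splits)
    have r: "R' 31 = z" "R' 22 = length es" "R' 21 = l" using I by (auto simp: base_def)
    have kM: "keep (cols z {3, 11}) M M'" using I by blast
    have k: "keep (cols z work_cols) M M'" using kM keep_mono cols_mono[of "{3, 11}" work_cols z] by blast
    have inp': "inp M'" using inp_keep[OF k M] .
    have f': "M' (cell z 10 j) = ?f j" for j using keepD[OF kM] by simp
    have "Suc ?i * l \<le> r * l" using i by (intro mult_right_mono) auto
    then have il: "?i * l + l \<le> r * l" by simp
    have t: "(4 * l + 8) * (r - ?i) = (4 * l + 8) + (4 * l + 8) * (r - Suc ?i)"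
      using i by (metis Suc_diff_Suc mult_Suc_right)
    have b: "wp L draw_bits (\<lambda>t. wp L (Asg 15 (arr 8 (Bin Mod (Var 13) (Var 22))) ;;
        Put (addr 11 (Var 11)) (Var 15) ;;
        Put (addr 3 (Get (Num 2 \<oplus> Num 3 \<otimes> Var 15))) (Num 1) ;;
        Asg 11 (Var 11 \<oplus> Num 1)) (\<lambda>t' R'' M''. ?I R'' M'' \<and>
          Suc (1 + (1 + (t + t'))) + ?\<phi> R'' M'' \<le> ?\<phi> R' M')) (R'(13 := 0, 14 := 0)) M'"
    proof (rule wp_draw_bits[of _ l "?i * l"])
      show "?i * l + l \<le> X" using il X by simp
      show "M' (cell z 10 (?i * l + j)) \<le> 1" if "j < l" for j using f' f il that by simp
      show "2 ^ l < L" by fact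
    next
      fix t R1
      assume 1: "keep {12, 13, 14} (R'(13 := 0, 14 := 0)) R1" "R1 12 = ?i * l + l"
        "R1 13 = bitsval (\<lambda>i. M' (cell z 10 i)) (?i * l) l" "t \<le> 1 + 4 * l"
      have R1: "R1 31 = z" "R1 11 = ?i" "R1 22 = length es" using keepD[OF 1(1)] r by simp_all
      let ?k = "R1 13 mod length es"
      have v: "R1 13 = bitsval ?f (?i * l) l" using 1(3) f' by simp
      have kl: "?k < length es" using es by simp
      have g: "M' (cell z 8 ?k) = ?al ?i" using inp' kl unfolding v by (simp add: inp_def sample_at_def)
      have g2: "M' (2 + 3 * ?al ?i) = tl (?al ?i)" using inp' al(1) by (simp add: inp_def)
      have lz: "2 + 3 * ?al ?i < z" using al(1)[of ?i] z_eq by simp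
      have sL: "?k < m" "tl (?al ?i) < n" "?al ?i < m" "3 * ?al ?i < L" "2 + 3 * ?al ?i < L"
        using kl length_es al small_L(3)[OF al(1)[of ?i]] by auto
      let ?M = "M'(cell z 11 ?i := ?al ?i, cell z 3 (tl (?al ?i)) := 1)"
      have k1: "keep work_regs R (R1(15 := ?al ?i, 11 := Suc ?i))"
      proof -
        have "keep work_regs R R1" by (rule keep_trans[OF _ 1(1), of work_regs]) (use I in auto)
        then show ?thesis by simp
      qed
      have mk: "{v. v < n \<and> ?M (cell z 3 v) \<noteq> 0} = (\<lambda>i. tl (?al i)) ` {..<Suc ?i}"
      proof -
        have "{v. v < n \<and> ?M (cell z 3 v) \<noteq> 0} = insert (tl (?al ?i)) {v. v < n \<and> M' (cell z 3 v) \<noteq> 0}"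
          using sL by auto
        then show ?thesis using I by (simp add: lessThan_Suc)
      qed
      have r27: "R1 27 = R 27" using keepD[OF 1(1)] I by simp
      have b1: "base q r l (R1(15 := ?al ?i, 11 := Suc ?i))" using base_keep[OF k1 R] .
      have "wp L (Asg 15 (arr 8 (Bin Mod (Var 13) (Var 22))) ;;
        Put (addr 11 (Var 11)) (Var 15) ;;
        Put (addr 3 (Get (Num 2 \<oplus> Num 3 \<otimes> Var 15))) (Num 1) ;;
        Asg 11 (Var 11 \<oplus> Num 1)) (\<lambda>t' R'' M''. R'' = R1(15 := ?al ?i, 11 := Suc ?i) \<and> M'' = ?M \<and> t' = 4) R1 M'"
        using R1 g g2 sL room room_X X i lz by (simp add: wp_simps)
      then show "wp L (Asg 15 (arr 8 (Bin Mod (Var 13) (Var 22))) ;;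
        Put (addr 11 (Var 11)) (Var 15) ;;
        Put (addr 3 (Get (Num 2 \<oplus> Num 3 \<otimes> Var 15))) (Num 1) ;;
        Asg 11 (Var 11 \<oplus> Num 1)) (\<lambda>t' R'' M''. ?I R'' M'' \<and>
          Suc (1 + (1 + (t + t'))) + ?\<phi> R'' M'' \<le> ?\<phi> R' M') R1 M'"
      proof (rule wp_mono)
        fix t' :: nat and R'' M''
        assume 2: "R'' = R1(15 := ?al ?i, 11 := Suc ?i) \<and> M'' = ?M \<and> t' = 4"
        have R2: "R'' = R1(15 := ?al ?i, 11 := Suc ?i)" and M2: "M'' = ?M" and t2: "t' = 4"
          using 2 by auto
        have "?I R'' M''"
          unfolding R2 M2 using k1 b1 mk r27 kM i 1(2) I by (auto simp: less_Suc_eq)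
        moreover have "Suc (1 + (1 + (t + t'))) + ?\<phi> R'' M'' \<le> ?\<phi> R' M'"
          unfolding t R2 t2 using 1(4) by simp
        ultimately show "?I R'' M'' \<and> Suc (1 + (1 + (t + t'))) + ?\<phi> R'' M'' \<le> ?\<phi> R' M'" by blast
      qed
    qed (use I r in simp_all)
    then show "wp L ?body (\<lambda>t R'' M''. ?I R'' M'' \<and> Suc t + ?\<phi> R'' M'' \<le> ?\<phi> R' M') R' M'"
      unfolding wp_Seq[of L "Asg 13 (Num 0)"] wp_Seq[of L "Asg 14 (Num 0)"] wp_Seq[of L draw_bits] wp_Asg[of L 13] wp_Asg[of L 14]
      using room by simp
  next
    fix t R' M'
    assume I: "?I R' M'" and e: "ev (Var 11 \<lless> Var 23) R' M' = 0"
      and t: "t + ?\<phi> R' M' \<le> Suc (?\<phi> (R(11 := ev (Num 0) R M, 12 := ev (Num 0) (R(11 := ev (Num 0) R M)) M)) M)"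
    then have "R' 11 = r" by (auto simp: base_def split: if_splits)
    then show "Q (1 + (1 + t)) R' M'" using I t by (intro Q) auto
  qed simp
qed

text \<open>\<open>D\<close> is the distance to the nearest marked vertex, known only as a lower
  bound that is attained when finite; this suffices for the approximation argument and covers
  unreachable samples.\<close>

lemma wp_farthest:
  assumes R: "base q r l R" and M: "inp M" and src: "\<exists>s<n. sd s"
    and Q: "\<And>t R' M' D. keep work_regs R R' \<Longrightarrow> R' 27 = R 27 \<Longrightarrow> keep (cols z {0, 15}) M M' \<Longrightarrow>
      (\<And>v x. v < n \<Longrightarrow> x < n \<Longrightarrow> M (cell z 3 x) \<noteq> 0 \<Longrightarrow> D v \<le> gd v x) \<Longrightarrow>
      (\<And>v. v < n \<Longrightarrow> D v < BIG \<Longrightarrow> \<exists>x<n. M (cell z 3 x) \<noteq> 0 \<and> gwk v x (D v)) \<Longrightarrow>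
      R' 13 < n \<Longrightarrow> sd (R' 13) \<Longrightarrow> R' 12 = D (R' 13) \<Longrightarrow>
      (\<And>v. v < n \<Longrightarrow> sd v \<Longrightarrow> D v \<le> D (R' 13)) \<Longrightarrow>
      t \<le> bwm.dij_time + 4 + 6 * n \<Longrightarrow> Q t R' M'"
  shows "wp L farthest Q R M"
  unfolding farthest_def wp_Seq[of L "dij 3 2 6 7"]
proof (rule bwm.wp_dij)
  show "R 31 = z" "R 30 = n" "R 28 = BIG" "bwm.graph_in M" using R M by (auto simp: base_def inp_def)
next
  fix t1 R1 M1
  let ?A = "{v. v < n \<and> M (cell z 3 v) \<noteq> 0}"
  assume 1: "keep {2..9} R R1" "keep (cols z {0, 15}) M M1" "bwm.is_dist ?A (bwm.dcol M1)" "t1 \<le> bwm.dij_time"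
  define D where "D = bwm.dcol M1"
  have D1: "D v \<le> gd v x" if "v < n" "x \<in> ?A" for v x
  proof (cases "\<exists>c. gwk v x c")
    case True
    then have "gwk v x (gd v x)" by (auto simp: gd_def intro: LeastI)
    then have "bwm.src_walk ?A v (gd v x)"
      unfolding bwm.src_walk_def gwk_reverse using that by blast
    then show ?thesis using bwm.is_distD(2)[OF 1(3)] that by (auto simp: D_def)
  next
    case False
    then show ?thesis using bwm.is_distD(3)[OF 1(3)] that by (auto simp: gd_def D_def)
  qed
  have D2: "\<exists>x\<in>?A. gwk v x (D v)" if "v < n" "D v < BIG" for v
    using bwm.is_distD(1)[OF 1(3) that(1)] that by (auto simp: bwm.src_walk_def gwk_reverse D_def)
  have k1: "keep work_regs R R1" by (rule keep_mono[OF 1(1)]) auto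
  have b1: "base q r l R1" using base_keep[OF k1 R] .
  have inp1: "inp M1"
    using inp_keep[of M M1] keep_mono[OF 1(2)] cols_mono[of "{0, 15}" work_cols z] M by blast
  let ?b = "Cond (side_of (Var 3))
         (Cond (arr 0 (Var 3) \<lless> Var 12) Skip (Asg 12 (arr 0 (Var 3)) ;; Asg 13 (Var 3))) Skip ;;
        Asg 3 (Var 3 \<oplus> Num 1)"
  let ?R = "R1(12 := 0, 13 := 0, 3 := 0)"
  let ?I = "\<lambda>R' M'. M' = M1 \<and> base q r l R' \<and> keep work_regs R R' \<and> R' 27 = R 27 \<and> R' 3 \<le> n \<and>
    (\<forall>v<R' 3. sd v \<longrightarrow> D v \<le> R' 12) \<and>
    (if \<exists>v<R' 3. sd v then R' 13 < n \<and> sd (R' 13) \<and> R' 12 = D (R' 13) else R' 12 = 0)"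
  have "wp L (Loop (Var 3 \<lless> Var 30) ?b) (\<lambda>t. Q (t1 + (1 + (1 + (1 + t))))) ?R M1"
  proof (rule wp_Loop[where I = ?I and \<phi> = "\<lambda>R' M'. 6 * (n - R' 3)"])
    have "R1 27 = R 27" using keepD[OF 1(1)] by simp
    then show "?I ?R M1" using k1 b1 by (simp add: base_def)
  next
    fix R' M'
    assume I: "?I R' M'" and ne: "ev (Var 3 \<lless> Var 30) R' M' \<noteq> 0"
    let ?v = "R' 3"
    have i: "?v < n" using I ne by (auto simp: base_def split: if_splits)
    have r: "R' 31 = z" "R' 29 = m" using I by (auto simp: base_def)
    have s: "M1 (2 + 3 * m + ?v) = of_bool (sd ?v)" using inp1 i by (simp add: inp_def)
    have d: "M1 (cell z 0 ?v) = D ?v" by (simp add: D_def bwm.dcol_def)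
    have t: "6 * (n - ?v) = 6 + 6 * (n - Suc ?v)" using i by auto
    have L3: "3 * m < L" "2 + 3 * m < L" "2 + 3 * m + ?v < L" "Suc ?v < L" using small_L(1) i by auto
    have kp: "keep work_regs R (R'(12 := x, 13 := y, 3 := w))" "keep work_regs R (R'(3 := w))" for x y w
      using I by auto
    have bs: "base q r l (R'(12 := x, 13 := y, 3 := w))" "base q r l (R'(3 := w))" for x y w
      using I by (auto simp: base_def)
    let ?R2 = "if sd ?v \<and> \<not> D ?v < R' 12 then R'(12 := D ?v, 13 := ?v, 3 := Suc ?v) else R'(3 := Suc ?v)"
    have "wp L ?b (\<lambda>t R'' M''. R'' = ?R2 \<and> M'' = M1 \<and> t \<le> 5) R' M'"
      using I i s d r L3 room by (auto simp: wp_simps side_of_def)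
    then show "wp L ?b (\<lambda>t R'' M''. ?I R'' M'' \<and> Suc t + 6 * (n - R'' 3) \<le> 6 * (n - R' 3)) R' M'"
    proof (rule wp_mono)
      fix t' :: nat and R'' M''
      assume 2: "R'' = ?R2 \<and> M'' = M1 \<and> t' \<le> 5"
      show "?I R'' M'' \<and> Suc t' + 6 * (n - R'' 3) \<le> 6 * (n - R' 3)"
      proof (cases "sd ?v \<and> \<not> D ?v < R' 12")
        case True
        then have R2: "R'' = R'(12 := D ?v, 13 := ?v, 3 := Suc ?v)" using 2 by simp
        have "\<forall>v<Suc ?v. sd v \<longrightarrow> D v \<le> D ?v" using I True by (auto simp: less_Suc_eq intro: order_trans)
        moreover have "\<exists>v<Suc ?v. sd v" using True by blast
        ultimately show ?thesis using 2 I i True kp bs t unfolding R2 by simp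
      next
        case False
        then have R2: "R'' = R'(3 := Suc ?v)" using 2 by auto
        have "\<exists>v<?v. sd v" if "sd ?v"
        proof (rule ccontr)
          assume n: "\<not> (\<exists>v<?v. sd v)"
          have "if \<exists>v<?v. sd v then R' 13 < n \<and> sd (R' 13) \<and> R' 12 = D (R' 13) else R' 12 = 0" using I by blast
          then have "R' 12 = 0" using n by simp
          then show False using False that by simp
        qed
        then have e: "(\<exists>v<Suc ?v. sd v) = (\<exists>v<?v. sd v)" by (auto simp: less_Suc_eq)
        have "\<forall>v<Suc ?v. sd v \<longrightarrow> D v \<le> R' 12" using I False by (auto simp: less_Suc_eq)
        then show ?thesis using 2 I i kp bs t unfolding R2 by (simp add: e)
      qed
    qed
  next
    fix t R' M'
    assume I: "?I R' M'" and e: "ev (Var 3 \<lless> Var 30) R' M' = 0"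
      and t: "t + 6 * (n - R' 3) \<le> Suc (6 * (n - ?R 3))"
    then have n: "R' 3 = n" by (auto simp: base_def split: if_splits)
    have w: "R' 13 < n" "sd (R' 13)" "R' 12 = D (R' 13)"
      using I src unfolding n by (auto split: if_splits)
    have "Q (t1 + (1 + (1 + (1 + t)))) R' M1"
      by (rule Q[where D = D]) (use I w D1 D2 1 t n in auto)
    then show "Q (t1 + (1 + (1 + (1 + t)))) R' M'" using I by simp
  next
    fix R' M' assume I: "?I R' M'"
    then show "safe L (Var 3 \<lless> Var 30) R' M'" by simp
  qed
  then show "wp L (Asg 12 (Num 0) ;; Asg 13 (Num 0) ;; Asg 3 (Num 0) ;; Loop (Var 3 \<lless> Var 30) ?b)
      (\<lambda>t'. Q (t1 + t')) R1 M1"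
    unfolding wp_Seq[of L "Asg _ _"] wp_Asg[of L _ "Num 0"] using room by simp
qed

lemma wp_select:
  assumes R: "base q r l R" "R 12 = \<rho>" and M: "inp M" "\<And>v. v < n \<Longrightarrow> M (cell z 0 v) = g v"
    and q: "q \<le> X"
    and Q: "\<And>t R' M' c. keep work_regs R R' \<Longrightarrow> R' 27 = R 27 \<Longrightarrow> keep (cols z {9}) M M' \<Longrightarrow>
      R' 15 = c \<Longrightarrow> c \<le> q \<Longrightarrow>
      (\<And>i. i < c \<Longrightarrow> \<exists>k<length es. M' (cell z 9 i) = hd (es ! k)) \<Longrightarrow>
      (\<And>k. card {k. k < length es \<and> g (tl (es ! k)) < \<rho>} \<le> q \<Longrightarrow> k < length es \<Longrightarrow>
        g (tl (es ! k)) < \<rho> \<Longrightarrow> \<exists>i<c. M' (cell z 9 i) = hd (es ! k)) \<Longrightarrow>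
      t \<le> 3 + 7 * length es \<Longrightarrow> Q t R' M'"
  shows "wp L select Q R M"
proof -
  let ?P = "\<lambda>k. g (tl (es ! k)) < \<rho>"
  let ?b = "Asg 16 (arr 8 (Var 14)) ;;
        Cond ((arr 0 (Get (Num 2 \<oplus> Num 3 \<otimes> Var 16)) \<lless> Var 12) \<otimes> (Var 15 \<lless> Var 25))
          (Put (addr 9 (Var 15)) (Get (Num 3 \<oplus> Num 3 \<otimes> Var 16)) ;; Asg 15 (Var 15 \<oplus> Num 1))
          Skip ;;
        Asg 14 (Var 14 \<oplus> Num 1)"
  let ?I = "\<lambda>R' M'. base q r l R' \<and> R' 12 = \<rho> \<and> keep work_regs R R' \<and> R' 27 = R 27 \<and>
    keep (cols z {9}) M M' \<and> R' 14 \<le> length es \<and>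
    R' 15 = min q (card {k. k < R' 14 \<and> ?P k}) \<and>
    (\<forall>i<R' 15. \<exists>k<length es. M' (cell z 9 i) = hd (es ! k)) \<and>
    (card {k. k < R' 14 \<and> ?P k} \<le> q \<longrightarrow> (\<forall>k<R' 14. ?P k \<longrightarrow> (\<exists>i<R' 15. M' (cell z 9 i) = hd (es ! k))))"
  let ?R = "R(14 := 0, 15 := 0)"
  have "wp L (Loop (Var 14 \<lless> Var 22) ?b) (\<lambda>t. Q (1 + (1 + t))) ?R M"
  proof (rule wp_Loop[where I = ?I and \<phi> = "\<lambda>R' M'. 7 * (length es - R' 14)"])
    show "?I ?R M" using R by (simp add: base_def)
  next
    fix R' M'
    assume I: "?I R' M'" and ne: "ev (Var 14 \<lless> Var 22) R' M' \<noteq> 0"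
    let ?k = "R' 14" let ?e = "es ! ?k" let ?c = "R' 15"
    have i: "?k < length es" using I ne by (auto simp: base_def split: if_splits)
    have kM: "keep (cols z {9}) M M'" using I by blast
    have inp': "inp M'" using inp_keep[of M M'] keep_mono[OF kM] cols_mono[of "{9}" work_cols z] M by blast
    have r: "R' 31 = z" "R' 25 = q" "R' 12 = \<rho>" using I by (auto simp: base_def)
    have e: "?e < m" "tl ?e < n" "hd ?e < n" using es_nth[OF i] tl_less hd_less by auto
    have m: "M' (cell z 8 ?k) = ?e" "M' (2 + 3 * ?e) = tl ?e" "M' (3 + 3 * ?e) = hd ?e"
      using inp' i e by (auto simp: inp_def)
    have g: "M' (cell z 0 (tl ?e)) = g (tl ?e)" using keepD[OF kM] M(2) e by simp
    have t: "7 * (length es - ?k) = 7 + 7 * (length es - Suc ?k)" using i by auto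
    have L3: "3 * ?e < L" "2 + 3 * ?e < L" "3 + 3 * ?e < L" "?k < m" "Suc ?k < L"
      using small_L(1) small_L(3)[OF e(1)] i length_es e(1) by auto
    have c: "?c \<le> q" "?c < L" using I q small_L(2) by auto
    let ?C = "?P ?k \<and> ?c < q"
    let ?R2 = "if ?C then R'(16 := ?e, 15 := Suc ?c, 14 := Suc ?k) else R'(16 := ?e, 14 := Suc ?k)"
    let ?M2 = "if ?C then M'(cell z 9 ?c := hd ?e) else M'"
    have L4: "Suc 0 < L" "16 < L" "?c < q \<Longrightarrow> Suc ?c < L" using room q small_L(2) by auto
    have w: "wp L ?b (\<lambda>t R'' M''. R'' = ?R2 \<and> M'' = ?M2 \<and> t \<le> 6) R' M'"
      using I i e r m g L3 L4 c room room_X q by (auto simp: wp_simps)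
    have sets: "{k. k < Suc ?k \<and> ?P k} = (if ?P ?k then insert ?k {k. k < ?k \<and> ?P k} else {k. k < ?k \<and> ?P k})"
      by (auto simp: less_Suc_eq)
    have card: "card {k. k < Suc ?k \<and> ?P k} = card {k. k < ?k \<and> ?P k} + (if ?P ?k then 1 else 0)"
      unfolding sets by simp
    from w show "wp L ?b (\<lambda>t R'' M''. ?I R'' M'' \<and> Suc t + 7 * (length es - R'' 14) \<le> 7 * (length es - R' 14)) R' M'"
    proof (rule wp_mono)
      fix t' :: nat and R'' M''
      assume 2: "R'' = ?R2 \<and> M'' = ?M2 \<and> t' \<le> 6"
      show "?I R'' M'' \<and> Suc t' + 7 * (length es - R'' 14) \<le> 7 * (length es - R' 14)"
      proof (cases ?C)
        case True
        then have R2: "R'' = R'(16 := ?e, 15 := Suc ?c, 14 := Suc ?k)" and M2: "M'' = M'(cell z 9 ?c := hd ?e)"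
          using 2 by auto
        have c': "Suc ?c = min q (card {k. k < Suc ?k \<and> ?P k})" using I True unfolding card by auto
        have ex: "\<forall>i<Suc ?c. \<exists>k<length es. M'' (cell z 9 i) = hd (es ! k)"
          using I i unfolding M2 by (auto simp: less_Suc_eq)
        have all: "\<exists>i<Suc ?c. M'' (cell z 9 i) = hd (es ! k)"
          if "card {k. k < Suc ?k \<and> ?P k} \<le> q" "k < Suc ?k" "?P k" for k
        proof (cases "k = ?k")
          case False
          then have "\<exists>i<?c. M' (cell z 9 i) = hd (es ! k)" using I that card by (auto split: if_splits)
          then obtain i where "i < ?c" "M' (cell z 9 i) = hd (es ! k)" by blast
          then show ?thesis unfolding M2 by (intro exI[of _ i]) simp
        qed (auto simp: M2)
        have b: "base q r l R''" "keep work_regs R R''" "R'' 12 = \<rho>" "R'' 27 = R 27" "keep (cols z {9}) M M''"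
          using I unfolding R2 M2 by (auto simp: base_def)
        have u: "R'' 14 = Suc ?k" "R'' 15 = Suc ?c" unfolding R2 by simp_all
        have "Suc ?k \<le> length es" using i by simp
        moreover have "Suc t' + 7 * (length es - Suc ?k) \<le> 7 * (length es - R' 14)"
          using 2 t by simp
        ultimately show ?thesis
          unfolding u using b c' ex all by blast
      next
        case False
        then have R2: "R'' = R'(16 := ?e, 14 := Suc ?k)" and M2: "M'' = M'" using 2 by auto
        have c': "?c = min q (card {k. k < Suc ?k \<and> ?P k})" using I False unfolding card by auto
        have all: "\<exists>i<?c. M' (cell z 9 i) = hd (es ! k)"
          if a: "card {k. k < Suc ?k \<and> ?P k} \<le> q" "k < Suc ?k" "?P k" for k
        proof -
          \<comment> \<open>Had the current edge qualified and been dropped, the list would already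
            hold \<open>q\<close> entries, and the count including this edge would exceed
            \<open>q\<close>.\<close>
          have "k < ?k"
          proof (rule ccontr)
            assume "\<not> k < ?k"
            then have "k = ?k" using a by simp
            then have "\<not> ?c < q" "card {k. k < ?k \<and> ?P k} < q" using False a card by auto
            then show False using I by auto
          qed
          then show ?thesis using I a card by auto
        qed
        have b: "base q r l R''" "keep work_regs R R''" "R'' 12 = \<rho>" "R'' 27 = R 27"
          using I unfolding R2 by (auto simp: base_def)
        have u: "R'' 14 = Suc ?k" "R'' 15 = ?c" unfolding R2 by simp_all
        have "Suc ?k \<le> length es" using i by simp
        moreover have "Suc t' + 7 * (length es - Suc ?k) \<le> 7 * (length es - R' 14)"
          using 2 t by simp
        moreover have "keep (cols z {9}) M M'" "\<forall>i<?c. \<exists>k<length es. M' (cell z 9 i) = hd (es ! k)"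
          using I by blast+
        ultimately show ?thesis
          unfolding u M2 using b c' all by blast
      qed
    qed
  next
    fix t R' M'
    assume I: "?I R' M'" and e: "ev (Var 14 \<lless> Var 22) R' M' = 0"
      and t: "t + 7 * (length es - R' 14) \<le> Suc (7 * (length es - ?R 14))"
    then have n: "R' 14 = length es" by (auto simp: base_def split: if_splits)
    show "Q (1 + (1 + t)) R' M'"
      by (rule Q[where c = "R' 15"]) (use I t in \<open>auto simp: n\<close>)
  qed simp
  then show ?thesis
    unfolding select_def wp_Seq[of L "Asg _ _"] wp_Asg[of L _ "Num 0"] using room by simp
qed

end

section \<open>Preprocessing: infinity, sample size, adjacency lists\<close>

definition sum_weights :: prog where
  "sum_weights = Asg 2 (Num 0) ;;
     Loop (Var 2 \<lless> Var 29)
       (Asg 28 (Var 28 \<oplus> Get (Num 4 \<oplus> Num 3 \<otimes> Var 2)) ;; Asg 2 (Var 2 \<oplus> Num 1)) ;;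
     Asg 28 (Var 30 \<otimes> Var 28 \<oplus> Num 1)"

definition sample_size :: prog where
  "sample_size = Loop (Var 25 \<otimes> Var 25 \<lless> Var 29) (Asg 25 (Var 25 \<oplus> Num 1)) ;;
     Asg 2 (Var 29) ;;
     Loop (Var 2) (Asg 2 (Bin Div (Var 2) (Num 2)) ;; Asg 24 (Var 24 \<oplus> Num 1)) ;;
     Asg 23 (Var 25 \<otimes> Var 24 \<otimes> Var 24)"

definition build_lists :: prog where
  "build_lists = Asg 2 (Num 0) ;;
     Loop (Var 2 \<lless> Var 29)
       (Asg 3 (Get (Num 2 \<oplus> Num 3 \<otimes> Var 2)) ;; Asg 4 (Get (Num 3 \<oplus> Num 3 \<otimes> Var 2)) ;;
        Put (addr 5 (Var 2)) (arr 4 (Var 3)) ;; Put (addr 4 (Var 3)) (Var 2 \<oplus> Num 1) ;;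
        Put (addr 7 (Var 2)) (arr 6 (Var 4)) ;; Put (addr 6 (Var 4)) (Var 2 \<oplus> Num 1) ;;
        Cond (side_of (Var 3))
          (Cond (side_of (Var 4)) Skip
            (Put (addr 8 (Var 22)) (Var 2) ;; Asg 22 (Var 22 \<oplus> Num 1))) Skip ;;
        Asg 2 (Var 2 \<oplus> Num 1))"

text \<open>Registers 1, 3, 4 and 5 are the interface to the coin-flip loop: number of flips,
  address of the first one in column 10, the distance 16 of neighbours in a column, and the
  decrement 1. Register 26 enables the main phase.\<close>

definition plan_bits :: prog where
  "plan_bits = Asg 2 (Num 1) ;;
     Loop (Var 2 \<lless> Var 22) (Asg 2 (Num 2 \<otimes> Var 2) ;; Asg 21 (Var 21 \<oplus> Num 1)) ;;
     Asg 26 (Num 1) ;; Asg 1 (Var 23 \<otimes> Var 21) ;; Asg 3 (addr 10 (Num 0)) ;;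
     Asg 4 (Num 16) ;; Asg 5 (Num 1)"

definition setup_body :: prog where
  "setup_body = Asg 31 (Num 2 \<oplus> Num 3 \<otimes> Var 29 \<oplus> Var 30) ;; sum_weights ;; sample_size ;;
     build_lists ;; Cond (Var 22) plan_bits Skip"

text \<open>For \<open>n > 2 * m\<close> all work is skipped: register 1 stays 0, no coin is
  flipped, and denominator 0 means infinity. The same output results if there is no edge from
  \<open>S\<close> to \<open>T\<close>.\<close>

definition setup_prog :: prog where
  "setup_prog = Asg 30 (Get (Num 0)) ;; Asg 29 (Get (Num 1)) ;;
     Cond (Num 2 \<otimes> Var 29 \<lless> Var 30) Skip setup_body"

text \<open>The square root rounded up: the number of samples before logarithmic factors and also
  the maximal number of candidates, balanced so that their product covers all \<open>m\<close>
  edges.\<close>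

definition csqrt_nat :: "nat \<Rightarrow> nat" where
  "csqrt_nat m = (LEAST q. m \<le> q * q)"

definition clog :: "nat \<Rightarrow> nat" where
  "clog k = (LEAST l. k \<le> 2 ^ l)"

text \<open>One logarithmic factor would give a failure probability of some fixed polynomial order;
  its square pushes it below every polynomial, so that the program does not depend on the exponent
  \<open>c\<close>.\<close>

definition samples :: "nat \<Rightarrow> nat" where
  "samples m = csqrt_nat m * bitlen m * bitlen m"

lemma csqrt_nat: "m \<le> csqrt_nat m * csqrt_nat m" "p < csqrt_nat m \<Longrightarrow> p * p < m"
proof -
  have "m \<le> m * m" by (cases m) auto
  then show "m \<le> csqrt_nat m * csqrt_nat m" unfolding csqrt_nat_def by (rule LeastI)
  show "p < csqrt_nat m \<Longrightarrow> p * p < m" unfolding csqrt_nat_def using not_less_Least by force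
qed

lemma clog: "k \<le> 2 ^ clog k" "j < clog k \<Longrightarrow> 2 ^ j < k"
proof -
  have "k \<le> 2 ^ k" by (rule less_imp_le[OF less_exp])
  then show "k \<le> 2 ^ clog k" unfolding clog_def by (rule LeastI)
  show "j < clog k \<Longrightarrow> 2 ^ j < k" unfolding clog_def using not_less_Least by force
qed

lemma csqrt_nat_le: "csqrt_nat m \<le> m"
  unfolding csqrt_nat_def by (rule Least_le) (cases m; simp)

lemma clog_le: "clog k \<le> k"
  unfolding clog_def by (rule Least_le) (rule less_imp_le[OF less_exp])

lemma two_pow_clog: "2 ^ clog k \<le> 2 * k" if "0 < k"
proof (cases "clog k")
  case (Suc j)
  then show ?thesis using clog(2)[of j k] by simp
qed (use that in simp)

lemma bitlen_le: "bitlen n \<le> n"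
  by (simp add: bitlen_le_iff less_exp)

context bichrom
begin

text \<open>\<open>\<rho>\<close> ranges over the lower bounds for the distances from \<open>s\<close> to the samples \<open>al i\<close>, which avoids a
  minimum over a possibly empty set.\<close>

definition hit :: "nat \<Rightarrow> nat \<Rightarrow> (nat \<Rightarrow> nat) \<Rightarrow> bool" where
  "hit q r al \<longleftrightarrow> (\<forall>s<n. sd s \<longrightarrow> (\<forall>\<rho>. (\<forall>i<r. \<rho> \<le> gd s (tl (al i))) \<longrightarrow>
     card {k. k < length es \<and> gd s (tl (es ! k)) < \<rho>} \<le> q))"

definition good :: "nat \<Rightarrow> bool" where
  "good y \<longleftrightarrow> (\<forall>s t. y < BIG \<longrightarrow> s < n \<longrightarrow> sd s \<longrightarrow> t < n \<longrightarrow> \<not> sd t \<longrightarrow> (\<exists>c\<le>2 * y. gwk s t c))"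

abbreviation main_time :: "nat \<Rightarrow> nat \<Rightarrow> nat \<Rightarrow> nat" where
  "main_time q r l \<equiv> 20 + (4 * l + 8) * r + (ecc_time + 3) * r + 2 * ecc_time + 6 * n + 7 * m +
     (ecc_time + 3) * q"

lemma time_sum:
  fixes t1 :: nat
  assumes "t1 \<le> 3 + A" "t2 \<le> 2 + B" "t3 \<le> E + 4 + 6 * n" "t4 \<le> E" "t5 \<le> 3 + 7 * K" "t6 \<le> 2 + C" "C \<le> C'" "K \<le> m"
  shows "t1 + (t2 + (t3 + (1 + (t4 + (t5 + (t6 + 2)))))) \<le> 20 + A + B + 2 * E + 6 * n + 7 * m + C'"
  using assms by linarith

text \<open>For fixed coin flips everything is deterministic. That the estimate is not too large
  (\<open>attained\<close>) and the time bound hold for all flips; only the factor 2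
  (\<open>good\<close>) depends on the sample.\<close>

lemma wp_main_body:
  assumes R: "base q r l R" "R 27 = 0" and M: "inp M" and es: "es \<noteq> []" and src: "\<exists>s<n. sd s"
    and f: "\<And>i. i < r * l \<Longrightarrow> M (cell z 10 i) \<le> 1" and X: "r * l \<le> X" "r \<le> X" "q \<le> X"
    and l: "2 ^ l < L" and clear: "\<And>v. v < n \<Longrightarrow> M (cell z 3 v) = 0"
    and Q: "\<And>t R' M' y. R' 0 = y \<Longrightarrow> R' 1 = of_bool (y < BIG) \<Longrightarrow> y \<le> BIG \<Longrightarrow> attained y \<Longrightarrow>
      (hit q r (sample_at (\<lambda>i. M (cell z 10 i)) l) \<Longrightarrow> good y) \<Longrightarrow>
      t \<le> main_time q r l \<Longrightarrow> Q t R' M'"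
  shows "wp L main_body Q R M"
  unfolding main_body_def wp_Seq[of L draw_samples]
proof (rule wp_draw_samples[OF R(1) es M f X(1,2) l clear])
  define al where "al = sample_at (\<lambda>i. M (cell z 10 i)) l"
  have al: "al i < m" "sd (tl (al i))" for i
  proof -
    have "bitsval (\<lambda>i. M (cell z 10 i)) (i * l) l mod length es < length es" using es by simp
    then show "al i < m" "sd (tl (al i))" unfolding al_def sample_at_def using es_nth by blast+
  qed
  fix t1 R1 M1
  assume 1: "keep work_regs R R1" "R1 27 = R 27" "keep (cols z {3, 11}) M M1"
    "\<And>i. i < r \<Longrightarrow> M1 (cell z 11 i) = sample_at (\<lambda>i. M (cell z 10 i)) l i"
    "{v. v < n \<and> M1 (cell z 3 v) \<noteq> 0} = (\<lambda>i. tl (sample_at (\<lambda>i. M (cell z 10 i)) l i)) ` {..<r}"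
    "t1 \<le> 3 + (4 * l + 8) * r"
  have sub: "cols z C \<subseteq> cols z work_cols" if "C \<subseteq> work_cols" for C using that by (rule cols_mono)
  have inp1: "inp M1" using inp_keep[OF keep_mono[OF 1(3) sub] M] by simp
  have b1: "base q r l R1" using base_keep[OF 1(1) R(1)] .
  show "wp L (sample_eccs ;; farthest ;; Asg 10 (Var 13) ;; ecc 0 2 3 4 5 ;;
     select ;; cand_eccs ;; Asg 0 (Var 27) ;; Asg 1 (Var 27 \<lless> Var 28)) (\<lambda>t. Q (t1 + t)) R1 M1"
    unfolding wp_Seq[of L sample_eccs]
  proof (rule wp_sample_eccs[OF b1 _ X(2) inp1])
    show "R1 27 \<le> BIG" using 1 R by simp
    show "M1 (cell z 11 i) = al i" "al i < m \<and> sd (tl (al i))" if "i < r" for i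
      using 1(4)[OF that] al by (auto simp: al_def)
  next
    fix t2 R2 M2
    assume 2: "keep work_regs R1 R2" "keep (cols z {0, 2, 15}) M1 M2" "R2 27 \<le> BIG"
      "\<And>i. i < r \<Longrightarrow> reach_out (R2 27) (tl (al i))" "attained (R1 27) \<Longrightarrow> attained (R2 27)"
      "t2 \<le> 2 + (ecc_time + 3) * r"
    have inp2: "inp M2" using inp_keep[OF keep_mono[OF 2(2) sub] inp1] by simp
    have b2: "base q r l R2" using base_keep[OF 2(1) b1] .
    have at2: "attained (R2 27)" using 2(5) 1(2) R by (simp add: attained_def)
    have marks: "{v. v < n \<and> M2 (cell z 3 v) \<noteq> 0} = (\<lambda>i. tl (al i)) ` {..<r}"
      using 1(5) keepD[OF 2(2)] by (simp add: al_def)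
    show "wp L (farthest ;; Asg 10 (Var 13) ;; ecc 0 2 3 4 5 ;;
       select ;; cand_eccs ;; Asg 0 (Var 27) ;; Asg 1 (Var 27 \<lless> Var 28)) (\<lambda>t. Q (t1 + (t2 + t))) R2 M2"
      unfolding wp_Seq[of L farthest]
    proof (rule wp_farthest[OF b2 inp2 src])
      fix t3 R3 M3 D
      assume 3: "keep work_regs R2 R3" "R3 27 = R2 27" "keep (cols z {0, 15}) M2 M3"
        "\<And>v x. v < n \<Longrightarrow> x < n \<Longrightarrow> M2 (cell z 3 x) \<noteq> 0 \<Longrightarrow> D v \<le> gd v x"
        "\<And>v. v < n \<Longrightarrow> D v < BIG \<Longrightarrow> \<exists>x<n. M2 (cell z 3 x) \<noteq> 0 \<and> gwk v x (D v)"
        "R3 13 < n" "sd (R3 13)" "R3 12 = D (R3 13)" "\<And>v. v < n \<Longrightarrow> sd v \<Longrightarrow> D v \<le> D (R3 13)"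
        "t3 \<le> bwm.dij_time + 4 + 6 * n"
      define s0 where "s0 = R3 13"
      have s0: "s0 < n" "sd s0" using 3 by (auto simp: s0_def)
      have D1: "D v \<le> gd v (tl (al i))" if "v < n" "i < r" for v i
      proof -
        have "tl (al i) \<in> {v. v < n \<and> M2 (cell z 3 v) \<noteq> 0}" unfolding marks using that by blast
        then show ?thesis using 3(4) that by auto
      qed
      have D2: "\<exists>x\<in>(\<lambda>i. tl (al i)) ` {..<r}. gwk v x (D v)" if "v < n" "D v < BIG" for v
        using 3(5)[OF that] unfolding marks[symmetric] by auto
      have inp3: "inp M3" using inp_keep[OF keep_mono[OF 3(3) sub] inp2] by simp
      have b3: "base q r l R3" using base_keep[OF 3(1) b2] .
      let ?R4 = "R3(10 := s0)"
      have "wp L (ecc 0 2 3 4 5 ;; select ;; cand_eccs ;; Asg 0 (Var 27) ;; Asg 1 (Var 27 \<lless> Var 28))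
        (\<lambda>t. Q (t1 + (t2 + (t3 + (1 + t))))) ?R4 M3"
        unfolding wp_Seq[of L "ecc _ _ _ _ _"]
      proof (rule wp_ecc_out)
        show "base q r l ?R4" using b3 by (simp add: base_def)
        show "?R4 27 \<le> BIG" "?R4 10 = s0" "s0 < n" "sd s0" "inp M3"
          using 3 2 s0 inp3 by auto
      next
        fix t4 R4 M4
        assume 4: "keep ({2..9} \<union> {27}) ?R4 R4" "keep (cols z {0, 2, 15}) M3 M4"
          "\<And>v. v < n \<Longrightarrow> M4 (cell z 0 v) = gd s0 v" "?R4 27 \<le> R4 27" "R4 27 \<le> BIG"
          "reach_out (R4 27) s0" "attained (?R4 27) \<Longrightarrow> attained (R4 27)" "t4 \<le> ecc_time"
        have k4: "keep work_regs R3 R4" by (rule keep_trans[OF _ 4(1), of work_regs]) auto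
        have b4: "base q r l R4" using base_keep[OF k4 b3] .
        have inp4: "inp M4" using inp_keep[OF keep_mono[OF 4(2) sub] inp3] by simp
        have R412: "R4 12 = D s0" using keepD[OF 4(1)] 3 by (simp add: s0_def)
        show "wp L (select ;; cand_eccs ;; Asg 0 (Var 27) ;; Asg 1 (Var 27 \<lless> Var 28))
          (\<lambda>t. Q (t1 + (t2 + (t3 + (1 + (t4 + t)))))) R4 M4"
          unfolding wp_Seq[of L select]
        proof (rule wp_select[OF b4 R412 inp4 4(3) X(3)])
          fix t5 R5 M5 c
          assume 5: "keep work_regs R4 R5" "R5 27 = R4 27" "keep (cols z {9}) M4 M5" "R5 15 = c" "c \<le> q"
            "\<And>i. i < c \<Longrightarrow> \<exists>k<length es. M5 (cell z 9 i) = hd (es ! k)"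
            "\<And>k. card {k. k < length es \<and> gd s0 (tl (es ! k)) < D s0} \<le> q \<Longrightarrow> k < length es \<Longrightarrow>
              gd s0 (tl (es ! k)) < D s0 \<Longrightarrow> \<exists>i<c. M5 (cell z 9 i) = hd (es ! k)"
            "t5 \<le> 3 + 7 * length es"
          have inp5: "inp M5" using inp_keep[OF keep_mono[OF 5(3) sub] inp4] by simp
          have b5: "base q r l R5" using base_keep[OF 5(1) b4] .
          show "wp L (cand_eccs ;; Asg 0 (Var 27) ;; Asg 1 (Var 27 \<lless> Var 28))
            (\<lambda>t. Q (t1 + (t2 + (t3 + (1 + (t4 + (t5 + t))))))) R5 M5"
            unfolding wp_Seq[of L cand_eccs]
          proof (rule wp_cand_eccs[OF b5 _ 5(4) _ inp5])
            show "R5 27 \<le> BIG" "c \<le> X" using 5 4 X by auto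
            show "M5 (cell z 9 i) = M5 (cell z 9 i)" for i ..
            show "M5 (cell z 9 i) < n \<and> \<not> sd (M5 (cell z 9 i))" if "i < c" for i
              using 5(6)[OF that] es_nth hd_less by auto
          next
            fix t6 R6 M6
            assume 6: "keep work_regs R5 R6" "R5 27 \<le> R6 27" "R6 27 \<le> BIG"
              "\<And>i. i < c \<Longrightarrow> reach_in (R6 27) (M5 (cell z 9 i))" "attained (R5 27) \<Longrightarrow> attained (R6 27)"
              "t6 \<le> 2 + (ecc_time + 3) * c"
            define y where "y = R6 27"
            have b6: "base q r l R6" using base_keep[OF 6(1) b5] .
            have at: "attained y" using 6(5) 5(2) 4(7) 3(2) at2 by (simp add: y_def)
            have le: "R2 27 \<le> y" "R4 27 \<le> y" using 6(2) 5(2) 4(4) 3(2) by (simp_all add: y_def)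
            have gd: "good y" if h: "hit q r (sample_at (\<lambda>i. M (cell z 10 i)) l)"
              unfolding good_def
            proof (intro allI impI)
              fix s t assume st: "y < BIG" "s < n" "sd s" "t < n" "\<not> sd t"
              \<comment> \<open>\<open>hit\<close> is used for the source \<open>s0\<close> with
                threshold \<open>D s0\<close>, which by \<open>D1\<close> is a lower bound for the
                distances from \<open>s0\<close> to all samples.\<close>
              have crd: "card {k. k < length es \<and> gd s0 (tl (es ! k)) < D s0} \<le> q"
                using h s0 D1 unfolding hit_def al_def[symmetric] by blast
              show "\<exists>c\<le>2 * y. gwk s t c"
              proof (rule two_approximation[where A = "(\<lambda>i. tl (al i)) ` {..<r}" and D = D])
                show "reach_out y x" if "x \<in> (\<lambda>i. tl (al i)) ` {..<r}" for x
                  using that 2(4) reach_mono(1)[OF le(1)] by auto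
                show "D v \<le> gd v x" if "v < n" "x \<in> (\<lambda>i. tl (al i)) ` {..<r}" for v x
                  using that D1 by auto
                show "\<exists>x\<in>(\<lambda>i. tl (al i)) ` {..<r}. gwk v x (D v)" if "v < n" "D v < BIG" for v
                  using D2 that .
                show "D v \<le> D s0" if "v < n" "sd v" for v using 3(9) that by (simp add: s0_def)
                show "reach_out y s0" using 4(6) reach_mono(1)[OF le(2)] by simp
                show "reach_in y (hd (es ! k))"
                  if "k < length es" "gd s0 (tl (es ! k)) < D s0" for k
                  using 5(7)[OF crd that] 6(4) unfolding y_def by metis
              qed fact+
            qed
            have "t1 + (t2 + (t3 + (1 + (t4 + (t5 + (t6 + 2)))))) \<le> main_time q r l"
            proof -
              have "(ecc_time + 3) * c \<le> (ecc_time + 3) * q" using 5(5) by (rule mult_left_mono) simp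
              moreover have "t3 \<le> ecc_time + 4 + 6 * n" using 3(10) by simp
              ultimately show ?thesis
                using time_sum[OF 1(6) 2(6) _ 4(8) 5(8) 6(6) _ length_es] by blast
            qed
            then have "Q (t1 + (t2 + (t3 + (1 + (t4 + (t5 + (t6 + 2))))))) (R6(0 := y, 1 := of_bool (y < BIG))) M6" for M6
              using at gd 6(3) by (intro Q) (auto simp: y_def)
            then show "wp L (Asg 0 (Var 27) ;; Asg 1 (Var 27 \<lless> Var 28))
              (\<lambda>t. Q (t1 + (t2 + (t3 + (1 + (t4 + (t5 + (t6 + t)))))))) R6 M6"
              using b6 by (simp add: wp_simps base_def y_def)
          qed
        qed
      qed
      then show "wp L (Asg 10 (Var 13) ;; ecc 0 2 3 4 5 ;; select ;; cand_eccs ;; Asg 0 (Var 27) ;;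
          Asg 1 (Var 27 \<lless> Var 28)) (\<lambda>t. Q (t1 + (t2 + (t3 + t)))) R3 M3"
        unfolding wp_Seq[of L "Asg 10 _"] wp_Asg[of L 10] by (simp add: s0_def)
    qed
  qed
qed

definition raw :: "(nat \<Rightarrow> nat) \<Rightarrow> bool" where
  "raw M \<longleftrightarrow> M 0 = n \<and> M 1 = m \<and>
     (\<forall>e<m. M (2 + 3 * e) = tl e \<and> M (3 + 3 * e) = hd e \<and> M (4 + 3 * e) = wt e) \<and>
     (\<forall>v<n. M (2 + 3 * m + v) = of_bool (sd v)) \<and> (\<forall>x\<ge>z. M x = 0)"

lemma raw_cell: "raw M \<Longrightarrow> M (cell z c i) = 0"
  by (simp add: raw_def cell_def)

text \<open>The sum of all weights serves as the bound \<open>W\<close> on single weights. It is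
  generous, but \<open>BIG\<close> remains polynomial in the magnitude of the instance.\<close>

lemma wp_sum_weights:
  assumes R: "R 30 = n" "R 29 = m" "R 28 = 0" and M: "raw M" and W: "W = (\<Sum>e<m. wt e)"
    and Q: "\<And>t R'. keep {2, 28} R R' \<Longrightarrow> R' 28 = BIG \<Longrightarrow> t \<le> 3 + 3 * m \<Longrightarrow> Q t R' M"
  shows "wp L sum_weights Q R M"
proof -
  let ?I = "\<lambda>R' M'. M' = M \<and> keep {2, 28} R R' \<and> R' 30 = n \<and> R' 29 = m \<and> R' 2 \<le> m \<and> R' 28 = (\<Sum>e<R' 2. wt e)"
  let ?b = "Asg 28 (Var 28 \<oplus> Get (Num 4 \<oplus> Num 3 \<otimes> Var 2)) ;; Asg 2 (Var 2 \<oplus> Num 1)"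
  have "wp L (Loop (Var 2 \<lless> Var 29) ?b) (\<lambda>t. wp L (Asg 28 (Var 30 \<otimes> Var 28 \<oplus> Num 1)) (\<lambda>t'. Q (1 + (t + t')))) (R(2 := 0)) M"
  proof (rule wp_Loop[where I = ?I and \<phi> = "\<lambda>R' M'. 3 * (m - R' 2)"])
    show "?I (R(2 := 0)) M" using R by simp
  next
    fix R' M'
    assume I: "?I R' M'" and ne: "ev (Var 2 \<lless> Var 29) R' M' \<noteq> 0"
    let ?e = "R' 2"
    have e: "?e < m" using I ne by (auto split: if_splits)
    have t: "3 * (m - ?e) = 3 + 3 * (m - Suc ?e)" using e by auto
    have w: "M (4 + 3 * ?e) = wt ?e" using M e by (simp add: raw_def)
    have "(\<Sum>e<Suc ?e. wt e) \<le> W" unfolding W using e by (intro sum_mono2) auto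
    then have s: "R' 28 + wt ?e < L" using I room_BIG' by simp
    have l: "3 * ?e < L" "4 + 3 * ?e < L" "Suc ?e < L" using small_L(1) e by auto
    show "wp L ?b (\<lambda>t R'' M''. ?I R'' M'' \<and> Suc t + 3 * (m - R'' 2) \<le> 3 * (m - R' 2)) R' M'"
      using I e w s l room unfolding t by (simp add: wp_simps)
  next
    fix t R' M'
    assume I: "?I R' M'" and ex: "ev (Var 2 \<lless> Var 29) R' M' = 0"
      and t: "t + 3 * (m - R' 2) \<le> Suc (3 * (m - (R(2 := 0)) 2))"
    then have "R' 2 = m" by (auto split: if_splits)
    then have r: "R' 28 = W" "R' 30 = n" using I W by auto
    have B: "n * W < L" "Suc (n * W) < L" "Suc 0 < L" using room_BIG' BIG_eq' room by auto
    have "Q (1 + (t + 1)) (R'(28 := BIG)) M"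
      using I t by (intro Q) auto
    then show "wp L (Asg 28 (Var 30 \<otimes> Var 28 \<oplus> Num 1)) (\<lambda>t'. Q (1 + (t + t'))) R' M'"
      using I r B BIG_eq' by (simp add: wp_Asg)
  qed simp
  then show ?thesis
    unfolding sum_weights_def wp_Seq wp_Asg[of L 2] using room by (simp add: add.assoc)
qed

lemma wp_sample_size:
  assumes R: "R 29 = m" "R 25 = 0" "R 24 = 0"
    and X: "samples m \<le> X" "m * m \<le> X"
    and Q: "\<And>t R'. keep {2, 23, 24, 25} R R' \<Longrightarrow> R' 25 = csqrt_nat m \<Longrightarrow> R' 23 = samples m \<Longrightarrow>
      t \<le> 4 + 2 * m + 3 * bitlen m \<Longrightarrow> Q t R' M"
  shows "wp L sample_size Q R M"
proof -
  let ?q = "csqrt_nat m" and ?l = "bitlen m"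
  have qm: "?q \<le> m" by (rule csqrt_nat_le)
  have lm: "?l \<le> m" by (rule bitlen_le)
  have XL: "X < L" using small_L(2) by simp
  let ?I2 = "\<lambda>R' M'. M' = M \<and> keep {2, 24, 25} R R' \<and> R' 25 = ?q \<and> R' 24 + bitlen (R' 2) = ?l"
  have second: "wp L (Loop (Var 2) (Asg 2 (Bin Div (Var 2) (Num 2)) ;; Asg 24 (Var 24 \<oplus> Num 1)))
     (\<lambda>t. wp L (Asg 23 (Var 25 \<otimes> Var 24 \<otimes> Var 24)) (\<lambda>t'. Q (t1 + (1 + (t + t'))))) (R1(2 := m)) M"
    if R1: "keep {25} R R1" "R1 25 = ?q" and t1: "t1 \<le> 1 + 2 * m" for R1 t1
  proof (rule wp_Loop[where I = ?I2 and \<phi> = "\<lambda>R' M'. 3 * bitlen (R' 2)"])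
    show "?I2 (R1(2 := m)) M" using R1 R keepD[OF R1(1), of 24] keep_mono[OF R1(1), of "{2, 24, 25}"] by simp
  next
    fix R' M'
    assume I: "?I2 R' M'" and ne: "ev (Var 2) R' M' \<noteq> 0"
    have b: "bitlen (R' 2) = Suc (bitlen (R' 2 div 2))" using ne bitlen_half by simp
    then have "Suc (R' 24) \<le> bitlen m" using I by auto
    then have "Suc (R' 24) < L" using lm small_L(1) by simp
    then show "wp L (Asg 2 (Bin Div (Var 2) (Num 2)) ;; Asg 24 (Var 24 \<oplus> Num 1))
      (\<lambda>t R'' M''. ?I2 R'' M'' \<and> Suc t + 3 * bitlen (R'' 2) \<le> 3 * bitlen (R' 2)) R' M'"
      using I room unfolding b by (simp add: wp_simps)
  next
    fix t R' M'
    assume I: "?I2 R' M'" and e: "ev (Var 2) R' M' = 0" and t: "t + 3 * bitlen (R' 2) \<le> Suc (3 * bitlen ((R1(2 := m)) 2))"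
    then have r: "R' 24 = ?l" "R' 25 = ?q" by auto
    have s: "?q * ?l * ?l < L" using X XL by (simp add: samples_def)
    have "?q * ?l \<le> ?q * ?l * ?l" by (cases ?l) auto
    then have s': "?q * ?l < L" using s by (rule le_less_trans)
    have "keep {2, 23, 24, 25} R R'" by (rule keep_mono[of "{2, 24, 25}"]) (use I in auto)
    then have "Q (t1 + (1 + (t + 1))) (R'(23 := samples m)) M"
      using I t t1 by (intro Q) auto
    then show "wp L (Asg 23 (Var 25 \<otimes> Var 24 \<otimes> Var 24)) (\<lambda>t'. Q (t1 + (1 + (t + t')))) R' M'"
      using I r s s' by (simp add: wp_Asg samples_def)
  qed simp
  let ?I1 = "\<lambda>R' M'. M' = M \<and> keep {25} R R' \<and> R' 29 = m \<and> R' 25 \<le> ?q"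
  have "wp L (Loop (Var 25 \<otimes> Var 25 \<lless> Var 29) (Asg 25 (Var 25 \<oplus> Num 1)))
    (\<lambda>t. wp L (Asg 2 (Var 29)) (\<lambda>t'. wp L (Loop (Var 2) (Asg 2 (Bin Div (Var 2) (Num 2)) ;; Asg 24 (Var 24 \<oplus> Num 1)))
     (\<lambda>t''. wp L (Asg 23 (Var 25 \<otimes> Var 24 \<otimes> Var 24)) (\<lambda>t'''. Q (t + (t' + (t'' + t'''))))))) R M"
  proof (rule wp_Loop[where I = ?I1 and \<phi> = "\<lambda>R' M'. 2 * (?q - R' 25)"])
    show "?I1 R M" using R by simp
  next
    fix R' M' assume I: "?I1 R' M'"
    have "R' 25 * R' 25 \<le> m * m" using I qm by (intro mult_mono) auto
    then show "safe L (Var 25 \<otimes> Var 25 \<lless> Var 29) R' M'" using XL X by simp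
    assume ne: "ev (Var 25 \<otimes> Var 25 \<lless> Var 29) R' M' \<noteq> 0"
    then have lt: "R' 25 * R' 25 < m" using I by (auto split: if_splits)
    then have "R' 25 \<noteq> ?q" using csqrt_nat(1)[of m] by auto
    then have lq: "R' 25 < ?q" using I by simp
    then have "2 * (?q - R' 25) = 2 + 2 * (?q - Suc (R' 25))" by auto
    moreover have "Suc (R' 25) < L" using lq qm small_L(1) by simp
    ultimately show "wp L (Asg 25 (Var 25 \<oplus> Num 1))
      (\<lambda>t R'' M''. ?I1 R'' M'' \<and> Suc t + 2 * (?q - R'' 25) \<le> 2 * (?q - R' 25)) R' M'"
      using I lq room by (simp add: wp_simps)
  next
    fix t R' M'
    assume I: "?I1 R' M'" and e: "ev (Var 25 \<otimes> Var 25 \<lless> Var 29) R' M' = 0"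
      and t: "t + 2 * (?q - R' 25) \<le> Suc (2 * (?q - R 25))"
    then have "m \<le> R' 25 * R' 25" by (auto split: if_splits)
    then have q: "R' 25 = ?q" using I csqrt_nat(2)[of "R' 25" m] by (cases "R' 25 < ?q") auto
    have "t \<le> 1 + 2 * m" using t qm R by simp
    then show "wp L (Asg 2 (Var 29)) (\<lambda>t'. wp L (Loop (Var 2) (Asg 2 (Bin Div (Var 2) (Num 2)) ;; Asg 24 (Var 24 \<oplus> Num 1)))
     (\<lambda>t''. wp L (Asg 23 (Var 25 \<otimes> Var 24 \<otimes> Var 24)) (\<lambda>t'''. Q (t + (t' + (t'' + t''')))))) R' M'"
      using second[of R' t, OF _ q] I by (simp add: wp_Asg[of L 2])
  qed
  then show ?thesis
    unfolding sample_size_def wp_Seq .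
qed

text \<open>Edges are prepended in the order of their indices, so after \<open>k\<close> of them the
  list of \<open>u\<close> begins with \<open>last_arc\<close> of \<open>u\<close> and
  \<open>k\<close>. Indices are stored plus one, whence the initially zero memory represents empty
  lists.\<close>

lemma wp_build_lists:
  assumes R: "R 31 = z" "R 29 = m" "R 22 = 0" and M: "raw M"
    and X: "m \<le> X"
    and Q: "\<And>t R' M'. keep {2, 3, 4, 22} R R' \<Longrightarrow> R' 22 = length es \<Longrightarrow> keep (cols z {4, 5, 6, 7, 8}) M M' \<Longrightarrow>
      inp M' \<Longrightarrow> t \<le> 2 + 12 * m \<Longrightarrow> Q t R' M'"
  shows "wp L build_lists Q R M"
proof -
  let ?P = "\<lambda>e. sd (tl e) \<and> \<not> sd (hd e)"
  let ?F = "\<lambda>i. filter ?P [0..<i]"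
  let ?C = "cols z {4, 5, 6, 7, 8}"
  let ?I = "\<lambda>R' M'. keep {2, 3, 4, 22} R R' \<and> R' 31 = z \<and> R' 29 = m \<and> R' 2 \<le> m \<and> keep ?C M M' \<and>
    (\<forall>e<R' 2. M' (cell z 5 e) = last_arc tl (tl e) e \<and> M' (cell z 7 e) = last_arc hd (hd e) e) \<and>
    (\<forall>u<n. M' (cell z 4 u) = last_arc tl u (R' 2) \<and> M' (cell z 6 u) = last_arc hd u (R' 2)) \<and>
    R' 22 = length (?F (R' 2)) \<and> (\<forall>k<R' 22. M' (cell z 8 k) = ?F (R' 2) ! k)"
  let ?b = "Asg 3 (Get (Num 2 \<oplus> Num 3 \<otimes> Var 2)) ;; Asg 4 (Get (Num 3 \<oplus> Num 3 \<otimes> Var 2)) ;;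
        Put (addr 5 (Var 2)) (arr 4 (Var 3)) ;; Put (addr 4 (Var 3)) (Var 2 \<oplus> Num 1) ;;
        Put (addr 7 (Var 2)) (arr 6 (Var 4)) ;; Put (addr 6 (Var 4)) (Var 2 \<oplus> Num 1) ;;
        Cond (side_of (Var 3))
          (Cond (side_of (Var 4)) Skip
            (Put (addr 8 (Var 22)) (Var 2) ;; Asg 22 (Var 22 \<oplus> Num 1))) Skip ;;
        Asg 2 (Var 2 \<oplus> Num 1)"
  have "wp L (Loop (Var 2 \<lless> Var 29) ?b) (\<lambda>t. Q (1 + t)) (R(2 := 0)) M"
  proof (rule wp_Loop[where I = ?I and \<phi> = "\<lambda>R' M'. 12 * (m - R' 2)"])
    show "?I (R(2 := 0)) M" using R raw_cell[OF M] by simp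
  next
    fix R' M'
    assume I: "?I R' M'" and ne: "ev (Var 2 \<lless> Var 29) R' M' \<noteq> 0"
    let ?e = "R' 2" let ?K = "R' 22"
    have e: "?e < m" using I ne by (auto split: if_splits)
    have kM: "keep ?C M M'" using I by blast
    have low: "M' x = M x" if "x < z" for x using keepD[OF kM] that by simp
    have "2 + 3 * ?e < z" "3 + 3 * ?e < z" using z_eq e by auto
    then have g: "M' (2 + 3 * ?e) = tl ?e" "M' (3 + 3 * ?e) = hd ?e"
      using low M e by (simp_all only: raw_def)
    have s: "M' (2 + 3 * m + v) = of_bool (sd v)" if "v < n" for v
    proof -
      have "2 + 3 * m + v < z" using z_eq that by simp
      then show ?thesis using low M that by (simp only: raw_def)
    qed
    have lz: "3 + 3 * ?e < z" "2 + 3 * m + tl ?e < z" "2 + 3 * m + hd ?e < z"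
      using z_eq e tl_less hd_less by auto
    have th: "tl ?e < n" "hd ?e < n" using e tl_less hd_less by auto
    have t: "12 * (m - ?e) = 12 + 12 * (m - Suc ?e)" using e by auto
    have K: "?K \<le> ?e" using I length_filter_le[of ?P "[0..<?e]"] by simp
    have l: "3 * ?e < L" "3 + 3 * ?e < L" "2 + 3 * ?e < L" "Suc ?e < L" "3 * m < L" "2 + 3 * m < L" "2 + 3 * m + tl ?e < L"
      "2 + 3 * m + hd ?e < L" "Suc ?K < L" "4 < L" "16 < L"
      using small_L(1) e th K room by auto
    have z': "R' 31 = z" "R' 29 = m" using I by auto
    let ?M1 = "M'(cell z 5 ?e := last_arc tl (tl ?e) ?e, cell z 4 (tl ?e) := Suc ?e,
      cell z 7 ?e := last_arc hd (hd ?e) ?e, cell z 6 (hd ?e) := Suc ?e)"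
    let ?M2 = "if ?P ?e then ?M1(cell z 8 ?K := ?e) else ?M1"
    let ?R1 = "R'(3 := tl ?e, 4 := hd ?e)"
    let ?R2 = "if ?P ?e then ?R1(22 := Suc ?K, 2 := Suc ?e) else ?R1(2 := Suc ?e)"
    have fo: "M' (cell z 4 (tl ?e)) = last_arc tl (tl ?e) ?e" "M' (cell z 6 (hd ?e)) = last_arc hd (hd ?e) ?e"
      using I th by auto
    have "wp L ?b (\<lambda>t R'' M''. R'' = ?R2 \<and> M'' = ?M2 \<and> t \<le> 11) R' M'"
      using z' e g s[OF th(1)] s[OF th(2)] fo l K th room lz by (auto simp: wp_simps side_of_def)
    then show "wp L ?b (\<lambda>t R'' M''. ?I R'' M'' \<and> Suc t + 12 * (m - R'' 2) \<le> 12 * (m - R' 2)) R' M'"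
    proof (rule wp_mono)
      fix t' :: nat and R'' M''
      assume 2: "R'' = ?R2 \<and> M'' = ?M2 \<and> t' \<le> 11"
      have R2: "R'' = ?R2" and M2: "M'' = ?M2" using 2 by auto
      have r2: "R'' 2 = Suc ?e" "R'' 31 = z" "R'' 29 = m" unfolding R2 using z' by auto
      have kR: "keep {2, 3, 4, 22} R R''" unfolding R2 using I by auto
      have kM2: "keep ?C M M''" unfolding M2 using I by auto
      have n5: "\<forall>e<Suc ?e. M'' (cell z 5 e) = last_arc tl (tl e) e \<and> M'' (cell z 7 e) = last_arc hd (hd e) e"
        unfolding M2 using I by (auto simp: less_Suc_eq)
      have n4: "\<forall>u<n. M'' (cell z 4 u) = last_arc tl u (Suc ?e) \<and> M'' (cell z 6 u) = last_arc hd u (Suc ?e)"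
        unfolding M2 using I by auto
      have F: "?F (Suc ?e) = (if ?P ?e then ?F ?e @ [?e] else ?F ?e)" by simp
      have n22: "R'' 22 = length (?F (Suc ?e))" unfolding R2 F using I by auto
      have n8: "\<forall>k<R'' 22. M'' (cell z 8 k) = ?F (Suc ?e) ! k"
        unfolding n22 F M2 using I by (auto simp: less_Suc_eq nth_append)
      have "Suc t' + 12 * (m - Suc ?e) \<le> 12 * (m - R' 2)" using 2 t by simp
      moreover have "Suc ?e \<le> m" using e by simp
      ultimately show "?I R'' M'' \<and> Suc t' + 12 * (m - R'' 2) \<le> 12 * (m - R' 2)"
        unfolding r2 using r2 kR kM2 n5 n4 n22 n8 by blast
    qed
  next
    fix t R' M'
    assume I: "?I R' M'" and ex: "ev (Var 2 \<lless> Var 29) R' M' = 0"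
      and t: "t + 12 * (m - R' 2) \<le> Suc (12 * (m - (R(2 := 0)) 2))"
    then have n: "R' 2 = m" by (auto split: if_splits)
    have kM: "keep ?C M M'" using I by blast
    have low: "M' x = M x" if "x < z" for x using keepD[OF kM] that by simp
    have lz: "2 + 3 * e < z" "3 + 3 * e < z" "4 + 3 * e < z" if "e < m" for e using z_eq that n_pos by auto
    have lv: "2 + 3 * m + v < z" if "v < n" for v using z_eq that by simp
    have "\<forall>v<n. M' (2 + 3 * m + v) = of_bool (sd v)" using low[OF lv] M unfolding raw_def by simp
    moreover have "\<forall>e<m. M' (2 + 3 * e) = tl e \<and> M' (3 + 3 * e) = hd e \<and> M' (4 + 3 * e) = wt e"
      using low[OF lz(1)] low[OF lz(2)] low[OF lz(3)] M unfolding raw_def by simp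
    ultimately have "inp M'"
      using I unfolding n inp_def fwd.graph_in_def bwd.graph_in_def es_def by auto
    then show "Q (1 + t) R' M'" using I t by (intro Q) (auto simp: n es_def)
  qed simp
  then show ?thesis
    unfolding build_lists_def wp_Seq[of L "Asg 2 _"] wp_Asg[of L 2 "Num 0"] using room by simp
qed

lemma wp_plan_bits:
  assumes R: "R 31 = z" "R 22 = length es" "R 21 = 0" "R 23 = r" and es: "es \<noteq> []"
    and X: "r * clog (length es) \<le> X" "2 * m \<le> X"
    and Q: "\<And>t R'. keep {1, 2, 3, 4, 5, 21, 26} R R' \<Longrightarrow> R' 21 = clog (length es) \<Longrightarrow> R' 26 = 1 \<Longrightarrow>
      R' 1 = r * clog (length es) \<Longrightarrow> R' 3 = cell z 10 0 \<Longrightarrow> R' 4 = 16 \<Longrightarrow> R' 5 = 1 \<Longrightarrow>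
      t \<le> 7 + 3 * m \<Longrightarrow> Q t R' M"
  shows "wp L plan_bits Q R M"
proof -
  let ?l = "clog (length es)"
  have lm: "?l \<le> m" using clog_le[of "length es"] length_es by simp
  let ?I = "\<lambda>R' M'. M' = M \<and> keep {2, 21} R R' \<and> R' 22 = length es \<and> R' 21 \<le> ?l \<and> R' 2 = 2 ^ R' 21"
  let ?rest = "Asg 26 (Num 1) ;; Asg 1 (Var 23 \<otimes> Var 21) ;; Asg 3 (addr 10 (Num 0)) ;;
     Asg 4 (Num 16) ;; Asg 5 (Num 1)"
  have XL: "X < L" using small_L(2) by simp
  have "wp L (Loop (Var 2 \<lless> Var 22) (Asg 2 (Num 2 \<otimes> Var 2) ;; Asg 21 (Var 21 \<oplus> Num 1)))
    (\<lambda>t. wp L ?rest (\<lambda>t'. Q (1 + (t + t')))) (R(2 := 1)) M"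
  proof (rule wp_Loop[where I = ?I and \<phi> = "\<lambda>R' M'. 3 * (?l - R' 21)"])
    show "?I (R(2 := 1)) M" using R by simp
  next
    fix R' M'
    assume I: "?I R' M'" and ne: "ev (Var 2 \<lless> Var 22) R' M' \<noteq> 0"
    then have lt: "(2::nat) ^ R' 21 < length es" by (auto split: if_splits)
    then have "R' 21 \<noteq> ?l" using clog(1)[of "length es"] by auto
    then have l: "R' 21 < ?l" using I by simp
    have t: "3 * (?l - R' 21) = 3 + 3 * (?l - Suc (R' 21))" using l by auto
    have "2 * 2 ^ R' 21 < L" "Suc (R' 21) < L" using lt length_es X(2) XL l lm by linarith+
    then show "wp L (Asg 2 (Num 2 \<otimes> Var 2) ;; Asg 21 (Var 21 \<oplus> Num 1))
      (\<lambda>t R'' M''. ?I R'' M'' \<and> Suc t + 3 * (?l - R'' 21) \<le> 3 * (?l - R' 21)) R' M'"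
      using I l room unfolding t by (simp add: wp_simps)
  next
    fix t R' M'
    assume I: "?I R' M'" and ex: "ev (Var 2 \<lless> Var 22) R' M' = 0"
      and t: "t + 3 * (?l - R' 21) \<le> Suc (3 * (?l - (R(2 := 1)) 21))"
    then have "length es \<le> 2 ^ R' 21" by (auto split: if_splits)
    then have l: "R' 21 = ?l" using I clog(2)[of "R' 21" "length es"] by (cases "R' 21 < ?l") auto
    have r: "R' 31 = z" "R' 23 = r" using keepD[of "{2, 21}" R R'] I R by simp_all
    have k: "keep {1, 2, 3, 4, 5, 21, 26} R R'" by (rule keep_mono[of "{2, 21}"]) (use I in auto)
    have rl: "r * ?l < L" using X XL by simp
    have s: "safe L (addr 10 (Num 0)) R'' M" if "R'' 31 = z" for R'' using that room_X by simp
    have "Q (Suc (Suc (Suc (Suc (Suc (Suc t)))))) (R'(26 := 1, 1 := r * ?l, 3 := cell z 10 0, 4 := 16, 5 := 1)) M"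
      by (rule Q) (use k l t lm R in auto)
    then show "wp L ?rest (\<lambda>t'. Q (1 + (t + t'))) R' M'"
      using I r l rl room s room_X by (simp add: wp_simps)
  qed simp
  then show ?thesis
    unfolding plan_bits_def wp_Seq[of L "Asg 2 _"] wp_Seq[of L "Loop _ _"] wp_Asg[of L 2 "Num 1"] using room
    by (simp add: add.assoc)
qed

end

definition main_prog :: prog where
  "main_prog = Cond (Var 26) main_body Skip"

text \<open>The only randomized part: the number of coin flips stored is given in register 1.\<close>

definition fill :: com where
  "fill = While 1 [Flip 2, Store 3 2, Op Add 3 3 4, Op Sub 1 1 5]"

definition diameter_prog :: "com list" where
  "diameter_prog = compile 32 setup_prog @ fill # compile 32 main_prog"

lemma regs_below_setup: "regs_below 32 setup_prog"
  by (simp add: setup_prog_def setup_body_def sum_weights_def sample_size_def build_lists_def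
      plan_bits_def side_of_def addr_def)

lemma regs_below_main: "regs_below 32 main_prog"
  by (simp add: main_prog_def main_body_def draw_samples_def draw_bits_def sample_eccs_def farthest_def
      select_def cand_eccs_def ecc_def clear_marks_def scan_def dij_def dij_init_def dij_build_def
      dij_main_def relax_def fixup_def pull_def descend_def side_of_def addr_def)

definition max_depth :: nat where
  "max_depth = max (prog_depth setup_prog) (prog_depth main_prog)"

section \<open>The distribution produced by the coin-flip loop\<close>

definition fill_step :: "bool \<Rightarrow> state \<Rightarrow> state" where
  "fill_step b s = s\<lparr>regs := (regs s)(2 := of_bool b, 3 := regs s 3 + 16, 1 := regs s 1 - 1),
     mem := (mem s)(regs s 3 := of_bool b)\<rparr>"

lemma fill_step_simps:
  "regs (fill_step b s) = (regs s)(2 := of_bool b, 3 := regs s 3 + 16, 1 := regs s 1 - 1)"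
  "mem (fill_step b s) = (mem s)(regs s 3 := of_bool b)"
  by (simp_all add: fill_step_def)

lemma run_Suc_return: "step w c = return_pmf c' \<Longrightarrow> run w (Suc t) c = run w t c'"
  by (simp add: bind_return_pmf)

lemma run_fill_step:
  assumes "regs s 1 \<noteq> 0" "regs s 4 = 16" "regs s 5 = 1" "regs s 3 + 16 < 2 ^ w" "regs s 1 < 2 ^ w"
  shows "run w (5 + t) (fill # cs, s) =
    bind_pmf (bernoulli_pmf (1 / 2)) (\<lambda>b. run w t (fill # cs, fill_step b s))"
proof -
  let ?s = "\<lambda>b. s\<lparr>regs := (regs s)(2 := of_bool b)\<rparr>"
  have b: "of_bool b < (2::nat) ^ w" for b
    using assms(4) by (cases b) auto
  have f: "run w (Suc t') (Flip 2 # cs', s) =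
      bind_pmf (bernoulli_pmf (1 / 2)) (\<lambda>b. run w t' (cs', ?s b))" for t' cs'
    using b by (simp add: write_reg_def bind_map_pmf)
  have r: "run w (Suc (Suc (Suc t))) (Store 3 2 # Op Add 3 3 4 # Op Sub 1 1 5 # fill # cs, ?s b) =
      run w t (fill # cs, fill_step b s)" for b
  proof -
    have "steps w (Suc (Suc (Suc 0))) (Store 3 2 # Op Add 3 3 4 # Op Sub 1 1 5 # fill # cs, ?s b)
        (fill # cs, fill_step b s)"
      using assms by (intro steps_Store steps_Op steps_eqI) (auto simp: fill_step_def fun_upd_def)
    then show ?thesis by (simp only: steps_def add_Suc add_0)
  qed
  have "run w (5 + t) (fill # cs, s) =
      run w (Suc (Suc (Suc (Suc t)))) (Flip 2 # Store 3 2 # Op Add 3 3 4 # Op Sub 1 1 5 # fill # cs, s)"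
    using assms(1) run_Suc_return[of w "(fill # cs, s)" "(Flip 2 # Store 3 2 # Op Add 3 3 4 # Op Sub 1 1 5 # fill # cs, s)"
        "Suc (Suc (Suc (Suc t)))"]
    by (simp add: fill_def eval_nat_numeral del: run.simps)
  also have "\<dots> = bind_pmf (bernoulli_pmf (1 / 2)) (\<lambda>b. run w t (fill # cs, fill_step b s))"
    unfolding f r ..
  finally show ?thesis .
qed

text \<open>All randomness is pulled to the front: a list of \<open>k\<close> independent bits is
  drawn, and everything after it is a function of this list. A pass takes five steps, the final test
  one more.\<close>

lemma run_fill:
  assumes "regs s 1 = k" "0 < k \<Longrightarrow> regs s 4 = 16 \<and> regs s 5 = 1 \<and> regs s 3 + 16 * k < 2 ^ w \<and> k < 2 ^ w"
  shows "run w (5 * k + 1 + t) (fill # cs, s) =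
    bind_pmf (replicate_pmf k (bernoulli_pmf (1 / 2))) (\<lambda>bs. run w t (cs, fold fill_step bs s))"
  using assms
proof (induction k arbitrary: s)
  case 0
  then show ?case
    using run_Suc_return[of w "(fill # cs, s)" "(cs, s)" t]
    by (simp add: fill_def bind_return_pmf del: run.simps)
next
  case (Suc k)
  have "5 * Suc k + 1 + t = 5 + (5 * k + 1 + t)" by simp
  then have "run w (5 * Suc k + 1 + t) (fill # cs, s) =
      bind_pmf (bernoulli_pmf (1 / 2)) (\<lambda>b. run w (5 * k + 1 + t) (fill # cs, fill_step b s))"
    using Suc.prems by (simp only:) (rule run_fill_step, auto)
  also have "\<dots> = bind_pmf (bernoulli_pmf (1 / 2)) (\<lambda>b.
      bind_pmf (replicate_pmf k (bernoulli_pmf (1 / 2))) (\<lambda>bs. run w t (cs, fold fill_step bs (fill_step b s))))"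
    by (rule bind_pmf_cong[OF refl], rule Suc.IH) (use Suc.prems in \<open>auto simp: fill_step_def\<close>)
  also have "\<dots> = bind_pmf (replicate_pmf (Suc k) (bernoulli_pmf (1 / 2))) (\<lambda>bs. run w t (cs, fold fill_step bs s))"
    by (simp add: bind_assoc_pmf bind_return_pmf)
  finally show ?case .
qed

lemma fold_fill_step_regs:
  "r \<notin> {1, 2, 3} \<Longrightarrow> regs (fold fill_step bs s) r = regs s r"
  "regs (fold fill_step bs s) 1 = regs s 1 - length bs"
  "regs (fold fill_step bs s) 3 = regs s 3 + 16 * length bs"
  by (induction bs arbitrary: s) (auto simp: fill_step_simps)

lemma fold_fill_step_regs_2: "regs (fold fill_step bs s) 2 \<le> max 1 (regs s 2)"
proof (induction bs arbitrary: s)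
  case (Cons b bs)
  then have "regs (fold fill_step bs (fill_step b s)) 2 \<le> max 1 (regs (fill_step b s) 2)" .
  then show ?case by (cases b) (simp_all add: fill_step_simps)
qed simp

lemma fold_fill_step_mem:
  "(\<And>i. i < length bs \<Longrightarrow> x \<noteq> regs s 3 + 16 * i) \<Longrightarrow> mem (fold fill_step bs s) x = mem s x"
proof (induction bs arbitrary: s)
  case (Cons b bs)
  have "mem (fold fill_step bs (fill_step b s)) x = mem (fill_step b s) x"
  proof (rule Cons.IH)
    fix i assume "i < length bs"
    then show "x \<noteq> regs (fill_step b s) 3 + 16 * i"
      using Cons.prems[of "Suc i"] by (simp add: fill_step_simps)
  qed
  moreover have "x \<noteq> regs s 3" using Cons.prems[of 0] by simp
  ultimately show ?case by (simp add: fill_step_simps)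
qed simp

lemma fold_fill_step_mem_nth:
  "i < length bs \<Longrightarrow> mem (fold fill_step bs s) (regs s 3 + 16 * i) = of_bool (bs ! i)"
proof (induction bs arbitrary: s i)
  case (Cons b bs)
  show ?case
  proof (cases i)
    case 0
    then show ?thesis
      using fold_fill_step_mem[of bs "regs s 3" "fill_step b s"] by (auto simp: fill_step_simps)
  next
    case (Suc j)
    then show ?thesis
      using Cons.IH[of j "fill_step b s"] Cons.prems by (simp add: fill_step_simps add.assoc)
  qed
qed simp

lemma run_halted: "run w t ([], s) = return_pmf ([], s)"
  by (induction t) (auto simp: bind_return_pmf)

text \<open>The time needed after the flips may vary with them; as a halted machine stays put,
  running up to the common bound \<open>T\<close> makes the whole run the image of a list of fair
  bits under \<open>fin\<close>.\<close>

lemma run_three_phases: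
  assumes 1: "steps w k1 (p1 @ fill # p3, s0) (fill # p3, s1)"
    and 2: "regs s1 1 = k"
      "0 < k \<Longrightarrow> regs s1 4 = 16 \<and> regs s1 5 = 1 \<and> regs s1 3 + 16 * k < 2 ^ w \<and> k < 2 ^ w"
    and 3: "\<And>bs. length bs = k \<Longrightarrow> \<exists>k3\<le>T3. steps w k3 (p3, fold fill_step bs s1) ([], fin bs)"
    and T: "k1 + (5 * k + 1) + T3 \<le> T"
  shows "run w T (p1 @ fill # p3, s0) =
    map_pmf (\<lambda>bs. ([], fin bs)) (replicate_pmf k (bernoulli_pmf (1 / 2)))"
proof -
  obtain T' where T': "T = k1 + (5 * k + 1 + T')" "T3 \<le> T'"
    using T by (metis add.assoc add_le_cancel_left le_Suc_ex le_add1 nat_le_iff_add)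
  have "run w T (p1 @ fill # p3, s0) = run w (5 * k + 1 + T') (fill # p3, s1)"
    using 1 unfolding steps_def T'(1) by blast
  also have "\<dots> = bind_pmf (replicate_pmf k (bernoulli_pmf (1 / 2))) (\<lambda>bs. run w T' (p3, fold fill_step bs s1))"
    by (rule run_fill[OF 2])
  also have "\<dots> = bind_pmf (replicate_pmf k (bernoulli_pmf (1 / 2))) (\<lambda>bs. return_pmf ([], fin bs))"
  proof (rule bind_pmf_cong[OF refl])
    fix bs assume "bs \<in> set_pmf (replicate_pmf k (bernoulli_pmf (1 / 2)))"
    then have "length bs = k" by (simp add: set_replicate_pmf)
    then obtain k3 where "k3 \<le> T3" "steps w k3 (p3, fold fill_step bs s1) ([], fin bs)" using 3 by blast
    moreover then have "T' = k3 + (T' - k3)" using T'(2) by simp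
    ultimately show "run w T' (p3, fold fill_step bs s1) = return_pmf ([], fin bs)"
      unfolding steps_def by (metis run_halted)
  qed
  finally show ?thesis by (simp add: map_pmf_def)
qed

context bichrom
begin

abbreviation setup_time :: nat where
  "setup_time \<equiv> 20 + 20 * m + 3 * bitlen m"

lemma wp_setup_body:
  assumes R: "\<And>x. R x = (if x = 30 then n else if x = 29 then m else 0)" and M: "raw M"
    and W: "W = (\<Sum>e<m. wt e)"
    and X: "samples m \<le> X" "m * m \<le> X" "2 * m \<le> X" "samples m * clog (length es) \<le> X"
    and Q: "\<And>t R' M' l. base (csqrt_nat m) (samples m) l R' \<Longrightarrow> R' 27 = 0 \<Longrightarrow> R' 0 = 0 \<Longrightarrow>
      R' 26 = of_bool (es \<noteq> []) \<Longrightarrow> (es = [] \<Longrightarrow> R' 1 = 0) \<Longrightarrow>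
      (es \<noteq> [] \<Longrightarrow> l = clog (length es) \<and> R' 1 = samples m * l \<and> R' 3 = cell z 10 0 \<and> R' 4 = 16 \<and> R' 5 = 1) \<Longrightarrow>
      keep (cols z {4, 5, 6, 7, 8}) M M' \<Longrightarrow> inp M' \<Longrightarrow> t \<le> setup_time \<Longrightarrow> Q t R' M'"
  shows "wp L setup_body Q R M"
proof -
  let ?R1 = "R(31 := z)"
  have "wp L (sum_weights ;; sample_size ;; build_lists ;; Cond (Var 22) plan_bits Skip)
    (\<lambda>t. Q (1 + t)) ?R1 M"
    unfolding wp_Seq[of L sum_weights]
  proof (rule wp_sum_weights[OF _ _ _ M W])
    fix t1 R2
    assume 1: "keep {2, 28} ?R1 R2" "R2 28 = BIG" "t1 \<le> 3 + 3 * m"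
    have R2: "R2 x = (if x = 30 then n else if x = 29 then m else if x = 31 then z else if x = 28 then BIG else 0)"
      if "x \<noteq> 2" for x
      using keepD[OF 1(1), of x] R 1(2) that by auto
    show "wp L (sample_size ;; build_lists ;; Cond (Var 22) plan_bits Skip) (\<lambda>t. Q (1 + (t1 + t))) R2 M"
      unfolding wp_Seq[of L sample_size]
    proof (rule wp_sample_size[OF _ _ _ X(1,2)])
      fix t2 R3
      assume 2: "keep {2, 23, 24, 25} R2 R3" "R3 25 = csqrt_nat m" "R3 23 = samples m"
        "t2 \<le> 4 + 2 * m + 3 * bitlen m"
      have R3: "R3 x = R2 x" if "x \<notin> {2, 23, 24, 25}" for x
        using keepD[OF 2(1) that] .
      show "wp L (build_lists ;; Cond (Var 22) plan_bits Skip) (\<lambda>t. Q (1 + (t1 + (t2 + t)))) R3 M"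
        unfolding wp_Seq[of L build_lists]
      proof (rule wp_build_lists[OF _ _ _ M])
        show "R3 31 = z" "R3 29 = m" "R3 22 = 0" using R3 R2 by simp_all
        show "m \<le> X" using X(3) by simp
      next
        fix t3 R4 M'
        assume 3: "keep {2, 3, 4, 22} R3 R4" "R4 22 = length es" "keep (cols z {4, 5, 6, 7, 8}) M M'"
          "inp M'" "t3 \<le> 2 + 12 * m"
        have R4: "R4 x = R3 x" if "x \<notin> {2, 3, 4, 22}" for x
          using keepD[OF 3(1) that] .
        have r4: "R4 31 = z" "R4 30 = n" "R4 29 = m" "R4 28 = BIG" "R4 27 = 0" "R4 26 = 0" "R4 21 = 0"
          "R4 0 = 0" "R4 1 = 0" "R4 25 = csqrt_nat m" "R4 23 = samples m"
          using R4 R3 R2 2 by simp_all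
        show "wp L (Cond (Var 22) plan_bits Skip) (\<lambda>t. Q (1 + (t1 + (t2 + (t3 + t))))) R4 M'"
        proof (cases "es = []")
          case True
          have "Q (1 + (t1 + (t2 + (t3 + 1)))) R4 M'"
            by (rule Q[where l = 0]) (use r4 3 1 2 True in \<open>auto simp: base_def\<close>)
          then show ?thesis using 3(2) True by (simp add: wp_simps)
        next
          case False
          have "wp L plan_bits (\<lambda>t. Q (1 + (t1 + (t2 + (t3 + Suc t))))) R4 M'"
          proof (rule wp_plan_bits[OF r4(1) 3(2) r4(7) r4(11) False X(4,3)])
            fix t4 R5
            assume 4: "keep {1, 2, 3, 4, 5, 21, 26} R4 R5" "R5 21 = clog (length es)" "R5 26 = 1"
              "R5 1 = samples m * clog (length es)" "R5 3 = cell z 10 0" "R5 4 = 16" "R5 5 = 1"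
              "t4 \<le> 7 + 3 * m"
            have r5: "R5 x = R4 x" if "x \<notin> {1, 2, 3, 4, 5, 21, 26}" for x
              using keepD[OF 4(1) that] .
            have "base (csqrt_nat m) (samples m) (clog (length es)) R5"
              using r5 r4 3(2) 4 by (simp add: base_def)
            moreover have "1 + (t1 + (t2 + (t3 + Suc t4))) \<le> setup_time"
              using 1 2 3 4 by linarith
            moreover have "R5 27 = 0" "R5 0 = 0" using r5 r4 by simp_all
            ultimately show "Q (1 + (t1 + (t2 + (t3 + Suc t4)))) R5 M'"
              using False 3 4 by (intro Q[where l = "clog (length es)"]) auto
          qed
          then show ?thesis using 3(2) False by (simp add: wp_Cond)
        qed
      qed
    qed (use R2 in simp_all)
  qed (use R in simp_all)
  moreover have "3 * m < L" "2 + 3 * m < L" "2 < L" using small_L(1) by auto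
  moreover have "2 + 3 * m + n < L" using small_L(1) by simp
  ultimately show ?thesis
    unfolding setup_body_def wp_Seq[of L "Asg 31 _"] wp_Asg[of L 31]
    using R room z_eq by simp
qed

end

section \<open>Instances\<close>

definition arc_tail :: "st_instance \<Rightarrow> nat \<Rightarrow> nat" where
  "arc_tail I e = fst (edge_list I ! e)"

definition arc_head :: "st_instance \<Rightarrow> nat \<Rightarrow> nat" where
  "arc_head I e = snd (edge_list I ! e)"

definition arc_weight :: "st_instance \<Rightarrow> nat \<Rightarrow> nat" where
  "arc_weight I e = weight I (edge_list I ! e)"

abbreviation inst_wk :: "st_instance \<Rightarrow> nat \<Rightarrow> nat \<Rightarrow> nat \<Rightarrow> bool" where
  "inst_wk I \<equiv> wk (edge_count I) (arc_tail I) (arc_head I) (arc_weight I)"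

lemma graph_of_simps:
  "verts (graph_of I) = {..<vertex_count I}" "arcs (graph_of I) = set (edge_list I)"
  "tail (graph_of I) = fst" "head (graph_of I) = snd"
  by (simp_all add: graph_of_def vertex_set_def)

lemma wf_graph_of:
  assumes "valid_instance I"
  shows "wf_digraph (graph_of I)"
  using assms by (simp add: valid_instance_def)

lemma arc_ends_less:
  assumes "valid_instance I" "e < edge_count I"
  shows "arc_tail I e < vertex_count I" "arc_head I e < vertex_count I"
proof -
  have "edge_list I ! e \<in> arcs (graph_of I)" using assms(2) by (simp add: graph_of_simps edge_count_def)
  then have "tail (graph_of I) (edge_list I ! e) \<in> verts (graph_of I)"
    "head (graph_of I) (edge_list I ! e) \<in> verts (graph_of I)"
    using wf_graph_of[OF assms(1)] wf_digraph.wellformed by fastforce+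
  then show "arc_tail I e < vertex_count I" "arc_head I e < vertex_count I"
    by (auto simp: graph_of_simps arc_tail_def arc_head_def)
qed

text \<open>Links the library's arc lists with walks over edge indices. Equal costs suffice, as the
  distance is an infimum over walks. The list grows at its front and \<open>wk\<close> at its end,
  so the pieces are joined by \<open>wk_trans\<close>.\<close>

lemma awalk_imp_wk:
  assumes "valid_instance I" "pre_digraph.awalk (graph_of I) u p v"
  shows "\<exists>c. inst_wk I u v c \<and> wf_digraph.awalk_cost (\<lambda>e. real (weight I e)) p = real c"
proof -
  interpret wf_digraph "graph_of I" by (rule wf_graph_of) fact
  show ?thesis
    using assms(2)
  proof (induction p arbitrary: u)
    case Nil
    then show ?case by (auto simp: awalk_Nil_iff intro!: exI[of _ 0] wk_refl)
  next
    case (Cons x p)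
    then have x: "x \<in> set (edge_list I)" "u = fst x" "awalk (snd x) p v"
      by (auto simp: awalk_Cons_iff graph_of_simps)
    obtain e where e: "e < edge_count I" "edge_list I ! e = x"
      using x(1) by (auto simp: in_set_conv_nth edge_count_def)
    obtain c where c: "inst_wk I (snd x) v c" "awalk_cost (\<lambda>e. real (weight I e)) p = real c"
      using Cons.IH[OF x(3)] by blast
    have "inst_wk I u (snd x) (weight I x)"
      using wk_single[OF e(1), of "arc_tail I" "arc_head I" "arc_weight I"] e x
      by (simp add: arc_tail_def arc_head_def arc_weight_def)
    then have "inst_wk I u v (weight I x + c)" by (rule wk_trans[OF c(1)])
    then show ?case using c(2) by (intro exI[of _ "weight I x + c"]) simp
  qed
qed

lemma wk_imp_awalk:
  assumes "valid_instance I" "inst_wk I u v c" "u < vertex_count I"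
  shows "\<exists>p. pre_digraph.awalk (graph_of I) u p v \<and>
    wf_digraph.awalk_cost (\<lambda>e. real (weight I e)) p = real c"
proof -
  interpret wf_digraph "graph_of I" by (rule wf_graph_of) fact
  show ?thesis
    using assms(2,3)
  proof (induction rule: wk.induct)
    case (wk_refl u)
    then have "u \<in> verts (graph_of I)" by (simp add: graph_of_simps)
    then show ?case by (intro exI[of _ "[]"]) (simp add: awalk_Nil_iff)
  next
    case (wk_edge u e c)
    then obtain p where p: "awalk u p (arc_tail I e)" "awalk_cost (\<lambda>e. real (weight I e)) p = real c"
      by blast
    let ?x = "edge_list I ! e"
    have "?x \<in> arcs (graph_of I)" using wk_edge by (simp add: graph_of_simps edge_count_def)
    then have "awalk (arc_tail I e) [?x] (arc_head I e)"
      using arc_implies_awalk[of ?x] by (simp add: arc_tail_def arc_head_def graph_of_simps)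
    then have "awalk u (p @ [?x]) (arc_head I e)" using p(1) by (rule awalk_appendI[rotated])
    then show ?case
      using p(2) by (intro exI[of _ "p @ [?x]"]) (simp add: arc_weight_def)
  qed
qed

lemma distance_le:
  assumes "valid_instance I" "inst_wk I u v c" "u < vertex_count I"
  shows "distance I u v \<le> ereal (real c)"
proof -
  interpret wf_digraph "graph_of I" by (rule wf_graph_of) fact
  obtain p where "awalk u p v" "awalk_cost (\<lambda>e. real (weight I e)) p = real c"
    using wk_imp_awalk[OF assms] by blast
  then show ?thesis
    unfolding distance_def using min_cost_le_walk_cost[of u p v "\<lambda>e. real (weight I e)"] by simp
qed

lemma distance_ge:
  assumes "valid_instance I" "\<And>c. inst_wk I u v c \<Longrightarrow> y \<le> ereal (real c)"
  shows "y \<le> distance I u v"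
proof -
  interpret wf_digraph "graph_of I" by (rule wf_graph_of) fact
  show ?thesis
    unfolding distance_def \<mu>_def
  proof (rule INF_greatest)
    fix p assume "p \<in> {p. awalk u p v}"
    then obtain c where "inst_wk I u v c" "awalk_cost (\<lambda>e. real (weight I e)) p = real c"
      using awalk_imp_wk[OF assms(1)] by blast
    then show "y \<le> ereal (awalk_cost (\<lambda>e. real (weight I e)) p)" using assms(2) by metis
  qed
qed

lemma source_target:
  assumes "valid_instance I"
  shows "finite (source_set I)" "finite (target_set I)" "source_set I \<noteq> {}" "target_set I \<noteq> {}"
    "source_set I \<subseteq> {..<vertex_count I}"
    "t \<in> target_set I \<longleftrightarrow> t < vertex_count I \<and> t \<notin> source_set I"
  using assms unfolding valid_instance_def target_set_def vertex_set_def
  by (auto intro: finite_subset)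

lemma distance_le_ST_diameter:
  assumes "valid_instance I" "s \<in> source_set I" "t \<in> target_set I"
  shows "distance I s t \<le> ST_diameter I"
proof -
  note st = source_target[OF assms(1)]
  have "distance I s t \<le> (MAX t\<in>target_set I. distance I s t)"
    using st assms by (intro Max_ge) auto
  also have "\<dots> \<le> ST_diameter I"
    unfolding ST_diameter_def using st assms by (intro Max_ge) auto
  finally show ?thesis .
qed

lemma ST_diameter_le:
  assumes "valid_instance I" "\<And>s t. s \<in> source_set I \<Longrightarrow> t \<in> target_set I \<Longrightarrow> distance I s t \<le> y"
  shows "ST_diameter I \<le> y"
proof -
  note st = source_target[OF assms(1)]
  have "(MAX t\<in>target_set I. distance I s t) \<le> y" if "s \<in> source_set I" for s
    using st(2,4) assms(2) that by (intro Max.boundedI) auto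
  then show ?thesis
    unfolding ST_diameter_def using st(1,3) by (intro Max.boundedI) auto
qed

lemma ST_diameter_infinite:
  assumes "valid_instance I" "s \<in> source_set I" "t \<in> target_set I" "\<And>c. \<not> inst_wk I s t c"
  shows "ST_diameter I = \<infinity>"
proof -
  have "\<infinity> \<le> distance I s t" by (rule distance_ge) (use assms in auto)
  then show ?thesis using distance_le_ST_diameter[OF assms(1-3)] by simp
qed

lemma approximates_infinite: "1 \<le> \<alpha> \<Longrightarrow> approximates \<alpha> \<infinity> \<infinity>"
  by (simp add: approximates_def)

text \<open>At most \<open>2 * m\<close> vertices touch an edge, so some vertex is isolated. It lies
  in \<open>S\<close> or in \<open>T\<close> and is not connected with any vertex of the other
  side.\<close>

lemma instance_many_vertices:
  assumes "valid_instance I" "2 * edge_count I < vertex_count I"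
  shows "ST_diameter I = \<infinity>"
proof -
  let ?m = "edge_count I"
  let ?E = "arc_tail I ` {..<?m} \<union> arc_head I ` {..<?m}"
  have "card ?E \<le> ?m + ?m"
    by (rule order_trans[OF card_Un_le]) (auto intro!: add_mono order_trans[OF card_image_le])
  then have "\<not> {..<vertex_count I} \<subseteq> ?E"
    using assms(2) card_mono[of ?E "{..<vertex_count I}"] by auto
  then obtain v where v: "v < vertex_count I" "v \<notin> ?E" by auto
  have iso: "x = y" if "inst_wk I x y c" "x = v \<or> y = v" for x y c
    using that
  proof (induction rule: wk.induct)
    case (wk_edge u e c)
    then show ?case using v(2) by blast
  qed simp
  note st = source_target[OF assms(1)]
  show ?thesis
  proof (cases "v \<in> source_set I")
    case True
    obtain t where "t \<in> target_set I" using st by blast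
    then show ?thesis
      using iso True st by (intro ST_diameter_infinite[OF assms(1) True, of t]) auto
  next
    case False
    then have "v \<in> target_set I" using st v by simp
    obtain s where "s \<in> source_set I" using st by blast
    then show ?thesis
      using iso False \<open>v \<in> target_set I\<close> by (intro ST_diameter_infinite[OF assms(1), of s v]) auto
  qed
qed

lemma nth_concat_const:
  assumes "\<And>x. length (f x) = d" "e < length es" "j < d"
  shows "concat (map f es) ! (d * e + j) = f (es ! e) ! j"
  using assms(2)
proof (induction es arbitrary: e)
  case (Cons x es)
  show ?case
  proof (cases e)
    case 0
    then show ?thesis using assms by (simp add: nth_append)
  next
    case (Suc e')
    then show ?thesis using Cons assms by (simp add: nth_append)
  qed
qed simp

lemma length_concat_triples: "(\<And>x. length (f x) = 3) \<Longrightarrow> length (concat (map f es)) = 3 * length es"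
  by (induction es) auto

definition inst_mem :: "st_instance \<Rightarrow> nat \<Rightarrow> nat" where
  "inst_mem I i = (if i < length (encode_instance I) then encode_instance I ! i else 0)"

lemma length_encode_instance:
  "length (encode_instance I) = 2 + 3 * edge_count I + vertex_count I"
  using length_concat_triples[of "\<lambda>e. [fst e, snd e, weight I e]" "edge_list I"]
  by (simp add: encode_instance_def edge_count_def)

lemma inst_mem_nth:
  "inst_mem I 0 = vertex_count I"
  "inst_mem I 1 = edge_count I"
  "e < edge_count I \<Longrightarrow> inst_mem I (2 + 3 * e) = arc_tail I e"
  "e < edge_count I \<Longrightarrow> inst_mem I (3 + 3 * e) = arc_head I e"
  "e < edge_count I \<Longrightarrow> inst_mem I (4 + 3 * e) = arc_weight I e"
  "v < vertex_count I \<Longrightarrow> inst_mem I (2 + 3 * edge_count I + v) = of_bool (v \<in> source_set I)"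
  "2 + 3 * edge_count I + vertex_count I \<le> x \<Longrightarrow> inst_mem I x = 0"
proof -
  let ?f = "\<lambda>e. [fst e, snd e, weight I e]"
  let ?c = "concat (map ?f (edge_list I))"
  have len: "length ?c = 3 * edge_count I"
    using length_concat_triples[of ?f "edge_list I"] by (simp add: edge_count_def)
  have enc: "inst_mem I (2 + i) = (?c @ map (\<lambda>v. of_bool (v \<in> source_set I)) [0..<vertex_count I]) ! i"
    if "i < 3 * edge_count I + vertex_count I" for i
    using that unfolding inst_mem_def length_encode_instance by (simp add: encode_instance_def)
  show "inst_mem I 0 = vertex_count I" "inst_mem I 1 = edge_count I"
    by (simp_all add: inst_mem_def encode_instance_def)
  show "2 + 3 * edge_count I + vertex_count I \<le> x \<Longrightarrow> inst_mem I x = 0"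
    by (simp add: inst_mem_def length_encode_instance)
  show "inst_mem I (2 + 3 * edge_count I + v) = of_bool (v \<in> source_set I)" if "v < vertex_count I"
    using enc[of "3 * edge_count I + v"] that len by (simp add: nth_append add.assoc)
  assume e: "e < edge_count I"
  have "?c ! (3 * e + j) = ?f (edge_list I ! e) ! j" if "j < 3" for j
    using e that by (intro nth_concat_const) (auto simp: edge_count_def)
  then have *: "inst_mem I (2 + (3 * e + j)) = ?f (edge_list I ! e) ! j" if "j < 3" for j
    using enc[of "3 * e + j"] e that len by (simp add: nth_append)
  show "inst_mem I (2 + 3 * e) = arc_tail I e" using *[of 0] by (simp add: arc_tail_def)
  show "inst_mem I (3 + 3 * e) = arc_head I e" using *[of 1] by (simp add: arc_head_def eval_nat_numeral)
  show "inst_mem I (4 + 3 * e) = arc_weight I e" using *[of 2] by (simp add: arc_weight_def eval_nat_numeral)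
qed

lemma arc_weight_le:
  assumes "e < edge_count I"
  shows "arc_weight I e \<le> Max (insert 0 (weight I ` set (edge_list I)))"
  using assms unfolding arc_weight_def edge_count_def by (intro Max_ge) auto

lemma inst_mem_le: "valid_instance I \<Longrightarrow> inst_mem I x \<le> instance_magnitude I + 1"
proof -
  assume v: "valid_instance I"
  let ?n = "vertex_count I" and ?m = "edge_count I"
  have n: "?n \<le> instance_magnitude I" "?m \<le> instance_magnitude I" by (auto simp: instance_magnitude_def)
  have w: "arc_weight I e \<le> instance_magnitude I" if "e < ?m" for e
    using arc_weight_le[OF that] by (simp add: instance_magnitude_def)
  consider "x = 0" | "x = 1" | "2 + 3 * ?m + ?n \<le> x" | "2 + 3 * ?m \<le> x" "x < 2 + 3 * ?m + ?n"
    | "2 \<le> x" "x < 2 + 3 * ?m" by linarith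
  then show ?thesis
  proof cases
    case 4
    define v where "v = x - (2 + 3 * ?m)"
    have "x = 2 + 3 * ?m + v" "v < ?n" unfolding v_def using 4 by linarith+
    then show ?thesis using inst_mem_nth(6)[of v I] by simp
  next
    case 5
    define e where "e = (x - 2) div 3"
    have e: "e < ?m" unfolding e_def using 5 by (simp add: less_mult_imp_div_less mult.commute)
    have "x - 2 = 3 * e + (x - 2) mod 3" unfolding e_def by simp
    moreover have "(x - 2) mod 3 < 3" by simp
    ultimately consider "x = 2 + 3 * e" | "x = 3 + 3 * e" | "x = 4 + 3 * e" using 5 by linarith
    then show ?thesis
    proof cases
      case 1
      then show ?thesis using inst_mem_nth(3)[OF e] arc_ends_less(1)[OF v e] n by simp
    next
      case 2
      then show ?thesis using inst_mem_nth(4)[OF e] arc_ends_less(2)[OF v e] n by simp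
    next
      case 3
      then show ?thesis using inst_mem_nth(5)[OF e] w[OF e] by simp
    qed
  next
    case 1
    then show ?thesis using n inst_mem_nth(1)[of I] by simp
  next
    case 2
    then show ?thesis using n inst_mem_nth(2)[of I] by simp
  next
    case 3
    then show ?thesis using inst_mem_nth(7)[of I x] by simp
  qed
qed

text \<open>The constant \<open>b\<close> in the word length is the degree of the polynomials that
  fit into a word.\<close>

lemma two_pow_word_bits: "(N + 2) ^ b \<le> 2 ^ word_bits b N"
proof -
  define k where "k = nat \<lceil>log 2 (real N + 2)\<rceil>"
  have "log 2 (real N + 2) \<le> real k" unfolding k_def by linarith
  then have "2 powr log 2 (real N + 2) \<le> 2 powr real k" by (intro powr_mono) auto
  then have "real (N + 2) \<le> real (2 ^ k)" by (simp add: powr_realpow)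
  then have "N + 2 \<le> 2 ^ k" by (simp only: of_nat_le_iff)
  then have "(N + 2) ^ b \<le> (2 ^ k) ^ b" by (rule power_mono) simp
  then show ?thesis by (simp add: word_bits_def k_def[symmetric] power_mult[symmetric] mult.commute)
qed

lemma bitsval_cong: "(\<And>i. i < j \<Longrightarrow> f (p + i) = g (p + i)) \<Longrightarrow> bitsval f p j = bitsval g p j"
  by (induction j) auto

lemma compile_wp:
  assumes wp: "wp (2 ^ w) p Q R M" and s: "implements w T D s R M" and w: "1 < (2::nat) ^ w"
    and p: "regs_below T p" "prog_depth p \<le> D"
  obtains t R' M' k s' where "Q t R' M'" "k \<le> step_cost p * t"
    "steps w k (compile T p @ cs, s) (cs, s')" "implements w T D s' R' M'"
proof -
  obtain t R' M' where "big (2 ^ w) p R M t R' M'" "Q t R' M'" using wp by (auto simp: wp_def)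
  moreover obtain k s' where "k \<le> step_cost p * t" "steps w k (compile T p @ cs, s) (cs, s')"
    "implements w T D s' R' M'"
    using compile_correct[OF calculation(1) s w p order_refl] by blast
  ultimately show ?thesis using that by blast
qed

section \<open>Word size and correctness of a complete run\<close>

definition inst_weight :: "st_instance \<Rightarrow> nat" where
  "inst_weight I = (\<Sum>e<edge_count I. arc_weight I e)"

definition inst_size :: "st_instance \<Rightarrow> nat" where
  "inst_size I = instance_magnitude I + 2"

text \<open>Degree 8 is ample: the infinity value is of degree 3 in \<open>inst_size I\<close> and
  addresses are of degree 4 because of the coin flips; the remaining degrees absorb
  constants.\<close>

locale run_instance =
  fixes I :: st_instance and b w :: nat
  assumes valid: "valid_instance I"
    and few: "vertex_count I \<le> 2 * edge_count I"
    and w_eq: "w = word_bits b (instance_magnitude I)" and b: "8 \<le> b"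
begin

lemma two_vertices: "2 \<le> vertex_count I"
proof -
  obtain s t where "s \<in> source_set I" "t \<in> target_set I" using source_target[OF valid] by blast
  then have "{s, t} \<subseteq> {..<vertex_count I}" "s \<noteq> t" using source_target[OF valid] by auto
  then show ?thesis using card_mono[of "{..<vertex_count I}" "{s, t}"] by simp
qed

lemma sizes:
  "vertex_count I + 2 \<le> inst_size I" "edge_count I + vertex_count I + 2 \<le> inst_size I"
  "4 \<le> inst_size I" "inst_weight I \<le> inst_size I * inst_size I"
  "vertex_count I * inst_weight I \<le> inst_size I ^ 3"
proof -
  show 1: "vertex_count I + 2 \<le> inst_size I" "edge_count I + vertex_count I + 2 \<le> inst_size I"
    "4 \<le> inst_size I"
    using two_vertices by (auto simp: instance_magnitude_def inst_size_def)
  have "arc_weight I e \<le> inst_size I" if "e < edge_count I" for e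
    using arc_weight_le[OF that] by (simp add: instance_magnitude_def inst_size_def)
  then have "inst_weight I \<le> edge_count I * inst_size I"
    unfolding inst_weight_def using sum_bounded_above[of "{..<edge_count I}" "arc_weight I" "inst_size I"]
    by auto
  also have "\<dots> \<le> inst_size I * inst_size I" using 1 by (intro mult_right_mono) auto
  finally show 2: "inst_weight I \<le> inst_size I * inst_size I" .
  have "vertex_count I * inst_weight I \<le> inst_size I * (inst_size I * inst_size I)"
    using 1 2 by (intro mult_mono) auto
  then show "vertex_count I * inst_weight I \<le> inst_size I ^ 3" by (simp add: power3_eq_cube mult.assoc)
qed

lemma room_pow: "inst_size I ^ 8 \<le> 2 ^ w"
proof -
  have "inst_size I ^ 8 \<le> inst_size I ^ b" using b by (intro power_increasing) (auto simp: inst_size_def)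
  also have "\<dots> \<le> 2 ^ w" unfolding w_eq inst_size_def by (rule two_pow_word_bits)
  finally show ?thesis .
qed

lemma pow_le: "i \<le> j \<Longrightarrow> inst_size I ^ i \<le> inst_size I ^ j"
  by (rule power_increasing) (auto simp: inst_size_def)

lemma pow_step: "j = Suc i \<Longrightarrow> 4 * inst_size I ^ i \<le> inst_size I ^ j"
  using mult_right_mono[OF sizes(3), of "inst_size I ^ i"] by simp

text \<open>\<open>inst_size I\<close> is at least 4, so each power exceeds four times the preceding
  one. Constants like 16 thus disappear by passing to a higher power.\<close>

lemma room_bounds:
  "16 * (2 + 3 * edge_count I + vertex_count I + inst_size I ^ 4) + 16 < 2 ^ w"
  "16 * (2 + 3 * edge_count I + vertex_count I + 2 * vertex_count I + edge_count I + 4) + 16 < 2 ^ w"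
  "vertex_count I * inst_weight I + 1 + inst_weight I < 2 ^ w"
  "4 * inst_size I < 2 ^ w"
proof -
  let ?A = "inst_size I"
  have s: "4 * ?A \<le> ?A ^ 2" "4 * ?A ^ 2 \<le> ?A ^ 3" "4 * ?A ^ 3 \<le> ?A ^ 4" "4 * ?A ^ 4 \<le> ?A ^ 5"
    "4 * ?A ^ 5 \<le> ?A ^ 6" "4 * ?A ^ 6 \<le> ?A ^ 7" "4 * ?A ^ 7 \<le> ?A ^ 8" "0 < ?A"
    using pow_step[of 2 1] pow_step[of 3 2] pow_step[of 4 3] pow_step[of 5 4] pow_step[of 6 5]
      pow_step[of 7 6] pow_step[of 8 7] sizes(3) by simp_all
  note r = room_pow
  show "16 * (2 + 3 * edge_count I + vertex_count I + inst_size I ^ 4) + 16 < 2 ^ w"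
    using s r sizes(2,3) unfolding distrib_left by linarith
  show "16 * (2 + 3 * edge_count I + vertex_count I + 2 * vertex_count I + edge_count I + 4) + 16 < 2 ^ w"
    using s r sizes(2,3) unfolding distrib_left by linarith
  have "inst_weight I \<le> ?A ^ 2" using sizes(4) by (simp add: power2_eq_square)
  then show "vertex_count I * inst_weight I + 1 + inst_weight I < 2 ^ w"
    using s r sizes(5,3) by linarith
  show "4 * inst_size I < 2 ^ w" using s r by linarith
qed

sublocale B: bichrom "2 ^ w" "2 + 3 * edge_count I + vertex_count I" "vertex_count I" "edge_count I"
  "arc_tail I" "arc_head I" "arc_weight I" "\<lambda>v. v \<in> source_set I" "inst_weight I"
  "vertex_count I * inst_weight I + 1" "inst_size I ^ 4"
proof
  show "0 < vertex_count I" using two_vertices by simp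
  show "4 + 3 * edge_count I \<le> 2 + 3 * edge_count I + vertex_count I" using two_vertices by simp
  show "arc_tail I e < vertex_count I" "arc_head I e < vertex_count I" if "e < edge_count I" for e
    using arc_ends_less[OF valid that] .
  show "arc_weight I e \<le> inst_weight I" if "e < edge_count I" for e
    unfolding inst_weight_def using that by (intro member_le_sum) auto
qed (use room_bounds in auto)

lemma raw_inst_mem: "B.raw (inst_mem I)"
  unfolding B.raw_def using inst_mem_nth[where I = I] by simp

abbreviation arcs_ST :: "nat list" where "arcs_ST \<equiv> B.es"

abbreviation num_bits :: nat where
  "num_bits \<equiv> clog (length B.es)"

abbreviation num_samples :: nat where
  "num_samples \<equiv> samples (edge_count I)"

text \<open>Root and logarithms are estimated crudely by \<open>m\<close>. This makes the number of
  coin flips at most \<open>m ^ 4\<close>, which is the origin of the column length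
  \<open>inst_size I ^ 4\<close>.\<close>

lemma sample_bounds:
  "num_samples \<le> edge_count I ^ 3" "num_samples * num_bits \<le> edge_count I ^ 4"
  "num_samples * num_bits \<le> inst_size I ^ 4" "num_samples \<le> inst_size I ^ 4"
  "csqrt_nat (edge_count I) \<le> inst_size I ^ 4" "edge_count I * edge_count I \<le> inst_size I ^ 4"
  "2 * edge_count I \<le> inst_size I ^ 4"
proof -
  let ?m = "edge_count I" and ?A = "inst_size I"
  have mA: "?m \<le> ?A" using sizes by simp
  show 1: "num_samples \<le> ?m ^ 3"
    unfolding samples_def power3_eq_cube using csqrt_nat_le bitlen_le by (intro mult_mono) auto
  have "num_bits \<le> ?m" using clog_le[of "length B.es"] B.length_es by simp
  then have "num_samples * num_bits \<le> ?m ^ 3 * ?m" using 1 by (intro mult_mono) auto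
  then show 2: "num_samples * num_bits \<le> ?m ^ 4" by (simp add: eval_nat_numeral)
  also have "\<dots> \<le> ?A ^ 4" using mA by (rule power_mono) simp
  finally show "num_samples * num_bits \<le> ?A ^ 4" .
  have "?m ^ 3 \<le> ?A ^ 3" using mA by (rule power_mono) simp
  then show "num_samples \<le> ?A ^ 4" using 1 pow_le[of 3 4] by linarith
  have "?A \<le> ?A ^ 4" using pow_le[of 1 4] by simp
  then show "csqrt_nat ?m \<le> ?A ^ 4" using csqrt_nat_le[of ?m] mA by linarith
  have "?m * ?m \<le> ?A ^ 2" unfolding power2_eq_square using mA by (intro mult_mono) auto
  then show "?m * ?m \<le> ?A ^ 4" using pow_le[of 2 4] by simp
  have "2 * ?m \<le> ?A ^ 2" using mA sizes(3) unfolding power2_eq_square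
    by (intro mult_mono) auto
  then show "2 * ?m \<le> ?A ^ 4" using pow_le[of 2 4] by simp
qed

lemma two_pow_bits: "2 ^ num_bits < (2::nat) ^ w"
proof (cases "B.es = []")
  case True
  have "clog 0 = 0" unfolding clog_def by simp
  then show ?thesis using True room_bounds(4) sizes(3) by simp
next
  case False
  then have "2 ^ num_bits \<le> 2 * length B.es" by (intro two_pow_clog) auto
  also have "\<dots> \<le> 4 * inst_size I" using B.length_es sizes(2) by linarith
  also have "\<dots> < 2 ^ w" by (rule room_bounds(4))
  finally show ?thesis .
qed

lemma implements_init:
  "implements w 32 D \<lparr>regs = (\<lambda>_. 0), mem = inst_mem I\<rparr> (\<lambda>_. 0) (inst_mem I)"
proof -
  have "inst_mem I x < 2 ^ w" for x
    using inst_mem_le[OF valid, of x] room_bounds(4) by (simp add: inst_size_def)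
  moreover have "0 < (2::nat) ^ w" by simp
  ultimately show ?thesis by (simp add: implements_def bounded_def)
qed

text \<open>\<open>attained\<close> gives the upper bound
  \<open>estimate s \<le> ST_diameter I\<close>, with \<open>y = BIG\<close> only for an unreachable
  pair, and \<open>good\<close> gives the factor 2; an infinite estimate meets the latter bound
  trivially.\<close>

lemma approximates_estimate:
  assumes y: "regs s 0 = y" "regs s 1 = of_bool (y < vertex_count I * inst_weight I + 1)"
    and at: "B.attained y" and gd: "B.good y"
  shows "approximates 2 (ST_diameter I) (estimate s)"
proof -
  let ?B = "vertex_count I * inst_weight I + 1"
  note st = source_target[OF valid]
  have est: "estimate s = (if y < ?B then ereal (real y) else \<infinity>)"
    using y by (simp add: estimate_def)
  obtain s0 t0 where s0: "s0 \<in> source_set I" "t0 \<in> target_set I" using st by blast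
  have upper: "estimate s \<le> ST_diameter I"
  proof -
    consider "y = 0" | u t where "u < vertex_count I" "t < vertex_count I" "u \<in> source_set I"
      "t \<notin> source_set I" "\<forall>c. inst_wk I u t c \<longrightarrow> y \<le> c \<and> y < ?B"
      using at unfolding B.attained_def by blast
    then show ?thesis
    proof cases
      case 1
      have "0 \<le> distance I s0 t0" by (rule distance_ge[OF valid]) simp
      also have "\<dots> \<le> ST_diameter I" by (rule distance_le_ST_diameter[OF valid s0])
      finally show ?thesis using 1 est by (simp add: zero_ereal_def)
    next
      case 2
      have "estimate s \<le> distance I u t" by (rule distance_ge[OF valid]) (use 2 est in auto)
      then show ?thesis using distance_le_ST_diameter[OF valid 2(3), of t] 2 st by (simp add: order_trans)
    qed
  qed
  have lower: "ST_diameter I / ereal 2 \<le> estimate s"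
  proof (cases "y < ?B")
    case True
    have "ST_diameter I \<le> ereal (2 * real y)"
    proof (rule ST_diameter_le[OF valid])
      fix s t assume s: "s \<in> source_set I" and t: "t \<in> target_set I"
      then obtain c where c: "c \<le> 2 * y" "inst_wk I s t c"
        using gd True st unfolding B.good_def by blast
      have "distance I s t \<le> ereal (real c)"
        by (rule distance_le[OF valid c(2)]) (use s st in auto)
      also have "\<dots> \<le> ereal (2 * real y)" using c(1) by simp
      finally show "distance I s t \<le> ereal (2 * real y)" .
    qed
    then show ?thesis using True est by (cases "ST_diameter I") auto
  qed (simp add: est)
  show ?thesis unfolding approximates_def using upper lower by simp
qed

lemma no_arcs_infinite:
  assumes "B.es = []"
  shows "ST_diameter I = \<infinity>"
proof -
  note st = source_target[OF valid]
  obtain s0 t0 where s0: "s0 \<in> source_set I" "t0 \<in> target_set I" using st by blast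
  have "\<not> inst_wk I s0 t0 c" for c
  proof
    assume "inst_wk I s0 t0 c"
    then obtain e where "e < edge_count I" "arc_tail I e \<in> source_set I" "arc_head I e \<notin> source_set I"
      using B.crossing_arc[of s0 t0 c] s0 st by auto
    then show False using B.es_complete assms by fastforce
  qed
  then show ?thesis using ST_diameter_infinite[OF valid s0] by blast
qed

abbreviation total_time :: nat where
  "total_time \<equiv> step_cost setup_prog * (B.setup_time + 4) + (5 * (num_samples * num_bits) + 1) +
     step_cost main_prog * (B.main_time (csqrt_nat (edge_count I)) num_samples num_bits + 2)"

text \<open>The final state is a function \<open>fin\<close> of the flips, obtained by choice from
  the halting runs for the individual bit lists. Halting is therefore certain, and the event of
  success can be discussed as a set of lists.\<close>

lemma run_diameter_prog:
  assumes T: "total_time \<le> T"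
  obtains k fin where
    "run w T (init_config diameter_prog (encode_instance I)) =
      map_pmf (\<lambda>bs. ([], fin bs)) (replicate_pmf k (bernoulli_pmf (1 / 2)))"
    "\<And>bs. B.es = [] \<Longrightarrow> length bs = k \<Longrightarrow> approximates 2 (ST_diameter I) (estimate (fin bs))"
    "B.es \<noteq> [] \<Longrightarrow> k = num_samples * num_bits"
    "\<And>bs. B.es \<noteq> [] \<Longrightarrow> length bs = k \<Longrightarrow>
      B.hit (csqrt_nat (edge_count I)) num_samples (B.sample_at (\<lambda>i. of_bool (bs ! i)) num_bits) \<Longrightarrow>
      approximates 2 (ST_diameter I) (estimate (fin bs))"
proof -
  let ?n = "vertex_count I" and ?m = "edge_count I" and ?M = "inst_mem I" and ?L = "(2::nat) ^ w"
  let ?z = "2 + 3 * ?m + ?n" and ?q = "csqrt_nat (edge_count I)"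
  let ?s0 = "\<lparr>regs = (\<lambda>_. 0), mem = ?M\<rparr>"
  let ?B = "?n * inst_weight I + 1"
  let ?R = "(\<lambda>_ :: nat. 0 :: nat)(30 := ?n, 29 := ?m)"
  have w1: "1 < ?L" using room_bounds(4) sizes(3) by simp
  let ?Q = "\<lambda>t R' M'. \<exists>l. B.base ?q num_samples l R' \<and> R' 27 = 0 \<and> R' 0 = 0 \<and>
      R' 26 = of_bool (B.es \<noteq> []) \<and> (B.es = [] \<longrightarrow> R' 1 = 0) \<and>
      (B.es \<noteq> [] \<longrightarrow> l = num_bits \<and> R' 1 = num_samples * l \<and> R' 3 = cell ?z 10 0 \<and> R' 4 = 16 \<and> R' 5 = 1) \<and>
      keep (cols ?z {4, 5, 6, 7, 8}) ?M M' \<and> B.inp M' \<and> t \<le> B.setup_time + 4"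
  have body: "wp ?L setup_body (\<lambda>t R' M'. ?Q (Suc (Suc (Suc t))) R' M') ?R ?M"
  proof (rule B.wp_setup_body[OF _ raw_inst_mem inst_weight_def])
    show "?R x = (if x = 30 then ?n else if x = 29 then ?m else 0)" for x :: nat by simp
    show "num_samples \<le> inst_size I ^ 4" "?m * ?m \<le> inst_size I ^ 4" "2 * ?m \<le> inst_size I ^ 4"
      "num_samples * num_bits \<le> inst_size I ^ 4" using sample_bounds by auto
  next
    fix t :: nat and R' M' and l :: nat
    assume a: "B.base ?q num_samples l R'" "R' 27 = 0" "R' 0 = 0" "R' 26 = of_bool (B.es \<noteq> [])"
      "B.es = [] \<Longrightarrow> R' 1 = 0"
      "B.es \<noteq> [] \<Longrightarrow> l = num_bits \<and> R' 1 = num_samples * l \<and> R' 3 = cell ?z 10 0 \<and> R' 4 = 16 \<and> R' 5 = 1"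
      "keep (cols ?z {4, 5, 6, 7, 8}) ?M M'" "B.inp M'" "t \<le> B.setup_time"
    have "Suc (Suc (Suc t)) \<le> B.setup_time + 4" using a(9) by linarith
    then show "?Q (Suc (Suc (Suc t))) R' M'" using a(1-8) by blast
  qed
  have m0: "?M 0 = ?n" "?M (Suc 0) = ?m" using inst_mem_nth(1,2)[of I] by auto
  have sl: "2 * ?m < ?L" using B.small_L(1) by simp
  have "wp ?L setup_prog ?Q (\<lambda>_. 0) ?M"
    using body few w1 sl m0 room_bounds(4) sizes(3) unfolding setup_prog_def
    by (simp add: wp_Seq wp_Asg wp_Cond)
  then obtain t1 R1 M1 k1 s1 where 1: "?Q t1 R1 M1" "k1 \<le> step_cost setup_prog * t1"
    "steps w k1 (compile 32 setup_prog @ fill # compile 32 main_prog, ?s0) (fill # compile 32 main_prog, s1)"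
    "implements w 32 max_depth s1 R1 M1"
    by (rule compile_wp[OF _ implements_init w1 regs_below_setup, where D = max_depth and cs = "fill # compile 32 main_prog"])
      (simp only: max_depth_def max.cobounded1, assumption)
  obtain l where l: "B.base ?q num_samples l R1" "R1 27 = 0" "R1 0 = 0" "R1 26 = of_bool (B.es \<noteq> [])"
    "B.es = [] \<longrightarrow> R1 1 = 0"
    "B.es \<noteq> [] \<longrightarrow> l = num_bits \<and> R1 1 = num_samples * l \<and> R1 3 = cell ?z 10 0 \<and> R1 4 = 16 \<and> R1 5 = 1"
    "keep (cols ?z {4, 5, 6, 7, 8}) ?M M1" "B.inp M1" "t1 \<le> B.setup_time + 4"
    using 1(1) by blast
  have s1: "regs s1 r = R1 r" if "r < 32" for r using 1(4) that by (simp add: implements_def)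
  have mem1: "mem s1 = M1" using 1(4) by (simp add: implements_def)
  define k where "k = R1 1"
  have r1: "regs s1 1 = k" using s1 by (simp add: k_def)
  have k_es: "B.es \<noteq> []" if "0 < k" using that l(5) by (auto simp: k_def)
  have kX: "k \<le> inst_size I ^ 4" using l(5,6) sample_bounds(3) by (cases "B.es = []") (auto simp: k_def)
  have fillroom: "cell ?z 10 0 + 16 * k < ?L" "k < ?L"
    using B.room_X kX unfolding cell_def distrib_left by linarith+
  have fillable: "0 < k \<Longrightarrow> regs s1 4 = 16 \<and> regs s1 5 = 1 \<and> regs s1 3 + 16 * k < ?L \<and> k < ?L"
    using k_es l(6) s1 fillroom by simp
  have k_eq: "B.es \<noteq> [] \<Longrightarrow> k = num_samples * num_bits" using l(6) by (simp add: k_def)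
  have k0: "B.es = [] \<Longrightarrow> k = 0" using l(5) by (simp add: k_def)
  have phase3: "\<exists>s3 k3. k3 \<le> step_cost main_prog * (B.main_time ?q num_samples num_bits + 2) \<and>
      steps w k3 (compile 32 main_prog, fold fill_step bs s1) ([], s3) \<and>
      (B.es = [] \<longrightarrow> approximates 2 (ST_diameter I) (estimate s3)) \<and>
      (B.es \<noteq> [] \<longrightarrow>
        B.hit ?q num_samples (B.sample_at (\<lambda>i. of_bool (bs ! i)) num_bits) \<longrightarrow>
        approximates 2 (ST_diameter I) (estimate s3))" if bs: "length bs = k" for bs
  proof -
    let ?s2 = "fold fill_step bs s1"
    \<comment> \<open>Below 32 the valuation must match the machine after the flips; above, nothing
      is compared, and the old values are kept because they are known to be bounded.\<close>
    define R2 where "R2 r = (if r < 32 then regs ?s2 r else R1 r)" for r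
    have regs2: "regs ?s2 r = regs s1 r" if "r \<notin> {1, 2, 3}" for r
      using fold_fill_step_regs(1)[OF that] .
    have R2: "R2 r = R1 r" if "r \<notin> {1, 2, 3}" for r using regs2[OF that] s1 by (simp add: R2_def)
    have m2: "mem ?s2 x < ?L" for x
    proof (cases "\<exists>i<length bs. x = regs s1 3 + 16 * i")
      case True
      then obtain i where "i < length bs" "x = regs s1 3 + 16 * i" by blast
      then show ?thesis using fold_fill_step_mem_nth[of i bs s1] w1 by simp
    next
      case False
      then have "mem ?s2 x = mem s1 x" by (intro fold_fill_step_mem) auto
      then show ?thesis using 1(4) by (simp add: implements_def bounded_def)
    qed
    have rb: "regs ?s2 r < ?L" for r
    proof -
      have a: "regs s1 r < ?L" for r using 1(4) by (simp add: implements_def)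
      consider "r \<notin> {1, 2, 3}" | "r = 1" | "r = 2" | "r = 3" by auto
      then show ?thesis
      proof cases
        case 2
        show ?thesis unfolding 2 fold_fill_step_regs(2) using a[of 1] by linarith
      next
        case 3
        show ?thesis unfolding 3 using fold_fill_step_regs_2[of bs s1] a[of 2] w1 by linarith
      next
        case 4
        show ?thesis
        proof (cases "0 < k")
          case True
          then show ?thesis using fold_fill_step_regs(3)[of bs s1] fillable bs 4 by simp
        next
          case False
          then show ?thesis using bs a 4 by simp
        qed
      qed (use regs2 a in simp)
    qed
    have imp: "implements w 32 max_depth ?s2 R2 (mem ?s2)"
      unfolding implements_def bounded_def
    proof (intro conjI allI impI)
      show "regs ?s2 r < ?L" "mem ?s2 r < ?L" for r using rb m2 by auto
      show "R2 r < ?L" for r using rb 1(4) by (auto simp: R2_def implements_def bounded_def)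
      show "regs ?s2 r = R2 r" if "r < 32" for r using that by (simp add: R2_def)
      show "regs ?s2 r = 0" if "32 + max_depth \<le> r" for r
        using regs2[of r] 1(4) that by (simp add: implements_def)
    qed simp
    show ?thesis
    proof (cases "B.es = []")
      case True
      have "wp ?L main_prog (\<lambda>t R' M'. R' 0 = 0 \<and> R' 1 = 0 \<and> t \<le> 2) R2 (mem ?s2)"
        using R2[of 26] R2[of 0] l(3,4) True k0[OF True] r1 bs w1
        by (simp add: main_prog_def wp_simps R2_def)
      then obtain t R' M' k3 s3 where 3: "R' 0 = 0 \<and> R' 1 = 0 \<and> t \<le> 2"
        "k3 \<le> step_cost main_prog * t" "steps w k3 (compile 32 main_prog @ [], ?s2) ([], s3)"
        "implements w 32 max_depth s3 R' M'"
        by (rule compile_wp[OF _ imp w1 regs_below_main, where cs = "[]"])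
          (simp only: max_depth_def max.cobounded2, assumption)
      have "regs s3 1 = 0" using 3(1,4) by (simp add: implements_def)
      then have "approximates 2 (ST_diameter I) (estimate s3)"
        using no_arcs_infinite[OF True] approximates_infinite[of 2] by (simp add: estimate_def)
      moreover have "k3 \<le> step_cost main_prog * (B.main_time ?q num_samples num_bits + 2)"
        by (rule order_trans[OF 3(2)], rule mult_le_mono2) (use 3(1) in simp)
      ultimately show ?thesis using 3(3) True by (intro exI[of _ s3] exI[of _ k3]) simp
    next
      case False
      have lb: "l = num_bits" "R1 3 = cell ?z 10 0" using l(6) False by auto
      have bits: "mem ?s2 (cell ?z 10 i) = of_bool (bs ! i)" if "i < k" for i
        using fold_fill_step_mem_nth[of i bs s1] that bs lb(2) s1[of 3] by (simp add: cell_def algebra_simps)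
      have kM: "keep (cols ?z {10}) M1 (mem ?s2)"
        unfolding keep_def
      proof (intro allI impI)
        fix x assume x: "x \<notin> cols ?z {10}"
        have "x \<noteq> regs s1 3 + 16 * i" for i
        proof
          assume "x = regs s1 3 + 16 * i"
          then have "x = cell ?z 10 i" using lb(2) s1[of 3] by (simp add: cell_def algebra_simps)
          then show False using x by (auto simp: cols_def)
        qed
        then show "mem ?s2 x = M1 x" using fold_fill_step_mem[of bs x s1] mem1 by simp
      qed
      have inp2: "B.inp (mem ?s2)"
      proof -
        have low: "mem ?s2 x = M1 x" if "x < ?z" for x using keepD[OF kM] that by simp
        have c: "mem ?s2 (cell ?z c i) = M1 (cell ?z c i)" if "c \<in> {4, 5, 6, 7, 8}" for c i
          using keepD[OF kM] that by auto
        have "mem ?s2 (2 + 3 * ?m + v) = M1 (2 + 3 * ?m + v)" if "v < ?n" for v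
          using low that by simp
        moreover have "mem ?s2 (2 + 3 * e) = M1 (2 + 3 * e)" "mem ?s2 (3 + 3 * e) = M1 (3 + 3 * e)"
          "mem ?s2 (4 + 3 * e) = M1 (4 + 3 * e)" if "e < ?m" for e
          using low that two_vertices by simp_all
        ultimately show ?thesis
          using l(8) c unfolding B.inp_def B.fwd.graph_in_def B.bwd.graph_in_def by simp
      qed
      have b2: "B.base ?q num_samples num_bits R2"
        using l(1) R2 unfolding lb(1) B.base_def by simp
      have clear: "mem ?s2 (cell ?z 3 v) = 0" for v
        using keepD[OF kM, of "cell ?z 3 v"] keepD[OF l(7), of "cell ?z 3 v"] B.raw_cell[OF raw_inst_mem, of 3 v]
        by simp
      have src: "\<exists>s<?n. s \<in> source_set I" using source_target[OF valid] by auto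
      let ?al = "B.sample_at (\<lambda>i. mem ?s2 (cell ?z 10 i)) num_bits"
      let ?al' = "B.sample_at (\<lambda>i. of_bool (bs ! i)) num_bits"
      \<comment> \<open>\<open>bs ! i\<close> is unspecified beyond the end of \<open>bs\<close>, so
        the two ways of reading the flips agree only on the blocks that are really sampled;
        \<open>hit\<close> looks at no others.\<close>
      have al: "?al i = ?al' i" if "i < num_samples" for i
      proof -
        have "i * num_bits + j < k" if "j < num_bits" for j
        proof -
          have "Suc i * num_bits \<le> num_samples * num_bits" using \<open>i < num_samples\<close> by (intro mult_right_mono) auto
          then show ?thesis using that k_eq[OF False] by simp
        qed
        then have "bitsval (\<lambda>i. mem ?s2 (cell ?z 10 i)) (i * num_bits) num_bits =
            bitsval (\<lambda>i. of_bool (bs ! i)) (i * num_bits) num_bits"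
          by (intro bitsval_cong bits)
        then show ?thesis by (simp add: B.sample_at_def)
      qed
      have hit: "B.hit ?q num_samples ?al" if "B.hit ?q num_samples ?al'"
        using that al unfolding B.hit_def by simp
      have "wp ?L main_body (\<lambda>t R' M'. \<exists>y. R' 0 = y \<and> R' 1 = of_bool (y < ?B) \<and> B.attained y \<and>
          (B.hit ?q num_samples ?al \<longrightarrow> B.good y) \<and> Suc t \<le> B.main_time ?q num_samples num_bits + 2) R2 (mem ?s2)"
      proof (rule B.wp_main_body[OF b2 _ inp2 False src _ sample_bounds(3,4,5) two_pow_bits clear])
        show "R2 27 = 0" using R2 l(2) by simp
        show "mem ?s2 (cell ?z 10 i) \<le> 1" if "i < num_samples * num_bits" for i
          using bits that k_eq[OF False] by simp
      next
        fix t :: nat and R' M' :: "nat \<Rightarrow> nat" and y :: nat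
        assume "R' 0 = y" "R' 1 = of_bool (y < ?B)" "y \<le> ?B" "B.attained y"
          "B.hit ?q num_samples ?al \<Longrightarrow> B.good y" "t \<le> B.main_time ?q num_samples num_bits"
        then show "\<exists>y. R' 0 = y \<and> R' 1 = of_bool (y < ?B) \<and> B.attained y \<and>
          (B.hit ?q num_samples ?al \<longrightarrow> B.good y) \<and> Suc t \<le> B.main_time ?q num_samples num_bits + 2"
          by (intro exI[of _ y] conjI impI) (assumption | linarith)+
      qed
      then have "wp ?L main_prog (\<lambda>t R' M'. \<exists>y. R' 0 = y \<and> R' 1 = of_bool (y < ?B) \<and> B.attained y \<and>
          (B.hit ?q num_samples ?al \<longrightarrow> B.good y) \<and> t \<le> B.main_time ?q num_samples num_bits + 2) R2 (mem ?s2)"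
        using R2[of 26] l(4) False unfolding main_prog_def wp_Cond by simp
      then obtain t R' M' k3 s3 where 3: "\<exists>y. R' 0 = y \<and> R' 1 = of_bool (y < ?B) \<and> B.attained y \<and>
          (B.hit ?q num_samples ?al \<longrightarrow> B.good y) \<and> t \<le> B.main_time ?q num_samples num_bits + 2"
        "k3 \<le> step_cost main_prog * t" "steps w k3 (compile 32 main_prog @ [], ?s2) ([], s3)"
        "implements w 32 max_depth s3 R' M'"
        by (rule compile_wp[OF _ imp w1 regs_below_main, where cs = "[]"])
          (simp only: max_depth_def max.cobounded2, assumption)
      obtain y where y: "R' 0 = y" "R' 1 = of_bool (y < ?B)" "B.attained y"
        "B.hit ?q num_samples ?al \<longrightarrow> B.good y" "t \<le> B.main_time ?q num_samples num_bits + 2"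
        using 3(1) by blast
      have s3: "regs s3 0 = y" "regs s3 1 = of_bool (y < ?B)" using 3(4) y by (simp_all add: implements_def)
      have "approximates 2 (ST_diameter I) (estimate s3)" if "B.hit ?q num_samples ?al'"
        using approximates_estimate[OF s3 y(3)] y(4) hit[OF that] by blast
      moreover have "k3 \<le> step_cost main_prog * (B.main_time ?q num_samples num_bits + 2)"
        by (rule order_trans[OF 3(2)], rule mult_le_mono2) (rule y(5))
      ultimately show ?thesis using 3(3) False by (intro exI[of _ s3] exI[of _ k3]) simp
    qed
  qed
  then obtain fin where fin: "\<And>bs. length bs = k \<Longrightarrow>
      (\<exists>k3\<le>step_cost main_prog * (B.main_time ?q num_samples num_bits + 2).
        steps w k3 (compile 32 main_prog, fold fill_step bs s1) ([], fin bs)) \<and>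
      (B.es = [] \<longrightarrow> approximates 2 (ST_diameter I) (estimate (fin bs))) \<and>
      (B.es \<noteq> [] \<longrightarrow>
        B.hit ?q num_samples (B.sample_at (\<lambda>i. of_bool (bs ! i)) num_bits) \<longrightarrow>
        approximates 2 (ST_diameter I) (estimate (fin bs)))"
    by metis
  have kk: "k \<le> num_samples * num_bits" using k_eq k0 by (cases "B.es = []") auto
  have "k1 \<le> step_cost setup_prog * (B.setup_time + 4)"
    by (rule order_trans[OF 1(2)], rule mult_le_mono2) (rule l(9))
  then have time: "k1 + (5 * k + 1) + step_cost main_prog * (B.main_time ?q num_samples num_bits + 2) \<le> T"
    using T kk by linarith
  have init: "init_config diameter_prog (encode_instance I) = (compile 32 setup_prog @ fill # compile 32 main_prog, ?s0)"
    unfolding init_config_def diameter_prog_def inst_mem_def ..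
  show ?thesis
  proof (rule that[of fin k])
    show "run w T (init_config diameter_prog (encode_instance I)) =
      map_pmf (\<lambda>bs. ([], fin bs)) (replicate_pmf k (bernoulli_pmf (1 / 2)))"
      unfolding init by (rule run_three_phases[OF 1(3) r1 fillable _ time]) (use fin in blast)+
  qed (use fin k_eq in blast)+
qed

end

section \<open>Success probability\<close>

lemma replicate_coin:
  "replicate_pmf n (bernoulli_pmf (1 / 2)) = pmf_of_set {bs :: bool list. length bs = n}"
proof -
  have fin: "finite {bs :: bool list. length bs = n}" "card {bs :: bool list. length bs = n} = 2 ^ n" for n
    using finite_lists_length_eq[of "UNIV :: bool set" n] card_lists_length_eq[of "UNIV :: bool set" n]
    by simp_all
  have ne: "{bs :: bool list. length bs = n} \<noteq> {}" for n by (auto intro: Ex_list_of_length)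
  have "pmf (replicate_pmf n (bernoulli_pmf (1 / 2))) bs = (if length bs = n then (1 / 2) ^ n else 0)" for bs
  proof (induction n arbitrary: bs)
    case 0
    then show ?case by (auto simp: pmf_return)
  next
    case (Suc n)
    have r: "replicate_pmf (Suc n) (bernoulli_pmf (1 / 2)) =
        map_pmf (\<lambda>(x, xs). x # xs) (pair_pmf (bernoulli_pmf (1 / 2)) (replicate_pmf n (bernoulli_pmf (1 / 2))))"
      by (simp add: pair_pmf_def map_bind_pmf map_pmf_def bind_assoc_pmf bind_return_pmf)
    show ?case
    proof (cases bs)
      case Nil
      then have "bs \<notin> set_pmf (replicate_pmf (Suc n) (bernoulli_pmf (1 / 2)))"
        by (simp add: set_replicate_pmf del: replicate_pmf.simps)
      then show ?thesis using Nil by (simp add: set_pmf_iff del: replicate_pmf.simps)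
    next
      case (Cons b bs')
      have "inj (\<lambda>(x :: bool, xs). x # xs)" by (auto simp: inj_on_def)
      from pmf_map_inj'[OF this, of _ "(b, bs')"] show ?thesis
        unfolding r Cons using Suc by (cases b) (simp_all add: pmf_pair)
    qed
  qed
  then show ?thesis
    by (intro pmf_eqI) (simp add: pmf_of_set[OF ne fin(1)] fin(2) power_one_over indicator_def)
qed

section \<open>Counting bit lists: blocks, residues and missed targets\<close>

definition bits_of :: "bool list \<Rightarrow> nat \<Rightarrow> nat" where
  "bits_of bs i = of_bool (bs ! i)"

definition bits_value :: "bool list \<Rightarrow> nat" where
  "bits_value bs = bitsval (bits_of bs) 0 (length bs)"

lemma bits_value_snoc: "bits_value (xs @ [b]) = 2 * bits_value xs + of_bool b"
proof -
  have "bitsval (bits_of (xs @ [b])) 0 (length xs) = bitsval (bits_of xs) 0 (length xs)"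
    by (rule bitsval_cong) (simp add: bits_of_def nth_append)
  then show ?thesis by (simp add: bits_value_def) (simp add: bits_of_def)
qed

lemma bits_value_inj: "length xs = length ys \<Longrightarrow> bits_value xs = bits_value ys \<Longrightarrow> xs = ys"
proof (induction xs arbitrary: ys rule: rev_induct)
  case (snoc b xs)
  then obtain ys' c where ys: "ys = ys' @ [c]" by (cases ys rule: rev_cases) auto
  have e: "2 * bits_value xs + of_bool b = 2 * bits_value ys' + of_bool c"
    using snoc.prems(2) unfolding ys bits_value_snoc .
  then have "(2 * bits_value xs + of_bool b) mod 2 = (2 * bits_value ys' + of_bool c) mod 2" by simp
  then have "b = c" by (cases b; cases c) auto
  then show ?case using snoc e ys by auto
qed simp

lemma bits_value_bij: "bij_betw bits_value {bs. length bs = l} {..<2 ^ l}"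
proof -
  have inj: "inj_on bits_value {bs. length bs = l}" using bits_value_inj by (auto simp: inj_on_def)
  have sub: "bits_value ` {bs. length bs = l} \<subseteq> {..<2 ^ l}"
    unfolding bits_value_def by (auto intro!: bitsval_less simp: bits_of_def)
  have "card (bits_value ` {bs. length bs = l}) = card {bs :: bool list. length bs = l}"
    using inj by (rule card_image)
  also have "\<dots> = card {..<2 ^ l :: nat}"
    using card_lists_length_eq[of "UNIV :: bool set" l] by simp
  finally have "bits_value ` {bs. length bs = l} = {..<2 ^ l}" using sub by (intro card_subset_eq) auto
  then show ?thesis using inj by (simp add: bij_betw_def)
qed

lemma card_block:
  assumes "V \<subseteq> {..<2 ^ l}"
  shows "card {bs. length bs = l \<and> bits_value bs \<notin> V} = 2 ^ l - card V"
proof -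
  have "bij_betw bits_value {bs. length bs = l \<and> bits_value bs \<notin> V} ({..<2 ^ l} - V)"
    using bits_value_bij[of l] unfolding bij_betw_def by (auto simp: inj_on_def)
  then have "card {bs. length bs = l \<and> bits_value bs \<notin> V} = card ({..<2 ^ l} - V)"
    by (rule bij_betw_same_card)
  also have "\<dots> = 2 ^ l - card V"
    using assms by (subst card_Diff_subset) (auto intro: finite_subset)
  finally show ?thesis .
qed

text \<open>Independence of the samples in counting form: cutting off the first \<open>l\<close>
  bits is a bijection onto pairs of a block and a shorter list, and conditions on different blocks
  do not interact.\<close>

lemma card_blocks:
  "card {bs. length bs = r * l \<and> (\<forall>i<r. bitsval (bits_of bs) (i * l) l \<notin> V)} =
    card {bs. length bs = l \<and> bits_value bs \<notin> V} ^ r"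
proof (induction r)
  case 0
  have "{bs :: bool list. bs = []} = {[]}" by auto
  then show ?case by simp
next
  case (Suc r)
  let ?A = "{bs. length bs = l \<and> bits_value bs \<notin> V}"
  let ?B = "\<lambda>r. {bs. length bs = r * l \<and> (\<forall>i<r. bitsval (bits_of bs) (i * l) l \<notin> V)}"
  have first: "bitsval (bits_of (xs @ ys)) 0 l = bits_value xs" if "length xs = l" for xs ys
    unfolding bits_value_def that by (rule bitsval_cong) (simp add: bits_of_def nth_append that)
  have rest: "bitsval (bits_of (xs @ ys)) (Suc i * l) l = bitsval (bits_of ys) (i * l) l"
    if "length xs = l" for xs ys i
  proof -
    have "bitsval (bits_of (xs @ ys)) (l + p) j = bitsval (bits_of ys) p j" for p j
      by (induction j) (auto simp: bits_of_def nth_append that)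
    then show ?thesis by simp
  qed
  have "bij_betw (\<lambda>(xs, ys). xs @ ys) (?A \<times> ?B r) (?B (Suc r))"
    unfolding bij_betw_def
  proof
    show "inj_on (\<lambda>(xs, ys). xs @ ys) (?A \<times> ?B r)" by (auto simp: inj_on_def)
    show "(\<lambda>(xs, ys). xs @ ys) ` (?A \<times> ?B r) = ?B (Suc r)"
    proof (intro set_eqI iffI)
      fix bs assume "bs \<in> (\<lambda>(xs, ys). xs @ ys) ` (?A \<times> ?B r)"
      then obtain xs ys where b: "bs = xs @ ys" "xs \<in> ?A" "ys \<in> ?B r" by auto
      have "bitsval (bits_of bs) (i * l) l \<notin> V" if "i < Suc r" for i
        using b first[of xs ys] rest[of xs ys "i - 1"] that by (cases i) auto
      then show "bs \<in> ?B (Suc r)" using b by auto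
    next
      fix bs assume bs: "bs \<in> ?B (Suc r)"
      let ?x = "take l bs" and ?y = "drop l bs"
      have x: "length ?x = l" "?x @ ?y = bs" "length ?y = r * l" using bs by auto
      have all: "bitsval (bits_of bs) (i * l) l \<notin> V" if "i < Suc r" for i using bs that by blast
      have "bits_value ?x \<notin> V" using first[OF x(1), of ?y] all[of 0] unfolding x(2) by simp
      moreover have "bitsval (bits_of ?y) (i * l) l \<notin> V" if "i < r" for i
        using rest[OF x(1), of ?y i] all[of "Suc i"] that unfolding x(2) by simp
      ultimately have "(?x, ?y) \<in> ?A \<times> ?B r" using x by auto
      then show "bs \<in> (\<lambda>(xs, ys). xs @ ys) ` (?A \<times> ?B r)"
        by (rule rev_image_eqI) (simp only: prod.case x(2))
    qed
  qed
  then have "card (?A \<times> ?B r) = card (?B (Suc r))" by (rule bij_betw_same_card)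
  then have "card (?B (Suc r)) = card (?A \<times> ?B r)" by (rule sym)
  then show ?case using Suc.IH by (simp add: card_cartesian_product)
qed

text \<open>Every residue in \<open>B\<close> is met once in each of the \<open>N div K\<close>
  complete periods below \<open>N\<close>.\<close>

lemma card_residues:
  assumes "B \<subseteq> {..<K}" "0 < K"
  shows "card B * (N div K) \<le> card {v. v < N \<and> v mod K \<in> B}"
proof -
  let ?f = "\<lambda>(x, j). j * K + x"
  have inj: "inj_on ?f (B \<times> {..<N div K})"
  proof (rule inj_onI, clarify)
    fix x j x' j' assume a: "x \<in> B" "x' \<in> B" "j * K + x = j' * K + x'"
    then have "x < K" "x' < K" using assms by auto
    then have "(j * K + x) mod K = x" "(j' * K + x') mod K = x'" by auto
    then have "x = x'" using a(3) by metis
    then show "x = x' \<and> j = j'" using a(3) assms(2) by simp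
  qed
  have "?f ` (B \<times> {..<N div K}) \<subseteq> {v. v < N \<and> v mod K \<in> B}"
  proof
    fix v assume "v \<in> ?f ` (B \<times> {..<N div K})"
    then obtain x j where a: "x \<in> B" "j \<in> {..<N div K}" and v: "v = j * K + x" by auto
    then have x: "x < K" and j: "Suc j \<le> N div K" using assms by auto
    have "j * K + x < Suc j * K" using x by simp
    also have "\<dots> \<le> N div K * K" using j by (rule mult_right_mono) simp
    also have "\<dots> \<le> N" by simp
    finally show "v \<in> {v. v < N \<and> v mod K \<in> B}" using x a v by simp
  qed
  then have "card (?f ` (B \<times> {..<N div K})) \<le> card {v. v < N \<and> v mod K \<in> B}"
    by (intro card_mono) auto
  then show ?thesis using card_image[OF inj] by (simp add: card_cartesian_product)
qed

text \<open>A block hits \<open>B\<close> with probability at least \<open>card B / (2 * K)\<close>;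
  the powers for \<open>r\<close> blocks are bounded by
  \<open>1 - x \<le> exp (- x)\<close>.\<close>

lemma prob_miss:
  assumes B: "B \<subseteq> {..<K}" and K: "0 < K" "K \<le> 2 ^ l"
  shows "measure_pmf.prob (replicate_pmf (r * l) (bernoulli_pmf (1 / 2)))
      {bs. \<forall>i<r. bitsval (bits_of bs) (i * l) l mod K \<notin> B} \<le> exp (- (real (card B) * real r / (2 * real K)))"
proof -
  let ?V = "{v. v < 2 ^ l \<and> v mod K \<in> B}" and ?N = "(2::nat) ^ l"
  let ?L = "{bs :: bool list. length bs = r * l}"
  have less: "bitsval (bits_of bs) p l < 2 ^ l" for bs p
    by (rule bitsval_less) (simp add: bits_of_def)
  have L: "finite ?L" "card ?L = 2 ^ (r * l)"
    using finite_lists_length_eq[of "UNIV :: bool set" "r * l"] card_lists_length_eq[of "UNIV :: bool set" "r * l"]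
    by simp_all
  have ne: "?L \<noteq> {}" by (auto intro: Ex_list_of_length)
  have sets: "?L \<inter> {bs. \<forall>i<r. bitsval (bits_of bs) (i * l) l mod K \<notin> B} =
      {bs. length bs = r * l \<and> (\<forall>i<r. bitsval (bits_of bs) (i * l) l \<notin> ?V)}"
    using less by auto
  have cV: "card ?V \<le> ?N" using card_mono[of "{..<?N}" ?V] by auto
  have "measure_pmf.prob (replicate_pmf (r * l) (bernoulli_pmf (1 / 2)))
      {bs. \<forall>i<r. bitsval (bits_of bs) (i * l) l mod K \<notin> B} = real ((?N - card ?V) ^ r) / real (2 ^ (r * l))"
    unfolding replicate_coin measure_pmf_of_set[OF ne L(1)] sets card_blocks L(2)
    by (subst card_block) auto
  also have "\<dots> = ((real ?N - real (card ?V)) / real ?N) ^ r"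
    using cV by (simp add: power_divide power_mult[symmetric] mult.commute of_nat_diff)
  also have "\<dots> = (1 - real (card ?V) / real ?N) ^ r" by (simp add: diff_divide_distrib)
  also have "\<dots> \<le> (1 - real (card B) / (2 * real K)) ^ r"
  proof (rule power_mono)
    have d: "1 \<le> ?N div K" using K by (simp add: Suc_le_eq div_greater_zero_iff)
    \<comment> \<open>Dropping the incomplete last period loses less than half of all values, since
      \<open>K \<le> 2 ^ l\<close> guarantees at least one complete period. This is the origin of
      the factor 2.\<close>
    have "?N < K * (?N div K) + K" using K(1) by (metis add_less_cancel_left mod_less_divisor mult_div_mod_eq)
    also have "\<dots> \<le> 2 * K * (?N div K)" using d by (simp add: algebra_simps)
    finally have "real ?N \<le> 2 * real K * real (?N div K)"
      by (metis less_imp_le of_nat_le_iff of_nat_mult of_nat_numeral)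
    then have "real (card B) * real ?N \<le> real (card B) * (2 * real K * real (?N div K))"
      by (intro mult_left_mono) auto
    also have "\<dots> = 2 * real K * real (card B * (?N div K))" by simp
    also have "\<dots> \<le> 2 * real K * real (card ?V)"
      using card_residues[OF B K(1), of ?N] by (intro mult_left_mono) (auto simp del: of_nat_mult)
    finally show "1 - real (card ?V) / real ?N \<le> 1 - real (card B) / (2 * real K)"
      using K by (simp add: field_simps)
    show "0 \<le> 1 - real (card ?V) / real ?N" using cV by (simp add: field_simps)
  qed
  also have "\<dots> \<le> exp (- (real (card B) / (2 * real K))) ^ r"
  proof (rule power_mono)
    show "1 - real (card B) / (2 * real K) \<le> exp (- (real (card B) / (2 * real K)))"
      using exp_ge_add_one_self[of "- (real (card B) / (2 * real K))"] by simp
    have "card B \<le> K" using card_mono[of "{..<K}" B] B by simp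
    then show "0 \<le> 1 - real (card B) / (2 * real K)" using K by (simp add: field_simps)
  qed
  also have "\<dots> = exp (- (real (card B) * real r / (2 * real K)))"
    by (simp add: exp_of_nat_mult[symmetric] mult.commute)
  finally show ?thesis .
qed

text \<open>Provides \<open>k\<close> elements of least \<open>f\<close>-value with ties broken
  arbitrarily, without sorting; applied to the edges nearest to a given source.\<close>

lemma smallest_subset:
  fixes f :: "nat \<Rightarrow> nat"
  assumes "finite A" "k \<le> card A"
  shows "\<exists>B\<subseteq>A. card B = k \<and> (\<forall>x\<in>B. \<forall>y\<in>A - B. f x \<le> f y)"
  using assms(2)
proof (induction k)
  case 0
  then show ?case by (intro exI[of _ "{}"]) simp
next
  case (Suc k)
  then obtain B where B: "B \<subseteq> A" "card B = k" "\<forall>x\<in>B. \<forall>y\<in>A - B. f x \<le> f y" by auto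
  have fB: "finite B" using B assms(1) finite_subset by blast
  have "A - B \<noteq> {}" using Suc.prems B card_mono[of B A] fB by auto
  then obtain a where a: "a \<in> A - B" "\<forall>y\<in>A - B. f a \<le> f y"
    using assms(1) arg_min_if_finite(1)[of "A - B" f] arg_min_least[of "A - B" _ f]
    by (metis finite_Diff)
  then show ?case
    using B fB by (intro exI[of _ "insert a B"]) auto
qed

context bichrom
begin

text \<open>If some sample is among the \<open>q\<close> nearest edges \<open>B s\<close>, an edge
  strictly nearer than all samples must belong to \<open>B s\<close> too, so there are at most
  \<open>q\<close> of them.\<close>

lemma hitI:
  assumes es: "es \<noteq> []" 
    and B: "\<And>s. s < n \<Longrightarrow> sd s \<Longrightarrow> B s \<subseteq> {..<length es} \<and> card (B s) = min q (length es) \<and>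
      (\<forall>x\<in>B s. \<forall>y\<in>{..<length es} - B s. gd s (tl (es ! x)) \<le> gd s (tl (es ! y)))"
    and h: "\<And>s. s < n \<Longrightarrow> sd s \<Longrightarrow> \<exists>i<r. bitsval f (i * l) l mod length es \<in> B s"
  shows "hit q r (sample_at f l)"
  unfolding hit_def
proof (intro allI impI)
  fix s \<rho> assume s: "s < n" "sd s" and \<rho>: "\<forall>i<r. \<rho> \<le> gd s (tl (sample_at f l i))"
  obtain i where i: "i < r" "bitsval f (i * l) l mod length es \<in> B s" using h[OF s] by blast
  have le: "\<rho> \<le> gd s (tl (es ! (bitsval f (i * l) l mod length es)))" using \<rho> i by (simp add: sample_at_def)
  have "{k. k < length es \<and> gd s (tl (es ! k)) < \<rho>} \<subseteq> B s"
  proof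
    fix k assume k: "k \<in> {k. k < length es \<and> gd s (tl (es ! k)) < \<rho>}"
    show "k \<in> B s"
    proof (rule ccontr)
      assume "k \<notin> B s"
      then have "gd s (tl (es ! (bitsval f (i * l) l mod length es))) \<le> gd s (tl (es ! k))"
        using B[OF s] i(2) k by auto
      then show False using le k by simp
    qed
  qed
  moreover have "finite (B s)" using B[OF s] finite_subset by blast
  ultimately have "card {k. k < length es \<and> gd s (tl (es ! k)) < \<rho>} \<le> card (B s)" by (intro card_mono)
  then show "card {k. k < length es \<and> gd s (tl (es ! k)) < \<rho>} \<le> q" using B[OF s] by simp
qed

text \<open>Union bound over the vertices. Although \<open>s0\<close> depends on the sample, no
  problem arises, because the event requires the sample to be good for all sources at once.\<close>

lemma prob_hit:
  assumes es: "es \<noteq> []"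
  defines "r \<equiv> samples m" and "l \<equiv> clog (length es)"
  shows "1 - real n * exp (- (real (bitlen m) ^ 2 / 2)) \<le>
    measure_pmf.prob (replicate_pmf (r * l) (bernoulli_pmf (1 / 2)))
      {bs. hit (csqrt_nat m) r (sample_at (bits_of bs) l)}"
proof -
  let ?q = "csqrt_nat m" and ?K = "length es" and ?P = "replicate_pmf (r * l) (bernoulli_pmf (1 / 2))"
  have K: "0 < ?K" "?K \<le> 2 ^ l" using es clog(1) by (auto simp: l_def)
  have "\<exists>B\<subseteq>{..<?K}. card B = min ?q ?K \<and>
      (\<forall>x\<in>B. \<forall>y\<in>{..<?K} - B. gd s (tl (es ! x)) \<le> gd s (tl (es ! y)))" for s
    by (rule smallest_subset) auto
  then obtain B where B: "\<And>s. B s \<subseteq> {..<?K} \<and> card (B s) = min ?q ?K \<and>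
      (\<forall>x\<in>B s. \<forall>y\<in>{..<?K} - B s. gd s (tl (es ! x)) \<le> gd s (tl (es ! y)))"
    by metis
  let ?M = "\<lambda>s. {bs. \<forall>i<r. bitsval (bits_of bs) (i * l) l mod ?K \<notin> B s}"
  let ?H = "{bs. hit ?q r (sample_at (bits_of bs) l)}"
  have miss: "measure_pmf.prob ?P (?M s) \<le> exp (- (real (bitlen m) ^ 2 / 2))" for s
  proof -
    \<comment> \<open>If \<open>?q \<le> ?K\<close>, this is
      \<open>?q * ?q \<ge> m \<ge> ?K\<close>, the reason for rounding the root up; otherwise the
      target set consists of all positions and \<open>?q \<ge> 1\<close> is enough.\<close>
    have "?K * (bitlen m * bitlen m) \<le> min ?q ?K * r"
    proof (cases "?q \<le> ?K")
      case True
      have "?K * (bitlen m * bitlen m) \<le> (?q * ?q) * (bitlen m * bitlen m)"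
        using length_es csqrt_nat(1)[of m] by (intro mult_right_mono) auto
      also have "\<dots> = min ?q ?K * r" using True by (simp add: r_def samples_def mult.assoc)
      finally show ?thesis .
    next
      case False
      then have "1 \<le> ?q" using K by simp
      then have "?K * (1 * (bitlen m * bitlen m)) \<le> ?K * (?q * (bitlen m * bitlen m))"
        by (intro mult_left_mono mult_right_mono) auto
      then show ?thesis using False by (simp add: r_def samples_def mult.assoc)
    qed
    then have "real (?K * (bitlen m * bitlen m)) \<le> real (min ?q ?K * r)" by (simp only: of_nat_le_iff)
    then have "real (bitlen m) ^ 2 / 2 \<le> real (card (B s)) * real r / (2 * real ?K)"
      using B[of s] K by (simp add: field_simps power2_eq_square)
    then have "exp (- (real (card (B s)) * real r / (2 * real ?K))) \<le> exp (- (real (bitlen m) ^ 2 / 2))"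
      by simp
    then show ?thesis using prob_miss[of "B s" ?K l r] B[of s] K by (auto intro: order_trans)
  qed
  have "- ?H \<subseteq> (\<Union>s<n. ?M s)"
  proof
    fix bs assume "bs \<in> - ?H"
    then have nh: "\<not> hit ?q r (sample_at (bits_of bs) l)" by simp
    show "bs \<in> (\<Union>s<n. ?M s)"
    proof (rule ccontr)
      assume "bs \<notin> (\<Union>s<n. ?M s)"
      then have h: "\<exists>i<r. bitsval (bits_of bs) (i * l) l mod ?K \<in> B s" if "s < n" for s
        using that by auto
      show False using nh hitI[OF es, of B ?q r "bits_of bs" l] B h by blast
    qed
  qed
  then have "measure_pmf.prob ?P (- ?H) \<le> measure_pmf.prob ?P (\<Union>s<n. ?M s)"
    by (intro measure_pmf.finite_measure_mono) auto
  also have "\<dots> \<le> (\<Sum>s<n. measure_pmf.prob ?P (?M s))"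
    by (rule measure_pmf.finite_measure_subadditive_finite) auto
  also have "\<dots> \<le> real n * exp (- (real (bitlen m) ^ 2 / 2))"
    using sum_bounded_above[of "{..<n}" "\<lambda>s. measure_pmf.prob ?P (?M s)"] miss by simp
  finally show ?thesis
    using measure_pmf.prob_compl[of ?H ?P] by (simp add: Compl_eq_Diff_UNIV)
qed

end

lemma implements_inst:
  assumes "valid_instance I" "instance_magnitude I + 1 < 2 ^ w"
  shows "implements w 32 D \<lparr>regs = (\<lambda>_. 0), mem = inst_mem I\<rparr> (\<lambda>_. 0) (inst_mem I)"
proof -
  have "inst_mem I x < 2 ^ w" for x
    using inst_mem_le[OF assms(1), of x] assms(2) by linarith
  moreover have "0 < (2::nat) ^ w" by simp
  ultimately show ?thesis by (simp add: implements_def bounded_def)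
qed

lemma run_diameter_prog_many_vertices:
  assumes I: "valid_instance I" "2 * edge_count I < vertex_count I"
    and w: "w = word_bits 8 (instance_magnitude I)"
    and T: "step_cost setup_prog * 3 + 1 + step_cost main_prog \<le> T"
  obtains s where "run w T (init_config diameter_prog (encode_instance I)) = return_pmf ([], s)"
    "approximates 2 (ST_diameter I) (estimate s)"
proof -
  let ?n = "vertex_count I" and ?m = "edge_count I" and ?M = "inst_mem I" and ?L = "(2::nat) ^ w"
  let ?s0 = "\<lparr>regs = (\<lambda>_. 0), mem = ?M\<rparr>"
  have n: "0 < ?n" "?n + ?m \<le> instance_magnitude I" using I by (auto simp: instance_magnitude_def)
  have "2 * (instance_magnitude I + 2) \<le> (instance_magnitude I + 2) ^ 2"
    by (simp add: power2_eq_square)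
  also have "\<dots> \<le> (instance_magnitude I + 2) ^ 8" by (rule power_increasing) auto
  also have "\<dots> \<le> ?L" unfolding w by (rule two_pow_word_bits)
  finally have L: "2 * (instance_magnitude I + 2) \<le> ?L" .
  then have w1: "1 < ?L" "instance_magnitude I + 1 < ?L" "2 * ?m < ?L" "2 < ?L" using n unfolding distrib_left by linarith+
  let ?Q1 = "\<lambda>t R' M'. R' = (\<lambda>_. 0)(30 := ?n, 29 := ?m) \<and> t = 3"
  have "wp ?L setup_prog ?Q1 (\<lambda>_. 0) ?M"
    using I(2) w1 inst_mem_nth(1,2)[of I] by (simp add: setup_prog_def wp_simps)
  then obtain t1 R1 M1 k1 s1 where 1: "?Q1 t1 R1 M1" "k1 \<le> step_cost setup_prog * t1"
    "steps w k1 (compile 32 setup_prog @ fill # compile 32 main_prog, ?s0) (fill # compile 32 main_prog, s1)"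
    "implements w 32 max_depth s1 R1 M1"
    by (rule compile_wp[OF _ implements_inst[OF I(1) w1(2)] w1(1) regs_below_setup,
          where D = max_depth and cs = "fill # compile 32 main_prog"])
      (simp only: max_depth_def max.cobounded1, assumption)
  have "wp ?L main_prog (\<lambda>t R' M'. R' 1 = 0 \<and> t = 1) R1 M1"
    using 1(1) w1 by (simp add: main_prog_def wp_simps)
  then obtain t2 R2 M2 k2 s2 where 2: "R2 1 = 0 \<and> t2 = 1" "k2 \<le> step_cost main_prog * t2"
    "steps w k2 (compile 32 main_prog @ [], s1) ([], s2)" "implements w 32 max_depth s2 R2 M2"
    by (rule compile_wp[OF _ 1(4) w1(1) regs_below_main, where cs = "[]"])
      (simp only: max_depth_def max.cobounded2, assumption)
  have init: "init_config diameter_prog (encode_instance I) = (compile 32 setup_prog @ fill # compile 32 main_prog, ?s0)"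
    unfolding init_config_def diameter_prog_def inst_mem_def ..
  have r1: "regs s1 1 = 0" using 1(1,4) by (simp add: implements_def)
  have time: "k1 + (5 * 0 + 1) + step_cost main_prog \<le> T" using T 1(1,2) by simp
  have last: "\<exists>k3\<le>step_cost main_prog. steps w k3 (compile 32 main_prog, fold fill_step bs s1) ([], s2)"
    if "length bs = 0" for bs
    using 2 that by auto
  have run: "run w T (init_config diameter_prog (encode_instance I)) =
      map_pmf (\<lambda>bs. ([], s2)) (replicate_pmf 0 (bernoulli_pmf (1 / 2)))"
    unfolding init by (rule run_three_phases[OF 1(3) r1 _ last time]) simp
  have "regs s2 1 = 0" using 2(1,4) by (simp add: implements_def)
  then have "approximates 2 (ST_diameter I) (estimate s2)"
    using instance_many_vertices[OF I] approximates_infinite[of 2] by (simp add: estimate_def)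
  then show ?thesis using that run by simp
qed

section \<open>Running time in terms of the number of edges\<close>

definition diameter_time :: "nat \<Rightarrow> nat" where
  "diameter_time m = (step_cost setup_prog + step_cost main_prog + 1) * 1000 *
     ((csqrt_nat m + 1) * (bitlen m + 2) ^ 3 * (m + 1))"

lemma clog_le_bitlen: "k \<le> m \<Longrightarrow> clog k \<le> bitlen m"
proof -
  assume "k \<le> m"
  then have "k \<le> 2 ^ bitlen m" using bitlen_le_iff[of m "bitlen m"] by simp
  then show ?thesis unfolding clog_def by (rule Least_le)
qed

context run_instance
begin

text \<open>About \<open>sqrt m * log\<^sup>2 m\<close> searches of \<open>m * log m\<close> steps
  each explain the three logarithmic factors. The number of vertices is eliminated by
  \<open>few\<close>; 1000 generously absorbs all constants apart from the two step costs.\<close>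

lemma total_time_le: "total_time \<le> diameter_time (edge_count I)"
proof -
  let ?m = "edge_count I" and ?n = "vertex_count I"
  define q where "q = csqrt_nat ?m"
  define \<beta> where "\<beta> = bitlen ?m + 2"
  define c1 where "c1 = step_cost setup_prog"
  define c3 where "c3 = step_cost main_prog"
  define E where "E = B.ecc_time"
  define Z where "Z = (q + 1) * \<beta> ^ 3 * (?m + 1)"
  have \<beta>: "2 \<le> \<beta>" "num_bits + 2 \<le> \<beta>"
    using clog_le_bitlen[OF B.length_es] by (auto simp: \<beta>_def)
  have "bitlen (2 * ?n) \<le> bitlen (2 * (2 * ?m))" using few by (intro bitlen_mono) simp
  also have "\<dots> \<le> \<beta>"
    using bitlen_half[of "2 * (2 * ?m)"] bitlen_half[of "2 * ?m"] by (cases "?m = 0") (auto simp: \<beta>_def)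
  finally have bl: "bitlen (2 * ?n) \<le> \<beta>" .
  have \<beta>m: "?m \<le> \<beta> * ?m" "1 \<le> \<beta> * (?m + 1)" "\<beta> * ?m \<le> \<beta> * (?m + 1)" "\<beta> \<le> \<beta> * (?m + 1)" using \<beta>(1) by auto
  have "E \<le> 100 * (\<beta> * (?m + 1))"
  proof -
    have a: "?n * (12 + 6 * bitlen (2 * ?n)) \<le> (2 * ?m) * (12 + 6 * \<beta>)"
      using few bl by (intro mult_mono) auto
    have b: "(10 + 3 * bitlen (2 * ?n)) * ?m \<le> (10 + 3 * \<beta>) * ?m" using bl by (intro mult_right_mono) auto
    have "E \<le> 5 + 8 * (2 * ?m) + (2 * ?m) * (12 + 6 * \<beta>) + (10 + 3 * \<beta>) * ?m + 7 * (2 * ?m) + 4"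
      unfolding E_def using a b few by linarith
    also have "\<dots> = 9 + 64 * ?m + 15 * (\<beta> * ?m)" by (simp add: algebra_simps)
    also have "\<dots> \<le> 100 * (\<beta> * (?m + 1))" using \<beta>m by linarith
    finally show ?thesis .
  qed
  then have E: "E \<le> 100 * (\<beta> * (?m + 1))" "E + 3 \<le> 103 * (\<beta> * (?m + 1))" using \<beta>m by linarith+
  have r: "num_samples \<le> q * (\<beta> * \<beta>)"
    unfolding samples_def q_def[symmetric] mult.assoc
    by (intro mult_left_mono mult_mono) (auto simp: \<beta>_def)
  have \<beta>3: "\<beta> * \<beta> \<le> \<beta> ^ 3" "\<beta> \<le> \<beta> ^ 3" "1 \<le> \<beta> ^ 3"
    using \<beta>(1) power_increasing[of 2 3 \<beta>] power_increasing[of 1 3 \<beta>] by (auto simp: power2_eq_square)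
  have Zge: "\<beta> ^ 3 * (?m + 1) \<le> Z" "q * \<beta> ^ 3 * (?m + 1) \<le> Z"
  proof -
    have "Z = \<beta> ^ 3 * (?m + 1) + q * \<beta> ^ 3 * (?m + 1)" by (simp add: Z_def algebra_simps)
    then show "\<beta> ^ 3 * (?m + 1) \<le> Z" "q * \<beta> ^ 3 * (?m + 1) \<le> Z" by simp_all
  qed
  have Z1: "\<beta> * (?m + 1) \<le> Z" 
    by (rule order_trans[OF mult_right_mono[OF \<beta>3(2)] Zge(1)]) simp
  have Z2: "1 \<le> Z" "?m \<le> Z" "\<beta> \<le> Z" using Z1 \<beta>m by linarith+
  have Z3: "q * \<beta> ^ 3 \<le> Z" by (rule order_trans[OF _ Zge(2)]) simp
  have rl: "num_samples * num_bits \<le> Z"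
  proof -
    have "num_samples * num_bits \<le> q * (\<beta> * \<beta>) * \<beta>" using r \<beta>(2) by (intro mult_mono) auto
    then show ?thesis using Z3 by (simp add: power3_eq_cube mult.assoc)
  qed
  have lr: "(4 * num_bits + 8) * num_samples \<le> 4 * Z"
  proof -
    have "(4 * num_bits + 8) * num_samples \<le> (4 * \<beta>) * (q * (\<beta> * \<beta>))" using r \<beta>(2) by (intro mult_mono) auto
    also have "\<dots> = 4 * (q * \<beta> ^ 3)" by (simp add: power3_eq_cube algebra_simps)
    finally show ?thesis using Z3 by linarith
  qed
  have Er: "(E + 3) * num_samples \<le> 103 * Z"
  proof -
    have "(E + 3) * num_samples \<le> 103 * (\<beta> * (?m + 1)) * (q * (\<beta> * \<beta>))" using r E(2) by (intro mult_mono) auto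
    also have "\<dots> = 103 * (q * \<beta> ^ 3 * (?m + 1))" by (simp add: power3_eq_cube algebra_simps)
    finally show ?thesis using Zge(2) by linarith
  qed
  have Eq: "(E + 3) * q \<le> 103 * Z"
  proof -
    have "\<beta> * (?m + 1) \<le> \<beta> ^ 3 * (?m + 1)" by (rule mult_right_mono[OF \<beta>3(2)]) simp
    then have "E + 3 \<le> 103 * (\<beta> ^ 3 * (?m + 1))" using E(2) by linarith
    then have "(E + 3) * q \<le> 103 * (\<beta> ^ 3 * (?m + 1)) * q" by (rule mult_right_mono) simp
    also have "\<dots> = 103 * (q * \<beta> ^ 3 * (?m + 1))" by (simp add: algebra_simps)
    finally show ?thesis using Zge(2) by linarith
  qed
  have main: "B.main_time q num_samples num_bits + 2 \<le> 1000 * Z"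
  proof -
    have key: "20 + x + y + 2 * e + 6 * ?n + 7 * ?m + u + 2 \<le> 1000 * Z"
      if "x \<le> 4 * Z" "y \<le> 103 * Z" "u \<le> 103 * Z" "e \<le> 100 * Z" for x y u e
      using that Z2 few by linarith
    have "E \<le> 100 * Z" using E(1) Z1 by linarith
    then have "B.ecc_time \<le> 100 * Z" by (simp only: E_def)
    then show ?thesis by (rule key[OF lr Er[unfolded E_def] Eq[unfolded E_def]])
  qed
  have pre: "B.setup_time + 4 \<le> 1000 * Z" using Z2 by (simp add: \<beta>_def)
  have "total_time \<le> c1 * (1000 * Z) + 1000 * Z + c3 * (1000 * Z)"
    unfolding c1_def[symmetric] c3_def[symmetric] q_def[symmetric]
    using mult_le_mono2[OF pre, of c1] mult_le_mono2[OF main, of c3] rl Z2 by linarith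
  also have "\<dots> = (c1 + c3 + 1) * 1000 * Z" by (simp add: algebra_simps)
  finally show ?thesis
    unfolding diameter_time_def Z_def q_def \<beta>_def c1_def c3_def .
qed

end

lemma bitlen_real: "0 < m \<Longrightarrow> real (bitlen m) \<le> log 2 (real m) + 1"
proof -
  assume m: "0 < m"
  then obtain k where k: "bitlen m = Suc k" using bitlen_half by blast
  then have "\<not> bitlen m \<le> k" by simp
  then have "2 ^ k \<le> m" by (simp add: bitlen_le_iff)
  then have "real (2 ^ k) \<le> real m" by (simp only: of_nat_le_iff)
  then have "2 powr real k \<le> real m" by (simp add: powr_realpow)
  then have "real k \<le> log 2 (real m)" using m by (simp add: le_log_iff)
  then show ?thesis using k by simp
qed

lemma csqrt_real: "real (csqrt_nat m) \<le> sqrt (real m) + 1"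
proof (cases "csqrt_nat m")
  case (Suc k)
  then have "k * k < m" using csqrt_nat(2)[of k m] by simp
  then have "real (k * k) \<le> real m" by (simp only: of_nat_le_iff)
  then have "(real k)\<^sup>2 \<le> real m" by (simp add: power2_eq_square)
  then have "real k \<le> sqrt (real m)" by (rule real_le_rsqrt)
  then show ?thesis using Suc by simp
qed simp

lemma diameter_time_bigo:
  "(\<lambda>m. real (diameter_time m)) \<in> O(\<lambda>m. real m powr (3 / 2) * ln (real m) ^ 3)"
proof -
  let ?C = "real ((step_cost setup_prog + step_cost main_prog + 1) * 1000)"
  let ?f = "\<lambda>m :: nat. (sqrt (real m) + 2) * (log 2 (real m) + 3) ^ 3 * (real m + 1)"
  have "(\<lambda>m. real (diameter_time m)) \<in> O(\<lambda>m. ?C * ?f m)"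
  proof (rule bigoI[of _ 1], rule eventually_mono[OF eventually_gt_at_top[of 0]])
    fix m :: nat assume m: "0 < m"
    have l: "0 \<le> log 2 (real m)" using m by simp
    have "real (diameter_time m) = ?C * ((real (csqrt_nat m) + 1) * (real (bitlen m) + 2) ^ 3 * (real m + 1))"
      unfolding diameter_time_def by (simp only: of_nat_mult of_nat_add of_nat_power of_nat_1 of_nat_numeral)
    also have "\<dots> \<le> ?C * ?f m"
      using csqrt_real[of m] bitlen_real[OF m] l
      by (intro mult_left_mono mult_right_mono mult_mono power_mono) auto
    finally have a: "real (diameter_time m) \<le> ?C * ?f m" .
    have "0 \<le> real (diameter_time m)" by simp
    then show "norm (real (diameter_time m)) \<le> 1 * norm (?C * ?f m)" using a by (simp only: real_norm_def mult_1)
  qed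
  also have "(\<lambda>m. ?C * ?f m) \<in> O(?f)" by simp
  also have "?f \<in> O(\<lambda>m. real m powr (3 / 2) * ln (real m) ^ 3)" by real_asymp
  finally show ?thesis .
qed

lemma halts_withinI: "run w t (init_config p xs) = map_pmf (\<lambda>x. ([], f x)) P \<Longrightarrow> halts_within w t p xs"
  by (auto simp: halts_within_def)

lemma output_prob_map:
  assumes "run w t (init_config p xs) = map_pmf (\<lambda>x. ([], f x)) P"
  shows "output_prob w t p xs Q = measure_pmf.prob P {x. Q (f x)}"
  unfolding output_prob_def assms by (simp add: vimage_def)

lemma diameter_prog_runs_in_time: "diameter_runs_in_time diameter_prog 8 diameter_time"
  unfolding diameter_runs_in_time_def
proof (intro allI impI)
  fix I assume I: "valid_instance I"
  show "halts_within (word_bits 8 (instance_magnitude I)) (diameter_time (edge_count I)) diameter_prog (encode_instance I)"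
  proof (cases "vertex_count I \<le> 2 * edge_count I")
    case True
    interpret run_instance I 8 "word_bits 8 (instance_magnitude I)"
      by unfold_locales (use I True in auto)
    show ?thesis by (rule run_diameter_prog[OF total_time_le]) (erule halts_withinI)
  next
    case False
    have "step_cost setup_prog * 3 + 1 + step_cost main_prog \<le> diameter_time (edge_count I)"
    proof -
      have "0 < (csqrt_nat (edge_count I) + 1) * (bitlen (edge_count I) + 2) ^ 3 * (edge_count I + 1)" by simp
      then have "1 \<le> (csqrt_nat (edge_count I) + 1) * (bitlen (edge_count I) + 2) ^ 3 * (edge_count I + 1)"
        by (simp only: Suc_le_eq One_nat_def)
      then have "(step_cost setup_prog + step_cost main_prog + 1) * 1000 * 1 \<le> diameter_time (edge_count I)"
        unfolding diameter_time_def by (intro mult_left_mono) auto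
      then show ?thesis by simp
    qed
    then obtain s where "run (word_bits 8 (instance_magnitude I)) (diameter_time (edge_count I))
        (init_config diameter_prog (encode_instance I)) = return_pmf ([], s)"
      using run_diameter_prog_many_vertices[OF I _ refl] False by (metis not_le)
    then show ?thesis by (simp add: halts_within_def)
  qed
qed

text \<open>Success is certain where the output is infinity without sampling. In the other case
  \<open>n \<le> 2 * m\<close> is recorded, since the failure bound is in terms of \<open>m\<close>
  and has to be compared with a power of \<open>n\<close>.\<close>

lemma diameter_prog_success:
  assumes I: "valid_instance I"
  shows "diameter_success_prob 2 diameter_prog 8 diameter_time I = 1 \<or>
    vertex_count I \<le> 2 * edge_count I \<and>
    1 - real (vertex_count I) * exp (- (real (bitlen (edge_count I)) ^ 2 / 2))
      \<le> diameter_success_prob 2 diameter_prog 8 diameter_time I"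
proof (cases "vertex_count I \<le> 2 * edge_count I")
  case True
  interpret run_instance I 8 "word_bits 8 (instance_magnitude I)"
    by unfold_locales (use I True in auto)
  obtain k fin where run: "run (word_bits 8 (instance_magnitude I)) (diameter_time (edge_count I))
      (init_config diameter_prog (encode_instance I)) =
      map_pmf (\<lambda>bs. ([], fin bs)) (replicate_pmf k (bernoulli_pmf (1 / 2)))"
    and 1: "\<And>bs. B.es = [] \<Longrightarrow> length bs = k \<Longrightarrow> approximates 2 (ST_diameter I) (estimate (fin bs))"
    and 2: "B.es \<noteq> [] \<Longrightarrow> k = num_samples * num_bits"
    and 3: "\<And>bs. B.es \<noteq> [] \<Longrightarrow> length bs = k \<Longrightarrow>
      B.hit (csqrt_nat (edge_count I)) num_samples (B.sample_at (\<lambda>i. of_bool (bs ! i)) num_bits) \<Longrightarrow>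
      approximates 2 (ST_diameter I) (estimate (fin bs))"
    by (rule run_diameter_prog[OF total_time_le]) blast
  let ?P = "replicate_pmf k (bernoulli_pmf (1 / 2))"
  let ?G = "{bs. approximates 2 (ST_diameter I) (estimate (fin bs))}"
  have len: "set_pmf ?P \<subseteq> {bs. length bs = k}" by (auto simp: set_replicate_pmf)
  have eq: "diameter_success_prob 2 diameter_prog 8 diameter_time I = measure_pmf.prob ?P ?G"
    unfolding diameter_success_prob_def by (rule output_prob_map[OF run])
  show ?thesis
  proof (cases "B.es = []")
    case True
    then have "set_pmf ?P \<subseteq> ?G" using 1 len by auto
    then have "measure_pmf.prob ?P ?G = 1" by (auto simp: measure_pmf.prob_eq_1 AE_measure_pmf_iff)
    then show ?thesis using eq by simp
  next
    case False
    let ?H = "{bs. B.hit (csqrt_nat (edge_count I)) num_samples (B.sample_at (bits_of bs) num_bits)}"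
    have b: "bits_of bs = (\<lambda>i. of_bool (bs ! i))" for bs by (simp add: bits_of_def fun_eq_iff)
    have "1 - real (vertex_count I) * exp (- (real (bitlen (edge_count I)) ^ 2 / 2)) \<le> measure_pmf.prob ?P ?H"
      using B.prob_hit[OF False] 2[OF False] by simp
    also have "\<dots> = measure_pmf.prob ?P (?H \<inter> set_pmf ?P)" by (rule measure_Int_set_pmf[symmetric])
    also have "\<dots> \<le> measure_pmf.prob ?P ?G"
      using 3[OF False] len by (intro measure_pmf.finite_measure_mono) (auto simp: b)
    finally show ?thesis using eq \<open>vertex_count I \<le> 2 * edge_count I\<close> by simp
  qed
next
  case False
  have T: "step_cost setup_prog * 3 + 1 + step_cost main_prog \<le> diameter_time (edge_count I)"
  proof -
    have "0 < (csqrt_nat (edge_count I) + 1) * (bitlen (edge_count I) + 2) ^ 3 * (edge_count I + 1)" by simp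
    then have "1 \<le> (csqrt_nat (edge_count I) + 1) * (bitlen (edge_count I) + 2) ^ 3 * (edge_count I + 1)"
      by (simp only: Suc_le_eq One_nat_def)
    then have "(step_cost setup_prog + step_cost main_prog + 1) * 1000 * 1 \<le> diameter_time (edge_count I)"
      unfolding diameter_time_def by (intro mult_left_mono) auto
    then show ?thesis by simp
  qed
  obtain s where "run (word_bits 8 (instance_magnitude I)) (diameter_time (edge_count I))
      (init_config diameter_prog (encode_instance I)) = return_pmf ([], s)"
    "approximates 2 (ST_diameter I) (estimate s)"
    using run_diameter_prog_many_vertices[OF I _ refl T] False by (metis not_le)
  then show ?thesis by (simp add: diameter_success_prob_def output_prob_def)
qed

text \<open>With \<open>l = bitlen m\<close>, the condition \<open>n \<le> 2 * m\<close> gives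
  \<open>ln n \<le> 2 * l\<close>. Once \<open>l \<ge> 4 * (c + 1)\<close>, the exponent
  \<open>l ^ 2 / 2\<close> is at least \<open>(c + 1) * ln n\<close>: one \<open>ln n\<close>
  cancels the factor \<open>n\<close>, the others give the power \<open>c\<close>.\<close>

lemma failure_bound:
  assumes c: "c > 0"
  shows "\<exists>n0. \<forall>n m. n0 \<le> n \<longrightarrow> n \<le> 2 * m \<longrightarrow>
    real n * exp (- (real (bitlen m) ^ 2 / 2)) \<le> 1 / real n powr c"
proof -
  define k where "k = nat \<lceil>4 * (c + 1)\<rceil>"
  show ?thesis
  proof (intro exI[of _ "2 * 2 ^ k"] allI impI)
    fix n m :: nat assume n: "2 * 2 ^ k \<le> n" "n \<le> 2 * m"
    define l where "l = bitlen m"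
    have "2 ^ k \<le> m" using n by linarith
    then have "\<not> l \<le> k" unfolding l_def bitlen_le_iff by simp
    then have l: "4 * (c + 1) \<le> real l" "1 \<le> real l" unfolding k_def by linarith+
    have np: "0 < n" using n(1) by (metis le_zero_eq mult_eq_0_iff neq0_conv power_not_zero zero_neq_numeral)
    have "m < 2 ^ l" using bitlen_le_iff[of m l] by (simp add: l_def)
    then have "n \<le> 2 ^ (l + 1)" using n(2) by simp
    then have "real n \<le> real (2 ^ (l + 1))" by (simp only: of_nat_le_iff)
    then have "ln (real n) \<le> ln (2 ^ (l + 1))" using np by simp
    also have "\<dots> = real (l + 1) * ln 2" by (rule ln_realpow)
    also have "\<dots> \<le> real (l + 1) * 1" using ln_2_less_1 by (intro mult_left_mono) auto
    finally have ln: "ln (real n) \<le> 2 * real l" using l by simp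
    have "(c + 1) * ln (real n) \<le> (c + 1) * (2 * real l)" using ln c by (intro mult_left_mono) auto
    also have "\<dots> \<le> real l / 4 * (2 * real l)" using l by (intro mult_right_mono) auto
    also have "\<dots> = real l ^ 2 / 2" by (simp add: power2_eq_square)
    finally have "ln (real n) + c * ln (real n) \<le> real l ^ 2 / 2" by (simp add: algebra_simps)
    then have "exp (ln (real n) + - (real l ^ 2 / 2)) \<le> exp (- (c * ln (real n)))" by simp
    moreover have "exp (ln (real n) + - (real l ^ 2 / 2)) = real n * exp (- (real l ^ 2 / 2))"
      unfolding exp_add using np by simp
    moreover have "exp (- (c * ln (real n))) = 1 / real n powr c"
      using np by (simp add: powr_def exp_minus inverse_eq_divide)
    ultimately show "real n * exp (- (real (bitlen m) ^ 2 / 2)) \<le> 1 / real n powr c"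
      by (simp only: l_def)
  qed
qed

theorem two_approximation_algorithm:
  "\<exists>p b T.
    (\<exists>k. (\<lambda>m. real (T m)) \<in> O(\<lambda>m. real m powr (3 / 2) * ln (real m) ^ k)) \<and>
    diameter_runs_in_time p b T \<and>
    (\<forall>c::real. c > 0 \<longrightarrow>
       (\<exists>n0. \<forall>I. valid_instance I \<and> vertex_count I \<ge> n0 \<longrightarrow>
          diameter_success_prob 2 p b T I \<ge> 1 - 1 / real (vertex_count I) powr c))"
proof -
  have "\<exists>n0. \<forall>I. valid_instance I \<and> vertex_count I \<ge> n0 \<longrightarrow>
    diameter_success_prob 2 diameter_prog 8 diameter_time I \<ge> 1 - 1 / real (vertex_count I) powr c"
    if "c > 0" for c :: real
  proof -
  obtain n0 where n0: "\<And>n m. n0 \<le> n \<Longrightarrow> n \<le> 2 * m \<Longrightarrow>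
    real n * exp (- (real (bitlen m) ^ 2 / 2)) \<le> 1 / real n powr c"
    using failure_bound[OF \<open>c > 0\<close>] by blast
  show "\<exists>n0. \<forall>I. valid_instance I \<and> vertex_count I \<ge> n0 \<longrightarrow>
    diameter_success_prob 2 diameter_prog 8 diameter_time I \<ge> 1 - 1 / real (vertex_count I) powr c"
  proof (intro exI[of _ n0] allI impI)
    fix I assume "valid_instance I \<and> vertex_count I \<ge> n0"
    then show "diameter_success_prob 2 diameter_prog 8 diameter_time I \<ge> 1 - 1 / real (vertex_count I) powr c"
      using diameter_prog_success[of I] n0[of "vertex_count I" "edge_count I"] by fastforce
  qed
  qed
  then show ?thesis using diameter_time_bigo diameter_prog_runs_in_time by blast
qed

section \<open>Composing programs\<close>

lemma run_self_loop:
  assumes "c \<in> set_pmf (step w c)"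
  shows "c \<in> set_pmf (run w t c)"
  using assms by (induction t) auto

text \<open>Longer words matter only for a step that overflows in the shorter ones, and then the
  configuration is among its own successors.\<close>

lemma step_word_mono:
  assumes "w0 \<le> w"
  shows "step w c = step w0 c \<or> c \<in> set_pmf (step w0 c) \<and> fst c \<noteq> []"
proof -
  have "(2::nat) ^ w0 \<le> 2 ^ w" using assms by (rule power_increasing) simp
  then have le: "x < 2 ^ w0 \<Longrightarrow> x < (2::nat) ^ w" for x by (rule less_le_trans[rotated])
  obtain cs s where c: "c = (cs, s)" by (cases c)
  show ?thesis
  proof (cases cs)
    case (Cons x xs)
    show ?thesis
    proof (cases x)
      case (Flip r)
      show ?thesis
      \<comment> \<open>Words of length 0 cannot hold a flipped 1, so even a coin flip may get stuck
        there.\<close>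
      proof (cases "w0 = 0")
        case True
        have "c = write_reg w0 r (of_bool True) (Flip r) xs s"
          using True c Cons Flip by (simp add: write_reg_def)
        then have "c \<in> (\<lambda>x. write_reg w0 r (of_bool x) (Flip r) xs s) ` set_pmf (bernoulli_pmf (1 / 2))"
          by (intro image_eqI[of _ _ True]) auto
        then show ?thesis using c Cons Flip by simp
      next
        case False
        then have "of_bool x < (2::nat) ^ w0" for x using one_less_power[of "2::nat" w0] by (cases x) auto
        then have "write_reg w r (of_bool x) (Flip r) xs s = write_reg w0 r (of_bool x) (Flip r) xs s" for x
          using le by (simp add: write_reg_def)
        then show ?thesis using c Cons Flip by simp
      qed
    qed (use c Cons le in \<open>auto simp: write_reg_def\<close>)
  qed (simp add: c)
qed

text \<open>A configuration that can stay where it is would, with positive probability, still be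
  there at time \<open>t\<close>. Certain halting thus excludes overflow, and the run is the same
  for longer words.\<close>

lemma run_word_mono:
  assumes "w0 \<le> w" "\<forall>c\<in>set_pmf (run w0 t c0). fst c = []"
  shows "run w t c0 = run w0 t c0"
  using assms(2)
proof (induction t arbitrary: c0)
  case (Suc t)
  have "step w c0 = step w0 c0"
  proof (rule ccontr)
    assume "step w c0 \<noteq> step w0 c0"
    then have "c0 \<in> set_pmf (step w0 c0)" "fst c0 \<noteq> []" using step_word_mono[OF assms(1), of c0] by auto
    then show False using run_self_loop[of c0 w0 "Suc t"] Suc.prems by blast
  qed
  moreover have "run w t c = run w0 t c" if "c \<in> set_pmf (step w0 c0)" for c
    using Suc.prems that by (intro Suc.IH) auto
  ultimately show ?case by (auto intro: bind_pmf_cong)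
qed simp

lemma run_add: "run w (t + u) c = bind_pmf (run w t c) (run w u)"
proof (induction t arbitrary: c)
  case (Suc t)
  have "run w (t + u) = (\<lambda>c. bind_pmf (run w t c) (run w u))" using Suc.IH by (rule ext)
  then show ?case by (simp add: bind_assoc_pmf)
qed (simp add: bind_return_pmf)

lemma run_extend:
  assumes "\<forall>c\<in>set_pmf (run w t c0). fst c = []"
  shows "run w (t + u) c0 = run w t c0"
proof -
  have "bind_pmf (run w t c0) (run w u) = bind_pmf (run w t c0) return_pmf"
  proof (rule bind_pmf_cong[OF refl])
    fix c assume "c \<in> set_pmf (run w t c0)"
    then have "c = ([], snd c)" using assms by (cases c) auto
    then show "run w u c = return_pmf c" using run_halted by metis
  qed
  then show ?thesis by (simp add: run_add bind_return_pmf')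
qed

lemma step_append:
  "step w ((x # p) @ cs, s) = map_pmf (\<lambda>(p', s'). (p' @ cs, s')) (step w (x # p, s))"
  by (cases x) (auto simp: write_reg_def map_pmf_comp intro!: map_pmf_cong)

text \<open>The length of the first run may depend on its coin flips. Since the code behind it halts
  within \<open>u\<close> steps from every state, early runs just idle until the common time
  \<open>t + u\<close>.\<close>

lemma run_append:
  assumes "\<forall>c\<in>set_pmf (run w t (p, s)). fst c = []"
    and post: "\<And>s'. run w u (cs, s') = return_pmf ([], g s')"
  shows "run w (t + u) (p @ cs, s) = map_pmf (\<lambda>c. ([], g (snd c))) (run w t (p, s))"
  using assms(1)
proof (induction t arbitrary: p s)
  case 0
  then show ?case using post by simp
next
  case (Suc t)
  show ?case
  proof (cases p)
    case Nil
    have "run w (u + Suc t) (cs, s) = run w u (cs, s)"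
      by (rule run_extend) (simp add: post)
    then show ?thesis using Nil post run_halted[of w "Suc t" s] by (simp add: add.commute del: run.simps)
  next
    case (Cons x p')
    have IH: "run w (t + u) (p1 @ cs, s1) = map_pmf (\<lambda>c. ([], g (snd c))) (run w t (p1, s1))"
      if "(p1, s1) \<in> set_pmf (step w (x # p', s))" for p1 s1
      by (rule Suc.IH) (use Suc.prems Cons that in auto)
    have "run w (Suc t + u) (p @ cs, s) =
        bind_pmf (step w (x # p', s)) (\<lambda>c. run w (t + u) (fst c @ cs, snd c))"
      using step_append[of w x p' cs s]
      by (simp add: Cons bind_map_pmf case_prod_unfold)
    also have "\<dots> = bind_pmf (step w (x # p', s)) (\<lambda>c. map_pmf (\<lambda>c. ([], g (snd c))) (run w t c))"
      by (rule bind_pmf_cong[OF refl]) (use IH in auto)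
    also have "\<dots> = map_pmf (\<lambda>c. ([], g (snd c))) (run w (Suc t) (p, s))"
      by (simp add: Cons map_bind_pmf)
    finally show ?thesis .
  qed
qed

definition clear_regs :: "nat \<Rightarrow> com list" where
  "clear_regs k = map (\<lambda>r. Const r 0) [0..<k]"

lemma steps_clear_regs:
  "steps w k (clear_regs k @ cs, s) (cs, s\<lparr>regs := (\<lambda>r. if r < k then 0 else regs s r)\<rparr>)"
proof -
  have "steps w (length rs) (map (\<lambda>r. Const r 0) rs @ cs, s)
      (cs, s\<lparr>regs := (\<lambda>r. if r \<in> set rs then 0 else regs s r)\<rparr>)" for rs
  proof (induction rs arbitrary: s)
    case Nil
    show ?case by (simp add: steps_refl)
  next
    case (Cons a rs)
    let ?s = "s\<lparr>regs := (regs s)(a := 0)\<rparr>"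
    have "(\<lambda>r. if r \<in> set rs then 0 else regs ?s r) = (\<lambda>r. if r \<in> set (a # rs) then 0 else regs s r)"
      by (auto simp: fun_eq_iff)
    then have e: "?s\<lparr>regs := (\<lambda>r. if r \<in> set rs then 0 else regs ?s r)\<rparr> =
        s\<lparr>regs := (\<lambda>r. if r \<in> set (a # rs) then 0 else regs s r)\<rparr>" by (simp only: state.simps) simp
    have "steps w (length rs) (map (\<lambda>r. Const r 0) rs @ cs, s\<lparr>regs := (regs s)(a := 0)\<rparr>)
        (cs, s\<lparr>regs := (\<lambda>r. if r \<in> set (a # rs) then 0 else regs s r)\<rparr>)"
      using Cons.IH[of ?s] unfolding e .
    then show ?case by (simp only: list.map append_Cons list.size add_Suc_right add_0_right) (intro steps_Const, simp_all)
  qed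
  from this[of "[0..<k]"] show ?thesis by (simp add: clear_regs_def)
qed

text \<open>Tests whether the estimate exceeds 1. Comparing numerator and denominator needs no
  division, and denominator 0, which means infinity, is answered with yes.\<close>

definition compare_one :: "com list" where
  "compare_one = [Op Less 0 1 0, If 1 [] [Const 0 1]]"

definition compared :: "state \<Rightarrow> state" where
  "compared s = s\<lparr>regs := (regs s)(0 := of_bool (regs s 1 = 0 \<or> regs s 1 < regs s 0))\<rparr>"

lemma run_compare_one:
  assumes "0 < w"
  shows "run w 3 (compare_one, s) = return_pmf ([], compared s)"
proof -
  have w: "of_bool b < (2::nat) ^ w" "Suc 0 < 2 ^ w" for b
    using one_less_power[of "2::nat" w] assms by (cases b; simp)+
  show ?thesis
    using w by (cases "regs s (Suc 0) = 0")
      (auto simp: compare_one_def compared_def numeral_3_eq_3 write_reg_def bind_return_pmf fun_upd_def cong: if_cong)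
qed

section \<open>From satisfiability to bichromatic diameter\<close>

text \<open>Rounded up, so the second half of the variables never needs more bits than the first and
  both sides can use the same number of assignments; for odd \<open>n\<close> one bit of the second
  half is without meaning.\<close>

definition half :: "nat \<Rightarrow> nat" where
  "half n = (n + 1) div 2"

fun sat_low :: "nat \<Rightarrow> nat \<Rightarrow> literal \<Rightarrow> bool" where
  "sat_low h a (i, s) \<longleftrightarrow> i < h \<and> (a div 2 ^ i) mod 2 = of_bool s"

fun sat_high :: "nat \<Rightarrow> nat \<Rightarrow> literal \<Rightarrow> bool" where
  "sat_high h a (i, s) \<longleftrightarrow> \<not> i < h \<and> (a div 2 ^ (i - h)) mod 2 = of_bool s"

definition clause_low :: "nat \<Rightarrow> nat \<Rightarrow> literal list \<Rightarrow> bool" where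
  "clause_low h a C \<longleftrightarrow> (\<exists>l\<in>set C. sat_low h a l)"

definition clause_high :: "nat \<Rightarrow> nat \<Rightarrow> literal list \<Rightarrow> bool" where
  "clause_high h a C \<longleftrightarrow> (\<exists>l\<in>set C. sat_high h a l)"

lemma number_with_bits: "\<exists>a<2 ^ h. \<forall>i<h. (a div 2 ^ i) mod 2 = (of_bool (\<sigma> i) :: nat)"
proof -
  let ?a = "horner_sum of_bool 2 (map \<sigma> [0..<h]) :: nat"
  have "?a < 2 ^ h" using horner_sum_of_bool_2_less[of "map \<sigma> [0..<h]"] by (simp add: nat_less_iff)
  moreover have "(?a div 2 ^ i) mod 2 = of_bool (\<sigma> i)" if "i < h" for i
  proof -
    have "bit ?a i = \<sigma> i" using that by (simp add: bit_horner_sum_bit_iff)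
    then show ?thesis by (simp add: bit_iff_odd mod_2_eq_odd)
  qed
  ultimately show ?thesis by blast
qed

lemma satisfiable_iff_halves:
  assumes "is_cnf n F"
  shows "satisfiable F \<longleftrightarrow>
    (\<exists>a<2 ^ half n. \<exists>b<2 ^ half n. \<forall>C\<in>set F. clause_low (half n) a C \<or> clause_high (half n) b C)"
proof
  let ?h = "half n"
  assume "satisfiable F"
  then obtain \<sigma> where \<sigma>: "\<forall>C\<in>set F. \<exists>l\<in>set C. \<sigma> (fst l) = snd l" by (auto simp: satisfiable_def)
  obtain a where a: "a < 2 ^ ?h" "\<forall>i<?h. (a div 2 ^ i) mod 2 = (of_bool (\<sigma> i) :: nat)"
    using number_with_bits by blast
  obtain b where b: "b < 2 ^ ?h" "\<forall>i<?h. (b div 2 ^ i) mod 2 = (of_bool (\<sigma> (?h + i)) :: nat)"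
    using number_with_bits[of ?h "\<lambda>i. \<sigma> (?h + i)"] by blast
  have "clause_low ?h a C \<or> clause_high ?h b C" if C: "C \<in> set F" for C
  proof -
    obtain i s where l: "(i, s) \<in> set C" "\<sigma> i = s" using \<sigma> C by fastforce
    then have "i < n" using assms C by (fastforce simp: is_cnf_def)
    then have "i - ?h < ?h" if "\<not> i < ?h" using that by (auto simp: half_def)
    then have "sat_low ?h a (i, s) \<or> sat_high ?h b (i, s)" using a(2) b(2) l(2) by (cases "i < ?h") auto
    then show ?thesis unfolding clause_low_def clause_high_def using l(1) by blast
  qed
  then show "\<exists>a<2 ^ ?h. \<exists>b<2 ^ ?h. \<forall>C\<in>set F. clause_low ?h a C \<or> clause_high ?h b C"
    using a b by blast
next
  let ?h = "half n"
  assume "\<exists>a<2 ^ ?h. \<exists>b<2 ^ ?h. \<forall>C\<in>set F. clause_low ?h a C \<or> clause_high ?h b C"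
  then obtain a b where ab: "\<forall>C\<in>set F. clause_low ?h a C \<or> clause_high ?h b C" by blast
  let ?\<sigma> = "\<lambda>i. if i < ?h then (a div 2 ^ i) mod 2 = 1 else (b div 2 ^ (i - ?h)) mod 2 = 1"
  have "\<exists>l\<in>set C. ?\<sigma> (fst l) = snd l" if C: "C \<in> set F" for C
  proof -
    have "\<exists>l\<in>set C. sat_low ?h a l \<or> sat_high ?h b l"
      using ab C by (auto simp: clause_low_def clause_high_def)
    then obtain i s where l: "(i, s) \<in> set C" "sat_low ?h a (i, s) \<or> sat_high ?h b (i, s)" by auto
    then have "?\<sigma> i = s" by (cases s) auto
    then show ?thesis using l(1) by (intro bexI[of _ "(i, s)"]) auto
  qed
  then show "satisfiable F" unfolding satisfiable_def by (intro exI[of _ ?\<sigma>]) blast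
qed

text \<open>With \<open>N = 2 ^ h\<close> half assignments and \<open>M\<close> clauses, the vertices are the assignments \<open>a\<close> to the first
  \<open>h\<close> variables, the clauses \<open>N + c\<close>, and the assignments \<open>N + M + b\<close> to the remaining variables.\<close>

definition sat_instance :: "nat \<Rightarrow> cnf \<Rightarrow> st_instance" where
  "sat_instance n F = (let h = half n; N = 2 ^ h; M = length F in
    \<lparr>vertex_count = 2 * N + M,
     edge_list = concat (map (\<lambda>j. [(j mod N, N + j div N), (N + j div N, N + M + j mod N)]) [0..<N * M]),
     weight = (\<lambda>(u, v). if u < N then of_bool (clause_low h u (F ! (v - N)))
       else 1 + of_bool (clause_high h (v - N - M) (F ! (u - N)))),
     source_set = {..<N}\<rparr>)"

locale sat_reduction =
  fixes n :: nat and F :: cnf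
  assumes cnf: "is_cnf n F"
begin

abbreviation (input) "h \<equiv> half n"

definition N :: nat where "N = 2 ^ h"

definition M :: nat where "M = length F"

definition arcs_at :: "nat \<Rightarrow> (nat \<times> nat) list" where
  "arcs_at j = [(j mod N, N + j div N), (N + j div N, N + M + j mod N)]"

lemma N_pos: "0 < N"
  by (simp add: N_def)

lemma sat_instance_simps:
  "vertex_count (sat_instance n F) = 2 * N + M"
  "edge_list (sat_instance n F) = concat (map arcs_at [0..<N * M])"
  "source_set (sat_instance n F) = {..<N}"
  "u < N \<Longrightarrow> weight (sat_instance n F) (u, v) = of_bool (clause_low h u (F ! (v - N)))"
  "\<not> u < N \<Longrightarrow> weight (sat_instance n F) (u, v) = 1 + of_bool (clause_high h (v - N - M) (F ! (u - N)))"
  by (simp_all add: sat_instance_def Let_def N_def M_def arcs_at_def[abs_def])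

lemma edge_count_sat_instance: "edge_count (sat_instance n F) = 2 * (N * M)"
  by (simp add: edge_count_def sat_instance_simps length_concat comp_def arcs_at_def sum_list_triv)

lemma arc_in_sat_instance:
  "x \<in> set (edge_list (sat_instance n F)) \<longleftrightarrow>
    (\<exists>a<N. \<exists>c<M. x = (a, N + c) \<or> x = (N + c, N + M + a))"
proof
  assume "x \<in> set (edge_list (sat_instance n F))"
  then obtain j where j: "j < N * M" "x \<in> set (arcs_at j)" by (auto simp: sat_instance_simps)
  then have "j mod N < N" "j div N < M" using N_pos by (auto simp: less_mult_imp_div_less mult.commute)
  then show "\<exists>a<N. \<exists>c<M. x = (a, N + c) \<or> x = (N + c, N + M + a)" using j(2) by (auto simp: arcs_at_def)
next
  assume "\<exists>a<N. \<exists>c<M. x = (a, N + c) \<or> x = (N + c, N + M + a)"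
  then obtain a c where ac: "a < N" "c < M" "x = (a, N + c) \<or> x = (N + c, N + M + a)" by blast
  have "c * N + a < Suc c * N" using ac by simp
  also have "\<dots> \<le> M * N" using ac by (intro mult_right_mono) auto
  finally have "c * N + a < N * M" by (simp add: mult.commute)
  moreover have "x \<in> set (arcs_at (c * N + a))" using ac by (auto simp: arcs_at_def)
  ultimately show "x \<in> set (edge_list (sat_instance n F))" by (auto simp: sat_instance_simps)
qed

lemma distinct_arcs: "distinct (concat (map arcs_at [0..<k]))"
  if "k \<le> N * M" for k
  using that
proof (induction k)
  case (Suc k)
  have new: "x \<notin> set (arcs_at j)" if "j < k" "x \<in> set (arcs_at k)" for j x
  proof
    assume "x \<in> set (arcs_at j)"
    moreover have "j mod N < N" "k mod N < N" using N_pos by auto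
    moreover have "j div N < M" "k div N < M"
      using Suc.prems that(1) by (auto intro!: less_mult_imp_div_less simp: mult.commute)
    ultimately have "j mod N = k mod N" "j div N = k div N" using that(2) by (auto simp: arcs_at_def)
    then have "j = k" by (metis div_mult_mod_eq)
    then show False using that(1) by simp
  qed
  have "distinct (arcs_at k)" using N_pos mod_less_divisor[OF N_pos, of k] by (simp add: arcs_at_def)
  then show ?case using Suc new by auto
qed simp

lemma valid_sat_instance: "valid_instance (sat_instance n F)"
  unfolding valid_instance_def
proof (intro conjI)
  let ?I = "sat_instance n F"
  show "wf_digraph (graph_of ?I)"
  proof
    fix e assume "e \<in> arcs (graph_of ?I)"
    then obtain a c where "a < N" "c < M" "e = (a, N + c) \<or> e = (N + c, N + M + a)"
      unfolding graph_of_simps arc_in_sat_instance by blast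
    then show "tail (graph_of ?I) e \<in> verts (graph_of ?I)" "head (graph_of ?I) e \<in> verts (graph_of ?I)"
      by (auto simp: graph_of_simps sat_instance_simps)
  qed
  show "distinct (edge_list ?I)" using distinct_arcs[of "N * M"] by (simp add: sat_instance_simps)
  show "source_set ?I \<subseteq> vertex_set ?I" by (auto simp: sat_instance_simps vertex_set_def)
  show "source_set ?I \<noteq> {}" using N_pos by (auto simp: sat_instance_simps)
  have "N \<in> target_set ?I" using N_pos by (simp add: target_set_def vertex_set_def sat_instance_simps)
  then show "target_set ?I \<noteq> {}" by blast
qed

lemma sat_arc_wk:
  assumes "(u, v) \<in> set (edge_list (sat_instance n F))"
  shows "inst_wk (sat_instance n F) u v (weight (sat_instance n F) (u, v))"
proof -
  obtain e where "e < edge_count (sat_instance n F)" "edge_list (sat_instance n F) ! e = (u, v)"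
    using assms by (auto simp: in_set_conv_nth edge_count_def)
  then show ?thesis
    using wk_single[of e "edge_count (sat_instance n F)" "arc_tail (sat_instance n F)"
        "arc_head (sat_instance n F)" "arc_weight (sat_instance n F)"]
    by (simp add: arc_tail_def arc_head_def arc_weight_def)
qed

text \<open>A feasible potential bounds the cost of walks from below, so that not all walks need to
  be analysed.\<close>

lemma wk_potential:
  assumes "wk m a b w u v c" "\<And>e. e < m \<Longrightarrow> f (b e) \<le> f (a e) + w e"
  shows "f v \<le> f u + (c :: nat)"
  using assms(1)
proof (induction rule: wk.induct)
  case (wk_edge u e c)
  then show ?case using assms(2)[of e] by simp
qed simp

text \<open>A clause falsified by both halves gives a path of cost \<open>0 + 1\<close> between
  them. The clause vertices are targets as well, as they lie outside \<open>S\<close>, but every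
  source has an edge of weight at most 1 to each.\<close>

lemma diameter_unsat:
  assumes "\<not> satisfiable F"
  shows "ST_diameter (sat_instance n F) \<le> 1"
proof (rule ST_diameter_le[OF valid_sat_instance])
  let ?I = "sat_instance n F"
  fix s t assume s: "s \<in> source_set ?I" and t: "t \<in> target_set ?I"
  have s': "s < N" using s by (simp add: sat_instance_simps)
  have t': "N \<le> t" "t < 2 * N + M" using t by (auto simp: target_set_def vertex_set_def sat_instance_simps)
  have "\<exists>c\<le>1. inst_wk ?I s t c"
  proof (cases "t < N + M")
    case True
    have "(s, t) \<in> set (edge_list ?I)"
      unfolding arc_in_sat_instance using s' t' True by (intro exI[of _ s] conjI exI[of _ "t - N"]) auto
    then have "inst_wk ?I s t (weight ?I (s, t))" by (rule sat_arc_wk)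
    moreover have "weight ?I (s, t) \<le> 1" using s' by (simp add: sat_instance_simps)
    ultimately show ?thesis by blast
  next
    case False
    define b where "b = t - N - M"
    have b: "b < N" "t = N + M + b" using t' False by (auto simp: b_def)
    have "\<exists>C\<in>set F. \<not> clause_low h s C \<and> \<not> clause_high h b C"
      using assms satisfiable_iff_halves[OF cnf] s' b unfolding N_def by blast
    then obtain c where c: "c < M" "\<not> clause_low h s (F ! c)" "\<not> clause_high h b (F ! c)"
      by (auto simp: in_set_conv_nth M_def)
    have "(s, N + c) \<in> set (edge_list ?I)" "(N + c, t) \<in> set (edge_list ?I)"
      unfolding arc_in_sat_instance using s' b c by blast+
    then have "inst_wk ?I s (N + c) (weight ?I (s, N + c))" "inst_wk ?I (N + c) t (weight ?I (N + c, t))"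
      using sat_arc_wk by blast+
    from wk_trans[OF this(2,1)]
    have "inst_wk ?I s t (weight ?I (s, N + c) + weight ?I (N + c, t))" .
    moreover have "weight ?I (s, N + c) = 0" "weight ?I (N + c, t) = 1"
      using s' b c by (simp_all add: sat_instance_simps)
    ultimately show ?thesis by (intro exI[of _ 1]) simp
  qed
  then obtain c where c: "c \<le> 1" "inst_wk ?I s t c" by blast
  have "distance ?I s t \<le> ereal (real c)"
    by (rule distance_le[OF valid_sat_instance c(2)]) (use s' in \<open>simp add: sat_instance_simps\<close>)
  also have "\<dots> \<le> 1" using c(1) by simp
  finally show "distance ?I s t \<le> 1" .
qed

text \<open>For a satisfying pair \<open>a\<close>, \<open>b\<close> every clause is satisfied by at
  least one half, so each path over a clause costs at least \<open>1 + 1\<close>.\<close>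

lemma diameter_sat:
  assumes "satisfiable F"
  shows "2 \<le> ST_diameter (sat_instance n F)"
proof -
  let ?I = "sat_instance n F"
  obtain a b where ab: "a < N" "b < N" "\<forall>C\<in>set F. clause_low h a C \<or> clause_high h b C"
    using assms satisfiable_iff_halves[OF cnf] by (auto simp: N_def)
  \<comment> \<open>The potential measures the distance from \<open>a\<close> where this matters:
    the weight already paid at a clause and 2 at the target \<open>b\<close>. The value 1 at all
    other sources renders their edges harmless.\<close>
  let ?f = "\<lambda>x. if x < N then of_bool (x \<noteq> a) else if x < N + M then of_bool (clause_low h a (F ! (x - N)))
    else if x = N + M + b then 2 else (0 :: nat)"
  have pot: "?f (arc_head ?I e) \<le> ?f (arc_tail ?I e) + arc_weight ?I e" if e: "e < edge_count ?I" for e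
  proof -
    let ?x = "edge_list ?I ! e"
    have "?x \<in> set (edge_list ?I)" using e by (simp add: edge_count_def)
    then obtain a' c where ac: "a' < N" "c < M" "?x = (a', N + c) \<or> ?x = (N + c, N + M + a')"
      unfolding arc_in_sat_instance by blast
    have "F ! c \<in> set F" using ac by (simp add: M_def)
    then have "clause_low h a (F ! c) \<or> clause_high h b (F ! c)" using ab by blast
    moreover have "arc_tail ?I e = a' \<and> arc_head ?I e = N + c \<and>
        arc_weight ?I e = of_bool (clause_low h a' (F ! c)) \<or>
      arc_tail ?I e = N + c \<and> arc_head ?I e = N + M + a' \<and>
        arc_weight ?I e = 1 + of_bool (clause_high h a' (F ! c))"
      using ac by (auto simp: arc_head_def arc_tail_def arc_weight_def sat_instance_simps)
    ultimately show ?thesis using ac ab by (elim disjE conjE) simp_all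
  qed
  have "2 \<le> c" if "inst_wk ?I a (N + M + b) c" for c
    using wk_potential[OF that, of ?f] pot ab(1) by simp
  then have "2 \<le> distance ?I a (N + M + b)"
    by (intro distance_ge[OF valid_sat_instance]) auto
  also have "\<dots> \<le> ST_diameter ?I"
    using ab by (intro distance_le_ST_diameter[OF valid_sat_instance])
      (auto simp: sat_instance_simps target_set_def vertex_set_def)
  finally show ?thesis .
qed

end

section \<open>Layout of an encoded formula\<close>

definition lit_code :: "literal \<Rightarrow> nat" where
  "lit_code l = 2 * fst l + of_bool (snd l)"

definition clause_code :: "literal list \<Rightarrow> nat list" where
  "clause_code C = length C # map lit_code C"

definition cnf_mem :: "nat \<Rightarrow> cnf \<Rightarrow> nat \<Rightarrow> nat" where
  "cnf_mem n F i = (if i < length (encode_cnf n F) then encode_cnf n F ! i else 0)"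

definition clause_offset :: "cnf \<Rightarrow> nat \<Rightarrow> nat" where
  "clause_offset F c = length (concat (map clause_code (take c F)))"

lemma encode_cnf_eq: "encode_cnf n F = [n, length F] @ concat (map clause_code F)"
proof -
  have "(\<lambda>(i, s). 2 * i + of_bool s) = lit_code" by (auto simp: lit_code_def fun_eq_iff)
  then show ?thesis by (simp add: encode_cnf_def clause_code_def[abs_def])
qed

lemma clause_offset_Suc:
  "c < length F \<Longrightarrow> clause_offset F (Suc c) = clause_offset F c + 1 + length (F ! c)"
  by (simp add: clause_offset_def take_Suc_conv_app_nth clause_code_def)

lemma concat_at_offset:
  assumes "c < length F" "k < length (clause_code (F ! c))"
  shows "clause_offset F c + k < length (concat (map clause_code F))"
    "concat (map clause_code F) ! (clause_offset F c + k) = clause_code (F ! c) ! k"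
proof -
  have "F = take c F @ F ! c # drop (Suc c) F" using assms(1) by (simp add: id_take_nth_drop)
  then have e: "concat (map clause_code F) = concat (map clause_code (take c F)) @
      (clause_code (F ! c) @ concat (map clause_code (drop (Suc c) F)))"
    by (metis concat.simps(2) concat_append list.simps(9) map_append)
  show "clause_offset F c + k < length (concat (map clause_code F))"
    unfolding e clause_offset_def using assms(2) by simp
  show "concat (map clause_code F) ! (clause_offset F c + k) = clause_code (F ! c) ! k"
    unfolding e clause_offset_def using assms(2) by (simp add: nth_append)
qed

lemma cnf_mem_clause:
  assumes "c < length F"
  shows "cnf_mem n F (2 + clause_offset F c) = length (F ! c)"
    "k < length (F ! c) \<Longrightarrow> cnf_mem n F (3 + clause_offset F c + k) = lit_code (F ! c ! k)"
proof -
  have *: "cnf_mem n F (2 + (clause_offset F c + k)) = clause_code (F ! c) ! k"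
    if "k < length (clause_code (F ! c))" for k
    using concat_at_offset[OF assms that] by (simp add: cnf_mem_def encode_cnf_eq)
  show "cnf_mem n F (2 + clause_offset F c) = length (F ! c)"
    using *[of 0] by (simp add: clause_code_def)
  show "cnf_mem n F (3 + clause_offset F c + k) = lit_code (F ! c ! k)" if "k < length (F ! c)"
    using *[of "Suc k"] that by (simp add: clause_code_def eval_nat_numeral)
qed

lemma cnf_mem_01: "cnf_mem n F 0 = n" "cnf_mem n F (Suc 0) = length F"
  by (simp_all add: cnf_mem_def encode_cnf_eq)

text \<open>A clause has distinct literals, of which only \<open>2 * n\<close> exist. This bounds
  the length of the input and the time spent on a clause polynomially in \<open>n\<close>.\<close>

lemma clause_length:
  assumes "is_cnf n F" "C \<in> set F"
  shows "length C \<le> 2 * n"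
proof -
  have d: "distinct C" and l: "\<forall>l\<in>set C. fst l < n" using assms by (auto simp: is_cnf_def)
  have s: "set C \<subseteq> {..<n} \<times> UNIV" using l by force
  have "length C = card (set C)" using d by (simp add: distinct_card)
  also have "\<dots> \<le> card ({..<n} \<times> (UNIV :: bool set))" using s by (intro card_mono) auto
  also have "\<dots> = 2 * n" by (simp add: card_cartesian_product)
  finally show ?thesis .
qed

lemma clause_offset_le:
  assumes "is_cnf n F" "c \<le> length F"
  shows "clause_offset F c \<le> c * (2 * n + 1)"
  using assms(2)
proof (induction c)
  case (Suc c)
  then have "length (F ! c) \<le> 2 * n" using clause_length[OF assms(1)] by simp
  then show ?case using Suc clause_offset_Suc[of c F] by simp
qed (simp add: clause_offset_def)

lemma length_encode_cnf:
  assumes "is_cnf n F"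
  shows "length (encode_cnf n F) \<le> 2 + length F * (2 * n + 1)"
  using clause_offset_le[OF assms order_refl] by (simp add: encode_cnf_eq clause_offset_def)

text \<open>Parameters, computed once: registers 23 to 30 contain the length of the encoded instance, \<open>N * M\<close>,
  a bound on the length of the formula, the address of its copy, \<open>N\<close>, \<open>h\<close>, \<open>M\<close> and \<open>n\<close>. The formula is
  moved out of the way, because the instance has to be written to address 0.\<close>

definition copy_prog :: prog where
  "copy_prog = Asg 2 (Num 0) ;;
     Loop (Var 2 \<lless> Var 25) (Put (Var 26 \<oplus> Var 2) (Get (Var 2)) ;; Asg 2 (Var 2 \<oplus> Num 1))"

definition lit_value :: "expr \<Rightarrow> expr" where
  "lit_value e = Bin Mod (Bin Shr (Var 4) e) (Num 2) \<doteq> Bin Mod (Var 10) (Num 2)"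

text \<open>The number in register 4 is read as an assignment to either half at once, because the
  edges written together belong to the source and to the far target with the same index.\<close>

definition clause_prog :: prog where
  "clause_prog = Loop (Var 7 \<lless> Get (Var 6))
     (Asg 10 (Get (Var 6 \<oplus> Var 7 \<oplus> Num 1)) ;;
      Cond (Bin Div (Var 10) (Num 2) \<lless> Var 28)
        (Cond (lit_value (Bin Div (Var 10) (Num 2))) (Asg 8 (Num 1)) Skip)
        (Cond (lit_value (Bin Div (Var 10) (Num 2) \<ominus> Var 28)) (Asg 9 (Num 1)) Skip) ;;
      Asg 7 (Var 7 \<oplus> Num 1))"

definition write_arcs :: prog where
  "write_arcs = Put (Var 11) (Var 4) ;;
      Put (Var 11 \<oplus> Num 1) (Var 27 \<oplus> Var 5) ;;
      Put (Var 11 \<oplus> Num 2) (Var 8) ;;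
      Put (Var 11 \<oplus> Num 3) (Var 27 \<oplus> Var 5) ;;
      Put (Var 11 \<oplus> Num 4) (Var 27 \<oplus> Var 29 \<oplus> Var 4) ;;
      Put (Var 11 \<oplus> Num 5) (Num 1 \<oplus> Var 9) ;;
      Asg 11 (Var 11 \<oplus> Num 6) ;; Asg 3 (Var 3 \<oplus> Num 1) ;; Asg 4 (Var 4 \<oplus> Num 1) ;;
      Cond (Var 4 \<lless> Var 27) Skip
        (Asg 6 (Var 6 \<oplus> Get (Var 6) \<oplus> Num 1) ;; Asg 4 (Num 0) ;; Asg 5 (Var 5 \<oplus> Num 1))"

definition arcs_prog :: prog where
  "arcs_prog = Loop (Var 3 \<lless> Var 24)
     (Asg 8 (Num 0) ;; Asg 9 (Num 0) ;; Asg 7 (Num 0) ;; clause_prog ;; write_arcs)"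

definition side_prog :: prog where
  "side_prog = Asg 2 (Num 0) ;;
     Loop (Var 2 \<lless> Num 2 \<otimes> Var 27 \<oplus> Var 29) (Put (Var 11 \<oplus> Var 2) (Var 2 \<lless> Var 27) ;; Asg 2 (Var 2 \<oplus> Num 1))"

text \<open>The diameter program may rely on all memory behind its input being 0, so the copy of the
  formula and its surroundings have to disappear.\<close>

definition erase_prog :: prog where
  "erase_prog = Asg 2 (Var 23) ;;
     Loop (Var 2 \<lless> Var 26 \<oplus> Var 25) (Put (Var 2) (Num 0) ;; Asg 2 (Var 2 \<oplus> Num 1))"

definition params_prog :: prog where
  "params_prog = Asg 30 (Get (Num 0)) ;; Asg 29 (Get (Num 1)) ;;
     Asg 28 (Bin Div (Var 30 \<oplus> Num 1) (Num 2)) ;; Asg 27 (Bin Shl (Num 1) (Var 28)) ;;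
     Asg 25 (Num 2 \<oplus> Var 29 \<otimes> (Num 2 \<otimes> Var 30 \<oplus> Num 1)) ;; Asg 24 (Var 27 \<otimes> Var 29) ;;
     Asg 23 (Num 2 \<oplus> Num 6 \<otimes> Var 24 \<oplus> (Num 2 \<otimes> Var 27 \<oplus> Var 29)) ;; Asg 26 (Var 25 \<oplus> Var 23)"

definition header_prog :: prog where
  "header_prog = Put (Num 0) (Num 2 \<otimes> Var 27 \<oplus> Var 29) ;; Put (Num 1) (Num 2 \<otimes> Var 24) ;;
     Asg 3 (Num 0) ;; Asg 4 (Num 0) ;; Asg 5 (Num 0) ;; Asg 6 (Var 26 \<oplus> Num 2) ;; Asg 11 (Num 2)"

definition reduction_prog :: prog where
  "reduction_prog = params_prog ;; copy_prog ;; header_prog ;; arcs_prog ;; side_prog ;; erase_prog"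

lemma wp_clause_prog:
  assumes R: "R 4 = a" "R 6 = p" "R 7 = 0" "R 8 = 0" "R 9 = 0" "R 28 = hh"
    and M: "M p = length C" "\<And>k. k < length C \<Longrightarrow> M (p + k + 1) = lit_code (C ! k)"
    and L: "p + length C + 3 < L"
    and Q: "\<And>t R'. keep {7, 8, 9, 10} R R' \<Longrightarrow> R' 8 = of_bool (clause_low hh a C) \<Longrightarrow>
      R' 9 = of_bool (clause_high hh a C) \<Longrightarrow> t \<le> 1 + 6 * length C \<Longrightarrow> Q t R' M"
  shows "wp L clause_prog Q R M"
  unfolding clause_prog_def
proof (rule wp_Loop[where I = "\<lambda>R' M'. M' = M \<and> keep {7, 8, 9, 10} R R' \<and> R' 7 \<le> length C \<and>
      R' 8 = of_bool (clause_low hh a (take (R' 7) C)) \<and> R' 9 = of_bool (clause_high hh a (take (R' 7) C))"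
      and \<phi> = "\<lambda>R' M'. 6 * (length C - R' 7)"])
  show "M = M \<and> keep {7, 8, 9, 10} R R \<and> R 7 \<le> length C \<and>
      R 8 = of_bool (clause_low hh a (take (R 7) C)) \<and> R 9 = of_bool (clause_high hh a (take (R 7) C))"
    using R by (simp add: clause_low_def clause_high_def)
next
  fix R' M'
  assume I: "M' = M \<and> keep {7, 8, 9, 10} R R' \<and> R' 7 \<le> length C \<and>
      R' 8 = of_bool (clause_low hh a (take (R' 7) C)) \<and> R' 9 = of_bool (clause_high hh a (take (R' 7) C))"
    and ne: "ev (Var 7 \<lless> Get (Var 6)) R' M' \<noteq> 0"
  let ?k = "R' 7" let ?low = "clause_low hh a (take ?k C)" let ?high = "clause_high hh a (take ?k C)"
  have r: "R' 4 = a" "R' 6 = p" "R' 28 = hh" using I R keepD[of "{7, 8, 9, 10}" R R'] by simp_all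
  have k: "?k < length C" using I ne r M by (auto split: if_splits)
  obtain i s where l: "C ! ?k = (i, s)" by (cases "C ! ?k")
  have code: "M (Suc (p + ?k)) = 2 * i + of_bool s" using M(2)[OF k] l by (simp add: lit_code_def)
  have dm: "(2 * i + of_bool s) div 2 = i" "(2 * i + of_bool s) mod 2 = (of_bool s :: nat)" by auto
  have tk: "take (Suc ?k) C = take ?k C @ [(i, s)]" using k l by (simp add: take_Suc_conv_app_nth)
  have low: "clause_low hh a (take (Suc ?k) C) \<longleftrightarrow> ?low \<or> sat_low hh a (i, s)"
    and high: "clause_high hh a (take (Suc ?k) C) \<longleftrightarrow> ?high \<or> sat_high hh a (i, s)"
    unfolding tk by (auto simp: clause_low_def clause_high_def)
  let ?low' = "clause_low hh a (take (Suc ?k) C)" let ?high' = "clause_high hh a (take (Suc ?k) C)"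
  let ?b = "Asg 10 (Get (Var 6 \<oplus> Var 7 \<oplus> Num 1)) ;;
      Cond (Bin Div (Var 10) (Num 2) \<lless> Var 28)
        (Cond (lit_value (Bin Div (Var 10) (Num 2))) (Asg 8 (Num 1)) Skip)
        (Cond (lit_value (Bin Div (Var 10) (Num 2) \<ominus> Var 28)) (Asg 9 (Num 1)) Skip) ;;
      Asg 7 (Var 7 \<oplus> Num 1)"
  have Ls: "p + ?k < L" "Suc (p + ?k) < L" "Suc ?k < L" "Suc 0 < L" "2 < L" using L k by auto
  have "wp L ?b (\<lambda>t R'' M''. M'' = M \<and> keep {7, 8, 9, 10} R R'' \<and> R'' 7 = Suc ?k \<and>
      R'' 8 = of_bool ?low' \<and> R'' 9 = of_bool ?high' \<and> t \<le> 5) R' M'"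
    using I r code dm Ls unfolding low high
    by (auto simp: wp_simps lit_value_def drop_bit_eq_div)
  then show "wp L ?b (\<lambda>t R'' M''. (M'' = M \<and> keep {7, 8, 9, 10} R R'' \<and> R'' 7 \<le> length C \<and>
      R'' 8 = of_bool (clause_low hh a (take (R'' 7) C)) \<and> R'' 9 = of_bool (clause_high hh a (take (R'' 7) C))) \<and>
      Suc t + 6 * (length C - R'' 7) \<le> 6 * (length C - R' 7)) R' M'"
  proof (rule wp_mono)
    fix t :: nat and R'' M''
    assume 1: "M'' = M \<and> keep {7, 8, 9, 10} R R'' \<and> R'' 7 = Suc ?k \<and>
      R'' 8 = of_bool ?low' \<and> R'' 9 = of_bool ?high' \<and> t \<le> 5"
    have "6 * (length C - ?k) = 6 + 6 * (length C - Suc ?k)" using k by auto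
    then show "(M'' = M \<and> keep {7, 8, 9, 10} R R'' \<and> R'' 7 \<le> length C \<and>
      R'' 8 = of_bool (clause_low hh a (take (R'' 7) C)) \<and> R'' 9 = of_bool (clause_high hh a (take (R'' 7) C))) \<and>
      Suc t + 6 * (length C - R'' 7) \<le> 6 * (length C - R' 7)"
      using 1 k by simp
  qed
next
  fix t R' M'
  assume I: "M' = M \<and> keep {7, 8, 9, 10} R R' \<and> R' 7 \<le> length C \<and>
      R' 8 = of_bool (clause_low hh a (take (R' 7) C)) \<and> R' 9 = of_bool (clause_high hh a (take (R' 7) C))"
    and e: "ev (Var 7 \<lless> Get (Var 6)) R' M' = 0" and t: "t + 6 * (length C - R' 7) \<le> Suc (6 * (length C - R 7))"
  have "R' 6 = p" using I R keepD[of "{7, 8, 9, 10}" R R'] by simp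
  then have "R' 7 = length C" using I e M by (auto split: if_splits)
  then have "Q t R' M" using I t R by (intro Q) auto
  then show "Q t R' M'" using I by simp
qed simp

lemma wp_write_arcs:
  assumes R: "R 3 = j" "R 4 = a" "R 5 = c" "R 6 = p" "R 8 = x" "R 9 = y" "R 11 = q" "R 27 = u" "R 29 = v"
    and M: "M p = l"
    and L: "q + 5 < p" "p + l + 1 < L" "u + v + a < L" "u + c < L" "j + 1 < L" "a + 1 < L" "c + 1 < L" "y + 1 < L"
  shows "wp L write_arcs (\<lambda>t R' M'.
    R' = (let R1 = R(11 := q + 6, 3 := j + 1, 4 := a + 1) in
      if a + 1 < u then R1 else R1(6 := p + l + 1, 4 := 0, 5 := c + 1)) \<and>
    M' = M(q := a, q + 1 := u + c, q + 2 := x, q + 3 := u + c, q + 4 := u + v + a, q + 5 := y + 1) \<and>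
    t \<le> 14) R M"
  using assms by (simp add: wp_simps write_arcs_def)

section \<open>The program that writes the instance\<close>

context sat_reduction
begin

abbreviation (input) "I \<equiv> sat_instance n F"

lemma nth_arcs:
  assumes "j < N * M" "i < 2"
  shows "edge_list I ! (2 * j + i) = arcs_at j ! i"
  using nth_concat_const[of arcs_at 2 j "[0..<N * M]" i] assms
  by (simp add: sat_instance_simps arcs_at_def)

lemma inst_mem_arcs:
  assumes j: "j < N * M"
  shows "inst_mem I (2 + 6 * j) = j mod N"
    "inst_mem I (3 + 6 * j) = N + j div N"
    "inst_mem I (4 + 6 * j) = of_bool (clause_low h (j mod N) (F ! (j div N)))"
    "inst_mem I (5 + 6 * j) = N + j div N"
    "inst_mem I (6 + 6 * j) = N + M + j mod N"
    "inst_mem I (7 + 6 * j) = 1 + of_bool (clause_high h (j mod N) (F ! (j div N)))"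
proof -
  have e: "2 * j < edge_count I" "2 * j + 1 < edge_count I" using j by (auto simp: edge_count_sat_instance)
  have a0: "edge_list I ! (2 * j) = (j mod N, N + j div N)"
    and a1: "edge_list I ! (2 * j + 1) = (N + j div N, N + M + j mod N)"
    using nth_arcs[OF j, of 0] nth_arcs[OF j, of 1] by (simp_all add: arcs_at_def)
  have lt: "j mod N < N" using N_pos by simp
  note f = inst_mem_nth(3-5)[OF e(1)] inst_mem_nth(3-5)[OF e(2)]
  have "2 + 3 * (2 * j) = 2 + 6 * j" "3 + 3 * (2 * j) = 3 + 6 * j" "4 + 3 * (2 * j) = 4 + 6 * j"
    "2 + 3 * (2 * j + 1) = 5 + 6 * j" "3 + 3 * (2 * j + 1) = 6 + 6 * j" "4 + 3 * (2 * j + 1) = 7 + 6 * j"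
    by simp_all
  note g = f[unfolded this arc_tail_def arc_head_def arc_weight_def a0 a1]
  show "inst_mem I (2 + 6 * j) = j mod N"
    "inst_mem I (3 + 6 * j) = N + j div N"
    "inst_mem I (4 + 6 * j) = of_bool (clause_low h (j mod N) (F ! (j div N)))"
    "inst_mem I (5 + 6 * j) = N + j div N"
    "inst_mem I (6 + 6 * j) = N + M + j mod N"
    "inst_mem I (7 + 6 * j) = 1 + of_bool (clause_high h (j mod N) (F ! (j div N)))"
    using g lt by (simp_all add: sat_instance_simps)
qed

definition Lb :: nat where "Lb = 2 + M * (2 * n + 1)"

definition Lo :: nat where "Lo = 2 + 6 * (N * M) + (2 * N + M)"

text \<open>The copy starts behind both the original, of at most \<open>Lb\<close> cells, and the
  instance, of \<open>Lo\<close> cells; so copying does not destroy what is still to be read, and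
  writing does not reach the copy.\<close>

definition X :: nat where "X = Lb + Lo"

lemma inst_mem_rest:
  "inst_mem I 0 = 2 * N + M" "inst_mem I (Suc 0) = 2 * (N * M)"
  "v < 2 * N + M \<Longrightarrow> inst_mem I (2 + 6 * (N * M) + v) = of_bool (v < N)"
  "Lo \<le> x \<Longrightarrow> inst_mem I x = 0"
proof -
  note f = inst_mem_nth[where I = I, unfolded edge_count_sat_instance sat_instance_simps(1,3)]
  show "inst_mem I 0 = 2 * N + M" "inst_mem I (Suc 0) = 2 * (N * M)" using f(1,2) by auto
  show "v < 2 * N + M \<Longrightarrow> inst_mem I (2 + 6 * (N * M) + v) = of_bool (v < N)"
    using f(6)[of v] by simp
  show "Lo \<le> x \<Longrightarrow> inst_mem I x = 0" using f(7)[of x] by (simp add: Lo_def)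
qed

definition copied :: "(nat \<Rightarrow> nat) \<Rightarrow> bool" where
  "copied Mm \<longleftrightarrow> (\<forall>i<Lb. Mm (X + i) = cnf_mem n F i) \<and> (\<forall>x\<ge>X + Lb. Mm x = 0)"

definition params :: "(nat \<Rightarrow> nat) \<Rightarrow> bool" where
  "params R \<longleftrightarrow> R 30 = n \<and> R 29 = M \<and> R 28 = h \<and> R 27 = N \<and> R 26 = X \<and> R 25 = Lb \<and> R 24 = N * M \<and> R 23 = Lo"

lemma params_keep: "keep {2..11} R R' \<Longrightarrow> params R \<Longrightarrow> params R'"
  by (simp add: params_def keep_def)

lemma copied_upd: "x < X \<Longrightarrow> copied (Mm(x := v)) \<longleftrightarrow> copied Mm"
  by (auto simp: copied_def)

lemma wp_copy_prog:
  assumes R: "params R" and L: "X + Lb + 8 < L"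
    and Q: "\<And>t R' M'. keep {2..11} R R' \<Longrightarrow> copied M' \<Longrightarrow> t \<le> 2 + 3 * Lb \<Longrightarrow> Q t R' M'"
  shows "wp L copy_prog Q R (cnf_mem n F)"
proof -
  let ?C = "cnf_mem n F"
  have LbX: "Lb \<le> X" by (simp add: X_def)
  have z: "?C x = 0" if "Lb \<le> x" for x
    using that length_encode_cnf[OF cnf] by (simp add: cnf_mem_def Lb_def M_def)
  let ?I = "\<lambda>R' M'. params R' \<and> keep {2..11} R R' \<and> R' 2 \<le> Lb \<and> (\<forall>i<R' 2. M' (X + i) = ?C i) \<and>
    (\<forall>x<X. M' x = ?C x) \<and> (\<forall>x\<ge>X + Lb. M' x = 0)"
  have "wp L (Loop (Var 2 \<lless> Var 25) (Put (Var 26 \<oplus> Var 2) (Get (Var 2)) ;; Asg 2 (Var 2 \<oplus> Num 1)))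
      (\<lambda>t. Q (1 + t)) (R(2 := 0)) ?C"
  proof (rule wp_Loop[where I = ?I and \<phi> = "\<lambda>R' M'. 3 * (Lb - R' 2)"])
    show "?I (R(2 := 0)) ?C" using R z by (simp add: params_def)
  next
    fix R' M'
    assume I: "?I R' M'" and ne: "ev (Var 2 \<lless> Var 25) R' M' \<noteq> 0"
    have i: "R' 2 < Lb" using I ne by (auto simp: params_def split: if_splits)
    have t: "3 * (Lb - R' 2) = 3 + 3 * (Lb - Suc (R' 2))" using i by auto
    have l: "X + R' 2 < L" "Suc (R' 2) < L" "Suc 0 < L" using i L by auto
    show "wp L (Put (Var 26 \<oplus> Var 2) (Get (Var 2)) ;; Asg 2 (Var 2 \<oplus> Num 1))
      (\<lambda>t R'' M''. ?I R'' M'' \<and> Suc t + 3 * (Lb - R'' 2) \<le> 3 * (Lb - R' 2)) R' M'"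
      using I i l LbX unfolding t by (simp add: wp_simps params_def less_Suc_eq)
  next
    fix t R' M'
    assume I: "?I R' M'" and e: "ev (Var 2 \<lless> Var 25) R' M' = 0" and t: "t + 3 * (Lb - R' 2) \<le> Suc (3 * (Lb - (R(2 := 0)) 2))"
    then have "R' 2 = Lb" by (auto simp: params_def split: if_splits)
    then show "Q (1 + t) R' M'" using I t by (intro Q) (auto simp: copied_def)
  qed simp
  then show ?thesis using L unfolding copy_prog_def wp_Seq[of L "Asg _ _"] wp_Asg[of L 2 "Num 0"] by simp
qed

definition arcs_done :: "nat \<Rightarrow> (nat \<Rightarrow> nat) \<Rightarrow> bool" where
  "arcs_done x Mm \<longleftrightarrow> (\<forall>y<x. Mm y = inst_mem I y)"

lemma wp_arcs_prog:
  assumes R: "params R" "R 3 = 0" "R 4 = 0" "R 5 = 0" "R 6 = X + 2" "R 11 = 2" and L: "X + Lb + 8 < L"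
    and M: "copied Mm" "arcs_done 2 Mm"
    and Q: "\<And>t R' M'. keep {2..11} R R' \<Longrightarrow> R' 11 = 2 + 6 * (N * M) \<Longrightarrow> copied M' \<Longrightarrow>
      arcs_done (2 + 6 * (N * M)) M' \<Longrightarrow> t \<le> 1 + (30 + 12 * n) * (N * M) \<Longrightarrow> Q t R' M'"
  shows "wp L arcs_prog Q R Mm"
proof -
  let ?I = "\<lambda>R' M'. params R' \<and> keep {2..11} R R' \<and> R' 3 \<le> N * M \<and> R' 4 = R' 3 mod N \<and> R' 5 = R' 3 div N \<and>
    R' 6 = X + 2 + clause_offset F (R' 3 div N) \<and> R' 11 = 2 + 6 * R' 3 \<and> copied M' \<and> arcs_done (2 + 6 * R' 3) M'"
  let ?\<phi> = "\<lambda>R' (M' :: nat \<Rightarrow> nat). (30 + 12 * n) * (N * M - R' 3)"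
  show ?thesis
    unfolding arcs_prog_def
  proof (rule wp_Loop[where I = ?I and \<phi> = ?\<phi>])
    show "?I R Mm" using R M by (simp add: clause_offset_def)
  next
    fix R' M'
    assume I: "?I R' M'" and ne: "ev (Var 3 \<lless> Var 24) R' M' \<noteq> 0"
    let ?j = "R' 3" let ?a = "?j mod N" let ?c = "?j div N" let ?C = "F ! ?c"
    have j: "?j < N * M" using I ne by (auto simp: params_def split: if_splits)
    have c: "?c < M" using j by (auto intro!: less_mult_imp_div_less simp: mult.commute)
    have a: "?a < N" using N_pos by simp
    have C: "?C \<in> set F" "length ?C \<le> 2 * n" using c clause_length[OF cnf, of ?C] by (auto simp: M_def)
    have off: "clause_offset F ?c + 1 + length ?C = clause_offset F (Suc ?c)"
      "clause_offset F (Suc ?c) \<le> Suc ?c * (2 * n + 1)"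
      using clause_offset_Suc[of ?c F] clause_offset_le[OF cnf, of "Suc ?c"] c by (auto simp: M_def)
    have "Suc ?c * (2 * n + 1) \<le> M * (2 * n + 1)" using c by (intro mult_right_mono) auto
    then have offb: "2 + clause_offset F ?c + length ?C < Lb" using off unfolding Lb_def by linarith
    let ?p = "X + 2 + clause_offset F ?c"
    have cp: "M' (X + i) = cnf_mem n F i" if "i < Lb" for i using I that by (simp add: copied_def)
    have Mp: "M' ?p = length ?C"
      using cp[of "2 + clause_offset F ?c"] offb cnf_mem_clause(1)[of ?c F n] c by (simp add: M_def add.assoc)
    have Ml: "M' (?p + k + 1) = lit_code (?C ! k)" if "k < length ?C" for k
    proof -
      have "M' (X + (3 + clause_offset F ?c + k)) = cnf_mem n F (3 + clause_offset F ?c + k)"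
        using cp[of "3 + clause_offset F ?c + k"] offb that by simp
      moreover have "?p + k + 1 = X + (3 + clause_offset F ?c + k)" by simp
      ultimately show ?thesis
        using cnf_mem_clause(2)[of ?c F k n] c that by (metis M_def)
    qed
    have t: "(30 + 12 * n) * (N * M - ?j) = (30 + 12 * n) + (30 + 12 * n) * (N * M - Suc ?j)"
      using j by (metis Suc_diff_Suc mult_Suc_right)
    let ?R = "R'(8 := 0, 9 := 0, 7 := 0)"
    have o: "2 + 6 * ?j + 5 < Lo" "Lo \<le> X" "N + M + ?a < Lo" "2 * N + M \<le> Lo" using j a by (auto simp: Lo_def X_def)
    have "wp L clause_prog (\<lambda>t. wp L write_arcs (\<lambda>t' R'' M''. ?I R'' M'' \<and> Suc (1 + (1 + (1 + (t + t')))) + ?\<phi> R'' M'' \<le> ?\<phi> R' M')) ?R M'"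
    proof (rule wp_clause_prog[where a = ?a and p = ?p and hh = h and C = ?C])
      show "?R 4 = ?a" "?R 6 = ?p" "?R 7 = 0" "?R 8 = 0" "?R 9 = 0" "?R 28 = h"
        using I by (auto simp: params_def)
      show "M' ?p = length ?C" by (rule Mp)
      show "M' (?p + k + 1) = lit_code (?C ! k)" if "k < length ?C" for k by (rule Ml[OF that])
      show "?p + length ?C + 3 < L" using offb L by linarith
    next
      fix t1 R1
      assume 1: "keep {7, 8, 9, 10} ?R R1" "R1 8 = of_bool (clause_low h ?a ?C)"
        "R1 9 = of_bool (clause_high h ?a ?C)" "t1 \<le> 1 + 6 * length ?C"
      have r1: "R1 3 = ?j" "R1 4 = ?a" "R1 5 = ?c" "R1 6 = ?p" "R1 11 = 2 + 6 * ?j" "R1 27 = N" "R1 29 = M"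
        using keepD[OF 1(1)] I by (simp_all add: params_def)
      have k1: "keep {2..11} R R1" by (rule keep_trans[OF _ 1(1), of "{2..11}"]) (use I in auto)
      define q where "q = 2 + 6 * ?j"
      have qn: "q + 1 = 3 + 6 * ?j" "q + 2 = 4 + 6 * ?j" "q + 3 = 5 + 6 * ?j" "q + 4 = 6 + 6 * ?j"
        "q + 5 = 7 + 6 * ?j" "q + 6 = 2 + 6 * Suc ?j" by (simp_all add: q_def)
      let ?x = "of_bool (clause_low h ?a ?C) :: nat" let ?y = "of_bool (clause_high h ?a ?C) :: nat"
      let ?M1 = "M'(q := ?a, q + 1 := N + ?c, q + 2 := ?x, q + 3 := N + ?c, q + 4 := N + M + ?a, q + 5 := ?y + 1)"
      let ?R1 = "R1(11 := q + 6, 3 := ?j + 1, 4 := ?a + 1)"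
      let ?R2 = "if ?a + 1 < N then ?R1 else ?R1(6 := ?p + length ?C + 1, 4 := 0, 5 := ?c + 1)"
      have qX: "q + 5 < X" using o by (simp add: q_def)
      have cop: "copied ?M1" using I qX by (simp add: copied_upd)
      have ad: "arcs_done (2 + 6 * Suc ?j) ?M1"
        unfolding arcs_done_def
      proof (intro allI impI)
        fix y assume "y < 2 + 6 * Suc ?j"
        then have "y < q + 6" by (simp add: q_def)
        then have "y < q \<or> y = q \<or> y = q + 1 \<or> y = q + 2 \<or> y = q + 3 \<or> y = q + 4 \<or> y = q + 5" by arith
        moreover have "M' y = inst_mem I y" if "y < q" using I that by (simp add: arcs_done_def q_def)
        moreover note im = inst_mem_arcs[OF j, folded qn q_def]
        ultimately show "?M1 y = inst_mem I y" by (elim disjE) simp_all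
      qed
      have Ls: "q + 5 < ?p" "?p + length ?C + 1 < L" "N + M + ?a < L" "N + ?c < L" "?j + 1 < L" "?a + 1 < L"
        "?c + 1 < L" "?y + 1 < L" using qX o L offb c a j by auto
      have w: "wp L write_arcs (\<lambda>t R'' M''. R'' = ?R2 \<and> M'' = ?M1 \<and> t \<le> 14) R1 M'"
        using wp_write_arcs[where R = R1 and M = M' and L = L, OF r1(1-4) 1(2,3) r1(5)[folded q_def] r1(6,7) Mp Ls] unfolding Let_def .
      have jj: "Suc ?j mod N = (if Suc ?a < N then Suc ?a else 0)" "Suc ?j div N = (if Suc ?a < N then ?c else Suc ?c)"
        using a by (auto simp: mod_Suc div_Suc)
      from w show "wp L write_arcs (\<lambda>t' R'' M''. ?I R'' M'' \<and> Suc (1 + (1 + (1 + (t1 + t')))) + ?\<phi> R'' M'' \<le> ?\<phi> R' M') R1 M'"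
      proof (rule wp_mono)
        fix t' :: nat and R'' M''
        assume 2: "R'' = ?R2 \<and> M'' = ?M1 \<and> t' \<le> 14"
        have R2: "R'' = ?R2" and M2: "M'' = ?M1" using 2 by auto
        have k2: "keep {2..11} R R''" unfolding R2 using k1 by simp
        have p2: "params R''" using params_keep[OF k2 R(1)] .
        have r2: "R'' 3 = Suc ?j" "R'' 4 = Suc ?j mod N" "R'' 5 = Suc ?j div N"
          "R'' 6 = X + 2 + clause_offset F (Suc ?j div N)" "R'' 11 = 2 + 6 * Suc ?j"
          unfolding R2 jj using r1 off(1) qn(6) by auto
        have time: "Suc (1 + (1 + (1 + (t1 + t')))) + (30 + 12 * n) * (N * M - Suc ?j) \<le> (30 + 12 * n) * (N * M - ?j)"
          unfolding t using 1(4) 2 C(2) by simp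
        show "?I R'' M'' \<and> Suc (1 + (1 + (1 + (t1 + t')))) + ?\<phi> R'' M'' \<le> ?\<phi> R' M'"
          unfolding r2(1) using p2 k2 j r2(2-) cop ad time unfolding M2 by (intro conjI) (assumption | simp)+
      qed
    qed
    then show "wp L (Asg 8 (Num 0) ;; Asg 9 (Num 0) ;; Asg 7 (Num 0) ;; clause_prog ;; write_arcs)
      (\<lambda>t R'' M''. ?I R'' M'' \<and> Suc t + ?\<phi> R'' M'' \<le> ?\<phi> R' M') R' M'"
      unfolding wp_Seq[of L "Asg 8 _"] wp_Seq[of L "Asg 9 _"] wp_Seq[of L "Asg 7 _"] wp_Seq[of L clause_prog]
        wp_Asg[of L 8] wp_Asg[of L 9] wp_Asg[of L 7] using L by simp
  next
    fix t R' M'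
    assume I: "?I R' M'" and e: "ev (Var 3 \<lless> Var 24) R' M' = 0" and t: "t + ?\<phi> R' M' \<le> Suc (?\<phi> R Mm)"
    then have "R' 3 = N * M" by (auto simp: params_def split: if_splits)
    then show "Q t R' M'" using I t R by (intro Q) auto
  qed simp
qed

end

text \<open>Yields \<open>n \<le> 2 * half n \<le> N\<close>, so room for the addresses is room for
  computing with \<open>n\<close> even if there are no clauses.\<close>

lemma two_mult_le_power: "2 * k \<le> (2::nat) ^ k"
proof (induction k)
  case (Suc k)
  then show ?case by (cases k) auto
qed simp

context sat_reduction
begin

lemma wp_params_prog:
  assumes L: "X + Lb + 8 < L" and Q: "\<And>R'. params R' \<Longrightarrow> Q 8 R' (cnf_mem n F)"
  shows "wp L params_prog Q (\<lambda>_. 0) (cnf_mem n F)"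
proof -
  have m: "cnf_mem n F 0 = n" "cnf_mem n F (Suc 0) = M" by (simp_all add: cnf_mem_01 M_def)
  have half: "Suc n div 2 = h" "n \<le> 2 * h" by (auto simp: half_def)
  have N: "2 * h \<le> N" "2 ^ h = N" unfolding N_def by (simp_all add: two_mult_le_power)
  have X: "X = Lb + Lo" by (simp add: X_def)
  have Ls: "2 * n + 1 < L" "Suc n < L" "N < L" "M < L" "N * M < L" "6 * (N * M) < L" "2 + 6 * (N * M) < L"
    "2 * N < L" "2 * N + M < L" "Lo < L" "Lb < L" "M * (2 * n + 1) < L" "X < L" "8 < L"
    using L half N unfolding X Lb_def Lo_def by linarith+
  have "wp L params_prog (\<lambda>t R' M'. t = 8 \<and> R' = (\<lambda>_. 0)(30 := n, 29 := M, 28 := h, 27 := N, 25 := Lb,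
      24 := N * M, 23 := Lo, 26 := X) \<and> M' = cnf_mem n F) (\<lambda>_. 0) (cnf_mem n F)"
    using m half N Ls by (simp add: params_prog_def wp_simps Lb_def Lo_def X_def add.assoc)
  then show ?thesis by (rule wp_mono) (auto intro!: Q simp: params_def)
qed

lemma wp_header_prog:
  assumes R: "params R" and L: "X + Lb + 8 < L" and M: "copied Mm"
    and Q: "\<And>R' M'. params R' \<Longrightarrow> R' 3 = 0 \<Longrightarrow> R' 4 = 0 \<Longrightarrow> R' 5 = 0 \<Longrightarrow> R' 6 = X + 2 \<Longrightarrow> R' 11 = 2 \<Longrightarrow>
      copied M' \<Longrightarrow> arcs_done 2 M' \<Longrightarrow> Q 7 R' M'"
  shows "wp L header_prog Q R Mm"
proof -
  have X: "X = Lb + Lo" by (simp add: X_def)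
  have r: "R 27 = N" "R 29 = M" "R 24 = N * M" "R 26 = X" using R by (simp_all add: params_def)
  have Ls: "2 * N + M < L" "2 * N < L" "2 * (N * M) < L" "Suc (Suc X) < L" "2 < L"
    using L unfolding X Lb_def Lo_def by linarith+
  have "wp L header_prog (\<lambda>t R' M'. t = 7 \<and> R' = R(3 := 0, 4 := 0, 5 := 0, 6 := X + 2, 11 := 2) \<and>
      M' = Mm(0 := 2 * N + M, 1 := 2 * (N * M))) R Mm"
    using r Ls by (simp add: header_prog_def wp_simps)
  then show ?thesis
  proof (rule wp_mono)
    fix t :: nat and R' M'
    assume 1: "t = 7 \<and> R' = R(3 := 0, 4 := 0, 5 := 0, 6 := X + 2, 11 := 2) \<and>
      M' = Mm(0 := 2 * N + M, 1 := 2 * (N * M))"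
    have "0 < X" "1 < X" by (simp_all add: X_def Lb_def)
    then have "copied M'" using 1 M by (simp add: copied_upd)
    moreover have "arcs_done 2 M'"
      using 1 inst_mem_rest(1,2) by (auto simp: arcs_done_def numeral_2_eq_2 less_Suc_eq)
    ultimately show "Q t R' M'" using 1 R Q[of R' M'] by (simp add: params_def)
  qed
qed

lemma wp_side_prog:
  assumes R: "params R" "R 11 = 2 + 6 * (N * M)" and L: "X + Lb + 8 < L"
    and M: "copied Mm" "arcs_done (2 + 6 * (N * M)) Mm"
    and Q: "\<And>t R' M'. params R' \<Longrightarrow> copied M' \<Longrightarrow> arcs_done Lo M' \<Longrightarrow> t \<le> 2 + 3 * (2 * N + M) \<Longrightarrow> Q t R' M'"
  shows "wp L side_prog Q R Mm"
proof -
  define q where "q = 2 + 6 * (N * M)"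
  define k where "k = 2 * N + M"
  have X: "X = Lb + Lo" and Lo: "Lo = q + k" by (simp_all add: X_def Lo_def q_def k_def)
  have Ls: "X < L" "2 * N < L" "2 * N + M < L" "2 < L" "Suc 0 < L" "Suc k < L"
    using L unfolding X Lb_def Lo q_def k_def by linarith+
  let ?I = "\<lambda>R' M'. params R' \<and> R' 11 = q \<and> R' 2 \<le> k \<and> copied M' \<and> arcs_done (q + R' 2) M'"
  have "wp L (Loop (Var 2 \<lless> Num 2 \<otimes> Var 27 \<oplus> Var 29) (Put (Var 11 \<oplus> Var 2) (Var 2 \<lless> Var 27) ;; Asg 2 (Var 2 \<oplus> Num 1)))
      (\<lambda>t. Q (1 + t)) (R(2 := 0)) Mm"
  proof (rule wp_Loop[where I = ?I and \<phi> = "\<lambda>R' M'. 3 * (k - R' 2)"])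
    show "?I (R(2 := 0)) Mm" using R M by (simp add: params_def q_def)
  next
    fix R' M'
    assume I: "?I R' M'"
    then show "safe L (Var 2 \<lless> Num 2 \<otimes> Var 27 \<oplus> Var 29) R' M'" using Ls by (simp add: params_def)
    assume ne: "ev (Var 2 \<lless> Num 2 \<otimes> Var 27 \<oplus> Var 29) R' M' \<noteq> 0"
    have i: "R' 2 < k" using I ne by (auto simp: params_def k_def split: if_splits)
    have t: "3 * (k - R' 2) = 3 + 3 * (k - Suc (R' 2))" using i by auto
    have l: "q + R' 2 < L" "Suc (R' 2) < L" "q + R' 2 < X" using i Ls unfolding X Lo by (auto simp: Lb_def)
    have m: "inst_mem I (q + R' 2) = of_bool (R' 2 < N)"
      using inst_mem_rest(3)[of "R' 2"] i by (simp add: q_def k_def)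
    have r: "R' 27 = N" using I by (simp add: params_def)
    have "wp L (Put (Var 11 \<oplus> Var 2) (Var 2 \<lless> Var 27) ;; Asg 2 (Var 2 \<oplus> Num 1))
      (\<lambda>t R'' M''. R'' = R'(2 := Suc (R' 2)) \<and> M'' = M'(q + R' 2 := of_bool (R' 2 < N)) \<and> t = 2) R' M'"
      using I l Ls r by (simp add: wp_simps)
    then show "wp L (Put (Var 11 \<oplus> Var 2) (Var 2 \<lless> Var 27) ;; Asg 2 (Var 2 \<oplus> Num 1))
      (\<lambda>t R'' M''. ?I R'' M'' \<and> Suc t + 3 * (k - R'' 2) \<le> 3 * (k - R' 2)) R' M'"
    proof (rule wp_mono)
      fix t' :: nat and R'' M''
      assume 2: "R'' = R'(2 := Suc (R' 2)) \<and> M'' = M'(q + R' 2 := of_bool (R' 2 < N)) \<and> t' = 2"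
      have "copied M''" using 2 I l(3) by (simp add: copied_upd)
      moreover have "arcs_done (q + Suc (R' 2)) M''"
        using 2 I m by (simp add: arcs_done_def less_Suc_eq)
      ultimately show "?I R'' M'' \<and> Suc t' + 3 * (k - R'' 2) \<le> 3 * (k - R' 2)"
        using 2 I i unfolding t by (simp add: params_def)
    qed
  next
    fix t R' M'
    assume I: "?I R' M'" and e: "ev (Var 2 \<lless> Num 2 \<otimes> Var 27 \<oplus> Var 29) R' M' = 0"
      and t: "t + 3 * (k - R' 2) \<le> Suc (3 * (k - (R(2 := 0)) 2))"
    then have "R' 2 = k" by (auto simp: params_def k_def split: if_splits)
    then show "Q (1 + t) R' M'" using I t by (intro Q) (simp_all add: Lo k_def)
  qed
  then show ?thesis using L unfolding side_prog_def wp_Seq[of L "Asg _ _"] wp_Asg[of L 2 "Num 0"] by simp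
qed

lemma wp_erase_prog:
  assumes R: "params R" and L: "X + Lb + 8 < L" and M: "copied Mm" "arcs_done Lo Mm"
    and Q: "\<And>t R'. t \<le> 2 + 3 * (X + Lb) \<Longrightarrow> Q t R' (inst_mem I)"
  shows "wp L erase_prog Q R Mm"
proof -
  have Lo: "Lo \<le> X" by (simp add: X_def)
  let ?I = "\<lambda>R' M'. params R' \<and> Lo \<le> R' 2 \<and> R' 2 \<le> X + Lb \<and> arcs_done (R' 2) M' \<and> (\<forall>x\<ge>X + Lb. M' x = 0)"
  have "wp L (Loop (Var 2 \<lless> Var 26 \<oplus> Var 25) (Put (Var 2) (Num 0) ;; Asg 2 (Var 2 \<oplus> Num 1)))
      (\<lambda>t. Q (1 + t)) (R(2 := Lo)) Mm"
  proof (rule wp_Loop[where I = ?I and \<phi> = "\<lambda>R' M'. 3 * (X + Lb - R' 2)"])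
    show "?I (R(2 := Lo)) Mm" using R M Lo by (simp add: params_def copied_def)
  next
    fix R' M'
    assume I: "?I R' M'"
    then show "safe L (Var 2 \<lless> Var 26 \<oplus> Var 25) R' M'" using L by (simp add: params_def)
    assume ne: "ev (Var 2 \<lless> Var 26 \<oplus> Var 25) R' M' \<noteq> 0"
    have i: "R' 2 < X + Lb" using I ne by (auto simp: params_def split: if_splits)
    have t: "3 * (X + Lb - R' 2) = 3 + 3 * (X + Lb - Suc (R' 2))" using i by auto
    have l: "Suc (R' 2) < L" "Suc 0 < L" "0 < L" using i L by auto
    have m: "inst_mem I (R' 2) = 0" using I by (intro inst_mem_rest(4)) simp
    show "wp L (Put (Var 2) (Num 0) ;; Asg 2 (Var 2 \<oplus> Num 1))
      (\<lambda>t R'' M''. ?I R'' M'' \<and> Suc t + 3 * (X + Lb - R'' 2) \<le> 3 * (X + Lb - R' 2)) R' M'"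
      using I i l m unfolding t by (simp add: wp_simps params_def arcs_done_def less_Suc_eq)
  next
    fix t R' M'
    assume I: "?I R' M'" and e: "ev (Var 2 \<lless> Var 26 \<oplus> Var 25) R' M' = 0"
      and t: "t + 3 * (X + Lb - R' 2) \<le> Suc (3 * (X + Lb - (R(2 := Lo)) 2))"
    have r2: "R' 2 = X + Lb" using I e by (auto simp: params_def split: if_splits)
    have "M' x = inst_mem I x" for x
    proof (cases "x < X + Lb")
      case False
      then show ?thesis using I Lo inst_mem_rest(4)[of x] by simp
    qed (use I r2 in \<open>simp add: arcs_done_def\<close>)
    then have "M' = inst_mem I" by (rule ext)
    then show "Q (1 + t) R' M'" using t by (auto intro!: Q)
  qed
  then show ?thesis using R L unfolding erase_prog_def wp_Seq[of L "Asg _ _"] wp_Asg[of L 2 "Var 23"] by (simp add: params_def)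
qed

definition reduction_time :: nat where
  "reduction_time = 22 + 3 * Lb + (30 + 12 * n) * (N * M) + 3 * (2 * N + M) + 3 * (X + Lb)"

lemma wp_reduction_prog:
  assumes L: "X + Lb + 8 < L"
  shows "wp L reduction_prog (\<lambda>t R' M'. M' = inst_mem I \<and> t \<le> reduction_time) (\<lambda>_. 0) (cnf_mem n F)"
  unfolding reduction_prog_def wp_Seq[of L params_prog] wp_Seq[of L copy_prog] wp_Seq[of L header_prog]
    wp_Seq[of L arcs_prog] wp_Seq[of L side_prog]
proof (rule wp_params_prog[OF L], rule wp_copy_prog[OF _ L], assumption)
  fix t1 R1 R2 M2
  assume 1: "params R1" "keep {2..11} R1 R2" "copied M2" "t1 \<le> 2 + 3 * Lb"
  have p: "params R2" by (rule params_keep[OF 1(2,1)])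
  show "wp L header_prog (\<lambda>t2. wp L arcs_prog (\<lambda>t3. wp L side_prog (\<lambda>t4. wp L erase_prog
      (\<lambda>t5 R' M'. M' = inst_mem I \<and> 8 + (t1 + (t2 + (t3 + (t4 + t5)))) \<le> reduction_time)))) R2 M2"
  proof (rule wp_header_prog[OF p L 1(3)], rule wp_arcs_prog[OF _ _ _ _ _ _ L], assumption+)
    fix R3 t4 R4 M4
    assume 2: "params R3" "keep {2..11} R3 R4" "R4 11 = 2 + 6 * (N * M)" "copied M4"
      "arcs_done (2 + 6 * (N * M)) M4" "t4 \<le> 1 + (30 + 12 * n) * (N * M)"
    have p: "params R4" by (rule params_keep[OF 2(2,1)])
    show "wp L side_prog (\<lambda>t5. wp L erase_prog
      (\<lambda>t6 R' M'. M' = inst_mem I \<and> 8 + (t1 + (7 + (t4 + (t5 + t6)))) \<le> reduction_time)) R4 M4"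
      by (rule wp_side_prog[OF p 2(3) L 2(4,5)], rule wp_erase_prog[OF _ L], assumption+)
        (use 1(4) 2(6) in \<open>simp add: reduction_time_def\<close>)
  qed
qed

lemma regs_below_reduction: "regs_below 32 reduction_prog"
  by (simp add: reduction_prog_def params_prog_def copy_prog_def header_prog_def arcs_prog_def
      side_prog_def erase_prog_def clause_prog_def write_arcs_def lit_value_def)

lemma cnf_mem_less:
  assumes "Lb + n < 2 ^ w"
  shows "cnf_mem n F x < 2 ^ w"
proof -
  have le: "y \<le> Lb + n" if y: "y \<in> set (encode_cnf n F)" for y
  proof -
    have n: "2 * n \<le> Lb" if "C \<in> set F" for C
    proof -
      have "1 \<le> M" using that by (cases "length F") (auto simp: M_def)
      then have "1 * (2 * n + 1) \<le> M * (2 * n + 1)" by (rule mult_right_mono) simp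
      then show ?thesis by (simp add: Lb_def)
    qed
    have "y = n \<or> y = M \<or> (\<exists>C\<in>set F. y = length C \<or> (\<exists>l\<in>set C. y = lit_code l))"
      using y by (auto simp: encode_cnf_eq clause_code_def M_def)
    then consider "y = n" | "y = M" | C where "C \<in> set F" "y = length C"
      | C l where "C \<in> set F" "l \<in> set C" "y = lit_code l" by blast
    then show ?thesis
    proof cases
      case 3
      then show ?thesis using clause_length[OF cnf, of C] n[of C] by simp
    next
      case 4
      then have "fst l < n" using cnf by (auto simp: is_cnf_def)
      then have "y \<le> 2 * n" using 4 by (simp add: lit_code_def of_bool_def)
      then show ?thesis using n[of C] 4 by simp
    qed (simp_all add: Lb_def)
  qed
  then have "cnf_mem n F x \<le> Lb + n" by (auto simp: cnf_mem_def)
  then show ?thesis using assms by linarith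
qed

definition room :: nat where "room = X + Lb + n + 8"

end

section \<open>Deciding satisfiability with a diameter program\<close>

definition sat_prog :: "com list \<Rightarrow> com list" where
  "sat_prog p = compile 32 reduction_prog @ clear_regs (32 + prog_depth reduction_prog) @ p @ compare_one"

context sat_reduction
begin

text \<open>Compiled code leaves garbage only in finitely many registers. After clearing these and
  with the memory equal to the encoded instance, the state is literally the initial one of
  \<open>p\<close>.\<close>

lemma steps_reduction:
  assumes w: "room < 2 ^ w"
  obtains k where "k \<le> step_cost reduction_prog * reduction_time + (32 + prog_depth reduction_prog)"
    "steps w k (init_config (sat_prog p) (encode_cnf n F))
      (p @ compare_one, snd (init_config p (encode_instance I)))"
proof -
  let ?D = "prog_depth reduction_prog"
  let ?s0 = "\<lparr>regs = (\<lambda>_. 0), mem = cnf_mem n F\<rparr>"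
  let ?cs = "clear_regs (32 + ?D) @ p @ compare_one"
  have w1: "1 < (2::nat) ^ w" "X + Lb + 8 < 2 ^ w" "Lb + n < 2 ^ w" using w by (auto simp: room_def)
  have imp: "implements w 32 ?D ?s0 (\<lambda>_. 0) (cnf_mem n F)"
    using w1 cnf_mem_less by (simp add: implements_def bounded_def)
  obtain t R' M' k s' where 1: "M' = inst_mem I \<and> t \<le> reduction_time" "k \<le> step_cost reduction_prog * t"
    "steps w k (compile 32 reduction_prog @ ?cs, ?s0) (?cs, s')" "implements w 32 ?D s' R' M'"
    by (rule compile_wp[OF wp_reduction_prog[OF w1(2)] imp w1(1) regs_below_reduction order_refl])
  have "s'\<lparr>regs := (\<lambda>r. if r < 32 + ?D then 0 else regs s' r)\<rparr> = \<lparr>regs = (\<lambda>_. 0), mem = inst_mem I\<rparr>"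
    using 1(1,4) by (auto simp: implements_def fun_eq_iff)
  then have "steps w (k + (32 + ?D)) (compile 32 reduction_prog @ ?cs, ?s0)
      (p @ compare_one, \<lparr>regs = (\<lambda>_. 0), mem = inst_mem I\<rparr>)"
    using steps_trans[OF 1(3) steps_clear_regs] by metis
  moreover have "init_config (sat_prog p) (encode_cnf n F) = (compile 32 reduction_prog @ ?cs, ?s0)"
    by (simp add: init_config_def sat_prog_def cnf_mem_def[abs_def])
  moreover have "snd (init_config p (encode_instance I)) = \<lparr>regs = (\<lambda>_. 0), mem = inst_mem I\<rparr>"
    by (simp add: init_config_def inst_mem_def[abs_def])
  moreover have "step_cost reduction_prog * t \<le> step_cost reduction_prog * reduction_time"
    using 1(1) by simp
  moreover have "k \<le> step_cost reduction_prog * reduction_time" using 1(2) calculation(4) by (rule order_trans)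
  ultimately show ?thesis using that[of "k + (32 + ?D)"] by simp
qed

lemma run_sat_prog:
  assumes w: "room < 2 ^ w" "w0 \<le> w" and p: "halts_within w0 t p (encode_instance I)"
    and T: "step_cost reduction_prog * reduction_time + (32 + prog_depth reduction_prog) + t + 3 \<le> T"
  shows "run w T (init_config (sat_prog p) (encode_cnf n F)) =
    map_pmf (\<lambda>c. ([], compared (snd c))) (run w0 t (init_config p (encode_instance I)))"
proof -
  let ?c = "init_config (sat_prog p) (encode_cnf n F)" let ?i = "init_config p (encode_instance I)"
  have ip: "?i = (p, snd ?i)" by (simp add: init_config_def)
  have w1: "0 < w" using w(1) by (cases w) (auto simp: room_def)
  obtain k where k: "k \<le> step_cost reduction_prog * reduction_time + (32 + prog_depth reduction_prog)"
    "steps w k ?c (p @ compare_one, snd ?i)" using steps_reduction[OF w(1)] by blast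
  have e: "run w t ?i = run w0 t ?i" using run_word_mono[OF w(2)] p by (simp add: halts_within_def)
  have "\<forall>c\<in>set_pmf (run w t (p, snd ?i)). fst c = []" using p e ip by (simp add: halts_within_def)
  then have "run w (t + 3) (p @ compare_one, snd ?i) = map_pmf (\<lambda>c. ([], compared (snd c))) (run w t (p, snd ?i))"
    by (rule run_append) (rule run_compare_one[OF w1])
  then have 1: "run w (k + (t + 3)) ?c = map_pmf (\<lambda>c. ([], compared (snd c))) (run w0 t ?i)"
    using k(2) e ip unfolding steps_def by metis
  have "run w (k + (t + 3) + (T - (k + (t + 3)))) ?c = run w (k + (t + 3)) ?c"
    by (rule run_extend) (auto simp: 1)
  then show ?thesis using 1 k(1) T by simp
qed

text \<open>The gap at 1: an unsatisfiable formula forces an estimate of at most 1, a satisfiable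
  one at least \<open>2 / (2 - \<delta>)\<close>. As \<open>approximates\<close> includes
  \<open>1 \<le> 2 - \<delta>\<close>, this quotient is well-defined and exceeds 1.\<close>

lemma sat_prog_decides:
  assumes w: "room < 2 ^ w" "w0 \<le> w" and p: "halts_within w0 t p (encode_instance I)"
    and T: "step_cost reduction_prog * reduction_time + (32 + prog_depth reduction_prog) + t + 3 \<le> T"
    and \<delta>: "0 < \<delta>"
    and succ: "2 / 3 \<le> output_prob w0 t p (encode_instance I) (\<lambda>s. approximates (2 - \<delta>) (ST_diameter I) (estimate s))"
  shows "halts_within w T (sat_prog p) (encode_cnf n F)"
    "2 / 3 \<le> output_prob w T (sat_prog p) (encode_cnf n F) (\<lambda>s. regs s 0 \<noteq> 0 \<longleftrightarrow> satisfiable F)"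
proof -
  note r = run_sat_prog[OF w p T]
  show "halts_within w T (sat_prog p) (encode_cnf n F)" unfolding halts_within_def r by auto
  have decide: "(regs (compared s) 0 \<noteq> 0) = satisfiable F" if a: "approximates (2 - \<delta>) (ST_diameter I) (estimate s)" for s
  proof (cases "satisfiable F")
    case False
    then have "estimate s \<le> 1" using a diameter_unsat order_trans by (auto simp: approximates_def)
    then have "regs s 1 \<noteq> 0" "regs s 0 \<le> regs s 1"
      by (auto simp: estimate_def one_ereal_def divide_le_eq split: if_splits)
    then show ?thesis using False by (simp add: compared_def)
  next
    case True
    have d: "1 \<le> 2 - \<delta>" "ST_diameter I / ereal (2 - \<delta>) \<le> estimate s" using a by (auto simp: approximates_def)
    have "(2::ereal) / ereal (2 - \<delta>) \<le> ST_diameter I / ereal (2 - \<delta>)"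
      using diameter_sat[OF True] d(1) by (intro ereal_divide_right_mono) auto
    then have "(2::ereal) / ereal (2 - \<delta>) \<le> estimate s" using d(2) by (rule order_trans)
    moreover have "(2::ereal) / ereal (2 - \<delta>) = ereal (2 / (2 - \<delta>))"
      unfolding numeral_eq_ereal ereal_divide using d(1) by simp
    ultimately have "ereal (2 / (2 - \<delta>)) \<le> estimate s" by simp
    moreover have "ereal 1 < ereal (2 / (2 - \<delta>))" using d(1) \<delta> by (simp add: less_divide_eq)
    ultimately have "ereal 1 < estimate s" by (rule less_le_trans[rotated])
    then have "regs s 1 = 0 \<or> regs s 1 < regs s 0"
      by (auto simp: estimate_def one_ereal_def less_divide_eq split: if_splits)
    then show ?thesis using True by (simp add: compared_def)
  qed
  have "output_prob w0 t p (encode_instance I) (\<lambda>s. approximates (2 - \<delta>) (ST_diameter I) (estimate s)) \<le>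
      output_prob w T (sat_prog p) (encode_cnf n F) (\<lambda>s. regs s 0 \<noteq> 0 \<longleftrightarrow> satisfiable F)"
    unfolding output_prob_def r measure_map_pmf using decide
    by (intro measure_pmf.finite_measure_mono) auto
  then show "2 / 3 \<le> output_prob w T (sat_prog p) (encode_cnf n F) (\<lambda>s. regs s 0 \<noteq> 0 \<longleftrightarrow> satisfiable F)"
    using succ by linarith
qed

end

section \<open>Asymptotics of the reduction: time and word length\<close>

lemma square_times_power_bigo:
  fixes \<beta> \<gamma> :: real
  assumes "1 < \<beta>" "\<beta> < \<gamma>"
  shows "(\<lambda>n. (real n + 1)\<^sup>2 * \<beta> ^ (n + 1)) \<in> O(\<lambda>n. \<gamma> ^ n)"
proof -
  have "ln \<beta> < ln \<gamma>" "0 < \<beta>" "0 < \<gamma>" using assms by auto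
  then show ?thesis using assms by real_asymp
qed

text \<open>The finitely many values before the asymptotic regime are absorbed into the constant by
  their sum. Using \<open>real m + 1\<close> keeps the bound positive for \<open>m = 0\<close>,
  which occurs for the empty formula.\<close>

lemma bigo_powr_bound:
  assumes "(\<lambda>m. real (T m)) \<in> O(\<lambda>m. real m powr a)" "a \<le> a'" "0 \<le> a'"
  obtains C where "0 \<le> C" "\<And>m. real (T m) \<le> C * (real m + 1) powr a'"
proof -
  obtain c where c: "0 < c" "eventually (\<lambda>m. real (T m) \<le> c * real m powr a) sequentially"
    using assms(1) by (elim landau_o.bigE) simp
  then obtain m0 where m0: "\<And>m. m0 \<le> m \<Longrightarrow> real (T m) \<le> c * real m powr a"
    by (auto simp: eventually_sequentially)
  let ?C = "c + (\<Sum>m\<le>m0. real (T m))"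
  have s: "0 \<le> (\<Sum>m\<le>m0. real (T m))" by (simp add: sum_nonneg)
  have "real (T m) \<le> ?C * (real m + 1) powr a'" for m
  proof (cases "m \<le> m0")
    case True
    have "real (T m) \<le> (\<Sum>m\<le>m0. real (T m))" using True by (intro member_le_sum) auto
    also have "\<dots> \<le> ?C" using c(1) by simp
    also have "\<dots> = ?C * 1" by simp
    also have "\<dots> \<le> ?C * (real m + 1) powr a'"
      using assms(3) c(1) s by (intro mult_left_mono ge_one_powr_ge_zero) auto
    finally show ?thesis .
  next
    case False
    then have "real (T m) \<le> c * real m powr a" using m0 by simp
    also have "\<dots> \<le> c * real m powr a'" using False c(1) assms(2) by (intro mult_left_mono powr_mono) auto
    also have "\<dots> \<le> c * (real m + 1) powr a'" using c(1) assms(3) by (intro mult_left_mono powr_mono2) auto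
    also have "\<dots> \<le> ?C * (real m + 1) powr a'" using s by (intro mult_right_mono) auto
    finally show ?thesis .
  qed
  then show ?thesis using that[of ?C] c(1) s by simp
qed

text \<open>The summand 2 under the logarithm lifts the ceiling from \<open>n\<close> to at least
  \<open>n + 1\<close>.\<close>

lemma word_bits_power_ge: "b * (n + 1) \<le> word_bits b (2 ^ n)"
proof -
  have "real n = log 2 (2 ^ n)" by simp
  also have "\<dots> < log 2 (2 ^ n + 2)" by (subst log_less_cancel_iff) (auto simp: add_pos_pos)
  finally have "int n < \<lceil>log 2 (real (2 ^ n) + 2)\<rceil>" by (simp add: less_ceiling_iff)
  then have "n + 1 \<le> nat \<lceil>log 2 (real (2 ^ n) + 2)\<rceil>" by linarith
  then show ?thesis unfolding word_bits_def by (rule mult_le_mono2)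
qed

lemma word_bits_le:
  assumes "x + 2 \<le> 2 ^ k"
  shows "word_bits b x \<le> b * k"
proof -
  have "real (x + 2) \<le> real (2 ^ k)" using assms by (rule of_nat_mono)
  then have "log 2 (real x + 2) \<le> log 2 (2 ^ k)" by (subst log_le_cancel_iff) auto
  then have "log 2 (real x + 2) \<le> real k" by simp
  then have "nat \<lceil>log 2 (real x + 2)\<rceil> \<le> k" by (simp add: ceiling_le_iff nat_le_iff)
  then show ?thesis unfolding word_bits_def by (rule mult_le_mono2)
qed

locale sparse_reduction = sat_reduction +
  fixes K :: nat
  assumes sparse: "length F \<le> K * n"
begin

text \<open>Common yardstick for all sizes: \<open>N\<close> times the number of clauses gives one
  factor \<open>n + 1\<close>, and a clause of up to \<open>2 * n\<close> literals examined for each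
  pair gives the other.\<close>

definition scale :: nat where "scale = (n + 1)\<^sup>2 * N"

lemma scale_bounds:
  "1 \<le> scale" "N \<le> scale" "n \<le> scale" "M \<le> K * scale" "N * M \<le> K * scale"
  "M * (2 * n + 1) \<le> 2 * (K * scale)" "(30 + 12 * n) * (N * M) \<le> 30 * (K * scale)"
proof -
  let ?s = "n + 1"
  have M: "M \<le> K * ?s" using sparse by (simp add: M_def)
  have N: "1 \<le> N" using N_pos by simp
  have s2: "?s * ?s * N = scale" by (simp add: scale_def power2_eq_square)
  have "1 * 1 * N \<le> ?s * ?s * N" by (intro mult_le_mono) auto
  then show Ns: "N \<le> scale" unfolding s2 by simp
  show "1 \<le> scale" using N Ns by linarith
  have "?s * 1 * 1 \<le> ?s * ?s * N" by (intro mult_le_mono N) auto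
  then have s: "?s \<le> scale" unfolding s2 by simp
  then show "n \<le> scale" by simp
  have "K * ?s \<le> K * scale" using s by (rule mult_le_mono2)
  then show "M \<le> K * scale" using M by linarith
  have "N * M \<le> N * (K * ?s)" using M by (rule mult_le_mono2)
  also have "\<dots> = K * (1 * ?s * N)" by (simp add: algebra_simps)
  also have "\<dots> \<le> K * (?s * ?s * N)" by (intro mult_le_mono) auto
  finally show "N * M \<le> K * scale" unfolding s2 .
  have "M * (2 * n + 1) \<le> (K * ?s) * (2 * ?s)" using M by (intro mult_le_mono) auto
  also have "\<dots> = 2 * (K * (?s * ?s * 1))" by (simp add: algebra_simps)
  also have "\<dots> \<le> 2 * (K * (?s * ?s * N))" using N by (intro mult_le_mono) auto
  finally show "M * (2 * n + 1) \<le> 2 * (K * scale)" unfolding s2 .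
  have "(30 + 12 * n) * (N * M) \<le> (30 * ?s) * (N * (K * ?s))" using M by (intro mult_le_mono) auto
  also have "\<dots> = 30 * (K * (?s * ?s * N))" by (simp add: algebra_simps)
  finally show "(30 + 12 * n) * (N * M) \<le> 30 * (K * scale)" unfolding s2 .
qed

lemma reduction_time_le: "reduction_time \<le> (72 * K + 58) * scale"
proof -
  have "reduction_time \<le> 72 * (K * scale) + 58 * scale"
    using scale_bounds unfolding reduction_time_def X_def Lo_def Lb_def distrib_left by linarith
  then show ?thesis by (simp add: add_mult_distrib)
qed

text \<open>\<open>11 * K + 17\<close> takes \<open>K + 5\<close> bits and \<open>scale\<close>
  takes \<open>3 * (n + 1)\<close>; together at most \<open>(K + 8) * (n + 1)\<close>.\<close>

lemma scale_le_power: "(11 * K + 17) * scale \<le> 2 ^ ((K + 8) * (n + 1))"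
proof -
  have p: "k + 1 \<le> (2::nat) ^ k" for k by (simp only: Suc_eq_plus1[symmetric] Suc_le_eq less_exp)
  have s: "n + 1 \<le> 2 ^ (n + 1)" using p[of "n + 1"] by simp
  have "half n \<le> n + 1" by (simp add: half_def)
  then have N: "N \<le> 2 ^ (n + 1)" unfolding N_def by (intro power_increasing) auto
  have "11 * K + 17 \<le> 2 ^ 5 * (K + 1)" by simp
  also have "\<dots> \<le> 2 ^ 5 * 2 ^ K" by (intro mult_le_mono2 p)
  finally have K: "11 * K + 17 \<le> 2 ^ (5 + K)" by (simp only: power_add)
  have "scale \<le> (2 ^ (n + 1))\<^sup>2 * 2 ^ (n + 1)" unfolding scale_def by (intro mult_le_mono power_mono s N) simp
  also have "\<dots> = 2 ^ (3 * (n + 1))"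
    unfolding power_mult[symmetric] power_add[symmetric] by (rule arg_cong[where f = "power 2"]) simp
  finally have "(11 * K + 17) * scale \<le> 2 ^ (5 + K) * 2 ^ (3 * (n + 1))" using K by (intro mult_le_mono)
  also have "\<dots> = 2 ^ (5 + K + 3 * (n + 1))" by (simp only: power_add)
  also have "\<dots> \<le> 2 ^ ((K + 8) * (n + 1))" by (intro power_increasing) (auto simp: algebra_simps)
  finally show ?thesis .
qed

lemma room_less: "room < 2 ^ word_bits (Suc b * (K + 9)) (2 ^ n)"
proof -
  \<comment> \<open>Adding up \<open>2 * Lb + Lo + n + 8\<close>: the terms with \<open>K\<close>
    have coefficients 4, 6 and 1, the others 3 and the constant 14.\<close>
  have "room \<le> 11 * (K * scale) + 17 * scale"
    using scale_bounds unfolding room_def X_def Lo_def Lb_def by linarith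
  then have "room \<le> (11 * K + 17) * scale" by (simp add: add_mult_distrib)
  also have "\<dots> \<le> 2 ^ ((K + 8) * (n + 1))" by (rule scale_le_power)
  also have "\<dots> < 2 ^ ((K + 9) * (n + 1))" by (intro power_strict_increasing mult_strict_right_mono) auto
  also have "(K + 9) * (n + 1) \<le> Suc b * (K + 9) * (n + 1)" unfolding mult.assoc by simp
  then have "(2::nat) ^ ((K + 9) * (n + 1)) \<le> 2 ^ word_bits (Suc b * (K + 9)) (2 ^ n)"
    using word_bits_power_ge[of "Suc b * (K + 9)" n] by (intro power_increasing) (auto intro: order_trans)
  finally show ?thesis .
qed

lemma magnitude_le: "instance_magnitude I + 2 \<le> (11 * K + 17) * scale"
proof -
  have "weight I e \<le> 2" for e
    by (cases e) (simp add: sat_instance_def Let_def)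
  then have "Max (insert 0 (weight I ` set (edge_list I))) \<le> 2" by (intro Max.boundedI) auto
  then have "instance_magnitude I + 2 \<le> 11 * (K * scale) + 17 * scale"
    using scale_bounds unfolding instance_magnitude_def sat_instance_simps(1) edge_count_sat_instance by linarith
  then show ?thesis by (simp add: add_mult_distrib)
qed

text \<open>This comparison is what allows \<open>p\<close> to be run in the longer words of the
  deciding program. The factor \<open>Suc b\<close> in the word length serves \<open>p\<close>, and
  it leaves room for the reduction even if \<open>b = 0\<close>.\<close>

lemma word_bits_magnitude: "word_bits b (instance_magnitude I) \<le> word_bits (Suc b * (K + 9)) (2 ^ n)"
proof -
  have "word_bits b (instance_magnitude I) \<le> b * ((K + 8) * (n + 1))"
    by (rule word_bits_le) (rule order_trans[OF magnitude_le scale_le_power])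
  also have "\<dots> \<le> Suc b * (K + 9) * (n + 1)"
    unfolding mult.assoc by (intro mult_le_mono) auto
  also have "\<dots> \<le> word_bits (Suc b * (K + 9)) (2 ^ n)" by (rule word_bits_power_ge)
  finally show ?thesis .
qed

lemma N_le_powr: "real N \<le> 2 powr (real (n + 1) / 2)"
proof -
  have "real (half n) \<le> real (n + 1) / 2" by (simp add: half_def field_simps)
  then have "2 powr real (half n) \<le> 2 powr (real (n + 1) / 2)" by (intro powr_mono) auto
  then show ?thesis by (simp add: N_def powr_realpow)
qed

text \<open>With about \<open>n * 2 ^ (n / 2)\<close> edges, the power \<open>a\<close> yields a
  polynomial times \<open>2 powr (a / 2)\<close> to the \<open>n\<close>, whose base is below 2 for
  \<open>a < 2\<close>. The exponent \<open>n + 1\<close> accounts for the rounding in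
  \<open>half n\<close>. As \<open>a \<ge> 1\<close>, the size of the reduction obeys the same kind
  of bound.\<close>

lemma edge_count_powr:
  assumes "1 \<le> a" "a \<le> 2"
  shows "(real (edge_count I) + 1) powr a \<le> (2 * real K + 1)\<^sup>2 * ((real n + 1)\<^sup>2 * (2 powr (a / 2)) ^ (n + 1))"
    "real scale \<le> (real n + 1)\<^sup>2 * (2 powr (a / 2)) ^ (n + 1)"
proof -
  let ?k = "(2 * real K + 1) * (real n + 1)" let ?\<beta> = "2 powr (a / 2)"
  have \<beta>: "(2 powr (real (n + 1) / 2)) powr a = ?\<beta> ^ (n + 1)"
    unfolding powr_powr powr_realpow[of "2 powr (a / 2)", simplified, symmetric] powr_powr by (simp add: algebra_simps)
  have k: "1 \<le> ?k" by (simp add: algebra_simps)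
  have "real M \<le> real (K * n)" using sparse unfolding M_def by (rule of_nat_mono)
  then have "2 * real M + 1 \<le> ?k" by (simp add: algebra_simps)
  moreover have N1: "1 \<le> real N" using N_pos by simp
  ultimately have "real N * (2 * real M + 1) \<le> real N * ?k" by (intro mult_left_mono) auto
  then have "real (edge_count I) + 1 \<le> ?k * real N"
    using N1 by (simp add: edge_count_sat_instance algebra_simps)
  also have "\<dots> \<le> ?k * 2 powr (real (n + 1) / 2)" using k N_le_powr by (intro mult_left_mono) auto
  finally have "(real (edge_count I) + 1) powr a \<le> (?k * 2 powr (real (n + 1) / 2)) powr a"
    using assms by (intro powr_mono2) auto
  also have "\<dots> = ?k powr a * ?\<beta> ^ (n + 1)" using k by (simp only: powr_mult \<beta>)
  also have "\<dots> \<le> ?k powr 2 * ?\<beta> ^ (n + 1)" using k assms by (intro mult_right_mono powr_mono) auto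
  also have "?k powr 2 = ?k\<^sup>2" using k by (subst powr_numeral) auto
  finally show "(real (edge_count I) + 1) powr a \<le> (2 * real K + 1)\<^sup>2 * ((real n + 1)\<^sup>2 * ?\<beta> ^ (n + 1))"
    by (simp only: power_mult_distrib mult.assoc)
  have "2 powr (real (n + 1) / 2) \<le> (2 powr (real (n + 1) / 2)) powr a"
    unfolding powr_powr using assms mult_left_mono[of 1 a "real (n + 1) / 2"] by (intro powr_mono) auto
  then have "real N \<le> ?\<beta> ^ (n + 1)" using N_le_powr unfolding \<beta> by linarith
  then have "(real n + 1)\<^sup>2 * real N \<le> (real n + 1)\<^sup>2 * ?\<beta> ^ (n + 1)" by (intro mult_left_mono) auto
  then show "real scale \<le> (real n + 1)\<^sup>2 * ?\<beta> ^ (n + 1)" by (simp add: scale_def algebra_simps)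
qed

end

theorem fast_approximation_refutes_SETH:
  fixes \<epsilon> \<delta> :: real
  assumes \<epsilon>: "0 < \<epsilon>" and \<delta>: "0 < \<delta>"
    and T: "(\<lambda>m. real (T m)) \<in> O(\<lambda>m. real m powr (2 - \<epsilon>))"
    and run: "diameter_runs_in_time p b T"
    and success: "\<And>I. valid_instance I \<Longrightarrow> 2 / 3 \<le> diameter_success_prob (2 - \<delta>) p b T I"
  shows "\<not> SETH"
proof -
  \<comment> \<open>Capping \<open>\<epsilon>\<close> at 1 keeps the exponent at least 1, so that
    the time for the reduction itself, linear in the size of the instance up to polynomial factors,
    is dominated as well.\<close>
  define a where "a = 2 - min \<epsilon> 1"
  have a: "1 \<le> a" "a < 2" "2 - \<epsilon> \<le> a" using \<epsilon> by (auto simp: a_def)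
  obtain C where C: "0 \<le> C" "\<And>m. real (T m) \<le> C * (real m + 1) powr a"
    using bigo_powr_bound[OF T a(3)] a(1) by auto
  define \<beta> where "\<beta> = 2 powr (a / 2)"
  have "2 powr 0 < \<beta>" unfolding \<beta>_def using a by (intro powr_less_mono) auto
  moreover have "\<beta> < 2 powr 1" unfolding \<beta>_def using a by (intro powr_less_mono) auto
  ultimately have \<beta>: "1 < \<beta>" "\<beta> < 2" by auto
  \<comment> \<open>\<open>2 - e\<close> is the midpoint of \<open>\<beta>\<close> and 2; the gap
    above \<open>\<beta>\<close> swallows the polynomial factor.\<close>
  define e where "e = (2 - \<beta>) / 2"
  have e: "0 < e" "e < 1" "\<beta> < 2 - e" using \<beta> by (auto simp: e_def field_simps)
  define f where "f n = (real n + 1)\<^sup>2 * \<beta> ^ (n + 1)" for n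
  have f1: "1 \<le> f n" for n
  proof -
    have "1 * 1 \<le> f n" unfolding f_def using \<beta>(1) by (intro mult_mono one_le_power) auto
    then show ?thesis by simp
  qed
  let ?c = "step_cost reduction_prog" and ?D = "32 + prog_depth reduction_prog"
  \<comment> \<open>\<open>e\<close> is fixed before \<open>K\<close>: refuting \<open>SETH\<close>
    takes one saving that works for every clause density.\<close>
  have "\<exists>p' b' T'. (\<lambda>n. real (T' n)) \<in> O(\<lambda>n. (2 - e) ^ n) \<and> decides_sat K p' b' T'" for K
  proof -
    define c where "c = real (?c * (72 * K + 58)) + (real ?D + 3) + C * (2 * real K + 1)\<^sup>2"
    define T' where "T' n = nat \<lceil>c * f n\<rceil>" for n
    have c0: "0 \<le> c" using C(1) by (simp add: c_def)
    have "real (T' n) \<le> (c + 1) * f n" for n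
    proof -
      have "0 \<le> c * f n" using c0 f1[of n] by simp
      then have "real (T' n) \<le> c * f n + 1" unfolding T'_def by linarith
      then show ?thesis using f1[of n] by (simp add: distrib_right)
    qed
    moreover have "0 \<le> f n" for n using f1[of n] by linarith
    ultimately have "(\<lambda>n. real (T' n)) \<in> O(f)"
      by (intro bigoI[of _ "c + 1"]) auto
    also have "f \<in> O(\<lambda>n. (2 - e) ^ n)"
      using square_times_power_bigo[OF \<beta>(1) e(3)] by (simp add: f_def[abs_def])
    finally have "(\<lambda>n. real (T' n)) \<in> O(\<lambda>n. (2 - e) ^ n)" .
    moreover have "decides_sat K (sat_prog p) (Suc b * (K + 9)) T'"
      unfolding decides_sat_def
    proof (intro allI impI)
      fix n F assume F: "is_cnf n F \<and> length F \<le> K * n"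
      then interpret sparse_reduction n F K by unfold_locales auto
      let ?I = "sat_instance n F"
      note v = valid_sat_instance
      have g: "real scale \<le> f n" "(real (edge_count ?I) + 1) powr a \<le> (2 * real K + 1)\<^sup>2 * f n"
        using edge_count_powr[of a] a unfolding f_def \<beta>_def by auto
      have "?c * reduction_time \<le> ?c * (72 * K + 58) * scale"
        using reduction_time_le by simp
      then have "real (?c * reduction_time) \<le> real (?c * (72 * K + 58) * scale)" by (rule of_nat_mono)
      also have "\<dots> = real (?c * (72 * K + 58)) * real scale" by (rule of_nat_mult)
      also have "\<dots> \<le> real (?c * (72 * K + 58)) * f n" using g(1) by (rule mult_left_mono) simp
      finally have 1: "real (?c * reduction_time) \<le> real (?c * (72 * K + 58)) * f n" .
      have "(real ?D + 3) * 1 \<le> (real ?D + 3) * f n" using f1 by (intro mult_left_mono) auto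
      moreover have "real (T (edge_count ?I)) \<le> C * (2 * real K + 1)\<^sup>2 * f n"
        using C(2)[of "edge_count ?I"] mult_left_mono[OF g(2) C(1)] by (simp add: mult.assoc)
      ultimately have "real (?c * reduction_time + ?D + T (edge_count ?I) + 3) \<le> c * f n"
        using 1 unfolding c_def distrib_right of_nat_add by simp
      then have time: "?c * reduction_time + ?D + T (edge_count ?I) + 3 \<le> T' n"
        unfolding T'_def by linarith
      have h: "halts_within (word_bits b (instance_magnitude ?I)) (T (edge_count ?I)) p (encode_instance ?I)"
        using run v by (simp add: diameter_runs_in_time_def)
      note d = sat_prog_decides[OF room_less word_bits_magnitude h time \<delta> success[OF v, unfolded diameter_success_prob_def]]
      show "halts_within (word_bits (Suc b * (K + 9)) (2 ^ n)) (T' n) (sat_prog p) (encode_cnf n F) \<and>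
        2 / 3 \<le> output_prob (word_bits (Suc b * (K + 9)) (2 ^ n)) (T' n) (sat_prog p) (encode_cnf n F)
          (\<lambda>s. regs s 0 \<noteq> 0 \<longleftrightarrow> satisfiable F)"
        using d by blast
    qed
    ultimately show ?thesis by blast
  qed
  then show ?thesis unfolding SETH_def using e(1,2) by blast
qed

theorem theorem4:
  shows
    "(\<exists>p b T.
        (\<exists>k. (\<lambda>m. real (T m)) \<in> O(\<lambda>m. real m powr (3 / 2) * ln (real m) ^ k)) \<and>
        diameter_runs_in_time p b T \<and>
        (\<forall>c::real. c > 0 \<longrightarrow>
           (\<exists>n0. \<forall>I. valid_instance I \<and> vertex_count I \<ge> n0 \<longrightarrow>
              diameter_success_prob 2 p b T I \<ge> 1 - 1 / real (vertex_count I) powr c)))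
     \<and>
     (\<forall>\<epsilon>::real. \<forall>\<delta>::real. \<epsilon> > 0 \<and> \<delta> > 0 \<longrightarrow>
        (\<exists>p b T.
           (\<lambda>m. real (T m)) \<in> O(\<lambda>m. real m powr (2 - \<epsilon>)) \<and>
           diameter_runs_in_time p b T \<and>
           (\<forall>I. valid_instance I \<longrightarrow> diameter_success_prob (2 - \<delta>) p b T I \<ge> 2 / 3))
        \<longrightarrow> \<not> SETH)"
proof (intro conjI allI impI)
  fix \<epsilon> \<delta> :: real
  assume "\<epsilon> > 0 \<and> \<delta> > 0"
    and "\<exists>p b T. (\<lambda>m. real (T m)) \<in> O(\<lambda>m. real m powr (2 - \<epsilon>)) \<and> diameter_runs_in_time p b T \<and>
      (\<forall>I. valid_instance I \<longrightarrow> diameter_success_prob (2 - \<delta>) p b T I \<ge> 2 / 3)"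
  then show "\<not> SETH" using fast_approximation_refutes_SETH by blast
qed (rule two_approximation_algorithm)

end
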